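(* Let $U$ be a regular stepped solid, let $(g_x)_{x\in V(U)}$ be a formal initial condition (independent variables), and let $g_{(0,0,0)}$ be the solution at the origin of Kashaev's recurrence with this initial condition. Then: 1. $g_{(0,0,0)}$ is a Laurent polynomial in the vertex variables $(g_x)_{x\in V(U)}$ and in the face variables defined on the faces of $G(U)$. 2. The monomials of this Laurent polynomial are in one-to-one correspondence with the taut $C^{(1)}_2$ loop configurations on $G(U)$ (a configuration $\sigma$ corresponding to the monomial of its weight $w^U_{\mathrm{taut}}(\sigma)$). 3. The $g$ variables appear with exponents in $\{-2,\dots,4\}$, and the face variables appear with exponents in $\{0,1\}$. 4. The coefficients in front of the monomials are powers of $2$.
   Context: Stepped solids. $(e_1,e_2,e_3)$ is the canonical basis of $\mathbb R^3$; for $(i,j,k)\in\mathbb Z^3$, $C_{(i,j,k)}=[i,i+1]\times[j,j+1]\times[k,k+1]$. A stepped solid is a union $U$ of such cubes. It is monotone if $C_{(i,j,k)}\subset U$ and $i'\le i,\ j'\le j,\ k'\le k$ imply $C_{(i',j',k')}\subset U$; all stepped solids are assumed monotone. The boundary $\partial U$ is a union of unit squares $(x,x+e_i,x+e_i+e_j,x+e_j)$, $x\in\mathbb Z^3$, $1\le i<j\le3$, and corresponds to an infinite planar quadrangulation $G(U)$ with $V(U)=\{x\in U\cap\mathbb Z^3: x+e_1+e_2+e_3\notin U\}$, edges joining $x,y\in V(U)$ with $x-y\in\{\pm e_1,\pm e_2,\pm e_3\}$, and faces $F(U)$ the squares of $\partial U$. Let $U_0=\mathbb R_-\times\mathbb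 R_-\times\mathbb R_-$ with $\mathbb{R}_-=(-\infty,0]$. $U$ is regular if $U\subset U_0$ and $U_0\setminus U$ is composed of finitely many cubes. Then $G(U)=G(U_0)$ outside some Euclidean ball $B(O,R_U)$ centred at the origin. Kashaev's recurrence. For $x\in\mathbb Z^3$ write $g=g_x$, $g_i=g_{x+e_i}$, $g_{ij}=g_{x+e_i+e_j}$, $g_{123}=g_{x+e_1+e_2+e_3}$. The recurrence is $$g_{123}=\frac{2g_1g_2g_3+g(g_1g_{23}+g_2g_{13}+g_3g_{12})+2XYZ}{g^2},$$ with $X=\sqrt{gg_{23}+g_2g_3}$, $Y=\sqrt{gg_{13}+g_1g_3}$, $Z=\sqrt{gg_{12}+g_1g_2}$. Starting from $(g_x)_{x\in V(U)}$ it recursively defines $g$ on $\mathbb Z_-^3\setminus U$ ($\mathbb Z_-=\{\dots,-1,0\}$); the resulting value $g_{(0,0,0)}$ is the solution at the origin. The variables can be thought of as positive reals, with positive square roots. Face variables. The face variable of a face bordered by $x,u,y,v$ in cyclic order is $\sqrt{g_xg_y+g_ug_v}$. Loop configurations. For a face $f$ with boundary vertices $x,u,y,v$ in cyclic order, the midpoints of its four sides are joined in pairs by two strands, each red or blue; a strand "turns around" a corner $p$ if it joins the midpoints of the two sides incident to $p$. The ten local configurations and weights are: $1_a,1_b$: strands turn around $u,v$, same colour, $w^f_1=g_xg_y$; $2_a,2_b$: strands turn around $x,y$, same colour, $w^f_2=g_ug_v$; $3_a,3_b$: strands turn around $u,v$, different colours, $w^f_3=\sqrt{g_xg_y}\sqrt{g_xg_y+g_ug_v}$;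 $4_a,4_b$: strands turn around $x,y$, different colours, $w^f_4=\sqrt{g_ug_v}\sqrt{g_xg_y+g_ug_v}$; $5_a,5_b$: strands join opposite sides (they cross), different colours, $w^f_5=\sqrt{g_xg_yg_ug_v}$. A $C^{(1)}_2$ loop configuration $\sigma$ on $G(U)$ is a choice of local configuration at every face such that colours agree across each edge; write $(f,i_k)\in\sigma$ if the local configuration at $f$ is $i_k$. It decomposes into infinite simple paths and finite closed loops; $N_\sigma$ is the number of finite closed loops. Taut configurations. $\sigma_0$ is the configuration on $G(U_0)$ in which, on each face $(x,x+e_i,x+e_i+e_j,x+e_j)$, $i<j$, both strands are blue and turn around $x+e_i$ and $x+e_j$. A configuration $\sigma$ on $G(U)$ is taut if it has the same connectivity as $\sigma_0$ on a neighbourhood of infinity: there is $R_\sigma\ge R_U$ such that $\sigma=\sigma_0$ outside the ball $B(O,R_\sigma)$, and the edges where paths enter or leave the part of the surface in $B(O,R_\sigma)$ that are connected by a path in $\sigma_0$ are also connected by a path in $\sigma$. $\Sigma(U)$ is the set of taut configurations; it is finite and each of its elements has finitely many finite loops. Weights. For $\sigma\in\Sigma(U)$, $$w^U_{\mathrm{taut}}(\sigma)=2^{N_\sigma}\Big(\prod_{(f,i_k)\in\sigma}w^f_i\Big)\Big(\prod_{x\in V(U)}\frac1{g_x^2}\Big),$$ where the infinite products are understood by collecting exponents: for all but finitely many $x$ the total exponent of $g_x$ (including the $-2$) is $0$, and only finitely many face variables appear. The monomial of $w^U_{\mathrm{taut}}(\sigma)$ is this expression in the vertex and face variables without the coefficient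 $2^{N_\sigma}$. *)

theory Defs
  imports "HOL-Analysis.Analysis" "HOL-Library.Poly_Mapping"
begin

type_synonym lattice = "int \<times> int \<times> int"

text \<open>The norm of the product type below is the Euclidean norm, so \<open>cball 0 R\<close> is a Euclidean ball.\<close>

type_synonym space = "real \<times> real \<times> real"

definition emb :: "lattice \<Rightarrow> space" where
  "emb = (\<lambda>(i, j, k). (of_int i, of_int j, of_int k))"

text \<open>Only the indices 1, 2, 3 are used.\<close>

definition evec :: "nat \<Rightarrow> lattice" where
  "evec i = (if i = 1 then (1, 0, 0) else if i = 2 then (0, 1, 0) else (0, 0, 1))"

definition cube :: "lattice \<Rightarrow> space set" where
  "cube = (\<lambda>(i, j, k). {of_int i .. of_int i + 1} \<times> {of_int j .. of_int j + 1}
                         \<times> {of_int k .. of_int k + 1})"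

definition stepped_solid :: "space set \<Rightarrow> bool" where
  "stepped_solid U \<longleftrightarrow> (\<exists>S. U = (\<Union>c\<in>S. cube c))"

definition monotone_solid :: "space set \<Rightarrow> bool" where
  "monotone_solid U \<longleftrightarrow>
     (\<forall>i j k i' j' k'. cube (i, j, k) \<subseteq> U \<and> i' \<le> i \<and> j' \<le> j \<and> k' \<le> k \<longrightarrow> cube (i', j', k') \<subseteq> U)"

definition octant :: "space set" where
  "octant = {..0} \<times> {..0} \<times> {..0}"

text \<open>\<open>octant - U\<close> is a union of finitely many cubes only up to boundary points, since \<open>U\<close> is closed;
  what is finite is the set of cubes of the octant that are missing from \<open>U\<close>.\<close>

definition regular_solid :: "space set \<Rightarrow> bool" where
  "regular_solid U \<longleftrightarrow> stepped_solid U \<and> monotone_solid U \<and> U \<subseteq> octant \<and>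
     finite {c. cube c \<subseteq> octant \<and> \<not> cube c \<subseteq> U}"

definition vertices :: "space set \<Rightarrow> lattice set" where
  "vertices U = {x. emb x \<in> U \<and> emb (x + evec 1 + evec 2 + evec 3) \<notin> U}"

text \<open>The triple \<open>(x, i, j)\<close> with \<open>i < j\<close> stands for the face with boundary vertices
  \<open>x, u = x + e\<^sub>i, y = x + e\<^sub>i + e\<^sub>j, v = x + e\<^sub>j\<close>, in this cyclic order.\<close>

type_synonym face = "lattice \<times> nat \<times> nat"

definition cx :: "face \<Rightarrow> lattice" where "cx = (\<lambda>(x, i, j). x)"
definition cu :: "face \<Rightarrow> lattice" where "cu = (\<lambda>(x, i, j). x + evec i)"
definition cy :: "face \<Rightarrow> lattice" where "cy = (\<lambda>(x, i, j). x + evec i + evec j)"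
definition cv :: "face \<Rightarrow> lattice" where "cv = (\<lambda>(x, i, j). x + evec j)"

definition square :: "face \<Rightarrow> space set" where
  "square = (\<lambda>(x, i, j). {emb x + s *\<^sub>R emb (evec i) + t *\<^sub>R emb (evec j) | s t.
                            0 \<le> s \<and> s \<le> 1 \<and> 0 \<le> t \<and> t \<le> 1})"

definition faces :: "space set \<Rightarrow> face set" where
  "faces U = {(x, i, j). 1 \<le> i \<and> i < j \<and> j \<le> 3 \<and> square (x, i, j) \<subseteq> frontier U}"

type_synonym edge = "lattice set"

definition sides :: "face \<Rightarrow> edge set" where
  "sides f = {{cx f, cu f}, {cu f, cy f}, {cy f, cv f}, {cv f, cx f}}"

definition kashaev_rhs :: "(lattice \<Rightarrow> real) \<Rightarrow> lattice \<Rightarrow> real" where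
  "kashaev_rhs g x =
    (let g0 = g x; g1 = g (x + evec 1); g2 = g (x + evec 2); g3 = g (x + evec 3);
         g12 = g (x + evec 1 + evec 2); g13 = g (x + evec 1 + evec 3);
         g23 = g (x + evec 2 + evec 3);
         X = sqrt (g0 * g23 + g2 * g3); Y = sqrt (g0 * g13 + g1 * g3); Z = sqrt (g0 * g12 + g1 * g2)
     in (2 * g1 * g2 * g3 + g0 * (g1 * g23 + g2 * g13 + g3 * g12) + 2 * X * Y * Z) / g0\<^sup>2)"

text \<open>The initial condition of a solution is its restriction to \<open>vertices U\<close>; on
  \<open>\<int>\<^sub>-\<^sup>3 - U\<close> its values are then computed from the initial condition by
  iterating the recurrence finitely many times.\<close>

definition kashaev_solution :: "space set \<Rightarrow> (lattice \<Rightarrow> real) \<Rightarrow> bool" where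
  "kashaev_solution U g \<longleftrightarrow>
     (\<forall>x. let z = x + evec 1 + evec 2 + evec 3
          in emb z \<in> octant - U \<longrightarrow> g z = kashaev_rhs g x)"

datatype var = Vertex lattice | Face face

text \<open>A monomial maps each variable to its exponent, and a Laurent polynomial maps each monomial to
  its coefficient; \<open>Poly_Mapping.keys\<close> is the support.\<close>

type_synonym laurent_monomial = "var \<Rightarrow>\<^sub>0 int"
type_synonym laurent_poly = "laurent_monomial \<Rightarrow>\<^sub>0 int"

definition variables :: "space set \<Rightarrow> var set" where
  "variables U = Vertex ` vertices U \<union> Face ` faces U"

fun var_value :: "(lattice \<Rightarrow> real) \<Rightarrow> var \<Rightarrow> real" where
  "var_value g (Vertex x) = g x"
| "var_value g (Face f) = sqrt (g (cx f) * g (cy f) + g (cu f) * g (cv f))"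

definition monomial_value :: "(lattice \<Rightarrow> real) \<Rightarrow> laurent_monomial \<Rightarrow> real" where
  "monomial_value g m = (\<Prod>v\<in>Poly_Mapping.keys m. var_value g v powi Poly_Mapping.lookup m v)"

definition laurent_value :: "(lattice \<Rightarrow> real) \<Rightarrow> laurent_poly \<Rightarrow> real" where
  "laurent_value g P =
     (\<Sum>m\<in>Poly_Mapping.keys P. of_int (Poly_Mapping.lookup P m) * monomial_value g m)"

datatype colour = Blue | Red

fun other :: "colour \<Rightarrow> colour" where
  "other Blue = Red"
| "other Red = Blue"

text \<open>The five constructors are the types 1 to 5. The colour is that of the strand through the side
  \<open>{u, y}\<close>; its two values give the variants a and b of each type.\<close>

datatype local_config = C1 colour | C2 colour | C3 colour | C4 colour | C5 colour

text \<open>A strand is given by the two sides whose midpoints it joins, together with its colour.\<close>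

fun strands :: "face \<Rightarrow> local_config \<Rightarrow> (edge set \<times> colour) set" where
  "strands f (C1 c) = {({{cx f, cu f}, {cu f, cy f}}, c), ({{cy f, cv f}, {cv f, cx f}}, c)}"
| "strands f (C2 c) = {({{cu f, cy f}, {cy f, cv f}}, c), ({{cv f, cx f}, {cx f, cu f}}, c)}"
| "strands f (C3 c) = {({{cx f, cu f}, {cu f, cy f}}, c), ({{cy f, cv f}, {cv f, cx f}}, other c)}"
| "strands f (C4 c) = {({{cu f, cy f}, {cy f, cv f}}, c), ({{cv f, cx f}, {cx f, cu f}}, other c)}"
| "strands f (C5 c) = {({{cu f, cy f}, {cv f, cx f}}, c), ({{cx f, cu f}, {cy f, cv f}}, other c)}"

definition loop_configs :: "space set \<Rightarrow> (face \<Rightarrow> local_config) set" where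
  "loop_configs U = {\<sigma> \<in> faces U \<rightarrow>\<^sub>E UNIV.
     \<forall>f\<in>faces U. \<forall>f'\<in>faces U. \<forall>(s, c)\<in>strands f (\<sigma> f). \<forall>(s', c')\<in>strands f' (\<sigma> f').
       s \<inter> s' \<noteq> {} \<longrightarrow> c = c'}"

definition linked :: "space set \<Rightarrow> (face \<Rightarrow> local_config) \<Rightarrow> (edge \<times> edge) set" where
  "linked U \<sigma> = {(a, b). \<exists>f\<in>faces U. \<exists>c. ({a, b}, c) \<in> strands f (\<sigma> f)}"

definition sigma0 :: "face \<Rightarrow> local_config" where
  "sigma0 = (\<lambda>f\<in>faces octant. C1 Blue)"

definition inside_faces :: "space set \<Rightarrow> real \<Rightarrow> face set" where
  "inside_faces U R = {f \<in> faces U. square f \<subseteq> cball 0 R}"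

definition outside_faces :: "space set \<Rightarrow> real \<Rightarrow> face set" where
  "outside_faces U R = {f \<in> faces U. \<not> square f \<subseteq> cball 0 R}"

definition same_outside :: "space set \<Rightarrow> real \<Rightarrow> bool" where
  "same_outside U R \<longleftrightarrow> outside_faces U R = outside_faces octant R \<and>
     {x \<in> vertices U. emb x \<notin> cball 0 R} = {x \<in> vertices octant. emb x \<notin> cball 0 R}"

text \<open>The edges where the paths of a configuration enter or leave the part of the surface in the
  ball. Every edge of the graph is crossed by exactly one path.\<close>

definition gates :: "space set \<Rightarrow> real \<Rightarrow> edge set" where
  "gates U R = (\<Union>f\<in>inside_faces U R. sides f) \<inter> (\<Union>f\<in>outside_faces U R. sides f)"

text \<open>The radii satisfying \<open>same_outside U\<close> are upward closed, so this condition on \<open>R\<close> says that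
  \<open>R\<close> is at least some radius outside which the two graphs agree.\<close>

definition taut_configs :: "space set \<Rightarrow> (face \<Rightarrow> local_config) set" where
  "taut_configs U = {\<sigma> \<in> loop_configs U. \<exists>R. same_outside U R \<and>
     (\<forall>f\<in>outside_faces U R. \<sigma> f = sigma0 f) \<and>
     (\<forall>a\<in>gates U R. \<forall>b\<in>gates U R.
        (a, b) \<in> (linked octant sigma0)\<^sup>* \<longrightarrow> (a, b) \<in> (linked U \<sigma>)\<^sup>*)}"

text \<open>Exponents of the variables in the local weights
  \<open>w\<^sub>1 = g\<^sub>x g\<^sub>y\<close>, \<open>w\<^sub>2 = g\<^sub>u g\<^sub>v\<close>, \<open>w\<^sub>3 = sqrt (g\<^sub>x g\<^sub>y) F\<close>, \<open>w\<^sub>4 = sqrt (g\<^sub>u g\<^sub>v) F\<close>,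
  \<open>w\<^sub>5 = sqrt (g\<^sub>x g\<^sub>y g\<^sub>u g\<^sub>v)\<close>, where \<open>F = sqrt (g\<^sub>x g\<^sub>y + g\<^sub>u g\<^sub>v)\<close> is the face variable.
  They are rational because of the square roots of vertex variables.\<close>

fun weight_exponent :: "face \<Rightarrow> local_config \<Rightarrow> var \<Rightarrow> rat" where
  "weight_exponent f (C1 _) v = of_bool (v \<in> {Vertex (cx f), Vertex (cy f)})"
| "weight_exponent f (C2 _) v = of_bool (v \<in> {Vertex (cu f), Vertex (cv f)})"
| "weight_exponent f (C3 _) v =
     of_bool (v \<in> {Vertex (cx f), Vertex (cy f)}) / 2 + of_bool (v = Face f)"
| "weight_exponent f (C4 _) v =
     of_bool (v \<in> {Vertex (cu f), Vertex (cv f)}) / 2 + of_bool (v = Face f)"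
| "weight_exponent f (C5 _) v =
     of_bool (v \<in> {Vertex (cx f), Vertex (cy f), Vertex (cu f), Vertex (cv f)}) / 2"

text \<open>Total exponent of \<open>v\<close> in the product of all local weights and of all \<open>1 / (g\<^sub>x)\<^sup>2\<close>.
  Only finitely many faces contribute to a given variable; restricting the sum to them is necessary
  because a sum over an infinite set is \<open>0\<close> by convention.\<close>

definition taut_exponent :: "space set \<Rightarrow> (face \<Rightarrow> local_config) \<Rightarrow> var \<Rightarrow> rat" where
  "taut_exponent U \<sigma> v =
     (\<Sum>f | f \<in> faces U \<and> weight_exponent f (\<sigma> f) v \<noteq> 0. weight_exponent f (\<sigma> f) v)
     - 2 * of_bool (v \<in> Vertex ` vertices U)"

definition is_taut_monomial :: "space set \<Rightarrow> (face \<Rightarrow> local_config) \<Rightarrow> laurent_monomial \<Rightarrow> bool" where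
  "is_taut_monomial U \<sigma> m \<longleftrightarrow> (\<forall>v. of_int (Poly_Mapping.lookup m v) = taut_exponent U \<sigma> v)"

end

theory Submission
  imports Defs
begin

text \<open>The idea is to remove the missing cubes from the octant one at a time and to watch how the partition
function of the taut configurations changes. A regular solid is encoded by its down-set \<open>S\<close> of cells;
its faces and vertices are those of \<open>face_set S\<close> and \<open>vertex_set S\<close>.

Removing a cell replaces three faces around one vertex, which form a hexagon, by the three opposite
faces of the same cube. Cut all configurations along this hexagon. What the outside sees of the inside
is the colours of its six boundary sides and which of them are connected. For each such boundary state,
the total weight of the fillings of the lower hexagon, closed loops being counted with weight 2, and the
total weight of the fillings of the upper hexagon agree up to the factor coming from the two
exchanged vertices: there are finitely many identities between polynomials in the square roots of
eight values and six face variables of a cube, and each of them follows from Kashaev's recurrence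
(\<open>pair_identities\<close>, \<open>cube_identities\<close>). So the partition function
is invariant (\<open>taut_sum_removal\<close>), and tautness, which only depends on colours and connections,
does not depend on the cube outside of which a configuration is required to be the ground
configuration (\<open>taut_independent\<close>).

On the octant itself the ground configuration is the only taut one (\<open>octant_rigid\<close>): the paths which
are forced to cross the square of side \<open>n\<close> in one of its quadrants are so many that they fill it.
Therefore the partition function equals the monomial of the ground configuration, and
dividing by it gives the value of the solution at the origin as the sum of all weights, with the
normalisation by which the monomial of the ground configuration is the variable at the origin
(\<open>exponent_difference\<close>, \<open>monomial_value_eq\<close>).

The bounds on the exponents are local. A vertex has at most six faces, each contributing an
exponent in \<open>{0, 1/2, 1}\<close>, and the halves occur at changes of colour around the vertex, the number of which
is even (\<open>vertex_exponent_bounds\<close>).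

Finally, the monomial determines the configuration. The face variables separate the types 3 and 4 from
the types 1, 2, 5; in each of these two classes the difference between two configurations is one
number per face, with alternating signs at its corners. Equality of the exponents says that these numbers,
suitably signed, sum to zero around each vertex, and the only such function with finite support is zero
(\<open>zero_vertex_sums\<close>). Knowing the types, the colours propagate from the far blue part along strips of
squares (\<open>equal_kinds_eq\<close>).\<close>

section \<open>Lattice surfaces\<close>

definition negs :: "lattice set" where
  "negs = {(i, j, k). i \<le> -1 \<and> j \<le> -1 \<and> k \<le> -1}"

definition downset :: "lattice set \<Rightarrow> bool" where
  "downset S \<longleftrightarrow> (\<forall>i j k i' j' k'. (i, j, k) \<in> S \<and> i' \<le> i \<and> j' \<le> j \<and> k' \<le> k \<longrightarrow> (i', j', k') \<in> S)"

definition face_set :: "lattice set \<Rightarrow> face set" where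
  "face_set S = {(x, i, j). 1 \<le> i \<and> i < j \<and> j \<le> 3 \<and> x \<notin> S \<and> x - evec (6 - i - j) \<in> S}"

definition vertex_set :: "lattice set \<Rightarrow> lattice set" where
  "vertex_set S = {x. x - (1, 1, 1) \<in> S \<and> x \<notin> S}"

definition edge :: "nat \<Rightarrow> lattice \<Rightarrow> edge" where
  "edge d p = {p, p + evec d}"

lemma evec_simps [simp]:
  "evec 1 = (1, 0, 0)" "evec (Suc 0) = (1, 0, 0)" "evec 2 = (0, 1, 0)" "evec 3 = (0, 0, 1)"
  by (auto simp: evec_def)

lemma downsetD:
  "downset S \<Longrightarrow> (i, j, k) \<in> S \<Longrightarrow> i' \<le> i \<Longrightarrow> j' \<le> j \<Longrightarrow> k' \<le> k \<Longrightarrow> (i', j', k') \<in> S"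
  unfolding downset_def by blast

lemma downset_negs: "downset negs"
  by (auto simp: downset_def negs_def)

lemma face_set_iff:
  "f \<in> face_set S \<longleftrightarrow> (\<exists>x. x \<notin> S \<and>
     (f = (x, 1, 2) \<and> x - (0, 0, 1) \<in> S \<or> f = (x, 1, 3) \<and> x - (0, 1, 0) \<in> S \<or>
      f = (x, 2, 3) \<and> x - (1, 0, 0) \<in> S))" (is "?l \<longleftrightarrow> ?r")
proof
  assume ?l
  then obtain x i j where f: "f = (x, i, j)" "1 \<le> i" "i < j" "j \<le> 3" "x \<notin> S" "x - evec (6 - i - j) \<in> S"
    by (auto simp: face_set_def)
  then consider "i = 1" "j = 2" | "i = 1" "j = 3" | "i = 2" "j = 3" by linarith
  then show ?r using f by cases (cases x; simp)+
qed (auto simp: face_set_def)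

lemma face_set_simps [simp]:
  "(x, Suc 0, 2) \<in> face_set S \<longleftrightarrow> x \<notin> S \<and> x - (0, 0, 1) \<in> S"
  "(x, Suc 0, 3) \<in> face_set S \<longleftrightarrow> x \<notin> S \<and> x - (0, 1, 0) \<in> S"
  "(x, 2, 3) \<in> face_set S \<longleftrightarrow> x \<notin> S \<and> x - (1, 0, 0) \<in> S"
  by (auto simp: face_set_def)

lemma face_cases [consumes 1, case_names 12 13 23]:
  assumes "f \<in> face_set S"
  obtains a b c where "f = ((a, b, c), 1, 2)" "(a, b, c) \<notin> S" "(a, b, c - 1) \<in> S"
        | a b c where "f = ((a, b, c), 1, 3)" "(a, b, c) \<notin> S" "(a, b - 1, c) \<in> S"
        | a b c where "f = ((a, b, c), 2, 3)" "(a, b, c) \<notin> S" "(a - 1, b, c) \<in> S"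
  using assms unfolding face_set_iff by (auto simp: minus_prod_def split: prod.splits)

lemma edge_eq_iff:
  assumes "d \<in> {1, 2, 3}" "d' \<in> {1, 2, 3}"
  shows "edge d p = edge d' p' \<longleftrightarrow> d = d' \<and> p = p'"
  using assms by (cases p; cases p') (auto simp: edge_def doubleton_eq_iff)

lemma edge_eq_simps [simp]:
  "edge d p = edge d p' \<longleftrightarrow> p = p'"
  "edge (Suc 0) p \<noteq> edge 2 p'" "edge 2 p \<noteq> edge (Suc 0) p'"
  "edge (Suc 0) p \<noteq> edge 3 p'" "edge 3 p \<noteq> edge (Suc 0) p'"
  "edge 2 p \<noteq> edge 3 p'" "edge 3 p \<noteq> edge 2 p'"
  by ((cases p; cases p'; auto simp: edge_def doubleton_eq_iff evec_def split: if_splits)+)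

text \<open>The four sides of a face, written as based edges.\<close>

lemma sides_edge:
  "sides (x, i, j) = {edge i x, edge j (x + evec i), edge i (x + evec j), edge j x}"
  by (auto simp: sides_def edge_def cx_def cu_def cv_def cy_def add_ac insert_commute)

lemma corner_sides:
  "{cx (x, i, j), cu (x, i, j)} = edge i x" "{cu (x, i, j), cy (x, i, j)} = edge j (x + evec i)"
  "{cy (x, i, j), cv (x, i, j)} = edge i (x + evec j)" "{cv (x, i, j), cx (x, i, j)} = edge j x"
  by (auto simp: edge_def cx_def cu_def cv_def cy_def add_ac insert_commute)

lemma strands_edge:
  "strands (x, i, j) (C1 c) = {({edge i x, edge j (x + evec i)}, c), ({edge i (x + evec j), edge j x}, c)}"
  "strands (x, i, j) (C2 c) = {({edge j (x + evec i), edge i (x + evec j)}, c), ({edge j x, edge i x}, c)}"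
  "strands (x, i, j) (C3 c) = {({edge i x, edge j (x + evec i)}, c), ({edge i (x + evec j), edge j x}, other c)}"
  "strands (x, i, j) (C4 c) = {({edge j (x + evec i), edge i (x + evec j)}, c), ({edge j x, edge i x}, other c)}"
  "strands (x, i, j) (C5 c) = {({edge j (x + evec i), edge j x}, c), ({edge i x, edge i (x + evec j)}, other c)}"
  by (simp_all only: strands.simps corner_sides)

lemma faces_at_edge:
  shows "{h \<in> face_set S. edge 1 (a, b, c) \<in> sides h} =
     {h. h = ((a, b, c), 1, 2) \<and> (a, b, c) \<notin> S \<and> (a, b, c - 1) \<in> S \<or>
         h = ((a, b, c), 1, 3) \<and> (a, b, c) \<notin> S \<and> (a, b - 1, c) \<in> S \<or>
         h = ((a, b - 1, c), 1, 2) \<and> (a, b - 1, c) \<notin> S \<and> (a, b - 1, c - 1) \<in> S \<or>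
         h = ((a, b, c - 1), 1, 3) \<and> (a, b, c - 1) \<notin> S \<and> (a, b - 1, c - 1) \<in> S}" (is "?A1 = ?B1")
  and "{h \<in> face_set S. edge 2 (a, b, c) \<in> sides h} =
     {h. h = ((a, b, c), 1, 2) \<and> (a, b, c) \<notin> S \<and> (a, b, c - 1) \<in> S \<or>
         h = ((a, b, c), 2, 3) \<and> (a, b, c) \<notin> S \<and> (a - 1, b, c) \<in> S \<or>
         h = ((a - 1, b, c), 1, 2) \<and> (a - 1, b, c) \<notin> S \<and> (a - 1, b, c - 1) \<in> S \<or>
         h = ((a, b, c - 1), 2, 3) \<and> (a, b, c - 1) \<notin> S \<and> (a - 1, b, c - 1) \<in> S}" (is "?A2 = ?B2")
  and "{h \<in> face_set S. edge 3 (a, b, c) \<in> sides h} =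
     {h. h = ((a, b, c), 1, 3) \<and> (a, b, c) \<notin> S \<and> (a, b - 1, c) \<in> S \<or>
         h = ((a, b, c), 2, 3) \<and> (a, b, c) \<notin> S \<and> (a - 1, b, c) \<in> S \<or>
         h = ((a - 1, b, c), 1, 3) \<and> (a - 1, b, c) \<notin> S \<and> (a - 1, b - 1, c) \<in> S \<or>
         h = ((a, b - 1, c), 2, 3) \<and> (a, b - 1, c) \<notin> S \<and> (a - 1, b - 1, c) \<in> S}" (is "?A3 = ?B3")
proof -
  have A1: "h \<in> ?B1" if "h \<in> face_set S" "edge 1 (a, b, c) \<in> sides h" for h
    using that by (cases rule: face_cases) (auto simp: sides_edge)
  have B1: "?B1 \<subseteq> ?A1" by (auto simp: sides_edge)
  show "?A1 = ?B1" by (rule subset_antisym, rule subsetI, rule A1, simp, simp, rule B1)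
  have A2: "h \<in> ?B2" if "h \<in> face_set S" "edge 2 (a, b, c) \<in> sides h" for h
    using that by (cases rule: face_cases) (auto simp: sides_edge)
  have B2: "?B2 \<subseteq> ?A2" by (auto simp: sides_edge)
  show "?A2 = ?B2" by (rule subset_antisym, rule subsetI, rule A2, simp, simp, rule B2)
  have A3: "h \<in> ?B3" if "h \<in> face_set S" "edge 3 (a, b, c) \<in> sides h" for h
    using that by (cases rule: face_cases) (auto simp: sides_edge)
  have B3: "?B3 \<subseteq> ?A3" by (auto simp: sides_edge)
  show "?A3 = ?B3" by (rule subset_antisym, rule subsetI, rule A3, simp, simp, rule B3)
qed

lemma side_of_faceE:
  assumes "f \<in> face_set S" "e \<in> sides f"
  obtains d p where "d \<in> {1, 2, 3}" "e = edge d p"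
proof (cases f)
  case (fields x i j)
  then have "i \<in> {1, 2, 3}" "j \<in> {1, 2, 3}" using assms(1) by (auto simp: face_set_def)
  moreover have "e = edge i x \<or> e = edge j (x + evec i) \<or> e = edge i (x + evec j) \<or> e = edge j x"
    using assms(2) fields by (simp add: sides_edge)
  ultimately show ?thesis using that by metis
qed

text \<open>The four unit cubes around an edge form a square; its cells in a down-set are all or none of
  them unless the edge is on the surface, and then exactly two of the four walls between the cells
  separate the down-set from its complement.\<close>

lemma edge_in_two_faces:
  assumes "downset S" "f \<in> face_set S" "e \<in> sides f"
  obtains f' where "f' \<noteq> f" "{h \<in> face_set S. e \<in> sides h} = {f, f'}"
proof -
  have two: "\<exists>f1 f2. f1 \<noteq> f2 \<and> {h. h = f1' \<or> h = f2'} = {f1, f2}" if "f1' \<noteq> f2'" for f1' f2' :: face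
    using that by blast
  have "\<exists>f1 f2. f1 \<noteq> f2 \<and> {h \<in> face_set S. e \<in> sides h} = {f1, f2}"
  proof -
    obtain d p where d: "d \<in> {1, 2, 3}" and e: "e = edge d p"
      using assms(2,3) by (rule side_of_faceE)
    obtain a b c where p: "p = (a, b, c)" by (cases p)
    have D: "(i', j', k') \<in> S" if "(i, j, k) \<in> S" "i' \<le> i" "j' \<le> j" "k' \<le> k" for i j k i' j' k'
      using downsetD[OF assms(1) that] .
    have f: "f \<in> {h \<in> face_set S. e \<in> sides h}" using assms(2,3) by simp
    have *: "(a, b, c) \<in> S \<Longrightarrow> (a - 1, b, c) \<in> S" "(a, b, c) \<in> S \<Longrightarrow> (a, b - 1, c) \<in> S"
      "(a, b, c) \<in> S \<Longrightarrow> (a, b, c - 1) \<in> S"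
      "(a - 1, b, c) \<in> S \<Longrightarrow> (a - 1, b - 1, c) \<in> S" "(a - 1, b, c) \<in> S \<Longrightarrow> (a - 1, b, c - 1) \<in> S"
      "(a, b - 1, c) \<in> S \<Longrightarrow> (a - 1, b - 1, c) \<in> S" "(a, b - 1, c) \<in> S \<Longrightarrow> (a, b - 1, c - 1) \<in> S"
      "(a, b, c - 1) \<in> S \<Longrightarrow> (a - 1, b, c - 1) \<in> S" "(a, b, c - 1) \<in> S \<Longrightarrow> (a, b - 1, c - 1) \<in> S"
      by (erule D; simp)+
    consider "d = 1" | "d = 2" | "d = 3" using d by blast
    then show ?thesis
    proof cases
      case 1
      have "(a, b, c) \<notin> S" "(a, b - 1, c - 1) \<in> S" using f * unfolding e p 1 faces_at_edge by auto
      then show ?thesis unfolding e p 1 faces_at_edge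
        by (cases "(a, b - 1, c) \<in> S"; cases "(a, b, c - 1) \<in> S") (simp del: split_paired_Ex, rule two, simp)+
    next
      case 2
      have "(a, b, c) \<notin> S" "(a - 1, b, c - 1) \<in> S" using f * unfolding e p 2 faces_at_edge by auto
      then show ?thesis unfolding e p 2 faces_at_edge
        by (cases "(a - 1, b, c) \<in> S"; cases "(a, b, c - 1) \<in> S") (simp del: split_paired_Ex, rule two, simp)+
    next
      case 3
      have "(a, b, c) \<notin> S" "(a - 1, b - 1, c) \<in> S" using f * unfolding e p 3 faces_at_edge by auto
      then show ?thesis unfolding e p 3 faces_at_edge
        by (cases "(a, b - 1, c) \<in> S"; cases "(a - 1, b, c) \<in> S") (simp del: split_paired_Ex, rule two, simp)+
    qed
  qed
  then obtain f1 f2 where "f1 \<noteq> f2" "{h \<in> face_set S. e \<in> sides h} = {f1, f2}" by blast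
  moreover have "f \<in> {h \<in> face_set S. e \<in> sides h}" using assms(2,3) by simp
  ultimately show ?thesis using that[of f1] that[of f2] by auto
qed

section \<open>From solids to down-sets of cells\<close>

definition cells :: "space set \<Rightarrow> lattice set" where
  "cells U = {c. cube c \<subseteq> U}"

text \<open>The cell \<open>(i, j, k)\<close> with the point in \<open>]i, i + 1] \<times> ]j, j + 1] \<times> ]k, k + 1]\<close>. It is the lowest of all cells
  whose cubes contain the point, so a monotone solid contains the point if and only if it contains this cell.\<close>

definition cell_below :: "space \<Rightarrow> lattice" where
  "cell_below = (\<lambda>(a, b, c). (\<lceil>a\<rceil> - 1, \<lceil>b\<rceil> - 1, \<lceil>c\<rceil> - 1))"

lemma mem_solid_iff:
  assumes "stepped_solid U" "monotone_solid U"
  shows "p \<in> U \<longleftrightarrow> cell_below p \<in> cells U"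
proof
  obtain a b c where p: "p = (a, b, c)" by (cases p)
  show "cell_below p \<in> cells U" if "p \<in> U"
  proof -
    obtain T where T: "U = (\<Union>c\<in>T. cube c)" using assms(1) by (auto simp: stepped_solid_def)
    then obtain i j k where ijk: "(i, j, k) \<in> T" "p \<in> cube (i, j, k)" using \<open>p \<in> U\<close> by auto
    then have "cube (i, j, k) \<subseteq> U" using T by auto
    moreover have "\<lceil>a\<rceil> - 1 \<le> i" "\<lceil>b\<rceil> - 1 \<le> j" "\<lceil>c\<rceil> - 1 \<le> k"
      using ijk(2) by (auto simp: p cube_def ceiling_le_iff algebra_simps)
    ultimately show ?thesis
      using assms(2) unfolding monotone_solid_def cells_def cell_below_def p by auto
  qed
  show "p \<in> U" if "cell_below p \<in> cells U"
  proof -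
    have "p \<in> cube (cell_below p)"
      by (auto simp: cube_def cell_below_def p)
    then show ?thesis using that by (auto simp: cells_def)
  qed
qed

lemma downset_cells: "monotone_solid U \<Longrightarrow> downset (cells U)"
  unfolding monotone_solid_def downset_def cells_def by blast

lemma emb_mem_iff:
  assumes "stepped_solid U" "monotone_solid U"
  shows "emb x \<in> U \<longleftrightarrow> x - (1, 1, 1) \<in> cells U"
  unfolding mem_solid_iff[OF assms] by (cases x) (simp add: emb_def cell_below_def)

lemma vertices_eq:
  assumes "stepped_solid U" "monotone_solid U"
  shows "vertices U = vertex_set (cells U)"
  unfolding vertices_def vertex_set_def emb_mem_iff[OF assms] by (auto simp: minus_prod_def)

text \<open>The relative interior of a unit square lies in the boundary of \<open>U\<close> exactly when the square
  separates a cell of \<open>U\<close> from a cell outside \<open>U\<close>. Points of the square are not interior because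
  moving in the direction \<open>(1, 1, 1)\<close> leaves \<open>U\<close> at once; conversely, near the centre of the square
  there are only its two adjacent cells.\<close>

lemma square_subset_frontier_iff:
  assumes "stepped_solid U" "monotone_solid U" and ijk: "(i, j) \<in> {(1, 2), (1, 3), (2, 3)}"
  shows "square (x, i, j) \<subseteq> frontier U \<longleftrightarrow> x \<notin> cells U \<and> x - evec (6 - i - j) \<in> cells U"
proof
  note mem = mem_solid_iff[OF assms(1,2)]
  obtain a b c where x: "x = (a, b, c)" by (cases x)
  have D: "(i', j', k') \<in> cells U" if "(i, j, k) \<in> cells U" "i' \<le> i" "j' \<le> j" "k' \<le> k" for i j k i' j' k'
    using downsetD[OF downset_cells[OF assms(2)] that] .
  assume "square (x, i, j) \<subseteq> frontier U"
  moreover define m where "m = emb x + (1/2) *\<^sub>R emb (evec i) + (1/2) *\<^sub>R emb (evec j)"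
  ultimately have fr: "m \<in> frontier U" unfolding square_def by force
  have near: "cell_below q = x \<or> cell_below q = x - evec (6 - i - j)" if "dist m q < 1/2" for q
  proof -
    obtain q1 q2 q3 where q: "q = (q1, q2, q3)" by (cases q)
    obtain m1 m2 m3 where m: "m = (m1, m2, m3)" by (cases m)
    have b: "\<bar>m1 - q1\<bar> < 1/2" "\<bar>m2 - q2\<bar> < 1/2" "\<bar>m3 - q3\<bar> < 1/2"
    proof -
      have "dist m1 q1 \<le> dist m q" "dist m2 q2 \<le> dist m q" "dist m3 q3 \<le> dist m q"
        using dist_fst_le[of m q] dist_snd_le[of m q] dist_fst_le[of "snd m" "snd q"]
          dist_snd_le[of "snd m" "snd q"] by (auto simp: m q)
      then show "\<bar>m1 - q1\<bar> < 1/2" "\<bar>m2 - q2\<bar> < 1/2" "\<bar>m3 - q3\<bar> < 1/2"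
        using that by (auto simp: dist_real_def)
    qed
    have half: "\<lceil>t\<rceil> - 1 = z" if "\<bar>of_int z + 1/2 - t\<bar> < 1/2" for t :: real and z
      using that by linarith
    have int: "\<lceil>t\<rceil> - 1 = z \<or> \<lceil>t\<rceil> - 1 = z - 1" if "\<bar>of_int z - t\<bar> < 1/2" for t :: real and z
      using that by linarith
    show ?thesis using ijk b half int[of a q1] int[of b q2] int[of c q3] m q unfolding m_def x
      by (auto simp: emb_def cell_below_def)
  qed
  show "x \<notin> cells U \<and> x - evec (6 - i - j) \<in> cells U"
  proof (intro conjI notI)
    assume "x \<in> cells U"
    moreover from this have "x - evec (6 - i - j) \<in> cells U"
      using ijk D[of a b c a b "c - 1"] D[of a b c a "b - 1" c] D[of a b c "a - 1" b c]
      unfolding x by auto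
    ultimately have "ball m (1/2) \<subseteq> U" using near mem by fastforce
    then have "m \<in> interior U" by (meson centre_in_ball half_gt_zero_iff mem_interior zero_less_one)
    with fr show False by (simp add: frontier_def)
  next
    show "x - evec (6 - i - j) \<in> cells U"
    proof (rule ccontr)
      assume n: "x - evec (6 - i - j) \<notin> cells U"
      have "x \<notin> cells U" using n ijk D[of a b c a b "c - 1"] D[of a b c a "b - 1" c] D[of a b c "a - 1" b c]
        unfolding x by auto
      then have "ball m (1/2) \<inter> U = {}" using near mem n by fastforce
      then have "m \<notin> closure U"
        by (metis Int_commute centre_in_ball disjoint_iff half_gt_zero_iff open_Int_closure_eq_empty open_ball zero_less_one)
      with fr show False by (simp add: frontier_def)
    qed
  qed
next
  note mem = mem_solid_iff[OF assms(1,2)]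
  obtain a b c where x: "x = (a, b, c)" by (cases x)
  have D: "(i', j', k') \<in> cells U" if "(i, j, k) \<in> cells U" "i' \<le> i" "j' \<le> j" "k' \<le> k" for i j k i' j' k'
    using downsetD[OF downset_cells[OF assms(2)] that] .
  assume A: "x \<notin> cells U \<and> x - evec (6 - i - j) \<in> cells U"
  show "square (x, i, j) \<subseteq> frontier U"
  proof
    fix p assume p: "p \<in> square (x, i, j)"
    obtain p1 p2 p3 where pp: "p = (p1, p2, p3)" by (cases p)
    have ge: "of_int a \<le> p1" "of_int b \<le> p2" "of_int c \<le> p3"
      using p ijk by (auto simp: square_def pp x emb_def)
    have "p \<in> cube (x - evec (6 - i - j))"
      using p ijk by (auto simp: square_def pp x emb_def cube_def)
    then have "p \<in> closure U" using A closure_subset by (auto simp: cells_def)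
    moreover have "p \<notin> interior U"
    proof
      assume "p \<in> interior U"
      then obtain e where e: "e > 0" "ball p e \<subseteq> U" by (auto simp: mem_interior)
      define q :: space where "q = p + (e/4, e/4, e/4)"
      have "dist p q = norm (e/4, e/4, e/4)" unfolding q_def dist_norm by (simp add: pp norm_Pair)
      also have "\<dots> \<le> e/4 + (e/4 + e/4)"
        using norm_Pair_le[of "e/4" "(e/4, e/4)"] norm_Pair_le[of "e/4" "e/4"] e(1) by simp
      also have "\<dots> < e" using e(1) by simp
      finally have "q \<in> U" using e(2) by auto
      then have "cell_below q \<in> cells U" using mem by simp
      moreover have "a \<le> \<lceil>p1 + e/4\<rceil> - 1" "b \<le> \<lceil>p2 + e/4\<rceil> - 1" "c \<le> \<lceil>p3 + e/4\<rceil> - 1"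
        using ge e(1) by linarith+
      ultimately show False using A D unfolding x q_def pp cell_below_def by auto
    qed
    ultimately show "p \<in> frontier U" by (simp add: frontier_def)
  qed
qed

lemma faces_eq:
  assumes "stepped_solid U" "monotone_solid U"
  shows "faces U = face_set (cells U)"
proof -
  have "(x, i, j) \<in> faces U \<longleftrightarrow> (x, i, j) \<in> face_set (cells U)" for x i j
  proof (cases "1 \<le> i \<and> i < j \<and> j \<le> 3")
    case True
    then have "(i, j) \<in> {(1, 2), (1, 3), (2, 3)}" by auto
    from square_subset_frontier_iff[OF assms this] True show ?thesis
      by (simp add: faces_def face_set_def)
  qed (auto simp: faces_def face_set_def)
  then show ?thesis by (metis prod_cases3 subsetI subset_antisym)
qed

lemma octant_solid: "stepped_solid octant" "monotone_solid octant" "cells octant = negs"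
proof -
  have c: "cube (i, j, k) \<subseteq> octant \<longleftrightarrow> i \<le> -1 \<and> j \<le> -1 \<and> k \<le> -1" for i j k
  proof
    assume "cube (i, j, k) \<subseteq> octant"
    moreover have "(of_int i + 1, of_int j + 1, of_int k + 1) \<in> cube (i, j, k)" by (simp add: cube_def)
    ultimately have "(of_int i + 1, of_int j + 1, of_int k + 1) \<in> octant" by blast
    then show "i \<le> -1 \<and> j \<le> -1 \<and> k \<le> -1" unfolding octant_def by auto
  next
    assume "i \<le> -1 \<and> j \<le> -1 \<and> k \<le> -1"
    then have "real_of_int i + 1 \<le> 0" "real_of_int j + 1 \<le> 0" "real_of_int k + 1 \<le> 0" by linarith+
    then show "cube (i, j, k) \<subseteq> octant" unfolding cube_def octant_def by auto
  qed
  show n: "cells octant = negs" unfolding cells_def negs_def using c by auto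
  show "monotone_solid octant" unfolding monotone_solid_def c by auto
  have "octant = (\<Union>c\<in>negs. cube c)"
  proof
    show "octant \<subseteq> (\<Union>c\<in>negs. cube c)"
    proof
      fix p assume p: "p \<in> octant"
      obtain p1 p2 p3 where pp: "p = (p1, p2, p3)" by (cases p)
      have "p \<in> cube (cell_below p)" by (auto simp: cube_def cell_below_def pp)
      moreover have "cell_below p \<in> negs" using p by (auto simp: octant_def negs_def cell_below_def pp)
      ultimately show "p \<in> (\<Union>c\<in>negs. cube c)" by blast
    qed
    show "(\<Union>c\<in>negs. cube c) \<subseteq> octant" using n by (auto simp: cells_def)
  qed
  then show "stepped_solid octant" unfolding stepped_solid_def by blast
qed

section \<open>Tautness in terms of cells\<close>

text \<open>A configuration is a loop configuration when there is one colouring of the edges that all local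
  configurations respect. Compared with the pairwise condition on strands, this splits into one condition per
  face.\<close>

definition fits :: "(edge \<Rightarrow> colour) \<Rightarrow> face \<Rightarrow> local_config \<Rightarrow> bool" where
  "fits col f \<tau> \<longleftrightarrow> (\<forall>s c e. (s, c) \<in> strands f \<tau> \<longrightarrow> e \<in> s \<longrightarrow> col e = c)"

lemma fitsD: "fits col f \<tau> \<Longrightarrow> (s, c) \<in> strands f \<tau> \<Longrightarrow> e \<in> s \<Longrightarrow> col e = c"
  by (simp add: fits_def)

definition loops :: "lattice set \<Rightarrow> (face \<Rightarrow> local_config) set" where
  "loops S = {\<sigma> \<in> face_set S \<rightarrow>\<^sub>E UNIV. \<exists>col. \<forall>f\<in>face_set S. fits col f (\<sigma> f)}"

lemma loop_configs_eq:
  assumes "faces U = face_set S"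
  shows "loop_configs U = loops S"
proof -
  have "(\<forall>f\<in>F. \<forall>f'\<in>F. \<forall>(s, c)\<in>strands f (\<sigma> f). \<forall>(s', c')\<in>strands f' (\<sigma> f'). s \<inter> s' \<noteq> {} \<longrightarrow> c = c')
    \<longleftrightarrow> (\<exists>col. \<forall>f\<in>F. fits col f (\<sigma> f))" (is "?l \<longleftrightarrow> ?r") for F and \<sigma> :: "face \<Rightarrow> local_config"
  proof
    assume l: ?l
    have eq: "c = c'" if "f \<in> F" "f' \<in> F" "(s, c) \<in> strands f (\<sigma> f)" "(s', c') \<in> strands f' (\<sigma> f')"
      "s \<inter> s' \<noteq> {}" for f f' s c s' c'
    proof -
      have "\<forall>(s', c')\<in>strands f' (\<sigma> f'). s \<inter> s' \<noteq> {} \<longrightarrow> c = c'"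
        using bspec[OF bspec[OF bspec[OF l that(1)] that(2)] that(3)] by simp
      from bspec[OF this that(4)] that(5) show ?thesis by simp
    qed
    define col where "col e = (SOME c. \<exists>f\<in>F. \<exists>s. (s, c) \<in> strands f (\<sigma> f) \<and> e \<in> s)" for e
    have "col e = c" if "f \<in> F" "(s, c) \<in> strands f (\<sigma> f)" "e \<in> s" for f s c e
    proof -
      have "\<exists>f\<in>F. \<exists>s. (s, col e) \<in> strands f (\<sigma> f) \<and> e \<in> s"
        unfolding col_def by (rule someI[where x = c]) (use that in blast)
      then obtain f' s' where "f' \<in> F" "(s', col e) \<in> strands f' (\<sigma> f')" "e \<in> s'" by blast
      then show ?thesis using eq[of f' f s' "col e" s c] that by blast
    qed
    then show ?r unfolding fits_def by (intro exI[of _ col] ballI) blast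
  next
    assume ?r
    then obtain col where col: "\<And>f. f \<in> F \<Longrightarrow> fits col f (\<sigma> f)" by blast
    have "c = c'" if "f \<in> F" "f' \<in> F" "(s, c) \<in> strands f (\<sigma> f)" "(s', c') \<in> strands f' (\<sigma> f')"
      "s \<inter> s' \<noteq> {}" for f f' s c s' c'
      using fitsD[OF col[OF that(1)] that(3)] fitsD[OF col[OF that(2)] that(4)] that(5) by blast
    then show ?l by (intro ballI, clarify) blast
  qed
  then show ?thesis unfolding loop_configs_def loops_def assms by simp
qed

definition linkage :: "face set \<Rightarrow> (face \<Rightarrow> local_config) \<Rightarrow> (edge \<times> edge) set" where
  "linkage F \<sigma> = {(a, b). \<exists>f\<in>F. \<exists>c. ({a, b}, c) \<in> strands f (\<sigma> f)}"

lemma linked_eq: "linked U \<sigma> = linkage (faces U) \<sigma>"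
  by (simp add: linked_def linkage_def)

lemma linkage_Un: "linkage (F \<union> G) \<sigma> = linkage F \<sigma> \<union> linkage G \<sigma>"
  by (auto simp: linkage_def)

lemma linkage_mono: "F \<subseteq> G \<Longrightarrow> linkage F \<sigma> \<subseteq> linkage G \<sigma>"
  by (auto simp: linkage_def)

lemma linkage_cong: "(\<And>f. f \<in> F \<Longrightarrow> \<sigma> f = \<tau> f) \<Longrightarrow> linkage F \<sigma> = linkage F \<tau>"
  by (auto simp: linkage_def)

lemma linkage_sym: "(a, b) \<in> linkage F \<sigma> \<Longrightarrow> (b, a) \<in> linkage F \<sigma>"
  by (auto simp: linkage_def insert_commute)

lemma linkage_rtrancl_sym: "(a, b) \<in> (linkage F \<sigma>)\<^sup>* \<Longrightarrow> (b, a) \<in> (linkage F \<sigma>)\<^sup>*"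
  by (meson linkage_sym sym_rtrancl symI symD)

lemma strand_sides: "(s, c) \<in> strands f \<tau> \<Longrightarrow> s \<subseteq> sides f"
  by (cases \<tau>) (auto simp: sides_def)

lemma linkage_sides: "(a, b) \<in> linkage F \<sigma> \<Longrightarrow> \<exists>f\<in>F. a \<in> sides f \<and> b \<in> sides f"
  unfolding linkage_def using strand_sides by fastforce

text \<open>Cubes replace Euclidean balls: the condition depends on the lattice point at the lower corner of a
  face alone, and far faces are literally the same for all solids that agree with the octant on far cells.\<close>

definition far :: "int \<Rightarrow> lattice \<Rightarrow> bool" where
  "far n = (\<lambda>(a, b, c). a < -n \<or> b < -n \<or> c < -n)"

definition far_faces :: "int \<Rightarrow> lattice set \<Rightarrow> face set" where
  "far_faces n S = {f \<in> face_set S. far n (cx f)}"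

definition near_faces :: "int \<Rightarrow> lattice set \<Rightarrow> face set" where
  "near_faces n S = {f \<in> face_set S. \<not> far n (cx f)}"

definition far_edges :: "int \<Rightarrow> edge set" where
  "far_edges n = (\<Union>f\<in>far_faces n negs. sides f)"

definition ground :: "(edge \<times> edge) set" where
  "ground = linkage (face_set negs) (\<lambda>_. C1 Blue)"

definition full_outside :: "int \<Rightarrow> lattice set \<Rightarrow> bool" where
  "full_outside n S \<longleftrightarrow> 0 \<le> n \<and> downset S \<and> S \<subseteq> negs \<and> (\<forall>x\<in>negs - S. \<not> far n x)"

text \<open>Tautness with respect to a cube. All far edges take part in the connectivity condition, not only those
  at the border of the far region; the far faces connect each of them to the border in the same way in
  both configurations.\<close>

definition taut :: "int \<Rightarrow> lattice set \<Rightarrow> (face \<Rightarrow> local_config) set" where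
  "taut n S = {\<sigma> \<in> loops S. (\<forall>f\<in>far_faces n S. \<sigma> f = C1 Blue) \<and>
     (\<forall>a\<in>far_edges n. \<forall>b\<in>far_edges n. (a, b) \<in> ground\<^sup>* \<longrightarrow> (a, b) \<in> (linkage (face_set S) \<sigma>)\<^sup>*)}"

lemma face_set_split: "face_set S = far_faces n S \<union> near_faces n S"
  by (auto simp: far_faces_def near_faces_def)

lemma far_minus: "far n x \<Longrightarrow> 0 \<le> i \<Longrightarrow> 0 \<le> j \<Longrightarrow> 0 \<le> k \<Longrightarrow> far n (x - (i, j, k))"
  by (cases x) (auto simp: far_def)

lemma far_minus_evec: "far n x \<Longrightarrow> far n (x - evec k)"
  by (cases x) (auto simp: far_def evec_def)

lemma full_outside_iff: "full_outside n S \<Longrightarrow> far n x \<Longrightarrow> x \<in> S \<longleftrightarrow> x \<in> negs"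
  by (auto simp: full_outside_def)

lemma far_faces_eq:
  assumes "full_outside n S"
  shows "far_faces n S = far_faces n negs"
proof -
  have "f \<in> face_set S \<longleftrightarrow> f \<in> face_set negs" if "far n (cx f)" for f
  proof (cases f)
    case (fields x i j)
    then have "far n x" "far n (x - evec (6 - i - j))" using that far_minus_evec by (auto simp: cx_def)
    then show ?thesis using full_outside_iff[OF assms] by (simp add: fields face_set_def)
  qed
  then show ?thesis by (auto simp: far_faces_def)
qed

lemma far_vertex_iff:
  assumes "full_outside n S" "far n x"
  shows "x \<in> vertex_set S \<longleftrightarrow> x \<in> vertex_set negs"
  using full_outside_iff[OF assms] full_outside_iff[OF assms(1) far_minus[OF assms(2), of 1 1 1]]
  by (simp add: vertex_set_def)

text \<open>A chain of two kinds of steps between points of \<open>N\<close>, where steps of the first kind stay in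
  \<open>N\<close>, only uses chains of steps of the second kind that start and end in \<open>N\<close>.\<close>

lemma rtrancl_Un_interface:
  assumes "A \<subseteq> N \<times> N" "a \<in> N" "b \<in> N"
  shows "(a, b) \<in> (A \<union> B)\<^sup>* \<longleftrightarrow> (a, b) \<in> (A \<union> (B\<^sup>* \<inter> N \<times> N))\<^sup>*"
proof
  let ?K = "(A \<union> (B\<^sup>* \<inter> N \<times> N))\<^sup>*"
  assume "(a, b) \<in> (A \<union> B)\<^sup>*"
  then have "\<exists>c\<in>N. (a, c) \<in> ?K \<and> (c, b) \<in> B\<^sup>*"
  proof (induction rule: rtrancl_induct)
    case base
    then show ?case using assms(2) by blast
  next
    case (step y z)
    then obtain c where c: "c \<in> N" "(a, c) \<in> ?K" "(c, y) \<in> B\<^sup>*" by blast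
    show ?case
    proof (cases "(y, z) \<in> B")
      case True
      then show ?thesis using c by (meson rtrancl.rtrancl_into_rtrancl)
    next
      case False
      then have yz: "(y, z) \<in> A" using step by blast
      then have N: "y \<in> N" "z \<in> N" using assms(1) by auto
      have "(c, y) \<in> A \<union> (B\<^sup>* \<inter> N \<times> N)" using c N by blast
      then have "(a, y) \<in> ?K" using c(2) by (rule rtrancl_into_rtrancl[rotated])
      then have "(a, z) \<in> ?K" using yz by (meson UnI1 rtrancl.rtrancl_into_rtrancl)
      then show ?thesis using N by blast
    qed
  qed
  then obtain c where c: "c \<in> N" "(a, c) \<in> ?K" "(c, b) \<in> B\<^sup>*" by blast
  then have "(c, b) \<in> A \<union> (B\<^sup>* \<inter> N \<times> N)" using assms(3) by blast
  then show "(a, b) \<in> ?K" using c(2) by (rule rtrancl_into_rtrancl[rotated])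
next
  assume "(a, b) \<in> (A \<union> (B\<^sup>* \<inter> N \<times> N))\<^sup>*"
  moreover have "A \<union> (B\<^sup>* \<inter> N \<times> N) \<subseteq> (A \<union> B)\<^sup>*"
    using rtrancl_mono[of B "A \<union> B"] by auto
  ultimately show "(a, b) \<in> (A \<union> B)\<^sup>*"
    by (metis rtrancl_mono rtrancl_idemp subsetD)
qed

lemma norm_emb_le: "norm (emb (a, b, c)) \<le> \<bar>of_int a\<bar> + \<bar>of_int b\<bar> + \<bar>of_int c\<bar>"
  using norm_Pair_le[of "of_int a :: real" "(of_int b :: real, of_int c :: real)"] norm_Pair_le[of "of_int b :: real" "of_int c :: real"]
  by (simp add: emb_def)

lemma norm_emb_ge: "\<bar>of_int a\<bar> \<le> norm (emb (a, b, c))" "\<bar>of_int b\<bar> \<le> norm (emb (a, b, c))"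
  "\<bar>of_int c\<bar> \<le> norm (emb (a, b, c))"
proof -
  let ?p = "emb (a, b, c)"
  have "norm (fst ?p) \<le> norm ?p" "norm (snd ?p) \<le> norm ?p" "norm (fst (snd ?p)) \<le> norm (snd ?p)"
    "norm (snd (snd ?p)) \<le> norm (snd ?p)"
    using norm_fst_le[of "fst ?p" "snd ?p"] norm_snd_le[of "snd ?p" "fst ?p"]
      norm_fst_le[of "fst (snd ?p)" "snd (snd ?p)"] norm_snd_le[of "snd (snd ?p)" "fst (snd ?p)"] by simp_all
  then show "\<bar>of_int a\<bar> \<le> norm (emb (a, b, c))" "\<bar>of_int b\<bar> \<le> norm (emb (a, b, c))"
    "\<bar>of_int c\<bar> \<le> norm (emb (a, b, c))"
    by (simp_all add: emb_def)
qed

lemma far_face_outside: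
  assumes "far n (cx f)" "R \<le> of_int n" "0 \<le> n"
  shows "\<not> square f \<subseteq> cball 0 R"
proof
  obtain x i j where f: "f = (x, i, j)" by (cases f)
  obtain a b c where x: "x = (a, b, c)" by (cases x)
  assume "square f \<subseteq> cball 0 R"
  moreover have "emb x \<in> square f" unfolding square_def f by (auto intro!: exI[of _ 0])
  ultimately have "norm (emb x) \<le> R" by auto
  then have "\<bar>real_of_int a\<bar> \<le> R" "\<bar>real_of_int b\<bar> \<le> R" "\<bar>real_of_int c\<bar> \<le> R"
    using norm_emb_ge[where a = a and b = b and c = c] unfolding x by linarith+
  then have "\<bar>real_of_int a\<bar> \<le> of_int n" "\<bar>real_of_int b\<bar> \<le> of_int n" "\<bar>real_of_int c\<bar> \<le> of_int n"
    using assms(2) by linarith+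
  then have "\<not> far n x" unfolding x far_def by auto
  then show False using assms(1) by (simp add: f cx_def)
qed

lemma near_norm_le:
  assumes "\<not> far n x" "x - (1, 1, 1) \<in> negs"
  shows "norm (emb x) \<le> 3 * of_int n"
proof -
  obtain a b c where x: "x = (a, b, c)" by (cases x)
  have "-n \<le> a \<and> -n \<le> b \<and> -n \<le> c \<and> a \<le> 0 \<and> b \<le> 0 \<and> c \<le> 0"
    using assms by (auto simp: x far_def negs_def)
  then have "\<bar>real_of_int a\<bar> \<le> of_int n" "\<bar>real_of_int b\<bar> \<le> of_int n" "\<bar>real_of_int c\<bar> \<le> of_int n"
    by linarith+
  then show ?thesis using norm_emb_le[of a b c] unfolding x by linarith
qed

lemma near_face_inside:
  assumes "f \<in> near_faces n S" "S \<subseteq> negs"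
  shows "square f \<subseteq> cball 0 (3 * of_int n + 2)"
proof -
  obtain x i j where f: "f = (x, i, j)" by (cases f)
  have fS: "f \<in> face_set S" "\<not> far n x" using assms(1) by (auto simp: near_faces_def f cx_def)
  have one: "norm (emb (evec k)) = 1" for k by (simp add: evec_def emb_def norm_Pair)
  have "x - (1, 1, 1) \<in> negs" using fS(1)
  proof (cases rule: face_cases)
    case (12 a b c)
    then have "(a, b, c - 1) \<in> negs" using assms(2) by blast
    then show ?thesis using 12(1) f by (simp add: negs_def)
  next
    case (13 a b c)
    then have "(a, b - 1, c) \<in> negs" using assms(2) by blast
    then show ?thesis using 13(1) f by (simp add: negs_def)
  next
    case (23 a b c)
    then have "(a - 1, b, c) \<in> negs" using assms(2) by blast
    then show ?thesis using 23(1) f by (simp add: negs_def)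
  qed
  then have n: "norm (emb x) \<le> 3 * of_int n" using near_norm_le fS(2) by blast
  have bound: "norm (emb x + s *\<^sub>R emb (evec i) + t *\<^sub>R emb (evec j)) \<le> 3 * of_int n + 2"
    if "0 \<le> s" "s \<le> 1" "0 \<le> t" "t \<le> 1" for s t
  proof -
    have "norm (emb x + s *\<^sub>R emb (evec i) + t *\<^sub>R emb (evec j))
      \<le> norm (emb x) + norm (s *\<^sub>R emb (evec i)) + norm (t *\<^sub>R emb (evec j))"
      by (meson norm_triangle_mono order_refl)
    also have "\<dots> \<le> 3 * of_int n + 1 + 1" using n one[of i] one[of j] that by simp
    finally show ?thesis by simp
  qed
  show ?thesis
  proof
    fix p assume "p \<in> square f"
    then obtain s t where "p = emb x + s *\<^sub>R emb (evec i) + t *\<^sub>R emb (evec j)"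
      "0 \<le> s" "s \<le> 1" "0 \<le> t" "t \<le> 1"
      unfolding square_def f by auto
    then show "p \<in> cball 0 (3 * of_int n + 2)" using bound by (simp add: mem_cball_0)
  qed
qed

lemma sigma0_eq: "f \<in> face_set negs \<Longrightarrow> sigma0 f = C1 Blue"
  by (simp add: sigma0_def faces_eq octant_solid)

lemma linked_ground: "linked octant sigma0 = ground"
  unfolding linked_eq ground_def faces_eq[OF octant_solid(1,2)] octant_solid(3)
  by (rule linkage_cong) (simp add: sigma0_eq)

lemma regular_cells:
  assumes "regular_solid U"
  shows "faces U = face_set (cells U)" "vertices U = vertex_set (cells U)" "downset (cells U)"
    "cells U \<subseteq> negs" "finite (negs - cells U)" "stepped_solid U" "monotone_solid U"
proof -
  have U: "stepped_solid U" "monotone_solid U" "U \<subseteq> octant" "finite {c. cube c \<subseteq> octant \<and> \<not> cube c \<subseteq> U}"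
    using assms by (auto simp: regular_solid_def)
  show "faces U = face_set (cells U)" "vertices U = vertex_set (cells U)" "downset (cells U)"
    "stepped_solid U" "monotone_solid U"
    using U by (auto simp: faces_eq vertices_eq downset_cells)
  show "cells U \<subseteq> negs" using U(3) octant_solid(3) by (auto simp: cells_def)
  show "finite (negs - cells U)"
    using U(4) unfolding octant_solid(3)[symmetric] by (rule finite_subset[rotated]) (auto simp: cells_def)
qed

lemma finite_not_far: "finite A \<Longrightarrow> \<exists>n\<ge>m. \<forall>x\<in>A. \<not> far n x"
proof (induction A rule: finite_induct)
  case (insert x A)
  then obtain n where n: "n \<ge> m" "\<forall>x\<in>A. \<not> far n x" by blast
  obtain a b c where x: "x = (a, b, c)" by (cases x)
  have "\<not> far (max n (\<bar>a\<bar> + \<bar>b\<bar> + \<bar>c\<bar>)) y" if "y \<in> insert x A" for y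
    using that n x by (cases y) (fastforce simp: far_def)
  then show ?case using n(1) by (meson max.coboundedI1)
qed auto

lemma full_outside_exists:
  assumes "regular_solid U"
  obtains n where "n \<ge> m" "full_outside n (cells U)"
  using finite_not_far[OF regular_cells(5)[OF assms], of "max m 0"] regular_cells(3,4)[OF assms]
  by (auto simp: full_outside_def)

text \<open>Balls and cubes are cofinal. A connection between two gates of a ball may be followed outwards to the far
  edges of a larger cube, and conversely, since beyond the smaller region both configurations are the
  ground configuration.\<close>

lemma taut_configs_eq:
  assumes U: "regular_solid U"
  shows "taut_configs U = (\<Union>n\<in>{n. full_outside n (cells U)}. taut n (cells U))"
proof -
  define S where "S = cells U"
  note reg = regular_cells[OF U, folded S_def]
  have FO: "faces octant = face_set negs" by (simp add: faces_eq octant_solid)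
  have VO: "vertices octant = vertex_set negs" by (simp add: vertices_eq octant_solid)
  have lc: "loop_configs U = loops S" using loop_configs_eq reg(1) by blast
  have lk: "linked U \<sigma> = linkage (face_set S) \<sigma>" for \<sigma> by (simp add: linked_eq reg(1))
  show ?thesis unfolding S_def[symmetric]
  proof (intro subset_antisym subsetI)
    fix \<sigma> assume "\<sigma> \<in> taut_configs U"
    then obtain R where \<sigma>: "\<sigma> \<in> loops S" and R: "same_outside U R"
      and out: "\<And>f. f \<in> outside_faces U R \<Longrightarrow> \<sigma> f = sigma0 f"
      and gate: "\<And>a b. a \<in> gates U R \<Longrightarrow> b \<in> gates U R \<Longrightarrow> (a, b) \<in> ground\<^sup>* \<Longrightarrow> (a, b) \<in> (linkage (face_set S) \<sigma>)\<^sup>*"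
      unfolding taut_configs_def lc lk linked_ground by blast
    obtain n where n: "n \<ge> \<lceil>R\<rceil>" "full_outside n S" using full_outside_exists[OF U, folded S_def] by blast
    have nR: "R \<le> of_int n" "0 \<le> n" using n by (auto simp: full_outside_def ceiling_le_iff)
    define O' where "O' = outside_faces U R"
    have O'_eq: "O' = outside_faces octant R" using R by (simp add: O'_def same_outside_def)
    then have O'_sub: "O' \<subseteq> face_set S" "O' \<subseteq> face_set negs"
      unfolding O'_def outside_faces_def using reg(1) FO O'_def by (auto simp: outside_faces_def)
    have far: "far_faces n negs \<subseteq> O'"
      using far_face_outside nR unfolding O'_eq outside_faces_def FO far_faces_def by blast
    have "\<sigma> f = C1 Blue" if "f \<in> far_faces n S" for f
      using that far out O'_sub sigma0_eq unfolding far_faces_eq[OF n(2)] O'_def by (metis subsetD)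
    moreover have "(a, b) \<in> (linkage (face_set S) \<sigma>)\<^sup>*"
      if ab: "a \<in> far_edges n" "b \<in> far_edges n" "(a, b) \<in> ground\<^sup>*" for a b
    proof -
      define I where "I = inside_faces octant R"
      define N where "N = (\<Union>f\<in>O'. sides f)"
      define A where "A = linkage O' (\<lambda>_. C1 Blue)"
      define B where "B = linkage I (\<lambda>_. C1 Blue)"
      have "face_set negs = O' \<union> I" unfolding O'_eq I_def inside_faces_def outside_faces_def FO by auto
      then have AB: "ground = A \<union> B" by (simp add: ground_def A_def B_def linkage_Un)
      have AN: "A \<subseteq> N \<times> N" unfolding A_def N_def by (auto dest!: linkage_sides)
      have abN: "a \<in> N" "b \<in> N" using ab far unfolding far_edges_def N_def by auto
      have gateI: "c \<in> gates U R" if c: "c \<in> N" "f \<in> I" "c \<in> sides f" for c f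
      proof -
        obtain h where h: "h \<in> O'" "c \<in> sides h" using c unfolding N_def by blast
        have hS: "h \<in> face_set S" "h \<in> face_set negs" using h O'_sub by auto
        obtain h' where h': "h' \<noteq> h" "{k \<in> face_set S. c \<in> sides k} = {h, h'}"
          using edge_in_two_faces[OF reg(3) hS(1) h(2)] .
        obtain h'' where h'': "h'' \<noteq> h" "{k \<in> face_set negs. c \<in> sides k} = {h, h''}"
          using edge_in_two_faces[OF downset_negs hS(2) h(2)] .
        have fO: "f \<notin> O'" "f \<in> face_set negs"
          using c(2) unfolding I_def O'_eq inside_faces_def outside_faces_def FO by auto
        have "f \<in> {k \<in> face_set negs. c \<in> sides k}" using fO(2) c(3) by simp
        then have "f \<in> {h, h''}" unfolding h''(2) .
        moreover have "f \<noteq> h" using fO(1) h(1) by blast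
        ultimately have "f = h''" by simp
        have "h' \<in> {k \<in> face_set S. c \<in> sides k}" unfolding h'(2) by simp
        then have h'S: "h' \<in> face_set S" "c \<in> sides h'" by simp_all
        have "h' \<notin> O'"
        proof
          assume "h' \<in> O'"
          then have "h' \<in> {k \<in> face_set negs. c \<in> sides k}" using subsetD[OF O'_sub(2)] h'S(2) by simp
          then have "h' \<in> {h, h''}" unfolding h''(2) .
          then have "h' = h''" using h'(1) by simp
          then show False using \<open>h' \<in> O'\<close> \<open>f = h''\<close> fO by simp
        qed
        then have "h' \<in> inside_faces U R"
          using h'S(1) unfolding O'_def inside_faces_def outside_faces_def reg(1) by simp
        then show ?thesis using h h'S(2) unfolding gates_def O'_def by blast
      qed
      have "(a, b) \<in> (A \<union> (B\<^sup>* \<inter> N \<times> N))\<^sup>*"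
        using ab(3) rtrancl_Un_interface[OF AN abN] unfolding AB by blast
      moreover have "A \<subseteq> (linkage (face_set S) \<sigma>)\<^sup>*"
      proof -
        have "A = linkage O' \<sigma>" unfolding A_def
          by (rule linkage_cong) (use out O'_sub sigma0_eq O'_def in \<open>metis subsetD\<close>)
        then show ?thesis using linkage_mono[OF O'_sub(1)] by blast
      qed
      moreover have "B\<^sup>* \<inter> N \<times> N \<subseteq> (linkage (face_set S) \<sigma>)\<^sup>*"
      proof (clarify)
        fix c d assume cd: "(c, d) \<in> B\<^sup>*" "c \<in> N" "d \<in> N"
        show "(c, d) \<in> (linkage (face_set S) \<sigma>)\<^sup>*"
        proof (cases "c = d")
          case False
          obtain c' where "(c, c') \<in> B" using cd(1) False by (meson converse_rtranclE)
          then have c: "c \<in> gates U R" using gateI cd(2) unfolding B_def by (blast dest: linkage_sides)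
          obtain d' where "(d', d) \<in> B" using cd(1) False by (meson rtranclE)
          then have d: "d \<in> gates U R" using gateI cd(3) unfolding B_def by (blast dest: linkage_sides)
          have "(c, d) \<in> ground\<^sup>*" using cd(1) unfolding AB by (meson Un_upper2 rtrancl_mono subsetD)
          then show ?thesis using gate c d by blast
        qed simp
      qed
      ultimately show ?thesis by (meson Un_least rtrancl_subset_rtrancl subsetD)
    qed
    ultimately show "\<sigma> \<in> (\<Union>n\<in>{n. full_outside n S}. taut n S)" using \<sigma> n(2) unfolding taut_def by blast
  next
    fix \<sigma> assume "\<sigma> \<in> (\<Union>n\<in>{n. full_outside n S}. taut n S)"
    then obtain n where n: "full_outside n S" and \<sigma>: "\<sigma> \<in> loops S"
      and far: "\<And>f. f \<in> far_faces n S \<Longrightarrow> \<sigma> f = C1 Blue"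
      and conn: "\<And>a b. a \<in> far_edges n \<Longrightarrow> b \<in> far_edges n \<Longrightarrow> (a, b) \<in> ground\<^sup>* \<Longrightarrow> (a, b) \<in> (linkage (face_set S) \<sigma>)\<^sup>*"
      unfolding taut_def by blast
    define R :: real where "R = 3 * of_int n + 2"
    have nearS: "f \<in> near_faces n S \<Longrightarrow> square f \<subseteq> cball 0 R" for f
      unfolding R_def using near_face_inside reg(4) by blast
    have nearO: "f \<in> near_faces n negs \<Longrightarrow> square f \<subseteq> cball 0 R" for f
      unfolding R_def using near_face_inside by blast
    have eq: "outside_faces U R = {f \<in> far_faces n negs. \<not> square f \<subseteq> cball 0 R}"
      "outside_faces octant R = {f \<in> far_faces n negs. \<not> square f \<subseteq> cball 0 R}"
      unfolding outside_faces_def reg(1) FO face_set_split[of S n] face_set_split[of negs n] far_faces_eq[OF n]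
      using nearS nearO by blast+
    have near: "emb x \<in> cball 0 R" if "x - (1, 1, 1) \<in> negs" "\<not> far n x" for x
      using near_norm_le[OF that(2,1)] unfolding R_def by simp
    have "x \<in> vertex_set S \<longleftrightarrow> x \<in> vertex_set negs" if "emb x \<notin> cball 0 R" for x
    proof (cases "far n x")
      case True
      then show ?thesis by (rule far_vertex_iff[OF n])
    next
      case False
      then have "x - (1, 1, 1) \<notin> negs" using near that by blast
      then show ?thesis using reg(4) by (auto simp: vertex_set_def)
    qed
    then have same: "same_outside U R" unfolding same_outside_def reg(2) VO using eq by auto
    have gates: "gates U R \<subseteq> far_edges n" unfolding gates_def eq(1) far_edges_def by auto
    have "\<sigma> f = sigma0 f" if "f \<in> outside_faces U R" for f
    proof -
      have f: "f \<in> far_faces n negs" using that unfolding eq(1) by blast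
      then have "f \<in> face_set negs" by (simp add: far_faces_def)
      then show ?thesis using far[of f] f far_faces_eq[OF n] sigma0_eq[of f] by simp
    qed
    moreover have "(a, b) \<in> (linkage (face_set S) \<sigma>)\<^sup>*"
      if "a \<in> gates U R" "b \<in> gates U R" "(a, b) \<in> ground\<^sup>*" for a b
      using conn subsetD[OF gates that(1)] subsetD[OF gates that(2)] that(3) by blast
    ultimately show "\<sigma> \<in> taut_configs U"
      unfolding taut_configs_def lc lk linked_ground using \<sigma> same by blast
  qed
qed

section \<open>Identities on a unit cube\<close>

text \<open>The weight of a face in terms of the square roots of the vertex variables and of the face variable,
  which makes it a monomial.\<close>

fun face_weight :: "real \<Rightarrow> real \<Rightarrow> real \<Rightarrow> real \<Rightarrow> real \<Rightarrow> nat \<Rightarrow> real" where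
  "face_weight px pu py pv F k =
    (if k = 1 then px^2 * py^2 else if k = 2 then pu^2 * pv^2 else if k = 3 then px * py * F
     else if k = 4 then pu * pv * F else px * py * pu * pv)"

lemma face_weight_simps:
  "face_weight px pu py pv F 1 = px^2 * py^2" "face_weight px pu py pv F 2 = pu^2 * pv^2"
  "face_weight px pu py pv F 3 = px * py * F" "face_weight px pu py pv F 4 = pu * pv * F"
  "face_weight px pu py pv F 5 = px * py * pu * pv"
  by simp_all

text \<open>A row stands for a filling of a hexagon: the number of closed loops and the types on the
  three faces.\<close>

definition rows_weight :: "(nat \<Rightarrow> real) \<Rightarrow> (nat \<Rightarrow> real) \<Rightarrow> (nat \<Rightarrow> real) \<Rightarrow> (nat \<times> nat list) list \<Rightarrow> real" where
  "rows_weight w1 w2 w3 rs = (\<Sum>(l, ks)\<leftarrow>rs. 2 ^ l * (w1 (ks ! 0) * w2 (ks ! 1) * w3 (ks ! 2)))"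

lemma rows_weight_simps:
  "rows_weight w1 w2 w3 [] = 0"
  "rows_weight w1 w2 w3 ((l, [a, b, c]) # rs) = 2 ^ l * (w1 a * w2 b * w3 c) + rows_weight w1 w2 w3 rs"
  by (simp_all add: rows_weight_def)

text \<open>The pairs of lists of fillings of the lower and the upper hexagon with a common boundary state,
  each occurring pair of lists being kept once.\<close>

definition pairs_list :: "((nat \<times> nat list) list \<times> (nat \<times> nat list) list) list" where
  "pairs_list = [([(0, [1, 1, 1])], [(0, [1, 2, 2]), (0, [2, 1, 2]), (0, [2, 2, 1]), (1, [2, 2, 2]), (1, [4, 4, 4])]),
    ([(0, [1, 1, 2])], [(0, [1, 1, 2])]),
    ([(0, [1, 1, 4])], [(0, [3, 3, 2]), (0, [5, 5, 4])]),
    ([(0, [1, 2, 1])], [(0, [1, 2, 1])]),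
    ([(0, [1, 2, 2]), (0, [2, 1, 2]), (0, [2, 2, 1]), (1, [2, 2, 2]), (1, [4, 4, 4])], [(0, [1, 1, 1])]),
    ([(0, [1, 2, 4]), (0, [2, 1, 4]), (1, [2, 2, 4]), (0, [4, 4, 1]), (1, [4, 4, 2])], [(0, [3, 3, 1])]),
    ([(0, [1, 3, 3])], [(0, [1, 4, 4]), (1, [2, 4, 4]), (0, [4, 1, 2]), (0, [4, 2, 1]), (1, [4, 2, 2])]),
    ([(0, [1, 3, 5])], [(0, [3, 5, 4]), (0, [5, 3, 2])]),
    ([(0, [1, 4, 1])], [(0, [3, 2, 3]), (0, [5, 4, 5])]),
    ([(0, [1, 4, 2]), (0, [2, 4, 1]), (1, [2, 4, 2]), (0, [4, 1, 4]), (1, [4, 2, 4])], [(0, [3, 1, 3])]),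
    ([(0, [1, 4, 4]), (1, [2, 4, 4]), (0, [4, 1, 2]), (0, [4, 2, 1]), (1, [4, 2, 2])], [(0, [1, 3, 3])]),
    ([(0, [1, 5, 3])], [(0, [3, 4, 5]), (0, [5, 2, 3])]),
    ([(0, [1, 5, 5])], [(0, [1, 5, 5])]),
    ([(0, [2, 1, 1])], [(0, [2, 1, 1])]),
    ([(0, [2, 3, 3]), (0, [4, 5, 5])], [(0, [4, 1, 1])]),
    ([(0, [2, 3, 5]), (0, [4, 5, 3])], [(0, [5, 3, 1])]),
    ([(0, [2, 5, 3]), (0, [4, 3, 5])], [(0, [5, 1, 3])]),
    ([(0, [2, 5, 5]), (0, [4, 3, 3])], [(0, [2, 5, 5]), (0, [4, 3, 3])]),
    ([(0, [3, 1, 3])], [(0, [1, 4, 2]), (0, [2, 4, 1]), (1, [2, 4, 2]), (0, [4, 1, 4]), (1, [4, 2, 4])]),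
    ([(0, [3, 1, 5])], [(0, [3, 5, 2]), (0, [5, 3, 4])]),
    ([(0, [3, 2, 3]), (0, [5, 4, 5])], [(0, [1, 4, 1])]),
    ([(0, [3, 2, 5]), (0, [5, 4, 3])], [(0, [3, 5, 1])]),
    ([(0, [3, 3, 1])], [(0, [1, 2, 4]), (0, [2, 1, 4]), (1, [2, 2, 4]), (0, [4, 4, 1]), (1, [4, 4, 2])]),
    ([(0, [3, 3, 2]), (0, [5, 5, 4])], [(0, [1, 1, 4])]),
    ([(0, [3, 3, 4]), (0, [5, 5, 2])], [(0, [3, 3, 4]), (0, [5, 5, 2])]),
    ([(0, [3, 4, 3]), (0, [5, 2, 5])], [(0, [3, 4, 3]), (0, [5, 2, 5])]),
    ([(0, [3, 4, 5]), (0, [5, 2, 3])], [(0, [1, 5, 3])]),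
    ([(0, [3, 5, 1])], [(0, [3, 2, 5]), (0, [5, 4, 3])]),
    ([(0, [3, 5, 2]), (0, [5, 3, 4])], [(0, [3, 1, 5])]),
    ([(0, [3, 5, 4]), (0, [5, 3, 2])], [(0, [1, 3, 5])]),
    ([(0, [4, 1, 1])], [(0, [2, 3, 3]), (0, [4, 5, 5])]),
    ([(0, [5, 1, 3])], [(0, [2, 5, 3]), (0, [4, 3, 5])]),
    ([(0, [5, 1, 5])], [(0, [5, 1, 5])]),
    ([(0, [5, 3, 1])], [(0, [2, 3, 5]), (0, [4, 5, 3])]),
    ([(0, [5, 5, 1])], [(0, [5, 5, 1])])]"
text \<open>In each pair the two sides are equal, or their difference is a multiple of one of the relations between the
  variables of the cube that follow from the recurrence.\<close>

lemma pair_identities: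
  fixes g0 g1 g2 g3 g12 g13 g23 g123 p0 p1 p2 p3 p12 p13 p23 p123 X1 X2 X3 U1 U2 U3 :: real
  assumes gp: "g0 = p0^2" "g1 = p1^2" "g2 = p2^2" "g3 = p3^2" "g12 = p12^2" "g13 = p13^2" "g23 = p23^2" "g123 = p123^2"
    and a1: "g0 * U1 = g1 * X1 + X2 * X3"
    and a2: "g0 * U2 = g2 * X2 + X1 * X3"
    and a3: "g0 * U3 = g3 * X3 + X1 * X2"
    and b1: "g123 * X1 = g23 * U1 + U2 * U3"
    and b2: "g123 * X2 = g13 * U2 + U1 * U3"
    and b3: "g123 * X3 = g12 * U3 + U1 * U2"
    and f1: "g123^2 * X2 * X3 = g123 * U1 * (g3 * g12 + g2 * g13) + 2 * g12 * g13 * g23 * U1 + U2 * U3 * (g1 * g123 + 2 * g12 * g13)"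
    and f2: "g123^2 * X1 * X3 = g123 * U2 * (g3 * g12 + g1 * g23) + 2 * g12 * g13 * g23 * U2 + U1 * U3 * (g2 * g123 + 2 * g12 * g23)"
    and f3: "g123^2 * X1 * X2 = g123 * U3 * (g1 * g23 + g2 * g13) + 2 * g12 * g13 * g23 * U3 + U1 * U2 * (g3 * g123 + 2 * g13 * g23)"
    and h1: "g0^2 * U2 * U3 = g0 * X1 * (g3 * g12 + g2 * g13) + 2 * g1 * g2 * g3 * X1 + X2 * X3 * (g0 * g23 + 2 * g2 * g3)"
    and h2: "g0^2 * U1 * U3 = g0 * X2 * (g3 * g12 + g1 * g23) + 2 * g1 * g2 * g3 * X2 + X1 * X3 * (g0 * g13 + 2 * g1 * g3)"
    and h3: "g0^2 * U1 * U2 = g0 * X3 * (g1 * g23 + g2 * g13) + 2 * g1 * g2 * g3 * X3 + X1 * X2 * (g0 * g12 + 2 * g1 * g2)"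
    and d: "g123^2 * g0 = 2 * g12 * g13 * g23 + g123 * (g1 * g23 + g2 * g13 + g3 * g12) + 2 * U1 * U2 * U3"
    and e: "g123 * (X1 * X2 * X3 + g1 * g2 * g3) = g0 * (U1 * U2 * U3 + g12 * g13 * g23)"
    and c: "g0^2 * g123 = 2 * g1 * g2 * g3 + g0 * (g1 * g23 + g2 * g13 + g3 * g12) + 2 * X1 * X2 * X3"
  shows "\<forall>(ls, us)\<in>set pairs_list.
    rows_weight (face_weight p0 p1 p12 p2 X3) (face_weight p0 p1 p13 p3 X2) (face_weight p0 p2 p23 p3 X1) ls * p123^4 =
    rows_weight (face_weight p3 p13 p123 p23 U3) (face_weight p2 p12 p123 p23 U2) (face_weight p1 p12 p123 p13 U1) us * p0^4"
    (is "\<forall>(ls, us)\<in>set pairs_list. ?L ls * p123^4 = ?R us * p0^4")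
proof -
  have "?L [(0, [1, 1, 1])] * p123^4 - ?R [(0, [1, 2, 2]), (0, [2, 1, 2]), (0, [2, 2, 1]), (1, [2, 2, 2]), (1, [4, 4, 4])] * p0^4 =
      p0^4*p12^2*p13^2*p23^2 * ((g123^2 * g0) - (2 * g12 * g13 * g23 + g123 * (g1 * g23 + g2 * g13 + g3 * g12) + 2 * U1 * U2 * U3))"
    by (simp only: rows_weight_simps face_weight_simps gp, algebra)
  then have i0: "?L [(0, [1, 1, 1])] * p123^4 = ?R [(0, [1, 2, 2]), (0, [2, 1, 2]), (0, [2, 2, 1]), (1, [2, 2, 2]), (1, [4, 4, 4])] * p0^4" by (simp only: d diff_self mult_zero_right right_minus_eq)
  have i1: "?L [(0, [1, 1, 2])] * p123^4 = ?R [(0, [1, 1, 2])] * p0^4"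
    by (simp only: rows_weight_simps face_weight_simps, algebra)
  have "?L [(0, [1, 1, 4])] * p123^4 - ?R [(0, [3, 3, 2]), (0, [5, 5, 4])] * p0^4 =
      p0^4*p2^1*p3^1*p12^2*p13^2*p123^2 * ((g123 * X1) - (g23 * U1 + U2 * U3))"
    by (simp only: rows_weight_simps face_weight_simps gp, algebra)
  then have i2: "?L [(0, [1, 1, 4])] * p123^4 = ?R [(0, [3, 3, 2]), (0, [5, 5, 4])] * p0^4" by (simp only: b1 diff_self mult_zero_right right_minus_eq)
  have i3: "?L [(0, [1, 2, 1])] * p123^4 = ?R [(0, [1, 2, 1])] * p0^4"
    by (simp only: rows_weight_simps face_weight_simps, algebra)
  have "?L [(0, [1, 2, 2]), (0, [2, 1, 2]), (0, [2, 2, 1]), (1, [2, 2, 2]), (1, [4, 4, 4])] * p123^4 - ?R [(0, [1, 1, 1])] * p0^4 =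
      (-1) * p1^2*p2^2*p3^2*p123^4 * ((g0^2 * g123) - (2 * g1 * g2 * g3 + g0 * (g1 * g23 + g2 * g13 + g3 * g12) + 2 * X1 * X2 * X3))"
    by (simp only: rows_weight_simps face_weight_simps gp, algebra)
  then have i4: "?L [(0, [1, 2, 2]), (0, [2, 1, 2]), (0, [2, 2, 1]), (1, [2, 2, 2]), (1, [4, 4, 4])] * p123^4 = ?R [(0, [1, 1, 1])] * p0^4" by (simp only: c diff_self mult_zero_right right_minus_eq)
  have "?L [(0, [1, 2, 4]), (0, [2, 1, 4]), (1, [2, 2, 4]), (0, [4, 4, 1]), (1, [4, 4, 2])] * p123^4 - ?R [(0, [3, 3, 1])] * p0^4 =
      (-1) * p1^2*p2^1*p3^1*p123^4 * ((g0^2 * U2 * U3) - (g0 * X1 * (g3 * g12 + g2 * g13) + 2 * g1 * g2 * g3 * X1 + X2 * X3 * (g0 * g23 + 2 * g2 * g3)))"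
    by (simp only: rows_weight_simps face_weight_simps gp, algebra)
  then have i5: "?L [(0, [1, 2, 4]), (0, [2, 1, 4]), (1, [2, 2, 4]), (0, [4, 4, 1]), (1, [4, 4, 2])] * p123^4 = ?R [(0, [3, 3, 1])] * p0^4" by (simp only: h1 diff_self mult_zero_right right_minus_eq)
  have "?L [(0, [1, 3, 3])] * p123^4 - ?R [(0, [1, 4, 4]), (1, [2, 4, 4]), (0, [4, 1, 2]), (0, [4, 2, 1]), (1, [4, 2, 2])] * p0^4 =
      p0^4*p12^2*p13^1*p23^1 * ((g123^2 * X1 * X2) - (g123 * U3 * (g1 * g23 + g2 * g13) + 2 * g12 * g13 * g23 * U3 + U1 * U2 * (g3 * g123 + 2 * g13 * g23)))"
    by (simp only: rows_weight_simps face_weight_simps gp, algebra)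
  then have i6: "?L [(0, [1, 3, 3])] * p123^4 = ?R [(0, [1, 4, 4]), (1, [2, 4, 4]), (0, [4, 1, 2]), (0, [4, 2, 1]), (1, [4, 2, 2])] * p0^4" by (simp only: f3 diff_self mult_zero_right right_minus_eq)
  have "?L [(0, [1, 3, 5])] * p123^4 - ?R [(0, [3, 5, 4]), (0, [5, 3, 2])] * p0^4 =
      p0^4*p2^1*p3^1*p12^2*p13^1*p23^1*p123^2 * ((g123 * X2) - (g13 * U2 + U1 * U3))"
    by (simp only: rows_weight_simps face_weight_simps gp, algebra)
  then have i7: "?L [(0, [1, 3, 5])] * p123^4 = ?R [(0, [3, 5, 4]), (0, [5, 3, 2])] * p0^4" by (simp only: b2 diff_self mult_zero_right right_minus_eq)
  have "?L [(0, [1, 4, 1])] * p123^4 - ?R [(0, [3, 2, 3]), (0, [5, 4, 5])] * p0^4 =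
      p0^4*p1^1*p3^1*p12^2*p23^2*p123^2 * ((g123 * X2) - (g13 * U2 + U1 * U3))"
    by (simp only: rows_weight_simps face_weight_simps gp, algebra)
  then have i8: "?L [(0, [1, 4, 1])] * p123^4 = ?R [(0, [3, 2, 3]), (0, [5, 4, 5])] * p0^4" by (simp only: b2 diff_self mult_zero_right right_minus_eq)
  have "?L [(0, [1, 4, 2]), (0, [2, 4, 1]), (1, [2, 4, 2]), (0, [4, 1, 4]), (1, [4, 2, 4])] * p123^4 - ?R [(0, [3, 1, 3])] * p0^4 =
      (-1) * p1^1*p2^2*p3^1*p123^4 * ((g0^2 * U1 * U3) - (g0 * X2 * (g3 * g12 + g1 * g23) + 2 * g1 * g2 * g3 * X2 + X1 * X3 * (g0 * g13 + 2 * g1 * g3)))"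
    by (simp only: rows_weight_simps face_weight_simps gp, algebra)
  then have i9: "?L [(0, [1, 4, 2]), (0, [2, 4, 1]), (1, [2, 4, 2]), (0, [4, 1, 4]), (1, [4, 2, 4])] * p123^4 = ?R [(0, [3, 1, 3])] * p0^4" by (simp only: h2 diff_self mult_zero_right right_minus_eq)
  have "?L [(0, [1, 4, 4]), (1, [2, 4, 4]), (0, [4, 1, 2]), (0, [4, 2, 1]), (1, [4, 2, 2])] * p123^4 - ?R [(0, [1, 3, 3])] * p0^4 =
      (-1) * p1^1*p2^1*p3^2*p123^4 * ((g0^2 * U1 * U2) - (g0 * X3 * (g1 * g23 + g2 * g13) + 2 * g1 * g2 * g3 * X3 + X1 * X2 * (g0 * g12 + 2 * g1 * g2)))"
    by (simp only: rows_weight_simps face_weight_simps gp, algebra)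
  then have i10: "?L [(0, [1, 4, 4]), (1, [2, 4, 4]), (0, [4, 1, 2]), (0, [4, 2, 1]), (1, [4, 2, 2])] * p123^4 = ?R [(0, [1, 3, 3])] * p0^4" by (simp only: h3 diff_self mult_zero_right right_minus_eq)
  have "?L [(0, [1, 5, 3])] * p123^4 - ?R [(0, [3, 4, 5]), (0, [5, 2, 3])] * p0^4 =
      p0^4*p1^1*p3^1*p12^2*p13^1*p23^1*p123^2 * ((g123 * X1) - (g23 * U1 + U2 * U3))"
    by (simp only: rows_weight_simps face_weight_simps gp, algebra)
  then have i11: "?L [(0, [1, 5, 3])] * p123^4 = ?R [(0, [3, 4, 5]), (0, [5, 2, 3])] * p0^4" by (simp only: b1 diff_self mult_zero_right right_minus_eq)
  have i12: "?L [(0, [1, 5, 5])] * p123^4 = ?R [(0, [1, 5, 5])] * p0^4"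
    by (simp only: rows_weight_simps face_weight_simps, algebra)
  have i13: "?L [(0, [2, 1, 1])] * p123^4 = ?R [(0, [2, 1, 1])] * p0^4"
    by (simp only: rows_weight_simps face_weight_simps, algebra)
  have "?L [(0, [2, 3, 3]), (0, [4, 5, 5])] * p123^4 - ?R [(0, [4, 1, 1])] * p0^4 =
      (-1) * p0^2*p1^2*p2^2*p13^1*p23^1*p123^4 * ((g0 * U3) - (g3 * X3 + X1 * X2))"
    by (simp only: rows_weight_simps face_weight_simps gp, algebra)
  then have i14: "?L [(0, [2, 3, 3]), (0, [4, 5, 5])] * p123^4 = ?R [(0, [4, 1, 1])] * p0^4" by (simp only: a3 diff_self mult_zero_right right_minus_eq)
  have "?L [(0, [2, 3, 5]), (0, [4, 5, 3])] * p123^4 - ?R [(0, [5, 3, 1])] * p0^4 =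
      (-1) * p0^2*p1^2*p2^1*p3^1*p13^1*p23^1*p123^4 * ((g0 * U2) - (g2 * X2 + X1 * X3))"
    by (simp only: rows_weight_simps face_weight_simps gp, algebra)
  then have i15: "?L [(0, [2, 3, 5]), (0, [4, 5, 3])] * p123^4 = ?R [(0, [5, 3, 1])] * p0^4" by (simp only: a2 diff_self mult_zero_right right_minus_eq)
  have "?L [(0, [2, 5, 3]), (0, [4, 3, 5])] * p123^4 - ?R [(0, [5, 1, 3])] * p0^4 =
      (-1) * p0^2*p1^1*p2^2*p3^1*p13^1*p23^1*p123^4 * ((g0 * U1) - (g1 * X1 + X2 * X3))"
    by (simp only: rows_weight_simps face_weight_simps gp, algebra)
  then have i16: "?L [(0, [2, 5, 3]), (0, [4, 3, 5])] * p123^4 = ?R [(0, [5, 1, 3])] * p0^4" by (simp only: a1 diff_self mult_zero_right right_minus_eq)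
  have "?L [(0, [2, 5, 5]), (0, [4, 3, 3])] * p123^4 - ?R [(0, [2, 5, 5]), (0, [4, 3, 3])] * p0^4 =
      p0^2*p1^1*p2^1*p13^1*p23^1*p123^2 * ((g123 * (X1 * X2 * X3 + g1 * g2 * g3)) - (g0 * (U1 * U2 * U3 + g12 * g13 * g23)))"
    by (simp only: rows_weight_simps face_weight_simps gp, algebra)
  then have i17: "?L [(0, [2, 5, 5]), (0, [4, 3, 3])] * p123^4 = ?R [(0, [2, 5, 5]), (0, [4, 3, 3])] * p0^4" by (simp only: e diff_self mult_zero_right right_minus_eq)
  have "?L [(0, [3, 1, 3])] * p123^4 - ?R [(0, [1, 4, 2]), (0, [2, 4, 1]), (1, [2, 4, 2]), (0, [4, 1, 4]), (1, [4, 2, 4])] * p0^4 =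
      p0^4*p12^1*p13^2*p23^1 * ((g123^2 * X1 * X3) - (g123 * U2 * (g3 * g12 + g1 * g23) + 2 * g12 * g13 * g23 * U2 + U1 * U3 * (g2 * g123 + 2 * g12 * g23)))"
    by (simp only: rows_weight_simps face_weight_simps gp, algebra)
  then have i18: "?L [(0, [3, 1, 3])] * p123^4 = ?R [(0, [1, 4, 2]), (0, [2, 4, 1]), (1, [2, 4, 2]), (0, [4, 1, 4]), (1, [4, 2, 4])] * p0^4" by (simp only: f2 diff_self mult_zero_right right_minus_eq)
  have "?L [(0, [3, 1, 5])] * p123^4 - ?R [(0, [3, 5, 2]), (0, [5, 3, 4])] * p0^4 =
      p0^4*p2^1*p3^1*p12^1*p13^2*p23^1*p123^2 * ((g123 * X3) - (g12 * U3 + U1 * U2))"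
    by (simp only: rows_weight_simps face_weight_simps gp, algebra)
  then have i19: "?L [(0, [3, 1, 5])] * p123^4 = ?R [(0, [3, 5, 2]), (0, [5, 3, 4])] * p0^4" by (simp only: b3 diff_self mult_zero_right right_minus_eq)
  have "?L [(0, [3, 2, 3]), (0, [5, 4, 5])] * p123^4 - ?R [(0, [1, 4, 1])] * p0^4 =
      (-1) * p0^2*p1^2*p3^2*p12^1*p23^1*p123^4 * ((g0 * U2) - (g2 * X2 + X1 * X3))"
    by (simp only: rows_weight_simps face_weight_simps gp, algebra)
  then have i20: "?L [(0, [3, 2, 3]), (0, [5, 4, 5])] * p123^4 = ?R [(0, [1, 4, 1])] * p0^4" by (simp only: a2 diff_self mult_zero_right right_minus_eq)
  have "?L [(0, [3, 2, 5]), (0, [5, 4, 3])] * p123^4 - ?R [(0, [3, 5, 1])] * p0^4 =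
      (-1) * p0^2*p1^2*p2^1*p3^1*p12^1*p23^1*p123^4 * ((g0 * U3) - (g3 * X3 + X1 * X2))"
    by (simp only: rows_weight_simps face_weight_simps gp, algebra)
  then have i21: "?L [(0, [3, 2, 5]), (0, [5, 4, 3])] * p123^4 = ?R [(0, [3, 5, 1])] * p0^4" by (simp only: a3 diff_self mult_zero_right right_minus_eq)
  have "?L [(0, [3, 3, 1])] * p123^4 - ?R [(0, [1, 2, 4]), (0, [2, 1, 4]), (1, [2, 2, 4]), (0, [4, 4, 1]), (1, [4, 4, 2])] * p0^4 =
      p0^4*p12^1*p13^1*p23^2 * ((g123^2 * X2 * X3) - (g123 * U1 * (g3 * g12 + g2 * g13) + 2 * g12 * g13 * g23 * U1 + U2 * U3 * (g1 * g123 + 2 * g12 * g13)))"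
    by (simp only: rows_weight_simps face_weight_simps gp, algebra)
  then have i22: "?L [(0, [3, 3, 1])] * p123^4 = ?R [(0, [1, 2, 4]), (0, [2, 1, 4]), (1, [2, 2, 4]), (0, [4, 4, 1]), (1, [4, 4, 2])] * p0^4" by (simp only: f1 diff_self mult_zero_right right_minus_eq)
  have "?L [(0, [3, 3, 2]), (0, [5, 5, 4])] * p123^4 - ?R [(0, [1, 1, 4])] * p0^4 =
      (-1) * p0^2*p2^2*p3^2*p12^1*p13^1*p123^4 * ((g0 * U1) - (g1 * X1 + X2 * X3))"
    by (simp only: rows_weight_simps face_weight_simps gp, algebra)
  then have i23: "?L [(0, [3, 3, 2]), (0, [5, 5, 4])] * p123^4 = ?R [(0, [1, 1, 4])] * p0^4" by (simp only: a1 diff_self mult_zero_right right_minus_eq)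
  have "?L [(0, [3, 3, 4]), (0, [5, 5, 2])] * p123^4 - ?R [(0, [3, 3, 4]), (0, [5, 5, 2])] * p0^4 =
      p0^2*p2^1*p3^1*p12^1*p13^1*p123^2 * ((g123 * (X1 * X2 * X3 + g1 * g2 * g3)) - (g0 * (U1 * U2 * U3 + g12 * g13 * g23)))"
    by (simp only: rows_weight_simps face_weight_simps gp, algebra)
  then have i24: "?L [(0, [3, 3, 4]), (0, [5, 5, 2])] * p123^4 = ?R [(0, [3, 3, 4]), (0, [5, 5, 2])] * p0^4" by (simp only: e diff_self mult_zero_right right_minus_eq)
  have "?L [(0, [3, 4, 3]), (0, [5, 2, 5])] * p123^4 - ?R [(0, [3, 4, 3]), (0, [5, 2, 5])] * p0^4 =
      p0^2*p1^1*p3^1*p12^1*p23^1*p123^2 * ((g123 * (X1 * X2 * X3 + g1 * g2 * g3)) - (g0 * (U1 * U2 * U3 + g12 * g13 * g23)))"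
    by (simp only: rows_weight_simps face_weight_simps gp, algebra)
  then have i25: "?L [(0, [3, 4, 3]), (0, [5, 2, 5])] * p123^4 = ?R [(0, [3, 4, 3]), (0, [5, 2, 5])] * p0^4" by (simp only: e diff_self mult_zero_right right_minus_eq)
  have "?L [(0, [3, 4, 5]), (0, [5, 2, 3])] * p123^4 - ?R [(0, [1, 5, 3])] * p0^4 =
      (-1) * p0^2*p1^1*p2^1*p3^2*p12^1*p23^1*p123^4 * ((g0 * U1) - (g1 * X1 + X2 * X3))"
    by (simp only: rows_weight_simps face_weight_simps gp, algebra)
  then have i26: "?L [(0, [3, 4, 5]), (0, [5, 2, 3])] * p123^4 = ?R [(0, [1, 5, 3])] * p0^4" by (simp only: a1 diff_self mult_zero_right right_minus_eq)
  have "?L [(0, [3, 5, 1])] * p123^4 - ?R [(0, [3, 2, 5]), (0, [5, 4, 3])] * p0^4 =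
      p0^4*p1^1*p3^1*p12^1*p13^1*p23^2*p123^2 * ((g123 * X3) - (g12 * U3 + U1 * U2))"
    by (simp only: rows_weight_simps face_weight_simps gp, algebra)
  then have i27: "?L [(0, [3, 5, 1])] * p123^4 = ?R [(0, [3, 2, 5]), (0, [5, 4, 3])] * p0^4" by (simp only: b3 diff_self mult_zero_right right_minus_eq)
  have "?L [(0, [3, 5, 2]), (0, [5, 3, 4])] * p123^4 - ?R [(0, [3, 1, 5])] * p0^4 =
      (-1) * p0^2*p1^1*p2^2*p3^1*p12^1*p13^1*p123^4 * ((g0 * U3) - (g3 * X3 + X1 * X2))"
    by (simp only: rows_weight_simps face_weight_simps gp, algebra)
  then have i28: "?L [(0, [3, 5, 2]), (0, [5, 3, 4])] * p123^4 = ?R [(0, [3, 1, 5])] * p0^4" by (simp only: a3 diff_self mult_zero_right right_minus_eq)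
  have "?L [(0, [3, 5, 4]), (0, [5, 3, 2])] * p123^4 - ?R [(0, [1, 3, 5])] * p0^4 =
      (-1) * p0^2*p1^1*p2^1*p3^2*p12^1*p13^1*p123^4 * ((g0 * U2) - (g2 * X2 + X1 * X3))"
    by (simp only: rows_weight_simps face_weight_simps gp, algebra)
  then have i29: "?L [(0, [3, 5, 4]), (0, [5, 3, 2])] * p123^4 = ?R [(0, [1, 3, 5])] * p0^4" by (simp only: a2 diff_self mult_zero_right right_minus_eq)
  have "?L [(0, [4, 1, 1])] * p123^4 - ?R [(0, [2, 3, 3]), (0, [4, 5, 5])] * p0^4 =
      p0^4*p1^1*p2^1*p13^2*p23^2*p123^2 * ((g123 * X3) - (g12 * U3 + U1 * U2))"
    by (simp only: rows_weight_simps face_weight_simps gp, algebra)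
  then have i30: "?L [(0, [4, 1, 1])] * p123^4 = ?R [(0, [2, 3, 3]), (0, [4, 5, 5])] * p0^4" by (simp only: b3 diff_self mult_zero_right right_minus_eq)
  have "?L [(0, [5, 1, 3])] * p123^4 - ?R [(0, [2, 5, 3]), (0, [4, 3, 5])] * p0^4 =
      p0^4*p1^1*p2^1*p12^1*p13^2*p23^1*p123^2 * ((g123 * X1) - (g23 * U1 + U2 * U3))"
    by (simp only: rows_weight_simps face_weight_simps gp, algebra)
  then have i31: "?L [(0, [5, 1, 3])] * p123^4 = ?R [(0, [2, 5, 3]), (0, [4, 3, 5])] * p0^4" by (simp only: b1 diff_self mult_zero_right right_minus_eq)
  have i32: "?L [(0, [5, 1, 5])] * p123^4 = ?R [(0, [5, 1, 5])] * p0^4"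
    by (simp only: rows_weight_simps face_weight_simps, algebra)
  have "?L [(0, [5, 3, 1])] * p123^4 - ?R [(0, [2, 3, 5]), (0, [4, 5, 3])] * p0^4 =
      p0^4*p1^1*p2^1*p12^1*p13^1*p23^2*p123^2 * ((g123 * X2) - (g13 * U2 + U1 * U3))"
    by (simp only: rows_weight_simps face_weight_simps gp, algebra)
  then have i33: "?L [(0, [5, 3, 1])] * p123^4 = ?R [(0, [2, 3, 5]), (0, [4, 5, 3])] * p0^4" by (simp only: b2 diff_self mult_zero_right right_minus_eq)
  have i34: "?L [(0, [5, 5, 1])] * p123^4 = ?R [(0, [5, 5, 1])] * p0^4"
    by (simp only: rows_weight_simps face_weight_simps, algebra)
  show ?thesis unfolding pairs_list_def
    by (simp only: list.set ball_simps prod.case, intro conjI TrueI, simp_all only: i0 i1 i2 i3 i4 i5 i6 i7 i8 i9 i10 i11 i12 i13 i14 i15 i16 i17 i18 i19 i20 i21 i22 i23 i24 i25 i26 i27 i28 i29 i30 i31 i32 i33 i34)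
qed

text \<open>The face variables above the removed cube are rational in those below it, and conversely.\<close>

lemma cube_relations:
  fixes g0 g1 g2 g3 g12 g13 g23 g123 X1 X2 X3 :: real
  assumes pos: "g0 > 0" "g1 > 0" "g2 > 0" "g3 > 0" "g12 > 0" "g13 > 0" "g23 > 0" "g123 > 0"
      "X1 > 0" "X2 > 0" "X3 > 0"
    and X1: "X1^2 = g0 * g23 + g2 * g3" and X2: "X2^2 = g0 * g13 + g1 * g3"
    and X3: "X3^2 = g0 * g12 + g1 * g2"
    and c: "g0^2 * g123 = 2 * g1 * g2 * g3 + g0 * (g1 * g23 + g2 * g13 + g3 * g12) + 2 * X1 * X2 * X3"
  defines "U1 \<equiv> sqrt (g1 * g123 + g12 * g13)" and "U2 \<equiv> sqrt (g2 * g123 + g12 * g23)"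
    and "U3 \<equiv> sqrt (g3 * g123 + g13 * g23)"
  shows "g0 * U1 = g1 * X1 + X2 * X3" (is ?a1) and "g0 * U2 = g2 * X2 + X1 * X3" (is ?a2)
    and "g0 * U3 = g3 * X3 + X1 * X2" (is ?a3)
    and "g123 * X1 = g23 * U1 + U2 * U3" (is ?b1) and "g123 * X2 = g13 * U2 + U1 * U3" (is ?b2)
    and "g123 * X3 = g12 * U3 + U1 * U2" (is ?b3)
    and "g123^2 * X2 * X3 = g123 * U1 * (g3 * g12 + g2 * g13) + 2 * g12 * g13 * g23 * U1
           + U2 * U3 * (g1 * g123 + 2 * g12 * g13)" (is ?f1)
    and "g123^2 * X1 * X3 = g123 * U2 * (g3 * g12 + g1 * g23) + 2 * g12 * g13 * g23 * U2
           + U1 * U3 * (g2 * g123 + 2 * g12 * g23)" (is ?f2)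
    and "g123^2 * X1 * X2 = g123 * U3 * (g1 * g23 + g2 * g13) + 2 * g12 * g13 * g23 * U3
           + U1 * U2 * (g3 * g123 + 2 * g13 * g23)" (is ?f3)
    and "g0^2 * U2 * U3 = g0 * X1 * (g3 * g12 + g2 * g13) + 2 * g1 * g2 * g3 * X1
           + X2 * X3 * (g0 * g23 + 2 * g2 * g3)" (is ?h1)
    and "g0^2 * U1 * U3 = g0 * X2 * (g3 * g12 + g1 * g23) + 2 * g1 * g2 * g3 * X2
           + X1 * X3 * (g0 * g13 + 2 * g1 * g3)" (is ?h2)
    and "g0^2 * U1 * U2 = g0 * X3 * (g1 * g23 + g2 * g13) + 2 * g1 * g2 * g3 * X3
           + X1 * X2 * (g0 * g12 + 2 * g1 * g2)" (is ?h3)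
    and "g123^2 * g0 = 2 * g12 * g13 * g23 + g123 * (g1 * g23 + g2 * g13 + g3 * g12) + 2 * U1 * U2 * U3" (is ?d)
    and "g123 * (X1 * X2 * X3 + g1 * g2 * g3) = g0 * (U1 * U2 * U3 + g12 * g13 * g23)" (is ?e)
proof -
  note U_def = U1_def U2_def U3_def
  have Upos: "U1 > 0" and Usq: "U1^2 = g1 * g123 + g12 * g13" "U2^2 = g2 * g123 + g12 * g23" "U3^2 = g3 * g123 + g13 * g23"
    using pos unfolding U_def by (simp_all add: add_pos_pos less_imp_le)
  have root: "g0 * sqrt a = b" if "b > 0" "b^2 - g0^2 * a = 0" for a b
  proof -
    have "g0 * sqrt a = sqrt (g0^2 * a)" using pos(1) by (simp add: real_sqrt_mult)
    also have "\<dots> = b" using that by (metis abs_of_pos eq_iff_diff_eq_0 real_sqrt_abs)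
    finally show ?thesis .
  qed
  have cancel: "a = b" if "t * a = t * b" "t > 0" for a b t :: real using that by simp
  have p2: "g0^2 > 0" using pos(1) by simp
  have "(g1 * X1 + X2 * X3)^2 - g0^2 * (g1 * g123 + g12 * g13) = g1^2 * (X1^2 - (g0 * g23 + g2 * g3)) + X3^2 * (X2^2 - (g0 * g13 + g1 * g3)) + (g0 * g13 + g1 * g3) * (X3^2 - (g0 * g12 + g1 * g2))
      - g1 * (g0^2 * g123 - (2 * g1 * g2 * g3 + g0 * (g1 * g23 + g2 * g13 + g3 * g12) + 2 * X1 * X2 * X3))"
    by (simp add: algebra_simps power2_eq_square)
  then show a1: ?a1 unfolding U_def
    by (intro root) (use pos in \<open>simp add: add_pos_pos\<close>, simp only: X1 X2 X3 c diff_self mult_zero_right add_0_right add_0_left diff_0_right right_minus_eq div_0)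
  have "(g2 * X2 + X1 * X3)^2 - g0^2 * (g2 * g123 + g12 * g23) = g2^2 * (X2^2 - (g0 * g13 + g1 * g3)) + X3^2 * (X1^2 - (g0 * g23 + g2 * g3)) + (g0 * g23 + g2 * g3) * (X3^2 - (g0 * g12 + g1 * g2))
      - g2 * (g0^2 * g123 - (2 * g1 * g2 * g3 + g0 * (g1 * g23 + g2 * g13 + g3 * g12) + 2 * X1 * X2 * X3))"
    by (simp add: algebra_simps power2_eq_square)
  then show a2: ?a2 unfolding U_def
    by (intro root) (use pos in \<open>simp add: add_pos_pos\<close>, simp only: X1 X2 X3 c diff_self mult_zero_right add_0_right add_0_left diff_0_right right_minus_eq div_0)
  have "(g3 * X3 + X1 * X2)^2 - g0^2 * (g3 * g123 + g13 * g23) = g3^2 * (X3^2 - (g0 * g12 + g1 * g2)) + X2^2 * (X1^2 - (g0 * g23 + g2 * g3)) + (g0 * g23 + g2 * g3) * (X2^2 - (g0 * g13 + g1 * g3))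
      - g3 * (g0^2 * g123 - (2 * g1 * g2 * g3 + g0 * (g1 * g23 + g2 * g13 + g3 * g12) + 2 * X1 * X2 * X3))"
    by (simp add: algebra_simps power2_eq_square)
  then show a3: ?a3 unfolding U_def
    by (intro root) (use pos in \<open>simp add: add_pos_pos\<close>, simp only: X1 X2 X3 c diff_self mult_zero_right add_0_right add_0_left diff_0_right right_minus_eq div_0)
  have zb1: "g0^2 * (g123 * X1) - g0^2 * (g23 * U1 + U2 * U3) = X1 * (g0^2 * g123 - (2 * g1 * g2 * g3 + g0 * (g1 * g23 + g2 * g13 + g3 * g12) + 2 * X1 * X2 * X3)) + X2 * X3 * (X1^2 - (g0 * g23 + g2 * g3))
      - g2 * X1 * (X2^2 - (g0 * g13 + g1 * g3)) - g3 * X1 * (X3^2 - (g0 * g12 + g1 * g2))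
      + g0 * g23 * ((g1 * X1 + X2 * X3) - g0 * U1) + (g3 * X3 + X1 * X2) * ((g2 * X2 + X1 * X3) - g0 * U2) + g0 * U2 * ((g3 * X3 + X1 * X2) - g0 * U3)"
    by (simp add: algebra_simps power2_eq_square)
  show b1: ?b1 by (rule cancel[OF _ p2], insert zb1) (simp only: a1 a2 a3 X1 X2 X3 c diff_self mult_zero_right add_0_right add_0_left diff_0_right right_minus_eq div_0)
  have zb2: "g0^2 * (g123 * X2) - g0^2 * (g13 * U2 + U1 * U3) = X2 * (g0^2 * g123 - (2 * g1 * g2 * g3 + g0 * (g1 * g23 + g2 * g13 + g3 * g12) + 2 * X1 * X2 * X3)) + X1 * X3 * (X2^2 - (g0 * g13 + g1 * g3))
      - g1 * X2 * (X1^2 - (g0 * g23 + g2 * g3)) - g3 * X2 * (X3^2 - (g0 * g12 + g1 * g2))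
      + g0 * g13 * ((g2 * X2 + X1 * X3) - g0 * U2) + (g3 * X3 + X1 * X2) * ((g1 * X1 + X2 * X3) - g0 * U1) + g0 * U1 * ((g3 * X3 + X1 * X2) - g0 * U3)"
    by (simp add: algebra_simps power2_eq_square)
  show b2: ?b2 by (rule cancel[OF _ p2], insert zb2) (simp only: a1 a2 a3 X1 X2 X3 c diff_self mult_zero_right add_0_right add_0_left diff_0_right right_minus_eq div_0)
  have zb3: "g0^2 * (g123 * X3) - g0^2 * (g12 * U3 + U1 * U2) = X3 * (g0^2 * g123 - (2 * g1 * g2 * g3 + g0 * (g1 * g23 + g2 * g13 + g3 * g12) + 2 * X1 * X2 * X3)) + X1 * X2 * (X3^2 - (g0 * g12 + g1 * g2))
      - g1 * X3 * (X1^2 - (g0 * g23 + g2 * g3)) - g2 * X3 * (X2^2 - (g0 * g13 + g1 * g3))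
      + g0 * g12 * ((g3 * X3 + X1 * X2) - g0 * U3) + (g2 * X2 + X1 * X3) * ((g1 * X1 + X2 * X3) - g0 * U1) + g0 * U1 * ((g2 * X2 + X1 * X3) - g0 * U2)"
    by (simp add: algebra_simps power2_eq_square)
  show b3: ?b3 by (rule cancel[OF _ p2], insert zb3) (simp only: a1 a2 a3 X1 X2 X3 c diff_self mult_zero_right add_0_right add_0_left diff_0_right right_minus_eq div_0)
  have "g123^2 * X2 * X3 - (g123 * U1 * (g3 * g12 + g2 * g13) + 2 * g12 * g13 * g23 * U1 + U2 * U3 * (g1 * g123 + 2 * g12 * g13)) =
      g13 * U1 * (U2^2 - (g2 * g123 + g12 * g23)) + g12 * U1 * (U3^2 - (g3 * g123 + g13 * g23)) + U2 * U3 * (U1^2 - (g1 * g123 + g12 * g13))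
      + g123 * X3 * (g123 * X2 - (g13 * U2 + U1 * U3)) + (g13 * U2 + U1 * U3) * (g123 * X3 - (g12 * U3 + U1 * U2))"
    by (simp add: algebra_simps power2_eq_square)
  then show f1: ?f1 by (simp only: b1 b2 b3 Usq diff_self mult_zero_right add_0_right add_0_left diff_0_right right_minus_eq div_0)
  have "g0^2 * U2 * U3 - (g0 * X1 * (g3 * g12 + g2 * g13) + 2 * g1 * g2 * g3 * X1 + X2 * X3 * (g0 * g23 + 2 * g2 * g3)) =
      g2 * X1 * (X2^2 - (g0 * g13 + g1 * g3)) + g3 * X1 * (X3^2 - (g0 * g12 + g1 * g2)) + X2 * X3 * (X1^2 - (g0 * g23 + g2 * g3))
      + g0 * U3 * (g0 * U2 - (g2 * X2 + X1 * X3)) + (g2 * X2 + X1 * X3) * (g0 * U3 - (g3 * X3 + X1 * X2))"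
    by (simp add: algebra_simps power2_eq_square)
  then show ?h1 by (simp only: a1 a2 a3 X1 X2 X3 diff_self mult_zero_right add_0_right add_0_left diff_0_right right_minus_eq div_0)
  have "g123^2 * X1 * X3 - (g123 * U2 * (g3 * g12 + g1 * g23) + 2 * g12 * g13 * g23 * U2 + U1 * U3 * (g2 * g123 + 2 * g12 * g23)) =
      g23 * U2 * (U1^2 - (g1 * g123 + g12 * g13)) + g12 * U2 * (U3^2 - (g3 * g123 + g13 * g23)) + U1 * U3 * (U2^2 - (g2 * g123 + g12 * g23))
      + g123 * X3 * (g123 * X1 - (g23 * U1 + U2 * U3)) + (g23 * U1 + U2 * U3) * (g123 * X3 - (g12 * U3 + U1 * U2))"
    by (simp add: algebra_simps power2_eq_square)
  then show f2: ?f2 by (simp only: b1 b2 b3 Usq diff_self mult_zero_right add_0_right add_0_left diff_0_right right_minus_eq div_0)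
  have "g0^2 * U1 * U3 - (g0 * X2 * (g3 * g12 + g1 * g23) + 2 * g1 * g2 * g3 * X2 + X1 * X3 * (g0 * g13 + 2 * g1 * g3)) =
      g1 * X2 * (X1^2 - (g0 * g23 + g2 * g3)) + g3 * X2 * (X3^2 - (g0 * g12 + g1 * g2)) + X1 * X3 * (X2^2 - (g0 * g13 + g1 * g3))
      + g0 * U3 * (g0 * U1 - (g1 * X1 + X2 * X3)) + (g1 * X1 + X2 * X3) * (g0 * U3 - (g3 * X3 + X1 * X2))"
    by (simp add: algebra_simps power2_eq_square)
  then show ?h2 by (simp only: a1 a2 a3 X1 X2 X3 diff_self mult_zero_right add_0_right add_0_left diff_0_right right_minus_eq div_0)
  have "g123^2 * X1 * X2 - (g123 * U3 * (g1 * g23 + g2 * g13) + 2 * g12 * g13 * g23 * U3 + U1 * U2 * (g3 * g123 + 2 * g13 * g23)) =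
      g23 * U3 * (U1^2 - (g1 * g123 + g12 * g13)) + g13 * U3 * (U2^2 - (g2 * g123 + g12 * g23)) + U1 * U2 * (U3^2 - (g3 * g123 + g13 * g23))
      + g123 * X2 * (g123 * X1 - (g23 * U1 + U2 * U3)) + (g23 * U1 + U2 * U3) * (g123 * X2 - (g13 * U2 + U1 * U3))"
    by (simp add: algebra_simps power2_eq_square)
  then show f3: ?f3 by (simp only: b1 b2 b3 Usq diff_self mult_zero_right add_0_right add_0_left diff_0_right right_minus_eq div_0)
  have "g0^2 * U1 * U2 - (g0 * X3 * (g1 * g23 + g2 * g13) + 2 * g1 * g2 * g3 * X3 + X1 * X2 * (g0 * g12 + 2 * g1 * g2)) =
      g1 * X3 * (X1^2 - (g0 * g23 + g2 * g3)) + g2 * X3 * (X2^2 - (g0 * g13 + g1 * g3)) + X1 * X2 * (X3^2 - (g0 * g12 + g1 * g2))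
      + g0 * U2 * (g0 * U1 - (g1 * X1 + X2 * X3)) + (g1 * X1 + X2 * X3) * (g0 * U2 - (g2 * X2 + X1 * X3))"
    by (simp add: algebra_simps power2_eq_square)
  then show ?h3 by (simp only: a1 a2 a3 X1 X2 X3 diff_self mult_zero_right add_0_right add_0_left diff_0_right right_minus_eq div_0)
  have zd: "U1 * (g123^2 * g0) - U1 * (2 * g12 * g13 * g23 + g123 * (g1 * g23 + g2 * g13 + g3 * g12) + 2 * U1 * U2 * U3) =
      g123^2 * (g0 * U1 - (g1 * X1 + X2 * X3)) + g1 * g123 * (g123 * X1 - (g23 * U1 + U2 * U3)) + (g123^2 * X2 * X3 - (g123 * U1 * (g3 * g12 + g2 * g13) + 2 * g12 * g13 * g23 * U1 + U2 * U3 * (g1 * g123 + 2 * g12 * g13)))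
      - 2 * U2 * U3 * (U1^2 - (g1 * g123 + g12 * g13))"
    by (simp add: algebra_simps power2_eq_square)
  show d: ?d by (rule cancel[OF _ Upos], insert zd) (simp only: a1 b1 f1 Usq diff_self mult_zero_right add_0_right add_0_left diff_0_right right_minus_eq div_0)
  have "(g123 * (X1 * X2 * X3 + g1 * g2 * g3) - g0 * (U1 * U2 * U3 + g12 * g13 * g23)) =
      (g0 * (g123^2 * g0 - (2 * g12 * g13 * g23 + g123 * (g1 * g23 + g2 * g13 + g3 * g12) + 2 * U1 * U2 * U3)) - g123 * (g0^2 * g123 - (2 * g1 * g2 * g3 + g0 * (g1 * g23 + g2 * g13 + g3 * g12) + 2 * X1 * X2 * X3))) / 2"
    by (simp add: field_simps power2_eq_square)
  then show ?e by (simp only: c d diff_self mult_zero_right add_0_right add_0_left diff_0_right right_minus_eq div_0)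
qed

definition corner_weight :: "real \<Rightarrow> real \<Rightarrow> real \<Rightarrow> real \<Rightarrow> nat \<Rightarrow> real" where
  "corner_weight x u y v = face_weight (sqrt x) (sqrt u) (sqrt y) (sqrt v) (sqrt (x * y + u * v))"

lemma cube_identities:
  fixes g0 g1 g2 g3 g12 g13 g23 g123 :: real
  assumes pos: "g0 > 0" "g1 > 0" "g2 > 0" "g3 > 0" "g12 > 0" "g13 > 0" "g23 > 0" "g123 > 0"
    and rec: "g123 = (2 * g1 * g2 * g3 + g0 * (g1 * g23 + g2 * g13 + g3 * g12)
        + 2 * sqrt (g0 * g23 + g2 * g3) * sqrt (g0 * g13 + g1 * g3) * sqrt (g0 * g12 + g1 * g2)) / g0^2"
    and mem: "(ls, us) \<in> set pairs_list"
  shows "rows_weight (corner_weight g0 g1 g12 g2) (corner_weight g0 g1 g13 g3) (corner_weight g0 g2 g23 g3) ls / g0^2 =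
    rows_weight (corner_weight g3 g13 g123 g23) (corner_weight g2 g12 g123 g23) (corner_weight g1 g12 g123 g13) us / g123^2"
proof -
  define X1 where "X1 = sqrt (g0 * g23 + g2 * g3)"
  define X2 where "X2 = sqrt (g0 * g13 + g1 * g3)"
  define X3 where "X3 = sqrt (g0 * g12 + g1 * g2)"
  note X_def = X1_def X2_def X3_def
  have Xpos: "X1 > 0" "X2 > 0" "X3 > 0" and
    Xsq: "X1^2 = g0 * g23 + g2 * g3" "X2^2 = g0 * g13 + g1 * g3" "X3^2 = g0 * g12 + g1 * g2"
    using pos unfolding X_def by (simp_all add: add_pos_pos less_imp_le)
  have c: "g0^2 * g123 = 2 * g1 * g2 * g3 + g0 * (g1 * g23 + g2 * g13 + g3 * g12) + 2 * X1 * X2 * X3"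
    using pos(1) by (simp add: rec X_def)
  define p0 p1 p2 p3 p12 p13 p23 p123 where p_def: "p0 = sqrt g0" "p1 = sqrt g1" "p2 = sqrt g2" "p3 = sqrt g3"
    "p12 = sqrt g12" "p13 = sqrt g13" "p23 = sqrt g23" "p123 = sqrt g123"
  have gp: "g0 = p0^2" "g1 = p1^2" "g2 = p2^2" "g3 = p3^2" "g12 = p12^2" "g13 = p13^2" "g23 = p23^2" "g123 = p123^2"
    using pos by (simp_all add: p_def)
  note R = cube_relations[OF pos Xpos Xsq c]
  define U1 where "U1 = sqrt (g1 * g123 + g12 * g13)"
  define U2 where "U2 = sqrt (g2 * g123 + g12 * g23)"
  define U3 where "U3 = sqrt (g3 * g123 + g13 * g23)"
  have "rows_weight (face_weight p0 p1 p12 p2 X3) (face_weight p0 p1 p13 p3 X2) (face_weight p0 p2 p23 p3 X1) ls * p123^4 =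
    rows_weight (face_weight p3 p13 p123 p23 U3) (face_weight p2 p12 p123 p23 U2) (face_weight p1 p12 p123 p13 U1) us * p0^4"
    using pair_identities[OF gp R[folded U1_def U2_def U3_def] c] mem by fast
  moreover have "g0^2 = p0^4" "g123^2 = p123^4" using gp by simp_all
  moreover have "p0 > 0" "p123 > 0" using pos by (simp_all add: p_def)
  moreover have "a / p0^4 = b / p123^4" if "a * p123^4 = b * p0^4" for a b
    using that \<open>p0 > 0\<close> \<open>p123 > 0\<close> by (simp add: frac_eq_eq)
  moreover have "X3 = sqrt (g0 * g12 + g1 * g2)" "X2 = sqrt (g0 * g13 + g1 * g3)" "X1 = sqrt (g0 * g23 + g2 * g3)"
    "U3 = sqrt (g3 * g123 + g13 * g23)" "U2 = sqrt (g2 * g123 + g12 * g23)" "U1 = sqrt (g1 * g123 + g12 * g13)"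
    by (simp_all add: X_def U1_def U2_def U3_def)
  ultimately show ?thesis
    unfolding corner_weight_def by (simp only: p_def)
qed

section \<open>The two triples of faces of a unit cube\<close>

type_synonym coded_face = "nat \<times> nat \<times> nat \<times> nat"

text \<open>The nine sides of a hexagon of three faces are numbered: \<open>0\<close> to \<open>5\<close> for the boundary in cyclic order, and
  \<open>6\<close> to \<open>8\<close> for the sides at the centre. A face is coded by its sides
  \<open>{x, u}\<close>, \<open>{u, y}\<close>, \<open>{y, v}\<close>, \<open>{v, x}\<close>, so that all fillings can be enumerated by
  rewriting.\<close>

fun coded_strands :: "coded_face \<Rightarrow> local_config \<Rightarrow> (nat \<times> nat \<times> colour) list" where
  "coded_strands (xu, uy, yv, vx) (C1 c) = [(xu, uy, c), (yv, vx, c)]"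
| "coded_strands (xu, uy, yv, vx) (C2 c) = [(uy, yv, c), (vx, xu, c)]"
| "coded_strands (xu, uy, yv, vx) (C3 c) = [(xu, uy, c), (yv, vx, other c)]"
| "coded_strands (xu, uy, yv, vx) (C4 c) = [(uy, yv, c), (vx, xu, other c)]"
| "coded_strands (xu, uy, yv, vx) (C5 c) = [(uy, vx, c), (xu, yv, other c)]"

definition lower_hex :: "coded_face list" where
  "lower_hex = [(6, 0, 1, 7), (6, 5, 4, 8), (7, 2, 3, 8)]"
definition upper_hex :: "coded_face list" where
  "upper_hex = [(4, 7, 8, 3), (1, 6, 8, 2), (0, 6, 7, 5)]"

definition hex_strands :: "coded_face list \<Rightarrow> local_config list \<Rightarrow> (nat \<times> nat \<times> colour) list" where
  "hex_strands H t = concat (map2 coded_strands H t)"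

definition node_colour :: "(nat \<times> nat \<times> colour) list \<Rightarrow> nat \<Rightarrow> colour" where
  "node_colour st k = snd (snd (hd (filter (\<lambda>(a, b, c). a = k \<or> b = k) st)))"

definition colours_agree :: "(nat \<times> nat \<times> colour) list \<Rightarrow> bool" where
  "colours_agree st \<longleftrightarrow> list_all (\<lambda>(a, b, c). node_colour st a = c \<and> node_colour st b = c) st"

definition merge :: "nat \<times> nat \<times> colour \<Rightarrow> nat list \<Rightarrow> nat list" where
  "merge = (\<lambda>(a, b, c) l. let u = l ! a; v = l ! b in map (\<lambda>z. if z = u then v else z) l)"

text \<open>Union-find on the nine sides: two sides have the same label if they are connected.\<close>

definition labels :: "(nat \<times> nat \<times> colour) list \<Rightarrow> nat list" where
  "labels st = fold merge st [0, 1, 2, 3, 4, 5, 6, 7, 8]"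

type_synonym boundary_state = "colour list \<times> nat list"

text \<open>The colours of the six boundary sides, together with the smallest boundary side connected to each of
  them. The latter is a canonical form of the connectivity.\<close>

definition boundary_state :: "(nat \<times> nat \<times> colour) list \<Rightarrow> boundary_state" where
  "boundary_state st =
     (map (node_colour st) [0, 1, 2, 3, 4, 5],
      let l = labels st in map (\<lambda>i. hd (filter (\<lambda>j. l ! j = l ! i) [0, 1, 2, 3, 4, 5])) [0, 1, 2, 3, 4, 5])"

text \<open>A closed loop inside a hexagon can only be the one around its centre, through all of the sides
  \<open>6\<close>, \<open>7\<close>, \<open>8\<close>.\<close>

definition closed_loops :: "(nat \<times> nat \<times> colour) list \<Rightarrow> nat" where
  "closed_loops st = (let l = labels st in if l ! 6 \<in> set (take 6 l) then 0 else 1)"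

fun kind :: "local_config \<Rightarrow> nat" where
  "kind (C1 _) = 1" | "kind (C2 _) = 2" | "kind (C3 _) = 3" | "kind (C4 _) = 4" | "kind (C5 _) = 5"

definition local_configs :: "local_config list" where
  "local_configs = [C1 Blue, C1 Red, C2 Blue, C2 Red, C3 Blue, C3 Red, C4 Blue, C4 Red, C5 Blue, C5 Red]"

definition hex_configs :: "coded_face list \<Rightarrow> local_config list list" where
  "hex_configs H = filter (\<lambda>t. colours_agree (hex_strands H t))
     (concat (map (\<lambda>a. concat (map (\<lambda>b. map (\<lambda>c. [a, b, c]) local_configs) local_configs)) local_configs))"

text \<open>What matters of a filling: its boundary state, whether it closes the loop around the centre, and its
  types, which give the weight.\<close>

definition hex_table :: "coded_face list \<Rightarrow> (boundary_state \<times> nat \<times> nat list) list" where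
  "hex_table H = map (\<lambda>t. let st = hex_strands H t in (boundary_state st, closed_loops st, map kind t)) (hex_configs H)"

lemma hex_configs_eval:
  "hex_configs lower_hex =
    [[C1 Blue, C1 Blue, C1 Blue], [C1 Blue, C1 Blue, C2 Blue], [C1 Blue, C1 Blue, C4 Red], [C1 Blue, C2 Blue,
     C1 Blue], [C1 Blue, C2 Blue, C2 Blue], [C1 Blue, C2 Blue, C4 Red], [C1 Blue, C3 Blue, C3 Blue], [C1 Blue,
     C3 Blue, C5 Red], [C1 Blue, C4 Red, C1 Blue], [C1 Blue, C4 Red, C2 Blue], [C1 Blue, C4 Red, C4 Red], [C1
     Blue, C5 Red, C3 Blue], [C1 Blue, C5 Red, C5 Red], [C1 Red, C1 Red, C1 Red], [C1 Red, C1 Red, C2 Red],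
     [C1 Red, C1 Red, C4 Blue], [C1 Red, C2 Red, C1 Red], [C1 Red, C2 Red, C2 Red], [C1 Red, C2 Red, C4 Blue],
     [C1 Red, C3 Red, C3 Red], [C1 Red, C3 Red, C5 Blue], [C1 Red, C4 Blue, C1 Red], [C1 Red, C4 Blue, C2
     Red], [C1 Red, C4 Blue, C4 Blue], [C1 Red, C5 Blue, C3 Red], [C1 Red, C5 Blue, C5 Blue], [C2 Blue, C1
     Blue, C1 Blue], [C2 Blue, C1 Blue, C2 Blue], [C2 Blue, C1 Blue, C4 Red], [C2 Blue, C2 Blue, C1 Blue], [C2
     Blue, C2 Blue, C2 Blue], [C2 Blue, C2 Blue, C4 Red], [C2 Blue, C3 Blue, C3 Blue], [C2 Blue, C3 Blue, C5
     Red], [C2 Blue, C4 Red, C1 Blue], [C2 Blue, C4 Red, C2 Blue], [C2 Blue, C4 Red, C4 Red], [C2 Blue, C5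
     Red, C3 Blue], [C2 Blue, C5 Red, C5 Red], [C2 Red, C1 Red, C1 Red], [C2 Red, C1 Red, C2 Red], [C2 Red, C1
     Red, C4 Blue], [C2 Red, C2 Red, C1 Red], [C2 Red, C2 Red, C2 Red], [C2 Red, C2 Red, C4 Blue], [C2 Red, C3
     Red, C3 Red], [C2 Red, C3 Red, C5 Blue], [C2 Red, C4 Blue, C1 Red], [C2 Red, C4 Blue, C2 Red], [C2 Red,
     C4 Blue, C4 Blue], [C2 Red, C5 Blue, C3 Red], [C2 Red, C5 Blue, C5 Blue], [C3 Blue, C1 Blue, C3 Red], [C3
     Blue, C1 Blue, C5 Blue], [C3 Blue, C2 Blue, C3 Red], [C3 Blue, C2 Blue, C5 Blue], [C3 Blue, C3 Blue, C1
     Red], [C3 Blue, C3 Blue, C2 Red], [C3 Blue, C3 Blue, C4 Blue], [C3 Blue, C4 Red, C3 Red], [C3 Blue, C4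
     Red, C5 Blue], [C3 Blue, C5 Red, C1 Red], [C3 Blue, C5 Red, C2 Red], [C3 Blue, C5 Red, C4 Blue], [C3 Red,
     C1 Red, C3 Blue], [C3 Red, C1 Red, C5 Red], [C3 Red, C2 Red, C3 Blue], [C3 Red, C2 Red, C5 Red], [C3 Red,
     C3 Red, C1 Blue], [C3 Red, C3 Red, C2 Blue], [C3 Red, C3 Red, C4 Red], [C3 Red, C4 Blue, C3 Blue], [C3
     Red, C4 Blue, C5 Red], [C3 Red, C5 Blue, C1 Blue], [C3 Red, C5 Blue, C2 Blue], [C3 Red, C5 Blue, C4 Red],
     [C4 Blue, C1 Red, C1 Red], [C4 Blue, C1 Red, C2 Red], [C4 Blue, C1 Red, C4 Blue], [C4 Blue, C2 Red, C1
     Red], [C4 Blue, C2 Red, C2 Red], [C4 Blue, C2 Red, C4 Blue], [C4 Blue, C3 Red, C3 Red], [C4 Blue, C3 Red,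
     C5 Blue], [C4 Blue, C4 Blue, C1 Red], [C4 Blue, C4 Blue, C2 Red], [C4 Blue, C4 Blue, C4 Blue], [C4 Blue,
     C5 Blue, C3 Red], [C4 Blue, C5 Blue, C5 Blue], [C4 Red, C1 Blue, C1 Blue], [C4 Red, C1 Blue, C2 Blue],
     [C4 Red, C1 Blue, C4 Red], [C4 Red, C2 Blue, C1 Blue], [C4 Red, C2 Blue, C2 Blue], [C4 Red, C2 Blue, C4
     Red], [C4 Red, C3 Blue, C3 Blue], [C4 Red, C3 Blue, C5 Red], [C4 Red, C4 Red, C1 Blue], [C4 Red, C4 Red,
     C2 Blue], [C4 Red, C4 Red, C4 Red], [C4 Red, C5 Red, C3 Blue], [C4 Red, C5 Red, C5 Red], [C5 Blue, C1
     Red, C3 Blue], [C5 Blue, C1 Red, C5 Red], [C5 Blue, C2 Red, C3 Blue], [C5 Blue, C2 Red, C5 Red], [C5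
     Blue, C3 Red, C1 Blue], [C5 Blue, C3 Red, C2 Blue], [C5 Blue, C3 Red, C4 Red], [C5 Blue, C4 Blue, C3
     Blue], [C5 Blue, C4 Blue, C5 Red], [C5 Blue, C5 Blue, C1 Blue], [C5 Blue, C5 Blue, C2 Blue], [C5 Blue, C5
     Blue, C4 Red], [C5 Red, C1 Blue, C3 Red], [C5 Red, C1 Blue, C5 Blue], [C5 Red, C2 Blue, C3 Red], [C5 Red,
     C2 Blue, C5 Blue], [C5 Red, C3 Blue, C1 Red], [C5 Red, C3 Blue, C2 Red], [C5 Red, C3 Blue, C4 Blue], [C5
     Red, C4 Red, C3 Red], [C5 Red, C4 Red, C5 Blue], [C5 Red, C5 Red, C1 Red], [C5 Red, C5 Red, C2 Red], [C5
     Red, C5 Red, C4 Blue]]"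
  "hex_configs upper_hex =
    [[C1 Blue, C1 Blue, C1 Blue], [C1 Blue, C1 Blue, C2 Blue], [C1 Blue, C1 Blue, C4 Blue], [C1 Blue, C2
     Blue, C1 Blue], [C1 Blue, C2 Blue, C2 Blue], [C1 Blue, C2 Blue, C4 Blue], [C1 Blue, C3 Red, C3 Red], [C1
     Blue, C3 Red, C5 Red], [C1 Blue, C4 Blue, C1 Blue], [C1 Blue, C4 Blue, C2 Blue], [C1 Blue, C4 Blue, C4
     Blue], [C1 Blue, C5 Red, C3 Red], [C1 Blue, C5 Red, C5 Red], [C1 Red, C1 Red, C1 Red], [C1 Red, C1 Red,
     C2 Red], [C1 Red, C1 Red, C4 Red], [C1 Red, C2 Red, C1 Red], [C1 Red, C2 Red, C2 Red], [C1 Red, C2 Red,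
     C4 Red], [C1 Red, C3 Blue, C3 Blue], [C1 Red, C3 Blue, C5 Blue], [C1 Red, C4 Red, C1 Red], [C1 Red, C4
     Red, C2 Red], [C1 Red, C4 Red, C4 Red], [C1 Red, C5 Blue, C3 Blue], [C1 Red, C5 Blue, C5 Blue], [C2 Blue,
     C1 Blue, C1 Blue], [C2 Blue, C1 Blue, C2 Blue], [C2 Blue, C1 Blue, C4 Blue], [C2 Blue, C2 Blue, C1 Blue],
     [C2 Blue, C2 Blue, C2 Blue], [C2 Blue, C2 Blue, C4 Blue], [C2 Blue, C3 Red, C3 Red], [C2 Blue, C3 Red, C5
     Red], [C2 Blue, C4 Blue, C1 Blue], [C2 Blue, C4 Blue, C2 Blue], [C2 Blue, C4 Blue, C4 Blue], [C2 Blue, C5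
     Red, C3 Red], [C2 Blue, C5 Red, C5 Red], [C2 Red, C1 Red, C1 Red], [C2 Red, C1 Red, C2 Red], [C2 Red, C1
     Red, C4 Red], [C2 Red, C2 Red, C1 Red], [C2 Red, C2 Red, C2 Red], [C2 Red, C2 Red, C4 Red], [C2 Red, C3
     Blue, C3 Blue], [C2 Red, C3 Blue, C5 Blue], [C2 Red, C4 Red, C1 Red], [C2 Red, C4 Red, C2 Red], [C2 Red,
     C4 Red, C4 Red], [C2 Red, C5 Blue, C3 Blue], [C2 Red, C5 Blue, C5 Blue], [C3 Blue, C1 Red, C3 Red], [C3
     Blue, C1 Red, C5 Red], [C3 Blue, C2 Red, C3 Red], [C3 Blue, C2 Red, C5 Red], [C3 Blue, C3 Blue, C1 Blue],
     [C3 Blue, C3 Blue, C2 Blue], [C3 Blue, C3 Blue, C4 Blue], [C3 Blue, C4 Red, C3 Red], [C3 Blue, C4 Red, C5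
     Red], [C3 Blue, C5 Blue, C1 Blue], [C3 Blue, C5 Blue, C2 Blue], [C3 Blue, C5 Blue, C4 Blue], [C3 Red, C1
     Blue, C3 Blue], [C3 Red, C1 Blue, C5 Blue], [C3 Red, C2 Blue, C3 Blue], [C3 Red, C2 Blue, C5 Blue], [C3
     Red, C3 Red, C1 Red], [C3 Red, C3 Red, C2 Red], [C3 Red, C3 Red, C4 Red], [C3 Red, C4 Blue, C3 Blue], [C3
     Red, C4 Blue, C5 Blue], [C3 Red, C5 Red, C1 Red], [C3 Red, C5 Red, C2 Red], [C3 Red, C5 Red, C4 Red], [C4
     Blue, C1 Blue, C1 Blue], [C4 Blue, C1 Blue, C2 Blue], [C4 Blue, C1 Blue, C4 Blue], [C4 Blue, C2 Blue, C1
     Blue], [C4 Blue, C2 Blue, C2 Blue], [C4 Blue, C2 Blue, C4 Blue], [C4 Blue, C3 Red, C3 Red], [C4 Blue, C3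
     Red, C5 Red], [C4 Blue, C4 Blue, C1 Blue], [C4 Blue, C4 Blue, C2 Blue], [C4 Blue, C4 Blue, C4 Blue], [C4
     Blue, C5 Red, C3 Red], [C4 Blue, C5 Red, C5 Red], [C4 Red, C1 Red, C1 Red], [C4 Red, C1 Red, C2 Red], [C4
     Red, C1 Red, C4 Red], [C4 Red, C2 Red, C1 Red], [C4 Red, C2 Red, C2 Red], [C4 Red, C2 Red, C4 Red], [C4
     Red, C3 Blue, C3 Blue], [C4 Red, C3 Blue, C5 Blue], [C4 Red, C4 Red, C1 Red], [C4 Red, C4 Red, C2 Red],
     [C4 Red, C4 Red, C4 Red], [C4 Red, C5 Blue, C3 Blue], [C4 Red, C5 Blue, C5 Blue], [C5 Blue, C1 Red, C3
     Red], [C5 Blue, C1 Red, C5 Red], [C5 Blue, C2 Red, C3 Red], [C5 Blue, C2 Red, C5 Red], [C5 Blue, C3 Blue,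
     C1 Blue], [C5 Blue, C3 Blue, C2 Blue], [C5 Blue, C3 Blue, C4 Blue], [C5 Blue, C4 Red, C3 Red], [C5 Blue,
     C4 Red, C5 Red], [C5 Blue, C5 Blue, C1 Blue], [C5 Blue, C5 Blue, C2 Blue], [C5 Blue, C5 Blue, C4 Blue],
     [C5 Red, C1 Blue, C3 Blue], [C5 Red, C1 Blue, C5 Blue], [C5 Red, C2 Blue, C3 Blue], [C5 Red, C2 Blue, C5
     Blue], [C5 Red, C3 Red, C1 Red], [C5 Red, C3 Red, C2 Red], [C5 Red, C3 Red, C4 Red], [C5 Red, C4 Blue, C3
     Blue], [C5 Red, C4 Blue, C5 Blue], [C5 Red, C5 Red, C1 Red], [C5 Red, C5 Red, C2 Red], [C5 Red, C5 Red,
     C4 Red]]"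
  by code_simp+

lemma hex_table_eval:
  "hex_table lower_hex =
    [(([Blue, Blue, Blue, Blue, Blue, Blue], [0, 1, 1, 3, 3, 0]), 0, [1, 1, 1]), (([Blue, Blue, Blue, Blue,
     Blue, Blue], [0, 1, 2, 2, 1, 0]), 0, [1, 1, 2]), (([Blue, Blue, Red, Red, Blue, Blue], [0, 1, 2, 2, 1,
     0]), 0, [1, 1, 4]), (([Blue, Blue, Blue, Blue, Blue, Blue], [0, 1, 1, 0, 4, 4]), 0, [1, 2, 1]), (([Blue,
     Blue, Blue, Blue, Blue, Blue], [0, 0, 2, 2, 4, 4]), 0, [1, 2, 2]), (([Blue, Blue, Red, Red, Blue, Blue],
     [0, 0, 2, 2, 4, 4]), 0, [1, 2, 4]), (([Blue, Blue, Blue, Red, Red, Blue], [0, 1, 1, 3, 3, 0]), 0, [1, 3,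
     3]), (([Blue, Blue, Red, Blue, Red, Blue], [0, 1, 2, 1, 2, 0]), 0, [1, 3, 5]), (([Blue, Blue, Blue, Blue,
     Red, Red], [0, 1, 1, 0, 4, 4]), 0, [1, 4, 1]), (([Blue, Blue, Blue, Blue, Red, Red], [0, 0, 2, 2, 4, 4]),
     0, [1, 4, 2]), (([Blue, Blue, Red, Red, Red, Red], [0, 0, 2, 2, 4, 4]), 0, [1, 4, 4]), (([Blue, Blue,
     Blue, Red, Blue, Red], [0, 1, 1, 3, 0, 3]), 0, [1, 5, 3]), (([Blue, Blue, Red, Blue, Blue, Red], [0, 1,
     2, 1, 0, 2]), 0, [1, 5, 5]), (([Red, Red, Red, Red, Red, Red], [0, 1, 1, 3, 3, 0]), 0, [1, 1, 1]),
     (([Red, Red, Red, Red, Red, Red], [0, 1, 2, 2, 1, 0]), 0, [1, 1, 2]), (([Red, Red, Blue, Blue, Red, Red],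
     [0, 1, 2, 2, 1, 0]), 0, [1, 1, 4]), (([Red, Red, Red, Red, Red, Red], [0, 1, 1, 0, 4, 4]), 0, [1, 2, 1]),
     (([Red, Red, Red, Red, Red, Red], [0, 0, 2, 2, 4, 4]), 0, [1, 2, 2]), (([Red, Red, Blue, Blue, Red, Red],
     [0, 0, 2, 2, 4, 4]), 0, [1, 2, 4]), (([Red, Red, Red, Blue, Blue, Red], [0, 1, 1, 3, 3, 0]), 0, [1, 3,
     3]), (([Red, Red, Blue, Red, Blue, Red], [0, 1, 2, 1, 2, 0]), 0, [1, 3, 5]), (([Red, Red, Red, Red, Blue,
     Blue], [0, 1, 1, 0, 4, 4]), 0, [1, 4, 1]), (([Red, Red, Red, Red, Blue, Blue], [0, 0, 2, 2, 4, 4]), 0,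
     [1, 4, 2]), (([Red, Red, Blue, Blue, Blue, Blue], [0, 0, 2, 2, 4, 4]), 0, [1, 4, 4]), (([Red, Red, Red,
     Blue, Red, Blue], [0, 1, 1, 3, 0, 3]), 0, [1, 5, 3]), (([Red, Red, Blue, Red, Red, Blue], [0, 1, 2, 1, 0,
     2]), 0, [1, 5, 5]), (([Blue, Blue, Blue, Blue, Blue, Blue], [0, 0, 2, 3, 3, 2]), 0, [2, 1, 1]), (([Blue,
     Blue, Blue, Blue, Blue, Blue], [0, 0, 2, 2, 4, 4]), 0, [2, 1, 2]), (([Blue, Blue, Red, Red, Blue, Blue],
     [0, 0, 2, 2, 4, 4]), 0, [2, 1, 4]), (([Blue, Blue, Blue, Blue, Blue, Blue], [0, 0, 2, 2, 4, 4]), 0, [2,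
     2, 1]), (([Blue, Blue, Blue, Blue, Blue, Blue], [0, 0, 2, 2, 4, 4]), 1, [2, 2, 2]), (([Blue, Blue, Red,
     Red, Blue, Blue], [0, 0, 2, 2, 4, 4]), 1, [2, 2, 4]), (([Blue, Blue, Blue, Red, Red, Blue], [0, 0, 2, 3,
     3, 2]), 0, [2, 3, 3]), (([Blue, Blue, Red, Blue, Red, Blue], [0, 0, 2, 3, 2, 3]), 0, [2, 3, 5]), (([Blue,
     Blue, Blue, Blue, Red, Red], [0, 0, 2, 2, 4, 4]), 0, [2, 4, 1]), (([Blue, Blue, Blue, Blue, Red, Red],
     [0, 0, 2, 2, 4, 4]), 1, [2, 4, 2]), (([Blue, Blue, Red, Red, Red, Red], [0, 0, 2, 2, 4, 4]), 1, [2, 4,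
     4]), (([Blue, Blue, Blue, Red, Blue, Red], [0, 0, 2, 3, 2, 3]), 0, [2, 5, 3]), (([Blue, Blue, Red, Blue,
     Blue, Red], [0, 0, 2, 3, 3, 2]), 0, [2, 5, 5]), (([Red, Red, Red, Red, Red, Red], [0, 0, 2, 3, 3, 2]), 0,
     [2, 1, 1]), (([Red, Red, Red, Red, Red, Red], [0, 0, 2, 2, 4, 4]), 0, [2, 1, 2]), (([Red, Red, Blue,
     Blue, Red, Red], [0, 0, 2, 2, 4, 4]), 0, [2, 1, 4]), (([Red, Red, Red, Red, Red, Red], [0, 0, 2, 2, 4,
     4]), 0, [2, 2, 1]), (([Red, Red, Red, Red, Red, Red], [0, 0, 2, 2, 4, 4]), 1, [2, 2, 2]), (([Red, Red,
     Blue, Blue, Red, Red], [0, 0, 2, 2, 4, 4]), 1, [2, 2, 4]), (([Red, Red, Red, Blue, Blue, Red], [0, 0, 2,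
     3, 3, 2]), 0, [2, 3, 3]), (([Red, Red, Blue, Red, Blue, Red], [0, 0, 2, 3, 2, 3]), 0, [2, 3, 5]), (([Red,
     Red, Red, Red, Blue, Blue], [0, 0, 2, 2, 4, 4]), 0, [2, 4, 1]), (([Red, Red, Red, Red, Blue, Blue], [0,
     0, 2, 2, 4, 4]), 1, [2, 4, 2]), (([Red, Red, Blue, Blue, Blue, Blue], [0, 0, 2, 2, 4, 4]), 1, [2, 4, 4]),
     (([Red, Red, Red, Blue, Red, Blue], [0, 0, 2, 3, 2, 3]), 0, [2, 5, 3]), (([Red, Red, Blue, Red, Red,
     Blue], [0, 0, 2, 3, 3, 2]), 0, [2, 5, 5]), (([Blue, Red, Red, Blue, Blue, Blue], [0, 1, 1, 3, 3, 0]), 0,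
     [3, 1, 3]), (([Blue, Red, Blue, Red, Blue, Blue], [0, 1, 2, 1, 2, 0]), 0, [3, 1, 5]), (([Blue, Red, Red,
     Blue, Blue, Blue], [0, 1, 1, 0, 4, 4]), 0, [3, 2, 3]), (([Blue, Red, Blue, Red, Blue, Blue], [0, 1, 0, 1,
     4, 4]), 0, [3, 2, 5]), (([Blue, Red, Red, Red, Red, Blue], [0, 1, 1, 3, 3, 0]), 0, [3, 3, 1]), (([Blue,
     Red, Red, Red, Red, Blue], [0, 1, 2, 2, 1, 0]), 0, [3, 3, 2]), (([Blue, Red, Blue, Blue, Red, Blue], [0,
     1, 2, 2, 1, 0]), 0, [3, 3, 4]), (([Blue, Red, Red, Blue, Red, Red], [0, 1, 1, 0, 4, 4]), 0, [3, 4, 3]),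
     (([Blue, Red, Blue, Red, Red, Red], [0, 1, 0, 1, 4, 4]), 0, [3, 4, 5]), (([Blue, Red, Red, Red, Blue,
     Red], [0, 1, 1, 3, 0, 3]), 0, [3, 5, 1]), (([Blue, Red, Red, Red, Blue, Red], [0, 1, 2, 2, 0, 1]), 0, [3,
     5, 2]), (([Blue, Red, Blue, Blue, Blue, Red], [0, 1, 2, 2, 0, 1]), 0, [3, 5, 4]), (([Red, Blue, Blue,
     Red, Red, Red], [0, 1, 1, 3, 3, 0]), 0, [3, 1, 3]), (([Red, Blue, Red, Blue, Red, Red], [0, 1, 2, 1, 2,
     0]), 0, [3, 1, 5]), (([Red, Blue, Blue, Red, Red, Red], [0, 1, 1, 0, 4, 4]), 0, [3, 2, 3]), (([Red, Blue,
     Red, Blue, Red, Red], [0, 1, 0, 1, 4, 4]), 0, [3, 2, 5]), (([Red, Blue, Blue, Blue, Blue, Red], [0, 1, 1,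
     3, 3, 0]), 0, [3, 3, 1]), (([Red, Blue, Blue, Blue, Blue, Red], [0, 1, 2, 2, 1, 0]), 0, [3, 3, 2]),
     (([Red, Blue, Red, Red, Blue, Red], [0, 1, 2, 2, 1, 0]), 0, [3, 3, 4]), (([Red, Blue, Blue, Red, Blue,
     Blue], [0, 1, 1, 0, 4, 4]), 0, [3, 4, 3]), (([Red, Blue, Red, Blue, Blue, Blue], [0, 1, 0, 1, 4, 4]), 0,
     [3, 4, 5]), (([Red, Blue, Blue, Blue, Red, Blue], [0, 1, 1, 3, 0, 3]), 0, [3, 5, 1]), (([Red, Blue, Blue,
     Blue, Red, Blue], [0, 1, 2, 2, 0, 1]), 0, [3, 5, 2]), (([Red, Blue, Red, Red, Red, Blue], [0, 1, 2, 2, 0,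
     1]), 0, [3, 5, 4]), (([Blue, Blue, Red, Red, Red, Red], [0, 0, 2, 3, 3, 2]), 0, [4, 1, 1]), (([Blue,
     Blue, Red, Red, Red, Red], [0, 0, 2, 2, 4, 4]), 0, [4, 1, 2]), (([Blue, Blue, Blue, Blue, Red, Red], [0,
     0, 2, 2, 4, 4]), 0, [4, 1, 4]), (([Blue, Blue, Red, Red, Red, Red], [0, 0, 2, 2, 4, 4]), 0, [4, 2, 1]),
     (([Blue, Blue, Red, Red, Red, Red], [0, 0, 2, 2, 4, 4]), 1, [4, 2, 2]), (([Blue, Blue, Blue, Blue, Red,
     Red], [0, 0, 2, 2, 4, 4]), 1, [4, 2, 4]), (([Blue, Blue, Red, Blue, Blue, Red], [0, 0, 2, 3, 3, 2]), 0,
     [4, 3, 3]), (([Blue, Blue, Blue, Red, Blue, Red], [0, 0, 2, 3, 2, 3]), 0, [4, 3, 5]), (([Blue, Blue, Red,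
     Red, Blue, Blue], [0, 0, 2, 2, 4, 4]), 0, [4, 4, 1]), (([Blue, Blue, Red, Red, Blue, Blue], [0, 0, 2, 2,
     4, 4]), 1, [4, 4, 2]), (([Blue, Blue, Blue, Blue, Blue, Blue], [0, 0, 2, 2, 4, 4]), 1, [4, 4, 4]),
     (([Blue, Blue, Red, Blue, Red, Blue], [0, 0, 2, 3, 2, 3]), 0, [4, 5, 3]), (([Blue, Blue, Blue, Red, Red,
     Blue], [0, 0, 2, 3, 3, 2]), 0, [4, 5, 5]), (([Red, Red, Blue, Blue, Blue, Blue], [0, 0, 2, 3, 3, 2]), 0,
     [4, 1, 1]), (([Red, Red, Blue, Blue, Blue, Blue], [0, 0, 2, 2, 4, 4]), 0, [4, 1, 2]), (([Red, Red, Red,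
     Red, Blue, Blue], [0, 0, 2, 2, 4, 4]), 0, [4, 1, 4]), (([Red, Red, Blue, Blue, Blue, Blue], [0, 0, 2, 2,
     4, 4]), 0, [4, 2, 1]), (([Red, Red, Blue, Blue, Blue, Blue], [0, 0, 2, 2, 4, 4]), 1, [4, 2, 2]), (([Red,
     Red, Red, Red, Blue, Blue], [0, 0, 2, 2, 4, 4]), 1, [4, 2, 4]), (([Red, Red, Blue, Red, Red, Blue], [0,
     0, 2, 3, 3, 2]), 0, [4, 3, 3]), (([Red, Red, Red, Blue, Red, Blue], [0, 0, 2, 3, 2, 3]), 0, [4, 3, 5]),
     (([Red, Red, Blue, Blue, Red, Red], [0, 0, 2, 2, 4, 4]), 0, [4, 4, 1]), (([Red, Red, Blue, Blue, Red,
     Red], [0, 0, 2, 2, 4, 4]), 1, [4, 4, 2]), (([Red, Red, Red, Red, Red, Red], [0, 0, 2, 2, 4, 4]), 1, [4,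
     4, 4]), (([Red, Red, Blue, Red, Blue, Red], [0, 0, 2, 3, 2, 3]), 0, [4, 5, 3]), (([Red, Red, Red, Blue,
     Blue, Red], [0, 0, 2, 3, 3, 2]), 0, [4, 5, 5]), (([Blue, Red, Blue, Red, Red, Red], [0, 1, 0, 3, 3, 1]),
     0, [5, 1, 3]), (([Blue, Red, Red, Blue, Red, Red], [0, 1, 2, 0, 2, 1]), 0, [5, 1, 5]), (([Blue, Red,
     Blue, Red, Red, Red], [0, 1, 0, 1, 4, 4]), 0, [5, 2, 3]), (([Blue, Red, Red, Blue, Red, Red], [0, 1, 1,
     0, 4, 4]), 0, [5, 2, 5]), (([Blue, Red, Blue, Blue, Blue, Red], [0, 1, 0, 3, 3, 1]), 0, [5, 3, 1]),
     (([Blue, Red, Blue, Blue, Blue, Red], [0, 1, 2, 2, 0, 1]), 0, [5, 3, 2]), (([Blue, Red, Red, Red, Blue,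
     Red], [0, 1, 2, 2, 0, 1]), 0, [5, 3, 4]), (([Blue, Red, Blue, Red, Blue, Blue], [0, 1, 0, 1, 4, 4]), 0,
     [5, 4, 3]), (([Blue, Red, Red, Blue, Blue, Blue], [0, 1, 1, 0, 4, 4]), 0, [5, 4, 5]), (([Blue, Red, Blue,
     Blue, Red, Blue], [0, 1, 0, 3, 1, 3]), 0, [5, 5, 1]), (([Blue, Red, Blue, Blue, Red, Blue], [0, 1, 2, 2,
     1, 0]), 0, [5, 5, 2]), (([Blue, Red, Red, Red, Red, Blue], [0, 1, 2, 2, 1, 0]), 0, [5, 5, 4]), (([Red,
     Blue, Red, Blue, Blue, Blue], [0, 1, 0, 3, 3, 1]), 0, [5, 1, 3]), (([Red, Blue, Blue, Red, Blue, Blue],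
     [0, 1, 2, 0, 2, 1]), 0, [5, 1, 5]), (([Red, Blue, Red, Blue, Blue, Blue], [0, 1, 0, 1, 4, 4]), 0, [5, 2,
     3]), (([Red, Blue, Blue, Red, Blue, Blue], [0, 1, 1, 0, 4, 4]), 0, [5, 2, 5]), (([Red, Blue, Red, Red,
     Red, Blue], [0, 1, 0, 3, 3, 1]), 0, [5, 3, 1]), (([Red, Blue, Red, Red, Red, Blue], [0, 1, 2, 2, 0, 1]),
     0, [5, 3, 2]), (([Red, Blue, Blue, Blue, Red, Blue], [0, 1, 2, 2, 0, 1]), 0, [5, 3, 4]), (([Red, Blue,
     Red, Blue, Red, Red], [0, 1, 0, 1, 4, 4]), 0, [5, 4, 3]), (([Red, Blue, Blue, Red, Red, Red], [0, 1, 1,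
     0, 4, 4]), 0, [5, 4, 5]), (([Red, Blue, Red, Red, Blue, Red], [0, 1, 0, 3, 1, 3]), 0, [5, 5, 1]), (([Red,
     Blue, Red, Red, Blue, Red], [0, 1, 2, 2, 1, 0]), 0, [5, 5, 2]), (([Red, Blue, Blue, Blue, Blue, Red], [0,
     1, 2, 2, 1, 0]), 0, [5, 5, 4])]"
  "hex_table upper_hex =
    [(([Blue, Blue, Blue, Blue, Blue, Blue], [0, 0, 2, 2, 4, 4]), 0, [1, 1, 1]), (([Blue, Blue, Blue, Blue,
     Blue, Blue], [0, 1, 2, 2, 1, 0]), 0, [1, 1, 2]), (([Red, Blue, Blue, Blue, Blue, Red], [0, 1, 2, 2, 1,
     0]), 0, [1, 1, 4]), (([Blue, Blue, Blue, Blue, Blue, Blue], [0, 1, 1, 0, 4, 4]), 0, [1, 2, 1]), (([Blue,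
     Blue, Blue, Blue, Blue, Blue], [0, 1, 1, 3, 3, 0]), 0, [1, 2, 2]), (([Red, Blue, Blue, Blue, Blue, Red],
     [0, 1, 1, 3, 3, 0]), 0, [1, 2, 4]), (([Red, Red, Blue, Blue, Blue, Blue], [0, 0, 2, 2, 4, 4]), 0, [1, 3,
     3]), (([Blue, Red, Blue, Blue, Blue, Red], [0, 1, 2, 2, 0, 1]), 0, [1, 3, 5]), (([Blue, Red, Red, Blue,
     Blue, Blue], [0, 1, 1, 0, 4, 4]), 0, [1, 4, 1]), (([Blue, Red, Red, Blue, Blue, Blue], [0, 1, 1, 3, 3,
     0]), 0, [1, 4, 2]), (([Red, Red, Red, Blue, Blue, Red], [0, 1, 1, 3, 3, 0]), 0, [1, 4, 4]), (([Red, Blue,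
     Red, Blue, Blue, Blue], [0, 1, 0, 1, 4, 4]), 0, [1, 5, 3]), (([Blue, Blue, Red, Blue, Blue, Red], [0, 1,
     2, 1, 0, 2]), 0, [1, 5, 5]), (([Red, Red, Red, Red, Red, Red], [0, 0, 2, 2, 4, 4]), 0, [1, 1, 1]),
     (([Red, Red, Red, Red, Red, Red], [0, 1, 2, 2, 1, 0]), 0, [1, 1, 2]), (([Blue, Red, Red, Red, Red, Blue],
     [0, 1, 2, 2, 1, 0]), 0, [1, 1, 4]), (([Red, Red, Red, Red, Red, Red], [0, 1, 1, 0, 4, 4]), 0, [1, 2, 1]),
     (([Red, Red, Red, Red, Red, Red], [0, 1, 1, 3, 3, 0]), 0, [1, 2, 2]), (([Blue, Red, Red, Red, Red, Blue],
     [0, 1, 1, 3, 3, 0]), 0, [1, 2, 4]), (([Blue, Blue, Red, Red, Red, Red], [0, 0, 2, 2, 4, 4]), 0, [1, 3,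
     3]), (([Red, Blue, Red, Red, Red, Blue], [0, 1, 2, 2, 0, 1]), 0, [1, 3, 5]), (([Red, Blue, Blue, Red,
     Red, Red], [0, 1, 1, 0, 4, 4]), 0, [1, 4, 1]), (([Red, Blue, Blue, Red, Red, Red], [0, 1, 1, 3, 3, 0]),
     0, [1, 4, 2]), (([Blue, Blue, Blue, Red, Red, Blue], [0, 1, 1, 3, 3, 0]), 0, [1, 4, 4]), (([Blue, Red,
     Blue, Red, Red, Red], [0, 1, 0, 1, 4, 4]), 0, [1, 5, 3]), (([Red, Red, Blue, Red, Red, Blue], [0, 1, 2,
     1, 0, 2]), 0, [1, 5, 5]), (([Blue, Blue, Blue, Blue, Blue, Blue], [0, 0, 2, 3, 3, 2]), 0, [2, 1, 1]),
     (([Blue, Blue, Blue, Blue, Blue, Blue], [0, 1, 1, 3, 3, 0]), 0, [2, 1, 2]), (([Red, Blue, Blue, Blue,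
     Blue, Red], [0, 1, 1, 3, 3, 0]), 0, [2, 1, 4]), (([Blue, Blue, Blue, Blue, Blue, Blue], [0, 1, 1, 3, 3,
     0]), 0, [2, 2, 1]), (([Blue, Blue, Blue, Blue, Blue, Blue], [0, 1, 1, 3, 3, 0]), 1, [2, 2, 2]), (([Red,
     Blue, Blue, Blue, Blue, Red], [0, 1, 1, 3, 3, 0]), 1, [2, 2, 4]), (([Red, Red, Blue, Blue, Blue, Blue],
     [0, 0, 2, 3, 3, 2]), 0, [2, 3, 3]), (([Blue, Red, Blue, Blue, Blue, Red], [0, 1, 0, 3, 3, 1]), 0, [2, 3,
     5]), (([Blue, Red, Red, Blue, Blue, Blue], [0, 1, 1, 3, 3, 0]), 0, [2, 4, 1]), (([Blue, Red, Red, Blue,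
     Blue, Blue], [0, 1, 1, 3, 3, 0]), 1, [2, 4, 2]), (([Red, Red, Red, Blue, Blue, Red], [0, 1, 1, 3, 3, 0]),
     1, [2, 4, 4]), (([Red, Blue, Red, Blue, Blue, Blue], [0, 1, 0, 3, 3, 1]), 0, [2, 5, 3]), (([Blue, Blue,
     Red, Blue, Blue, Red], [0, 0, 2, 3, 3, 2]), 0, [2, 5, 5]), (([Red, Red, Red, Red, Red, Red], [0, 0, 2, 3,
     3, 2]), 0, [2, 1, 1]), (([Red, Red, Red, Red, Red, Red], [0, 1, 1, 3, 3, 0]), 0, [2, 1, 2]), (([Blue,
     Red, Red, Red, Red, Blue], [0, 1, 1, 3, 3, 0]), 0, [2, 1, 4]), (([Red, Red, Red, Red, Red, Red], [0, 1,
     1, 3, 3, 0]), 0, [2, 2, 1]), (([Red, Red, Red, Red, Red, Red], [0, 1, 1, 3, 3, 0]), 1, [2, 2, 2]),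
     (([Blue, Red, Red, Red, Red, Blue], [0, 1, 1, 3, 3, 0]), 1, [2, 2, 4]), (([Blue, Blue, Red, Red, Red,
     Red], [0, 0, 2, 3, 3, 2]), 0, [2, 3, 3]), (([Red, Blue, Red, Red, Red, Blue], [0, 1, 0, 3, 3, 1]), 0, [2,
     3, 5]), (([Red, Blue, Blue, Red, Red, Red], [0, 1, 1, 3, 3, 0]), 0, [2, 4, 1]), (([Red, Blue, Blue, Red,
     Red, Red], [0, 1, 1, 3, 3, 0]), 1, [2, 4, 2]), (([Blue, Blue, Blue, Red, Red, Blue], [0, 1, 1, 3, 3, 0]),
     1, [2, 4, 4]), (([Blue, Red, Blue, Red, Red, Red], [0, 1, 0, 3, 3, 1]), 0, [2, 5, 3]), (([Red, Red, Blue,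
     Red, Red, Blue], [0, 0, 2, 3, 3, 2]), 0, [2, 5, 5]), (([Red, Red, Red, Red, Blue, Blue], [0, 0, 2, 2, 4,
     4]), 0, [3, 1, 3]), (([Blue, Red, Red, Red, Blue, Red], [0, 1, 2, 2, 0, 1]), 0, [3, 1, 5]), (([Red, Red,
     Red, Red, Blue, Blue], [0, 1, 1, 0, 4, 4]), 0, [3, 2, 3]), (([Blue, Red, Red, Red, Blue, Red], [0, 1, 1,
     3, 0, 3]), 0, [3, 2, 5]), (([Blue, Blue, Red, Red, Blue, Blue], [0, 0, 2, 2, 4, 4]), 0, [3, 3, 1]),
     (([Blue, Blue, Red, Red, Blue, Blue], [0, 1, 2, 2, 1, 0]), 0, [3, 3, 2]), (([Red, Blue, Red, Red, Blue,
     Red], [0, 1, 2, 2, 1, 0]), 0, [3, 3, 4]), (([Red, Blue, Blue, Red, Blue, Blue], [0, 1, 1, 0, 4, 4]), 0,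
     [3, 4, 3]), (([Blue, Blue, Blue, Red, Blue, Red], [0, 1, 1, 3, 0, 3]), 0, [3, 4, 5]), (([Blue, Red, Blue,
     Red, Blue, Blue], [0, 1, 0, 1, 4, 4]), 0, [3, 5, 1]), (([Blue, Red, Blue, Red, Blue, Blue], [0, 1, 2, 1,
     2, 0]), 0, [3, 5, 2]), (([Red, Red, Blue, Red, Blue, Red], [0, 1, 2, 1, 2, 0]), 0, [3, 5, 4]), (([Blue,
     Blue, Blue, Blue, Red, Red], [0, 0, 2, 2, 4, 4]), 0, [3, 1, 3]), (([Red, Blue, Blue, Blue, Red, Blue],
     [0, 1, 2, 2, 0, 1]), 0, [3, 1, 5]), (([Blue, Blue, Blue, Blue, Red, Red], [0, 1, 1, 0, 4, 4]), 0, [3, 2,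
     3]), (([Red, Blue, Blue, Blue, Red, Blue], [0, 1, 1, 3, 0, 3]), 0, [3, 2, 5]), (([Red, Red, Blue, Blue,
     Red, Red], [0, 0, 2, 2, 4, 4]), 0, [3, 3, 1]), (([Red, Red, Blue, Blue, Red, Red], [0, 1, 2, 2, 1, 0]),
     0, [3, 3, 2]), (([Blue, Red, Blue, Blue, Red, Blue], [0, 1, 2, 2, 1, 0]), 0, [3, 3, 4]), (([Blue, Red,
     Red, Blue, Red, Red], [0, 1, 1, 0, 4, 4]), 0, [3, 4, 3]), (([Red, Red, Red, Blue, Red, Blue], [0, 1, 1,
     3, 0, 3]), 0, [3, 4, 5]), (([Red, Blue, Red, Blue, Red, Red], [0, 1, 0, 1, 4, 4]), 0, [3, 5, 1]), (([Red,
     Blue, Red, Blue, Red, Red], [0, 1, 2, 1, 2, 0]), 0, [3, 5, 2]), (([Blue, Blue, Red, Blue, Red, Blue], [0,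
     1, 2, 1, 2, 0]), 0, [3, 5, 4]), (([Blue, Blue, Blue, Red, Red, Blue], [0, 0, 2, 3, 3, 2]), 0, [4, 1, 1]),
     (([Blue, Blue, Blue, Red, Red, Blue], [0, 1, 1, 3, 3, 0]), 0, [4, 1, 2]), (([Red, Blue, Blue, Red, Red,
     Red], [0, 1, 1, 3, 3, 0]), 0, [4, 1, 4]), (([Blue, Blue, Blue, Red, Red, Blue], [0, 1, 1, 3, 3, 0]), 0,
     [4, 2, 1]), (([Blue, Blue, Blue, Red, Red, Blue], [0, 1, 1, 3, 3, 0]), 1, [4, 2, 2]), (([Red, Blue, Blue,
     Red, Red, Red], [0, 1, 1, 3, 3, 0]), 1, [4, 2, 4]), (([Red, Red, Blue, Red, Red, Blue], [0, 0, 2, 3, 3,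
     2]), 0, [4, 3, 3]), (([Blue, Red, Blue, Red, Red, Red], [0, 1, 0, 3, 3, 1]), 0, [4, 3, 5]), (([Blue, Red,
     Red, Red, Red, Blue], [0, 1, 1, 3, 3, 0]), 0, [4, 4, 1]), (([Blue, Red, Red, Red, Red, Blue], [0, 1, 1,
     3, 3, 0]), 1, [4, 4, 2]), (([Red, Red, Red, Red, Red, Red], [0, 1, 1, 3, 3, 0]), 1, [4, 4, 4]), (([Red,
     Blue, Red, Red, Red, Blue], [0, 1, 0, 3, 3, 1]), 0, [4, 5, 3]), (([Blue, Blue, Red, Red, Red, Red], [0,
     0, 2, 3, 3, 2]), 0, [4, 5, 5]), (([Red, Red, Red, Blue, Blue, Red], [0, 0, 2, 3, 3, 2]), 0, [4, 1, 1]),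
     (([Red, Red, Red, Blue, Blue, Red], [0, 1, 1, 3, 3, 0]), 0, [4, 1, 2]), (([Blue, Red, Red, Blue, Blue,
     Blue], [0, 1, 1, 3, 3, 0]), 0, [4, 1, 4]), (([Red, Red, Red, Blue, Blue, Red], [0, 1, 1, 3, 3, 0]), 0,
     [4, 2, 1]), (([Red, Red, Red, Blue, Blue, Red], [0, 1, 1, 3, 3, 0]), 1, [4, 2, 2]), (([Blue, Red, Red,
     Blue, Blue, Blue], [0, 1, 1, 3, 3, 0]), 1, [4, 2, 4]), (([Blue, Blue, Red, Blue, Blue, Red], [0, 0, 2, 3,
     3, 2]), 0, [4, 3, 3]), (([Red, Blue, Red, Blue, Blue, Blue], [0, 1, 0, 3, 3, 1]), 0, [4, 3, 5]), (([Red,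
     Blue, Blue, Blue, Blue, Red], [0, 1, 1, 3, 3, 0]), 0, [4, 4, 1]), (([Red, Blue, Blue, Blue, Blue, Red],
     [0, 1, 1, 3, 3, 0]), 1, [4, 4, 2]), (([Blue, Blue, Blue, Blue, Blue, Blue], [0, 1, 1, 3, 3, 0]), 1, [4,
     4, 4]), (([Blue, Red, Blue, Blue, Blue, Red], [0, 1, 0, 3, 3, 1]), 0, [4, 5, 3]), (([Red, Red, Blue,
     Blue, Blue, Blue], [0, 0, 2, 3, 3, 2]), 0, [4, 5, 5]), (([Red, Red, Red, Blue, Red, Blue], [0, 0, 2, 3,
     2, 3]), 0, [5, 1, 3]), (([Blue, Red, Red, Blue, Red, Red], [0, 1, 2, 0, 2, 1]), 0, [5, 1, 5]), (([Red,
     Red, Red, Blue, Red, Blue], [0, 1, 1, 3, 0, 3]), 0, [5, 2, 3]), (([Blue, Red, Red, Blue, Red, Red], [0,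
     1, 1, 0, 4, 4]), 0, [5, 2, 5]), (([Blue, Blue, Red, Blue, Red, Blue], [0, 0, 2, 3, 2, 3]), 0, [5, 3, 1]),
     (([Blue, Blue, Red, Blue, Red, Blue], [0, 1, 2, 1, 2, 0]), 0, [5, 3, 2]), (([Red, Blue, Red, Blue, Red,
     Red], [0, 1, 2, 1, 2, 0]), 0, [5, 3, 4]), (([Red, Blue, Blue, Blue, Red, Blue], [0, 1, 1, 3, 0, 3]), 0,
     [5, 4, 3]), (([Blue, Blue, Blue, Blue, Red, Red], [0, 1, 1, 0, 4, 4]), 0, [5, 4, 5]), (([Blue, Red, Blue,
     Blue, Red, Blue], [0, 1, 0, 3, 1, 3]), 0, [5, 5, 1]), (([Blue, Red, Blue, Blue, Red, Blue], [0, 1, 2, 2,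
     1, 0]), 0, [5, 5, 2]), (([Red, Red, Blue, Blue, Red, Red], [0, 1, 2, 2, 1, 0]), 0, [5, 5, 4]), (([Blue,
     Blue, Blue, Red, Blue, Red], [0, 0, 2, 3, 2, 3]), 0, [5, 1, 3]), (([Red, Blue, Blue, Red, Blue, Blue],
     [0, 1, 2, 0, 2, 1]), 0, [5, 1, 5]), (([Blue, Blue, Blue, Red, Blue, Red], [0, 1, 1, 3, 0, 3]), 0, [5, 2,
     3]), (([Red, Blue, Blue, Red, Blue, Blue], [0, 1, 1, 0, 4, 4]), 0, [5, 2, 5]), (([Red, Red, Blue, Red,
     Blue, Red], [0, 0, 2, 3, 2, 3]), 0, [5, 3, 1]), (([Red, Red, Blue, Red, Blue, Red], [0, 1, 2, 1, 2, 0]),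
     0, [5, 3, 2]), (([Blue, Red, Blue, Red, Blue, Blue], [0, 1, 2, 1, 2, 0]), 0, [5, 3, 4]), (([Blue, Red,
     Red, Red, Blue, Red], [0, 1, 1, 3, 0, 3]), 0, [5, 4, 3]), (([Red, Red, Red, Red, Blue, Blue], [0, 1, 1,
     0, 4, 4]), 0, [5, 4, 5]), (([Red, Blue, Red, Red, Blue, Red], [0, 1, 0, 3, 1, 3]), 0, [5, 5, 1]), (([Red,
     Blue, Red, Red, Blue, Red], [0, 1, 2, 2, 1, 0]), 0, [5, 5, 2]), (([Blue, Blue, Red, Red, Blue, Blue], [0,
     1, 2, 2, 1, 0]), 0, [5, 5, 4])]"
  unfolding hex_table_def hex_configs_eval by code_simp+

lemma distinct_hex_configs: "distinct (hex_configs lower_hex)" "distinct (hex_configs upper_hex)"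
  unfolding hex_configs_eval by code_simp+

text \<open>The three sides around the centre either form a closed loop on their own, or each of them is
  joined to the boundary.\<close>

definition inner_sides_ok :: "(nat \<times> nat \<times> colour) list \<Rightarrow> bool" where
  "inner_sides_ok st \<longleftrightarrow> (let l = labels st in
     if l ! 6 \<in> set (take 6 l) then l ! 7 \<in> set (take 6 l) \<and> l ! 8 \<in> set (take 6 l)
     else l ! 7 = l ! 6 \<and> l ! 8 = l ! 6)"

lemma inner_sides_eval:
  "list_all (\<lambda>t. inner_sides_ok (hex_strands lower_hex t)) (hex_configs lower_hex)"
  "list_all (\<lambda>t. inner_sides_ok (hex_strands upper_hex t)) (hex_configs upper_hex)"
  unfolding hex_configs_eval by code_simp+

definition rows_at :: "(boundary_state \<times> nat \<times> nat list) list \<Rightarrow> boundary_state \<Rightarrow> (nat \<times> nat list) list" where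
  "rows_at T k = map snd (filter (\<lambda>r. fst r = k) T)"

text \<open>For each boundary state the fillings of both hexagons form one of the listed pairs.\<close>

lemma rows_eval:
  "list_all (\<lambda>k. (rows_at (hex_table lower_hex) k, rows_at (hex_table upper_hex) k) \<in> set pairs_list)
     (remdups (map fst (hex_table lower_hex)))"
  "list_all (\<lambda>k. k \<in> set (remdups (map fst (hex_table lower_hex)))) (map fst (hex_table upper_hex))"
  "list_all (\<lambda>(ls, us). ls \<noteq> [] \<and> us \<noteq> []) pairs_list"
  unfolding hex_table_eval by code_simp+

section \<open>Fillings of a hexagon with a given boundary state\<close>

definition joined :: "(nat \<times> nat \<times> colour) list \<Rightarrow> (nat \<times> nat) set" where
  "joined st = {(a, b). \<exists>c. (a, b, c) \<in> set st \<or> (b, a, c) \<in> set st}"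

lemma length_merge: "length (merge x l) = length l"
  by (cases x) (simp add: merge_def Let_def)

lemma length_labels: "length (labels st) = 9"
proof -
  have "length (fold merge st l) = length l" for l
    by (induction st arbitrary: l) (simp_all add: length_merge)
  then show ?thesis by (simp add: labels_def)
qed

text \<open>The labels compute connectivity: after each merging step, equal labels mean connected by the
  strands read so far.\<close>

lemma labels_iff:
  assumes "\<And>a b c. (a, b, c) \<in> set st \<Longrightarrow> a < 9 \<and> b < 9" "i < 9" "j < 9"
  shows "labels st ! i = labels st ! j \<longleftrightarrow> (i, j) \<in> (joined st)\<^sup>*"
  using assms
proof (induction st arbitrary: i j rule: rev_induct)
  case Nil
  have "labels [] ! k = k" if "k < 9" for k
  proof -
    have "k \<in> {0, 1, 2, 3, 4, 5, 6, 7, 8}" using that by auto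
    then show ?thesis by (auto simp: labels_def)
  qed
  moreover have "joined [] = {}" by (simp add: joined_def)
  ultimately show ?case using Nil by simp
next
  case (snoc x st)
  obtain a b c where x: "x = (a, b, c)" by (cases x)
  define l where "l = labels st"
  define l' where "l' = labels (st @ [x])"
  have ab: "a < 9" "b < 9" using snoc.prems(1)[of a b c] x by auto
  have len: "length l = 9" by (simp add: l_def length_labels)
  have l': "l' ! k = (if l ! k = l ! a then l ! b else l ! k)" if "k < 9" for k
    using that len unfolding l'_def l_def labels_def by (simp add: x merge_def Let_def)
  have IH: "l ! i = l ! j \<longleftrightarrow> (i, j) \<in> (joined st)\<^sup>*" if "i < 9" "j < 9" for i j
    unfolding l_def using snoc.IH[OF _ that] snoc.prems(1) by auto
  have J: "joined (st @ [x]) = joined st \<union> {(a, b), (b, a)}" by (auto simp: joined_def x)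
  have lt: "y < 9 \<and> z < 9" if "(y, z) \<in> joined st" for y z
    using that snoc.prems(1) by (auto simp: joined_def)
  show ?case unfolding l'_def[symmetric]
  proof
    assume eq: "l' ! i = l' ! j"
    have sub: "(joined st)\<^sup>* \<subseteq> (joined (st @ [x]))\<^sup>*" unfolding J by (rule rtrancl_mono) auto
    have st: "(a, b) \<in> (joined (st @ [x]))\<^sup>*" "(b, a) \<in> (joined (st @ [x]))\<^sup>*" unfolding J by auto
    consider "l ! i = l ! j" | "l ! i = l ! a" "l ! b = l ! j" | "l ! i = l ! b" "l ! a = l ! j"
      using eq l'[OF snoc.prems(2)] l'[OF snoc.prems(3)] by (auto split: if_splits)
    then show "(i, j) \<in> (joined (st @ [x]))\<^sup>*"
    proof cases
      case 1
      then show ?thesis using IH sub snoc.prems by blast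
    next
      case 2
      then have "(i, a) \<in> (joined st)\<^sup>*" "(b, j) \<in> (joined st)\<^sup>*" using IH ab snoc.prems by blast+
      then show ?thesis using sub st by (meson rtrancl_trans subsetD)
    next
      case 3
      then have "(i, b) \<in> (joined st)\<^sup>*" "(a, j) \<in> (joined st)\<^sup>*" using IH ab snoc.prems by blast+
      then show ?thesis using sub st by (meson rtrancl_trans subsetD)
    qed
  next
    assume "(i, j) \<in> (joined (st @ [x]))\<^sup>*"
    then have "j < 9 \<and> l' ! i = l' ! j"
    proof (induction rule: rtrancl_induct)
      case base
      then show ?case using snoc.prems by simp
    next
      case (step y z)
      show ?case
      proof (cases "(y, z) \<in> joined st")
        case True
        then have "y < 9" "z < 9" "l ! y = l ! z" using lt IH by blast+
        then show ?thesis using step.IH l' by simp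
      next
        case False
        then have "(y, z) = (a, b) \<or> (y, z) = (b, a)" using step.hyps J by auto
        then show ?thesis using step.IH l' ab by auto
      qed
    qed
    then show "l' ! i = l' ! j" by simp
  qed
qed

lemma less_6_set: "k < 6 \<longleftrightarrow> k \<in> set [0, 1, 2, 3, 4, 5 :: nat]" by auto

lemma boundary_state_colour:
  assumes "boundary_state st = boundary_state st'" "k < 6"
  shows "node_colour st k = node_colour st' k"
  using assms unfolding boundary_state_def less_6_set by auto

lemma boundary_state_joined:
  assumes eq: "boundary_state st = boundary_state st'" and ij: "i < 6" "j < 6"
    and lt: "\<And>a b c. (a, b, c) \<in> set st \<Longrightarrow> a < 9 \<and> b < 9" "\<And>a b c. (a, b, c) \<in> set st' \<Longrightarrow> a < 9 \<and> b < 9"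
  shows "(i, j) \<in> (joined st)\<^sup>* \<longleftrightarrow> (i, j) \<in> (joined st')\<^sup>*"
proof -
  let ?I = "[0, 1, 2, 3, 4, 5 :: nat]"
  define canon where "canon l i = hd (filter (\<lambda>j. l ! j = l ! i) ?I)" for l :: "nat list" and i
  have canon: "canon l i = canon l j \<longleftrightarrow> l ! i = l ! j" if "i \<in> set ?I" "j \<in> set ?I" for l i j
  proof
    assume c: "canon l i = canon l j"
    have "l ! canon l k = l ! k" if "k \<in> set ?I" for k
    proof -
      have "filter (\<lambda>j. l ! j = l ! k) ?I \<noteq> []" using that unfolding filter_empty_conv by blast
      then have "canon l k \<in> set (filter (\<lambda>j. l ! j = l ! k) ?I)" unfolding canon_def by (rule hd_in_set)
      then show ?thesis by (simp only: set_filter mem_Collect_eq)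
    qed
    then show "l ! i = l ! j" using c that by metis
  next
    assume "l ! i = l ! j"
    then show "canon l i = canon l j" by (simp only: canon_def)
  qed
  have "map (canon (labels st)) ?I = map (canon (labels st')) ?I"
    using eq unfolding boundary_state_def canon_def Let_def by simp
  then have "canon (labels st) k = canon (labels st') k" if "k \<in> set ?I" for k
    using that unfolding map_eq_conv by blast
  then have "labels st ! i = labels st ! j \<longleftrightarrow> labels st' ! i = labels st' ! j"
    using canon ij unfolding less_6_set by metis
  then show ?thesis using labels_iff[OF lt(1)] labels_iff[OF lt(2)] ij by simp
qed

lemma mem_local_configs: "\<tau> \<in> set local_configs"
  by (cases \<tau>; rename_tac c; case_tac c) (simp_all add: local_configs_def)

lemma mem_hex_configs: "t \<in> set (hex_configs H) \<longleftrightarrow> length t = 3 \<and> colours_agree (hex_strands H t)"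
proof -
  have "t \<in> set (concat (map (\<lambda>a. concat (map (\<lambda>b. map (\<lambda>c. [a, b, c]) local_configs) local_configs)) local_configs))
    \<longleftrightarrow> (\<exists>a b c. t = [a, b, c])"
    using mem_local_configs by (auto simp: image_iff)
  also have "\<dots> \<longleftrightarrow> length t = 3" by (auto simp: length_Suc_conv numeral_3_eq_3)
  finally show ?thesis unfolding hex_configs_def by auto
qed

lemma coded_strands_nodes:
  "(\<exists>y c. (x, y, c) \<in> set (coded_strands (p, q, r, s) \<tau>) \<or> (y, x, c) \<in> set (coded_strands (p, q, r, s) \<tau>))
    \<longleftrightarrow> x \<in> {p, q, r, s}"
  by (cases \<tau>) auto

lemma hex_strands_nodes:
  assumes "H = lower_hex \<or> H = upper_hex" "length t = 3"
  shows "(\<exists>y c. (x, y, c) \<in> set (hex_strands H t) \<or> (y, x, c) \<in> set (hex_strands H t)) \<longleftrightarrow> x < 9"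
proof -
  obtain t1 t2 t3 where t: "t = [t1, t2, t3]"
    using assms(2) by (auto simp: length_Suc_conv numeral_3_eq_3)
  have n: "x < 9 \<longleftrightarrow> x \<in> {0, 1, 2, 3, 4, 5, 6, 7, 8}" by auto
  have "(\<exists>y c. (x, y, c) \<in> set (hex_strands [h1, h2, h3] t) \<or> (y, x, c) \<in> set (hex_strands [h1, h2, h3] t))
    \<longleftrightarrow> (\<exists>y c. (x, y, c) \<in> set (coded_strands h1 t1) \<or> (y, x, c) \<in> set (coded_strands h1 t1)) \<or>
        (\<exists>y c. (x, y, c) \<in> set (coded_strands h2 t2) \<or> (y, x, c) \<in> set (coded_strands h2 t2)) \<or>
        (\<exists>y c. (x, y, c) \<in> set (coded_strands h3 t3) \<or> (y, x, c) \<in> set (coded_strands h3 t3))" for h1 h2 h3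
    unfolding hex_strands_def t by auto
  then show ?thesis using assms(1) unfolding lower_hex_def upper_hex_def n by (elim disjE) (simp_all only: coded_strands_nodes, auto)
qed

text \<open>A component that misses the boundary is the loop around the centre, hence unique.\<close>

lemma inner_sides:
  assumes H: "H = lower_hex \<or> H = upper_hex" and t: "t \<in> set (hex_configs H)" and k: "k \<in> {6, 7, 8}"
  defines "st \<equiv> hex_strands H t"
  shows "closed_loops st = 0 \<and> (\<exists>i<6. (k, i) \<in> (joined st)\<^sup>*) \<or>
    closed_loops st = 1 \<and> (\<forall>j<9. (k, j) \<in> (joined st)\<^sup>* \<longleftrightarrow> j \<in> {6, 7, 8})"
proof -
  have ok: "inner_sides_ok st"
    using inner_sides_eval H t unfolding list_all_iff st_def by blast
  have lt: "a < 9 \<and> b < 9" if "(a, b, c) \<in> set st" for a b c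
    using hex_strands_nodes[OF H] t that unfolding st_def mem_hex_configs by blast
  have iff: "labels st ! i = labels st ! j \<longleftrightarrow> (i, j) \<in> (joined st)\<^sup>*" if "i < 9" "j < 9" for i j
    using labels_iff lt that by blast
  define l where "l = labels st"
  have take: "x \<in> set (take 6 l) \<longleftrightarrow> (\<exists>i<6. l ! i = x)" for x
    using length_labels[of st] by (auto simp: in_set_conv_nth l_def)
  show ?thesis
  proof (cases "l ! 6 \<in> set (take 6 l)")
    case True
    then have "l ! k \<in> set (take 6 l)" using ok k unfolding inner_sides_ok_def l_def[symmetric] Let_def by auto
    then obtain i where "i < 6" "l ! i = l ! k" unfolding take by blast
    then have "(k, i) \<in> (joined st)\<^sup>*" using iff[of k i] k unfolding l_def by auto
    then show ?thesis using True \<open>i < 6\<close> by (auto simp: closed_loops_def l_def[symmetric])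
  next
    case False
    then have eq: "l ! 7 = l ! 6" "l ! 8 = l ! 6" using ok unfolding inner_sides_ok_def l_def[symmetric] Let_def by auto
    have "(k, j) \<in> (joined st)\<^sup>* \<longleftrightarrow> j \<in> {6, 7, 8}" if "j < 9" for j
    proof -
      have "(k, j) \<in> (joined st)\<^sup>* \<longleftrightarrow> l ! j = l ! 6"
        using iff[of k j] that k eq unfolding l_def by auto
      moreover have "j < 6 \<or> j \<in> {6, 7, 8}" using that by auto
      ultimately show ?thesis using False eq unfolding take by auto
    qed
    then show ?thesis using False by (auto simp: closed_loops_def l_def[symmetric])
  qed
qed

text \<open>Grouping the configurations by their boundary state reduces an identity of sums over all
  configurations to the identities for the listed pairs.\<close>

definition config_weight :: "(nat \<Rightarrow> real) \<Rightarrow> (nat \<Rightarrow> real) \<Rightarrow> (nat \<Rightarrow> real) \<Rightarrow> local_config list \<Rightarrow> real" where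
  "config_weight w1 w2 w3 t = w1 (kind (t ! 0)) * w2 (kind (t ! 1)) * w3 (kind (t ! 2))"

lemma sum_list_by_key:
  assumes "finite K" "set (map fst T) \<subseteq> K"
  shows "(\<Sum>(k, r)\<leftarrow>T. G k * v r) = (\<Sum>k\<in>K. G k * (\<Sum>r\<leftarrow>rows_at T k. v r :: real))"
  using assms(2)
proof (induction T)
  case (Cons p T)
  obtain k0 r0 where p: "p = (k0, r0)" by (cases p)
  have k0: "k0 \<in> K" using Cons.prems p by simp
  have "(\<Sum>k\<in>K. G k * (\<Sum>r\<leftarrow>rows_at (p # T) k. v r)) =
    (\<Sum>k\<in>K. (if k = k0 then G k0 * v r0 else 0) + G k * (\<Sum>r\<leftarrow>rows_at T k. v r))"
    by (intro sum.cong) (auto simp: rows_at_def p algebra_simps)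
  also have "\<dots> = G k0 * v r0 + (\<Sum>k\<in>K. G k * (\<Sum>r\<leftarrow>rows_at T k. v r))"
    using k0 assms(1) by (simp add: sum.distrib)
  finally show ?case using Cons p by simp
qed (simp add: rows_at_def)

lemma sum_hex_configs_by_state:
  assumes H: "H = lower_hex \<or> H = upper_hex"
  defines "K \<equiv> set (map fst (hex_table lower_hex))"
  shows "(\<Sum>t\<in>set (hex_configs H). G (boundary_state (hex_strands H t)) * 2 ^ closed_loops (hex_strands H t)
      * config_weight w1 w2 w3 t) = (\<Sum>k\<in>K. G k * rows_weight w1 w2 w3 (rows_at (hex_table H) k))"
proof -
  define v where "v = (\<lambda>(l, ks). 2 ^ l * (w1 (ks ! 0) * w2 (ks ! 1) * w3 (ks ! 2)))"
  have KH: "set (map fst (hex_table H)) \<subseteq> K"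
    using H rows_eval(2) unfolding K_def list_all_iff set_remdups by blast
  have "(\<Sum>t\<in>set (hex_configs H). G (boundary_state (hex_strands H t)) * 2 ^ closed_loops (hex_strands H t)
      * config_weight w1 w2 w3 t) =
    (\<Sum>t\<leftarrow>hex_configs H. G (boundary_state (hex_strands H t)) * 2 ^ closed_loops (hex_strands H t)
      * config_weight w1 w2 w3 t)"
    using distinct_hex_configs H by (auto simp: sum_list_distinct_conv_sum_set)
  also have "\<dots> = (\<Sum>(k, r)\<leftarrow>hex_table H. G k * v r)"
    unfolding hex_table_def map_map
    by (intro arg_cong[where f = sum_list] map_cong)
       (auto simp: Let_def v_def config_weight_def mem_hex_configs)
  also have "\<dots> = (\<Sum>k\<in>K. G k * (\<Sum>r\<leftarrow>rows_at (hex_table H) k. v r))"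
    using KH by (intro sum_list_by_key) (simp_all add: K_def)
  also have "\<dots> = (\<Sum>k\<in>K. G k * rows_weight w1 w2 w3 (rows_at (hex_table H) k))"
    by (simp add: rows_weight_def v_def)
  finally show ?thesis .
qed

lemma sum_hex_configs_transfer:
  assumes "\<And>ls us. (ls, us) \<in> set pairs_list \<Longrightarrow> rows_weight w1 w2 w3 ls * a = rows_weight v1 v2 v3 us * b"
  shows "(\<Sum>t\<in>set (hex_configs lower_hex). G (boundary_state (hex_strands lower_hex t))
      * 2 ^ closed_loops (hex_strands lower_hex t) * config_weight w1 w2 w3 t) * a =
    (\<Sum>t\<in>set (hex_configs upper_hex). G (boundary_state (hex_strands upper_hex t))
      * 2 ^ closed_loops (hex_strands upper_hex t) * config_weight v1 v2 v3 t) * b"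
proof -
  have "rows_weight w1 w2 w3 (rows_at (hex_table lower_hex) k) * a =
      rows_weight v1 v2 v3 (rows_at (hex_table upper_hex) k) * b"
    if "k \<in> set (map fst (hex_table lower_hex))" for k
    using rows_eval(1) that assms unfolding list_all_iff set_remdups by blast
  then show ?thesis
    unfolding sum_hex_configs_by_state[OF disjI1[OF refl]] sum_hex_configs_by_state[OF disjI2[OF refl]]
      sum_distrib_right by (intro sum.cong refl) (simp only: mult.assoc)
qed

text \<open>Every boundary state of one hexagon also occurs for the other one. So a filling can always be replaced
  by one that is indistinguishable from the outside.\<close>

lemma hex_configs_same_state:
  assumes "H = lower_hex \<or> H = upper_hex" "H' = lower_hex \<or> H' = upper_hex" "t \<in> set (hex_configs H)"
  obtains t' where "t' \<in> set (hex_configs H')" "boundary_state (hex_strands H' t') = boundary_state (hex_strands H t)"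
proof -
  have sub: "fst ` set (hex_table upper_hex) \<subseteq> fst ` set (hex_table lower_hex)"
    using rows_eval(2) unfolding list_all_iff set_remdups set_map subset_iff Ball_def .
  have "fst ` set (hex_table lower_hex) \<subseteq> fst ` set (hex_table upper_hex)"
  proof
    fix k assume "k \<in> fst ` set (hex_table lower_hex)"
    then have "(rows_at (hex_table lower_hex) k, rows_at (hex_table upper_hex) k) \<in> set pairs_list"
      using rows_eval(1) unfolding list_all_iff by auto
    then have "rows_at (hex_table upper_hex) k \<noteq> []" using rows_eval(3) unfolding list_all_iff by blast
    then show "k \<in> fst ` set (hex_table upper_hex)" by (auto simp: rows_at_def filter_empty_conv)
  qed
  with sub have "fst ` set (hex_table H) = fst ` set (hex_table H')"
    using assms(1,2) by (metis subset_antisym)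
  moreover have img: "fst ` set (hex_table H) = (\<lambda>t. boundary_state (hex_strands H t)) ` set (hex_configs H)" for H
    unfolding hex_table_def set_map image_image Let_def fst_conv by (rule refl)
  ultimately have "boundary_state (hex_strands H t) \<in> (\<lambda>t. boundary_state (hex_strands H' t)) ` set (hex_configs H')"
    using imageI[OF assms(3), of "\<lambda>t. boundary_state (hex_strands H t)"] by metis
  then show ?thesis by (rule imageE) (rule that, assumption, rule sym)
qed

section \<open>Replacing a hexagon\<close>

declare split_paired_All [simp del] split_paired_Ex [simp del]

text \<open>\<open>\<phi>\<close> maps the numbers of the nine sides of a hexagon to edges.\<close>

definition realizes :: "(nat \<Rightarrow> edge) \<Rightarrow> coded_face \<Rightarrow> face \<Rightarrow> bool" where
  "realizes \<phi> q f \<longleftrightarrow> (case q of (xu, uy, yv, vx) \<Rightarrow>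
     {cx f, cu f} = \<phi> xu \<and> {cu f, cy f} = \<phi> uy \<and> {cy f, cv f} = \<phi> yv \<and> {cv f, cx f} = \<phi> vx)"

lemma strands_coded:
  assumes "realizes \<phi> q f"
  shows "strands f \<tau> = (\<lambda>(a, b, c). ({\<phi> a, \<phi> b}, c)) ` set (coded_strands q \<tau>)"
  using assms by (cases q; cases \<tau>) (simp_all add: realizes_def)

text \<open>Closed loops are the components that do not reach the far edges; the infinite paths all do.\<close>

definition loop_count :: "int \<Rightarrow> face set \<Rightarrow> (face \<Rightarrow> local_config) \<Rightarrow> nat" where
  "loop_count n F \<sigma> = card {(linkage F \<sigma>)\<^sup>* `` {a} | a.
     a \<in> (\<Union>f\<in>F. sides f) \<and> (linkage F \<sigma>)\<^sup>* `` {a} \<inter> far_edges n = {}}"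

text \<open>Outside a hexagon only the connections between its six boundary sides matter.\<close>

definition shortcut :: "face set \<Rightarrow> (nat \<Rightarrow> edge) \<Rightarrow> (face \<Rightarrow> local_config) \<Rightarrow> (nat \<times> nat) set \<Rightarrow> (edge \<times> edge) set" where
  "shortcut Out \<phi> \<rho> P = linkage Out \<rho> \<union> {(\<phi> i, \<phi> j) | i j. i < 6 \<and> j < 6 \<and> (i, j) \<in> P}"

text \<open>Three faces that form a hexagon, and the faces outside of it. \<open>N\<close> is a set of edges which contains the
  sides of the outside faces and of which the hexagon only has its six boundary sides.\<close>

locale hexagon =
  fixes Out :: "face set" and f1 f2 f3 :: face and q1 q2 q3 :: coded_face
    and \<phi> :: "nat \<Rightarrow> edge" and N :: "edge set"
  assumes hex: "[q1, q2, q3] = lower_hex \<or> [q1, q2, q3] = upper_hex"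
    and real: "realizes \<phi> q1 f1" "realizes \<phi> q2 f2" "realizes \<phi> q3 f3"
    and dist: "distinct [f1, f2, f3]" "f1 \<notin> Out" "f2 \<notin> Out" "f3 \<notin> Out"
    and inj: "inj_on \<phi> {..<9}"
    and N: "\<And>k. k < 9 \<Longrightarrow> \<phi> k \<in> N \<longleftrightarrow> k < 6" "\<And>f. f \<in> Out \<Longrightarrow> sides f \<subseteq> N"
begin

abbreviation H where "H \<equiv> [q1, q2, q3]"
abbreviation F where "F \<equiv> {f1, f2, f3}"
abbreviation st where "st t \<equiv> hex_strands [q1, q2, q3] t"

definition combine :: "(face \<Rightarrow> local_config) \<Rightarrow> local_config list \<Rightarrow> face \<Rightarrow> local_config" where
  "combine \<rho> t = \<rho>(f1 := t ! 0, f2 := t ! 1, f3 := t ! 2)"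

lemma combine_simps [simp]:
  "combine \<rho> t f1 = t ! 0" "combine \<rho> t f2 = t ! 1" "combine \<rho> t f3 = t ! 2"
  "f \<in> Out \<Longrightarrow> combine \<rho> t f = \<rho> f"
  using dist by (auto simp: combine_def)

lemma length_3: "length t = 3 \<longleftrightarrow> (\<exists>a b c. t = [a, b, c])"
  by (auto simp: length_Suc_conv numeral_3_eq_3)

lemma st_set: "length t = 3 \<Longrightarrow> set (st t) = set (coded_strands q1 (t ! 0)) \<union> set (coded_strands q2 (t ! 1)) \<union> set (coded_strands q3 (t ! 2))"
  unfolding length_3 by (elim exE) (simp add: hex_strands_def Un_assoc)

lemma node_lt: "length t = 3 \<Longrightarrow> (a, b, c) \<in> set (st t) \<Longrightarrow> a < 9 \<and> b < 9"
  using hex_strands_nodes[OF hex] by blast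

lemma joined_lt: "length t = 3 \<Longrightarrow> (a, b) \<in> joined (st t) \<Longrightarrow> a < 9 \<and> b < 9"
  unfolding joined_def using node_lt by blast

lemma phi_eq: "a < 9 \<Longrightarrow> b < 9 \<Longrightarrow> \<phi> a = \<phi> b \<longleftrightarrow> a = b"
  using inj by (auto simp: inj_on_def)

lemma sides_F: "(\<Union>f\<in>F. sides f) = \<phi> ` {..<9}"
proof -
  have "(\<Union>f\<in>F. sides f) = (\<Union>(a, b, c, d)\<in>{q1, q2, q3}. \<phi> ` {a, b, c, d})"
    using real unfolding realizes_def sides_def by (auto split: prod.splits)
  also have "\<dots> = \<phi> ` (\<Union>(a, b, c, d)\<in>{q1, q2, q3}. {a, b, c, d})" by auto
  also have "(\<Union>(a, b, c, d)\<in>{q1, q2, q3}. {a, b, c, d}) = {..<9}"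
    using hex unfolding lower_hex_def upper_hex_def by (elim disjE; simp) auto
  finally show ?thesis .
qed

lemma linkage_F:
  assumes "length t = 3"
  shows "linkage F (combine \<rho> t) = map_prod \<phi> \<phi> ` joined (st t)"
proof -
  have F: "F = {f1} \<union> ({f2} \<union> {f3})" by auto
  have l: "linkage F (combine \<rho> t) =
      linkage {f1} (\<lambda>_. t ! 0) \<union> (linkage {f2} (\<lambda>_. t ! 1) \<union> linkage {f3} (\<lambda>_. t ! 2))"
    unfolding F linkage_Un by (intro arg_cong2[where f = "(\<union>)"] linkage_cong) auto
  have one: "linkage {f} (\<lambda>_. \<tau>) = map_prod \<phi> \<phi> ` joined (coded_strands q \<tau>)" if "realizes \<phi> q f" for f q \<tau>
  proof -
    have "(x, y) \<in> linkage {f} (\<lambda>_. \<tau>) \<longleftrightarrow> (x, y) \<in> map_prod \<phi> \<phi> ` joined (coded_strands q \<tau>)" for x y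
    proof -
      have "(x, y) \<in> linkage {f} (\<lambda>_. \<tau>) \<longleftrightarrow>
          (\<exists>a b c. (a, b, c) \<in> set (coded_strands q \<tau>) \<and> {x, y} = {\<phi> a, \<phi> b})"
        by (auto simp: linkage_def strands_coded[OF that] image_iff; force)
      also have "\<dots> \<longleftrightarrow> (\<exists>a b. (a, b) \<in> joined (coded_strands q \<tau>) \<and> x = \<phi> a \<and> y = \<phi> b)"
        unfolding joined_def doubleton_eq_iff by blast
      also have "\<dots> \<longleftrightarrow> (x, y) \<in> map_prod \<phi> \<phi> ` joined (coded_strands q \<tau>)" by (auto simp: image_iff Bex_def; blast)
      finally show ?thesis .
    qed
    then show ?thesis by auto
  qed
  have "joined (st t) = joined (coded_strands q1 (t ! 0)) \<union> (joined (coded_strands q2 (t ! 1)) \<union> joined (coded_strands q3 (t ! 2)))"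
    unfolding joined_def st_set[OF assms] by blast
  then show ?thesis unfolding l one[OF real(1)] one[OF real(2)] one[OF real(3)] by (simp add: image_Un)
qed

lemma phi_rtrancl:
  assumes "length t = 3" and i: "i < 9"
  shows "(\<phi> i, b) \<in> (map_prod \<phi> \<phi> ` joined (st t))\<^sup>* \<longleftrightarrow> (\<exists>j<9. b = \<phi> j \<and> (i, j) \<in> (joined (st t))\<^sup>*)"
proof
  assume "(\<phi> i, b) \<in> (map_prod \<phi> \<phi> ` joined (st t))\<^sup>*"
  then show "\<exists>j<9. b = \<phi> j \<and> (i, j) \<in> (joined (st t))\<^sup>*"
  proof (induction rule: rtrancl_induct)
    case base
    then show ?case using i by blast
  next
    case (step y z)
    then obtain j where j: "j < 9" "y = \<phi> j" "(i, j) \<in> (joined (st t))\<^sup>*" by blast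
    obtain k l where kl: "(k, l) \<in> joined (st t)" "y = \<phi> k" "z = \<phi> l" using step.hyps by auto
    then have "k = j" "l < 9" using joined_lt[OF assms(1) kl(1)] j phi_eq by auto
    have "(i, l) \<in> (joined (st t))\<^sup>*" using j(3) kl(1) \<open>k = j\<close> by (simp add: rtrancl_into_rtrancl)
    then show ?case using \<open>l < 9\<close> kl(3) by blast
  qed
next
  assume "\<exists>j<9. b = \<phi> j \<and> (i, j) \<in> (joined (st t))\<^sup>*"
  then obtain j where "b = \<phi> j" "(i, j) \<in> (joined (st t))\<^sup>*" by blast
  from this(2,1) show "(\<phi> i, b) \<in> (map_prod \<phi> \<phi> ` joined (st t))\<^sup>*"
  proof (induction arbitrary: b rule: rtrancl_induct)
    case (step y z)
    then have "(\<phi> i, \<phi> y) \<in> (map_prod \<phi> \<phi> ` joined (st t))\<^sup>*" by blast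
    moreover have "(\<phi> y, \<phi> z) \<in> map_prod \<phi> \<phi> ` joined (st t)" using step.hyps by (force intro: image_eqI)
    ultimately show ?case using step.prems by (simp add: rtrancl_into_rtrancl)
  qed auto
qed

lemma linkage_combine:
  "linkage (Out \<union> F) (combine \<rho> t) = linkage Out \<rho> \<union> linkage F (combine \<rho> t)"
proof -
  have "linkage Out (combine \<rho> t) = linkage Out \<rho>" by (rule linkage_cong) simp
  then show ?thesis by (simp only: linkage_Un)
qed

lemma Out_N: "(a, b) \<in> linkage Out \<rho> \<Longrightarrow> a \<in> N \<and> b \<in> N"
  using linkage_sides N(2) by blast

text \<open>A path between outer edges enters and leaves the hexagon through the boundary sides, so each of its
  passages through the hexagon can be replaced by a shortcut.\<close>

lemma shortcut_rtrancl:
  assumes t: "length t = 3" and ab: "a \<in> N" "b \<in> N"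
  shows "(a, b) \<in> (linkage (Out \<union> F) (combine \<rho> t))\<^sup>* \<longleftrightarrow> (a, b) \<in> (shortcut Out \<phi> \<rho> ((joined (st t))\<^sup>*))\<^sup>*"
proof -
  let ?A = "linkage Out \<rho>" and ?B = "linkage F (combine \<rho> t)"
  let ?P = "{(\<phi> i, \<phi> j) | i j. i < 6 \<and> j < 6 \<and> (i, j) \<in> (joined (st t))\<^sup>*}"
  have A: "?A \<subseteq> N \<times> N" by (auto dest: Out_N)
  have "?B\<^sup>* \<inter> N \<times> N \<subseteq> ?P \<union> Id"
  proof
    fix x assume "x \<in> ?B\<^sup>* \<inter> N \<times> N"
    then obtain c d where x: "x = (c, d)" and cd: "(c, d) \<in> ?B\<^sup>*" "c \<in> N" "d \<in> N" by auto
    show "x \<in> ?P \<union> Id"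
    proof (cases "c = d")
      case False
    then obtain c' where "(c, c') \<in> ?B" using cd(1) by (metis converse_rtranclE)
    then obtain i where i: "c = \<phi> i" "i < 9" unfolding linkage_F[OF t] using joined_lt[OF t] by auto
    obtain j where j: "j < 9" "d = \<phi> j" "(i, j) \<in> (joined (st t))\<^sup>*"
      using cd(1) unfolding linkage_F[OF t] i(1) phi_rtrancl[OF t i(2)] by blast
    have "i < 6" "j < 6" using N(1) i j cd by auto
    then show ?thesis using i j x by blast
    qed (simp add: x)
  qed
  then have "(?A \<union> (?B\<^sup>* \<inter> N \<times> N))\<^sup>* \<subseteq> ((?A \<union> ?P) \<union> Id)\<^sup>*" by (intro rtrancl_mono) blast
  moreover have "?P \<subseteq> ?B\<^sup>* \<inter> N \<times> N"
  proof
    fix x assume "x \<in> ?P"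
    then obtain i j where ij: "x = (\<phi> i, \<phi> j)" "i < 6" "j < 6" "(i, j) \<in> (joined (st t))\<^sup>*" by blast
    moreover from this have "(\<phi> i, \<phi> j) \<in> ?B\<^sup>*"
      unfolding linkage_F[OF t] by (subst phi_rtrancl[OF t]) (auto intro: exI[of _ j])
    ultimately show "x \<in> ?B\<^sup>* \<inter> N \<times> N" using N(1) by simp
  qed
  then have "(?A \<union> ?P)\<^sup>* \<subseteq> (?A \<union> (?B\<^sup>* \<inter> N \<times> N))\<^sup>*" by (intro rtrancl_mono) blast
  ultimately have "(?A \<union> (?B\<^sup>* \<inter> N \<times> N))\<^sup>* = (?A \<union> ?P)\<^sup>*"
    unfolding rtrancl_reflcl by (rule subset_antisym)
  then show ?thesis unfolding linkage_combine shortcut_def rtrancl_Un_interface[OF A ab, where B = ?B] by (simp only:)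
qed

lemma fits_iff:
  assumes "realizes \<phi> q f"
  shows "fits col f \<tau> \<longleftrightarrow> (\<forall>(a, b, c)\<in>set (coded_strands q \<tau>). col (\<phi> a) = c \<and> col (\<phi> b) = c)"
    (is "_ = ?r")
proof
  assume f: "fits col f \<tau>"
  have "col (\<phi> a) = c \<and> col (\<phi> b) = c" if "(a, b, c) \<in> set (coded_strands q \<tau>)" for a b c
  proof -
    have "({\<phi> a, \<phi> b}, c) \<in> strands f \<tau>" unfolding strands_coded[OF assms] using that by (force intro: image_eqI)
    then show ?thesis using fitsD[OF f] by blast
  qed
  then show ?r by blast
next
  assume ?r
  then show "fits col f \<tau>" unfolding fits_def strands_coded[OF assms] by (auto split: prod.splits)
qed

lemma loops_combine_iff:
  assumes t: "length t = 3" and S: "face_set S = Out \<union> F" and \<rho>: "\<rho> \<in> Out \<rightarrow>\<^sub>E UNIV"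
  shows "combine \<rho> t \<in> loops S \<longleftrightarrow> colours_agree (st t) \<and>
    (\<exists>col. (\<forall>f\<in>Out. fits col f (\<rho> f)) \<and> (\<forall>k<6. col (\<phi> k) = node_colour (st t) k))"
proof -
  have ext: "combine \<rho> t \<in> face_set S \<rightarrow>\<^sub>E UNIV"
    using \<rho> unfolding S combine_def by (auto simp: PiE_def extensional_def)
  have F_iff: "(\<forall>f\<in>F. fits col f (combine \<rho> t f)) \<longleftrightarrow> (\<forall>(a, b, c)\<in>set (st t). col (\<phi> a) = c \<and> col (\<phi> b) = c)" for col
    by (simp add: st_set[OF t] ball_Un fits_iff[OF real(1)] fits_iff[OF real(2)] fits_iff[OF real(3)] conj_assoc)
  have node: "node_colour (st t) k = col (\<phi> k)"
    if "\<forall>(a, b, c)\<in>set (st t). col (\<phi> a) = c \<and> col (\<phi> b) = c" "k < 9" for col k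
  proof -
    let ?l = "filter (\<lambda>(a, b, c). a = k \<or> b = k) (st t)"
    have "?l \<noteq> []" using hex_strands_nodes[OF hex t, of k] that(2) by (auto simp: filter_empty_conv)
    then have "hd ?l \<in> set ?l" by (rule hd_in_set)
    then show ?thesis using that(1) unfolding node_colour_def by (auto split: prod.splits)
  qed
  show ?thesis
  proof
    assume "combine \<rho> t \<in> loops S"
    then obtain col where col: "\<forall>f\<in>Out \<union> F. fits col f (combine \<rho> t f)" unfolding loops_def S by blast
    then have "\<forall>f\<in>F. fits col f (combine \<rho> t f)" by simp
    then have *: "\<forall>(a, b, c)\<in>set (st t). col (\<phi> a) = c \<and> col (\<phi> b) = c" unfolding F_iff .
    have "colours_agree (st t)"
      unfolding colours_agree_def list_all_iff using * node[OF *] node_lt[OF t] by fastforce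
    moreover have "\<forall>f\<in>Out. fits col f (\<rho> f)" using col by auto
    moreover have "\<forall>k<6. col (\<phi> k) = node_colour (st t) k" using node[OF *] by simp
    ultimately show "colours_agree (st t) \<and>
      (\<exists>col. (\<forall>f\<in>Out. fits col f (\<rho> f)) \<and> (\<forall>k<6. col (\<phi> k) = node_colour (st t) k))" by blast
  next
    assume "colours_agree (st t) \<and>
      (\<exists>col. (\<forall>f\<in>Out. fits col f (\<rho> f)) \<and> (\<forall>k<6. col (\<phi> k) = node_colour (st t) k))"
    then obtain col where agree: "colours_agree (st t)" and col: "\<forall>f\<in>Out. fits col f (\<rho> f)"
      "\<forall>k<6. col (\<phi> k) = node_colour (st t) k" by blast
    define col' where "col' e = (if \<exists>k<9. e = \<phi> k then node_colour (st t) (THE k. k < 9 \<and> e = \<phi> k) else col e)" for e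
    have phi: "col' (\<phi> k) = node_colour (st t) k" if "k < 9" for k
    proof -
      have "(THE k'. k' < 9 \<and> \<phi> k = \<phi> k') = k" using that phi_eq by (intro the_equality) auto
      then show ?thesis using that by (auto simp: col'_def)
    qed
    have same: "col' e = col e" if "e \<in> N" for e
    proof (cases "\<exists>k<9. e = \<phi> k")
      case True
      then obtain k where "k < 9" "e = \<phi> k" by blast
      then show ?thesis using phi col(2) that N(1) by auto
    qed (auto simp: col'_def)
    have "fits col' f (\<rho> f)" if "f \<in> Out" for f
      using col(1) that same N(2)[OF that] strand_sides[of _ _ f "\<rho> f"] unfolding fits_def by fast
    moreover have "\<forall>(a, b, c)\<in>set (st t). col' (\<phi> a) = c \<and> col' (\<phi> b) = c"
      using agree phi node_lt[OF t] unfolding colours_agree_def list_all_iff by fastforce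
    ultimately have "\<forall>f\<in>Out \<union> F. fits col' f (combine \<rho> t f)" using F_iff by auto
    then show "combine \<rho> t \<in> loops S" using ext unfolding loops_def S by blast
  qed
qed

text \<open>A loop either stays inside the hexagon or has an edge outside, and then it is determined by its
  trace on the outer edges.\<close>

lemma loop_count_combine:
  fixes \<rho> :: "face \<Rightarrow> local_config"
  assumes t: "t \<in> set (hex_configs H)" and far: "far_edges n \<subseteq> N"
    and fin: "finite (\<Union>f\<in>Out \<union> F. {e \<in> sides f. e \<notin> far_edges n})"
  defines "K \<equiv> (shortcut Out \<phi> \<rho> ((joined (st t))\<^sup>*))\<^sup>*"
  shows "loop_count n (Out \<union> F) (combine \<rho> t) = closed_loops (st t) +
    card {K `` {a} | a. a \<in> (\<Union>f\<in>Out. sides f) \<union> \<phi> ` {..<6} \<and> K `` {a} \<inter> far_edges n = {}}"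
proof -
  define L where "L = (linkage (Out \<union> F) (combine \<rho> t))\<^sup>*"
  have t3: "length t = 3" using t by (simp add: mem_hex_configs)
  have LK: "(a, b) \<in> L \<longleftrightarrow> (a, b) \<in> K" if "a \<in> N" "b \<in> N" for a b
    using shortcut_rtrancl[OF t3 that] by (simp add: L_def K_def)
  have Lsym: "(b, a) \<in> L" if "(a, b) \<in> L" for a b using that linkage_rtrancl_sym by (simp add: L_def)
  have Ltrans: "(a, c) \<in> L" if "(a, b) \<in> L" "(b, c) \<in> L" for a b c using that by (simp add: L_def)
  have Lrefl: "(a, a) \<in> L" for a by (simp add: L_def)
  have Kim: "K `` {a} \<subseteq> N" if "a \<in> N" for a
  proof
    fix b assume "b \<in> K `` {a}"
    then have "(a, b) \<in> (shortcut Out \<phi> \<rho> ((joined (st t))\<^sup>*))\<^sup>*" by (simp add: K_def)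
    then show "b \<in> N"
    proof (induction rule: rtrancl_induct)
      case (step y z)
      then show ?case unfolding shortcut_def using N(1) Out_N by auto
    qed (use that in simp)
  qed
  have im: "K `` {a} = L `` {a} \<inter> N" if "a \<in> N" for a using Kim[OF that] LK that by auto
  define EN where "EN = (\<Union>f\<in>Out. sides f) \<union> \<phi> ` {..<6}"
  define I where "I = \<phi> ` {6, 7, 8}"
  have EN: "EN \<subseteq> N" unfolding EN_def
    by (intro Un_least UN_least image_subsetI N(2)) (simp_all add: N(1))
  have IN: "I \<inter> N = {}" using N(1) by (auto simp: I_def)
  have split9: "{..<9} = {..<6} \<union> {6, 7, 8 :: nat}" by auto
  have E: "(\<Union>f\<in>Out \<union> F. sides f) = EN \<union> I"
  proof -
    have "(\<Union>f\<in>Out \<union> F. sides f) = (\<Union>f\<in>Out. sides f) \<union> \<phi> ` {..<9}" unfolding sides_F[symmetric] by auto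
    then show ?thesis unfolding EN_def I_def split9 by auto
  qed
  let ?C = "{L `` {a} | a. a \<in> EN \<union> I \<and> L `` {a} \<inter> far_edges n = {}}"
  let ?C1 = "{L `` {a} | a. a \<in> EN \<and> L `` {a} \<inter> far_edges n = {}}"
  let ?C2 = "{L `` {a} | a. a \<in> I \<and> L `` {a} \<inter> far_edges n = {} \<and> L `` {a} \<inter> EN = {}}"
  have cls: "L `` {a} = L `` {b}" if "(a, b) \<in> L" for a b using that Lsym Ltrans by blast
  have C: "?C = ?C1 \<union> ?C2"
  proof (intro subset_antisym subsetI)
    fix c assume "c \<in> ?C"
    then obtain a where a: "c = L `` {a}" "a \<in> EN \<union> I" "L `` {a} \<inter> far_edges n = {}" by blast
    show "c \<in> ?C1 \<union> ?C2"
    proof (cases "L `` {a} \<inter> EN = {}")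
      case True
      then have "a \<notin> EN" using Lrefl by blast
      then show ?thesis using a True by blast
    next
      case False
      then obtain b where b: "b \<in> EN" "(a, b) \<in> L" by blast
      have "c = L `` {b}" unfolding a(1) by (rule cls[OF b(2)])
      then show ?thesis using b(1) a(1,3) by (intro UnI1 CollectI exI[of _ b]) simp
    qed
  qed blast
  have disj: "?C1 \<inter> ?C2 = {}"
  proof -
    have "L `` {a} \<noteq> L `` {b}" if "a \<in> EN" "L `` {b} \<inter> EN = {}" for a b using that Lrefl by blast
    then show ?thesis by blast
  qed
  have lift: "(\<phi> i, \<phi> j) \<in> L" if "(i, j) \<in> (joined (st t))\<^sup>*" "i < 9" "j < 9" for i j
  proof -
    have "(\<phi> i, \<phi> j) \<in> (linkage F (combine \<rho> t))\<^sup>*" unfolding linkage_F[OF t3] phi_rtrancl[OF t3 that(2)] using that by blast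
    then show ?thesis unfolding L_def linkage_combine by (meson Un_upper2 rtrancl_mono subsetD)
  qed
  have C2: "card ?C2 = closed_loops (st t) \<and> finite ?C2"
  proof (cases "closed_loops (st t) = 0")
    case True
    have "L `` {a} \<inter> EN \<noteq> {}" if a: "a \<in> I" for a
    proof -
      obtain k where k: "k \<in> {6, 7, 8}" "a = \<phi> k" using a by (auto simp: I_def)
      obtain i where i: "i < 6" "(k, i) \<in> (joined (st t))\<^sup>*" using inner_sides[OF hex t k(1)] True by auto
      then have "(\<phi> k, \<phi> i) \<in> L" using k by (intro lift) auto
      then show ?thesis using i k by (auto simp: EN_def)
    qed
    then have C2: "?C2 = {}" by blast
    show ?thesis unfolding C2 using True by simp
  next
    case False
    have one: "closed_loops (st t) = 1" using inner_sides[OF hex t, of 6] False by auto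
    have cyc: "(k, j) \<in> (joined (st t))\<^sup>* \<longleftrightarrow> j \<in> {6, 7, 8}" if "k \<in> {6, 7, 8}" "j < 9" for k j
      using inner_sides[OF hex t that(1)] False that(2) by auto
    have LI: "L `` {a} = I" if a: "a \<in> I" for a
    proof -
      obtain k where k: "k \<in> {6, 7, 8}" "a = \<phi> k" using a by (auto simp: I_def)
      have "I \<subseteq> L `` {a}" using lift cyc k by (fastforce simp: I_def)
      moreover have "b \<in> I" if "(a, b) \<in> L" for b
        using that unfolding L_def
      proof (induction rule: rtrancl_induct)
        case base
        then show ?case using a .
      next
        case (step y z)
        then have "(y, z) \<notin> linkage Out \<rho>" using Out_N IN by blast
        then have "(y, z) \<in> map_prod \<phi> \<phi> ` joined (st t)"
          using step.hyps unfolding linkage_combine linkage_F[OF t3] by blast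
        then obtain i j where ij: "(i, j) \<in> joined (st t)" "y = \<phi> i" "z = \<phi> j" by auto
        obtain k where k: "k \<in> {6, 7, 8}" "y = \<phi> k" using step.IH by (auto simp: I_def)
        have lt: "i < 9" "j < 9" using joined_lt[OF t3 ij(1)] by auto
        then have "i = k" using ij k phi_eq by auto
        then have "j \<in> {6, 7, 8}" using cyc[OF k(1) lt(2)] ij(1) by blast
        then show ?case using ij by (auto simp: I_def)
      qed
      ultimately show ?thesis by blast
    qed
    have "I \<noteq> {}" by (simp add: I_def)
    moreover have "I \<inter> far_edges n = {}" "I \<inter> EN = {}" using IN far EN by auto
    ultimately have C2: "?C2 = {I}" using LI by auto
    show ?thesis unfolding C2 using one by simp
  qed
  have "finite ?C1"
  proof (rule finite_surj[OF fin])
    show "?C1 \<subseteq> (\<lambda>a. L `` {a}) ` (\<Union>f\<in>Out \<union> F. {e \<in> sides f. e \<notin> far_edges n})"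
      using E Lrefl by fastforce
  qed
  then have "card ?C = card ?C1 + card ?C2" unfolding C using disj C2 by (intro card_Un_disjoint) auto
  moreover have "card ?C1 = card {K `` {a} | a. a \<in> EN \<and> K `` {a} \<inter> far_edges n = {}}" (is "_ = card ?D")
  proof (rule bij_betw_same_card[of "\<lambda>c. c \<inter> N"])
    show "bij_betw (\<lambda>c. c \<inter> N) ?C1 ?D"
    proof (rule bij_betw_imageI)
      show "inj_on (\<lambda>c. c \<inter> N) ?C1"
      proof (rule inj_onI)
        fix c d assume cd: "c \<in> ?C1" "d \<in> ?C1" "c \<inter> N = d \<inter> N"
        obtain a where a: "c = L `` {a}" "a \<in> EN" using cd(1) by blast
        obtain b where b: "d = L `` {b}" using cd(2) by blast
        have "a \<in> c \<inter> N" using a EN Lrefl by blast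
        then have "(b, a) \<in> L" using cd(3) b by blast
        then show "c = d" using a(1) b cls by simp
      qed
      have same: "K `` {a} \<inter> far_edges n = L `` {a} \<inter> far_edges n" if "a \<in> EN" for a
        using im[OF subsetD[OF EN that]] far by blast
      show "(\<lambda>c. c \<inter> N) ` ?C1 = ?D"
      proof (intro subset_antisym subsetI)
        fix d assume "d \<in> (\<lambda>c. c \<inter> N) ` ?C1"
        then obtain a where a: "d = L `` {a} \<inter> N" "a \<in> EN" "L `` {a} \<inter> far_edges n = {}" by blast
        then show "d \<in> ?D" using im[OF subsetD[OF EN a(2)]] same[OF a(2)] by (intro CollectI exI[of _ a]) simp
      next
        fix d assume "d \<in> ?D"
        then obtain a where a: "d = K `` {a}" "a \<in> EN" "K `` {a} \<inter> far_edges n = {}" by blast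
        then have "L `` {a} \<in> ?C1" using same[OF a(2)] by blast
        moreover have "d = L `` {a} \<inter> N" using im[OF subsetD[OF EN a(2)]] a(1) by simp
        ultimately show "d \<in> (\<lambda>c. c \<inter> N) ` ?C1" by (rule rev_image_eqI)
      qed
    qed
  qed
  moreover have "loop_count n (Out \<union> F) (combine \<rho> t) = card ?C"
    unfolding loop_count_def L_def[symmetric] E by (rule refl)
  ultimately show ?thesis using C2 by (simp add: EN_def)
qed

end

section \<open>Partition functions of taut configurations\<close>

definition outer_configs :: "int \<Rightarrow> face set \<Rightarrow> (face \<Rightarrow> local_config) set" where
  "outer_configs n F = {\<rho> \<in> F \<rightarrow>\<^sub>E UNIV. \<forall>f\<in>F. far n (cx f) \<longrightarrow> \<rho> f = C1 Blue}"

text \<open>The condition on the boundary state of the hexagon under which a configuration outside of it becomes taut.\<close>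

definition boundary_ok :: "face set \<Rightarrow> (nat \<Rightarrow> edge) \<Rightarrow> int \<Rightarrow> (face \<Rightarrow> local_config) \<Rightarrow> (nat \<times> nat \<times> colour) list \<Rightarrow> bool" where
  "boundary_ok Out \<phi> n \<rho> s \<longleftrightarrow>
     (\<exists>col. (\<forall>f\<in>Out. fits col f (\<rho> f)) \<and> (\<forall>k<6. col (\<phi> k) = node_colour s k)) \<and>
     (\<forall>a\<in>far_edges n. \<forall>b\<in>far_edges n. (a, b) \<in> ground\<^sup>* \<longrightarrow> (a, b) \<in> (shortcut Out \<phi> \<rho> ((joined s)\<^sup>*))\<^sup>*)"

definition outer_loops :: "face set \<Rightarrow> (nat \<Rightarrow> edge) \<Rightarrow> int \<Rightarrow> (face \<Rightarrow> local_config) \<Rightarrow> (nat \<times> nat \<times> colour) list \<Rightarrow> nat" where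
  "outer_loops Out \<phi> n \<rho> s = card {(shortcut Out \<phi> \<rho> ((joined s)\<^sup>*))\<^sup>* `` {a} | a.
     a \<in> (\<Union>f\<in>Out. sides f) \<union> \<phi> ` {..<6} \<and> (shortcut Out \<phi> \<rho> ((joined s)\<^sup>*))\<^sup>* `` {a} \<inter> far_edges n = {}}"

lemma same_boundary:
  assumes "\<And>k. k < 6 \<Longrightarrow> \<phi> k = \<phi>' k" "\<And>k. k < 6 \<Longrightarrow> node_colour s k = node_colour s' k"
    "\<And>i j. i < 6 \<Longrightarrow> j < 6 \<Longrightarrow> (i, j) \<in> (joined s)\<^sup>* \<longleftrightarrow> (i, j) \<in> (joined s')\<^sup>*"
  shows "boundary_ok Out \<phi> n \<rho> s \<longleftrightarrow> boundary_ok Out \<phi>' n \<rho> s'"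
    "outer_loops Out \<phi> n \<rho> s = outer_loops Out \<phi>' n \<rho> s'"
proof -
  have 1: "shortcut Out \<phi> \<rho> ((joined s)\<^sup>*) = shortcut Out \<phi>' \<rho> ((joined s')\<^sup>*)"
  proof -
    have "{(\<phi> i, \<phi> j) | i j. i < 6 \<and> j < 6 \<and> (i, j) \<in> (joined s)\<^sup>*} =
      {(\<phi>' i, \<phi>' j) | i j. i < 6 \<and> j < 6 \<and> (i, j) \<in> (joined s')\<^sup>*}"
      using assms(1,3) by (intro Collect_cong ex_cong1) auto
    then show ?thesis by (simp only: shortcut_def)
  qed
  have 2: "\<phi> ` {..<6} = \<phi>' ` {..<6}" using assms(1) by (intro image_cong) auto
  have 3: "(\<forall>k<6. col (\<phi> k) = node_colour s k) \<longleftrightarrow> (\<forall>k<6. col (\<phi>' k) = node_colour s' k)" for col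
    using assms(1,2) by auto
  show "boundary_ok Out \<phi> n \<rho> s \<longleftrightarrow> boundary_ok Out \<phi>' n \<rho> s'" unfolding boundary_ok_def 1 3 ..
  show "outer_loops Out \<phi> n \<rho> s = outer_loops Out \<phi>' n \<rho> s'" unfolding outer_loops_def 1 2 ..
qed

lemma finite_box: "finite {x. \<not> far n x \<and> x - (1, 1, 1) \<in> negs}"
proof (rule finite_subset)
  show "{x. \<not> far n x \<and> x - (1, 1, 1) \<in> negs} \<subseteq> {-n..0} \<times> {-n..0} \<times> {-n..0}"
    by (auto simp: far_def negs_def)
qed simp

lemma face_corner_box: "f \<in> face_set S \<Longrightarrow> S \<subseteq> negs \<Longrightarrow> cx f - (1, 1, 1) \<in> negs"
  by (cases f rule: face_cases) (auto simp: cx_def negs_def subset_iff)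

lemma finite_near_faces:
  assumes "S \<subseteq> negs"
  shows "finite (near_faces n S)"
proof (rule finite_subset)
  show "near_faces n S \<subseteq> {x. \<not> far n x \<and> x - (1, 1, 1) \<in> negs} \<times> {1, 2} \<times> {2, 3}"
  proof
    fix f assume f: "f \<in> near_faces n S"
    then have "f \<in> face_set S" "\<not> far n (cx f)" by (simp_all add: near_faces_def)
    then show "f \<in> {x. \<not> far n x \<and> x - (1, 1, 1) \<in> negs} \<times> {1, 2} \<times> {2, 3}"
      using face_corner_box[OF _ assms, of f] by (cases f rule: face_cases) (auto simp: cx_def)
  qed
qed (simp add: finite_box)

lemma finite_local_config: "finite (UNIV :: local_config set)"
  using mem_local_configs by (intro finite_subset[of UNIV "set local_configs"]) auto

lemma finite_outer_configs:
  assumes "finite {f \<in> F. \<not> far n (cx f)}"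
  shows "finite (outer_configs n F)"
proof (rule finite_surj)
  show "finite ({f \<in> F. \<not> far n (cx f)} \<rightarrow>\<^sub>E (UNIV :: local_config set))"
    using assms finite_local_config by (intro finite_PiE) auto
  show "outer_configs n F \<subseteq> (\<lambda>h f. if f \<in> F then if far n (cx f) then C1 Blue else h f else undefined) `
      ({f \<in> F. \<not> far n (cx f)} \<rightarrow>\<^sub>E UNIV)"
  proof
    fix \<rho> assume \<rho>: "\<rho> \<in> outer_configs n F"
    let ?h = "restrict \<rho> {f \<in> F. \<not> far n (cx f)}"
    have "\<rho> = (\<lambda>f. if f \<in> F then if far n (cx f) then C1 Blue else ?h f else undefined)"
      using \<rho> by (auto simp: outer_configs_def PiE_def extensional_def)
    moreover have "?h \<in> {f \<in> F. \<not> far n (cx f)} \<rightarrow>\<^sub>E UNIV" by auto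
    ultimately show "\<rho> \<in> (\<lambda>h f. if f \<in> F then if far n (cx f) then C1 Blue else h f else undefined) `
      ({f \<in> F. \<not> far n (cx f)} \<rightarrow>\<^sub>E UNIV)" by (rule image_eqI)
  qed
qed

lemma taut_subset_outer: "taut n S \<subseteq> outer_configs n (face_set S)"
  by (auto simp: taut_def outer_configs_def loops_def far_faces_def)

lemma finite_taut: "S \<subseteq> negs \<Longrightarrow> finite (taut n S)"
  using finite_near_faces by (intro finite_subset[OF taut_subset_outer finite_outer_configs]) (simp add: near_faces_def)

definition kind_weight :: "(lattice \<Rightarrow> real) \<Rightarrow> face \<Rightarrow> nat \<Rightarrow> real" where
  "kind_weight g f = corner_weight (g (cx f)) (g (cu f)) (g (cy f)) (g (cv f))"

definition near_vertices :: "int \<Rightarrow> lattice set \<Rightarrow> lattice set" where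
  "near_vertices n S = {x \<in> vertex_set S. \<not> far n x}"

text \<open>The partition function with all far weights left out. They are the same for all configurations, so
  this only changes the infinite product by a constant factor.\<close>

definition taut_sum :: "int \<Rightarrow> (lattice \<Rightarrow> real) \<Rightarrow> lattice set \<Rightarrow> real" where
  "taut_sum n g S = (\<Sum>\<sigma>\<in>taut n S. 2 ^ loop_count n (face_set S) \<sigma> *
      (\<Prod>f\<in>near_faces n S. kind_weight g f (kind (\<sigma> f)))) / (\<Prod>x\<in>near_vertices n S. (g x)^2)"

locale hexagon_taut = hexagon +
  fixes S :: "lattice set"
  assumes S: "face_set S = Out \<union> F"
begin

definition near_hex :: "int \<Rightarrow> bool" where
  "near_hex n \<longleftrightarrow> full_outside n S \<and> \<not> far n (cx f1) \<and> \<not> far n (cx f2) \<and> \<not> far n (cx f3)"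

lemma far_Out: "near_hex n \<Longrightarrow> far_faces n S = {f \<in> Out. far n (cx f)}"
  unfolding far_faces_def S near_hex_def by auto

lemma far_edges_N: "near_hex n \<Longrightarrow> far_edges n \<subseteq> N"
proof -
  assume n: "near_hex n"
  then have eq: "far_edges n = (\<Union>f\<in>{f \<in> Out. far n (cx f)}. sides f)"
    unfolding far_edges_def far_Out[OF n, symmetric] using far_faces_eq[of n S] by (simp add: near_hex_def)
  show ?thesis unfolding eq using N(2) by blast
qed

lemma taut_combine_iff:
  assumes n: "near_hex n" and \<rho>: "\<rho> \<in> Out \<rightarrow>\<^sub>E UNIV" and t: "length t = 3"
  shows "combine \<rho> t \<in> taut n S \<longleftrightarrow> \<rho> \<in> outer_configs n Out \<and> colours_agree (st t) \<and> boundary_ok Out \<phi> n \<rho> (st t)"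
proof -
  have far: "(\<forall>f\<in>far_faces n S. combine \<rho> t f = C1 Blue) \<longleftrightarrow> \<rho> \<in> outer_configs n Out"
    using \<rho> by (simp add: far_Out[OF n] outer_configs_def) blast
  have conn: "(a, b) \<in> (linkage (face_set S) (combine \<rho> t))\<^sup>* \<longleftrightarrow> (a, b) \<in> (shortcut Out \<phi> \<rho> ((joined (st t))\<^sup>*))\<^sup>*"
    if "a \<in> far_edges n" "b \<in> far_edges n" for a b
    unfolding S by (rule shortcut_rtrancl[OF t]) (use that far_edges_N[OF n] in auto)
  show ?thesis
    unfolding taut_def boundary_ok_def mem_Collect_eq far loops_combine_iff[OF t S \<rho>]
    using conn by blast
qed

lemma config_split:
  assumes "\<sigma> \<in> face_set S \<rightarrow>\<^sub>E UNIV"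
  shows "\<sigma> = combine (restrict \<sigma> Out) [\<sigma> f1, \<sigma> f2, \<sigma> f3]"
proof
  fix f
  have "\<sigma> f = undefined" if "f \<notin> Out" "f \<notin> F" using assms that unfolding S by (auto simp: PiE_def extensional_def)
  then show "\<sigma> f = combine (restrict \<sigma> Out) [\<sigma> f1, \<sigma> f2, \<sigma> f3] f" by (auto simp: combine_def)
qed

text \<open>Cutting along the hexagon: a taut configuration is a configuration outside together with a filling
  whose boundary state is admissible.\<close>

lemma taut_bij:
  assumes n: "near_hex n"
  shows "bij_betw (\<lambda>(\<rho>, t). combine \<rho> t)
    (SIGMA \<rho>:outer_configs n Out. {t \<in> set (hex_configs H). boundary_ok Out \<phi> n \<rho> (st t)}) (taut n S)"
proof (rule bij_betw_imageI)
  have uniq: "\<rho> = \<rho>' \<and> t = t'" if "\<rho> \<in> Out \<rightarrow>\<^sub>E UNIV" "\<rho>' \<in> Out \<rightarrow>\<^sub>E UNIV" "length t = 3" "length t' = 3"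
    "combine \<rho> t = combine \<rho>' t'" for \<rho> \<rho>' t t'
  proof
    show "\<rho> = \<rho>'"
    proof
      fix f
      show "\<rho> f = \<rho>' f"
      proof (cases "f \<in> Out")
        case True
        then show ?thesis using fun_cong[OF that(5), of f] by simp
      next
        case False
        then show ?thesis using that(1,2) by (auto simp: PiE_def extensional_def)
      qed
    qed
    have "t ! 0 = t' ! 0" "t ! 1 = t' ! 1" "t ! 2 = t' ! 2"
      using fun_cong[OF that(5), of f1] fun_cong[OF that(5), of f2] fun_cong[OF that(5), of f3] by simp_all
    then show "t = t'" using that(3,4) unfolding length_3 by auto
  qed
  show "inj_on (\<lambda>(\<rho>, t). combine \<rho> t)
    (SIGMA \<rho>:outer_configs n Out. {t \<in> set (hex_configs H). boundary_ok Out \<phi> n \<rho> (st t)})" (is "inj_on _ ?A")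
  proof (rule inj_onI)
    fix p p' assume p: "p \<in> ?A" "p' \<in> ?A" and eq: "(case p of (\<rho>, t) \<Rightarrow> combine \<rho> t) = (case p' of (\<rho>, t) \<Rightarrow> combine \<rho> t)"
    obtain \<rho> t where 1: "p = (\<rho>, t)" "\<rho> \<in> outer_configs n Out" "t \<in> set (hex_configs H)" using p(1) by blast
    obtain \<rho>' t' where 2: "p' = (\<rho>', t')" "\<rho>' \<in> outer_configs n Out" "t' \<in> set (hex_configs H)" using p(2) by blast
    have "\<rho> = \<rho>' \<and> t = t'"
      by (rule uniq) (use 1 2 eq in \<open>simp_all add: outer_configs_def mem_hex_configs\<close>)
    then show "p = p'" using 1 2 by simp
  qed
  show "(\<lambda>(\<rho>, t). combine \<rho> t) `
    (SIGMA \<rho>:outer_configs n Out. {t \<in> set (hex_configs H). boundary_ok Out \<phi> n \<rho> (st t)}) = taut n S"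
  proof (intro subset_antisym subsetI)
    fix \<sigma> assume "\<sigma> \<in> (\<lambda>(\<rho>, t). combine \<rho> t) `
      (SIGMA \<rho>:outer_configs n Out. {t \<in> set (hex_configs H). boundary_ok Out \<phi> n \<rho> (st t)})"
    then obtain \<rho> t where *: "\<sigma> = combine \<rho> t" "\<rho> \<in> outer_configs n Out" "t \<in> set (hex_configs H)"
      "boundary_ok Out \<phi> n \<rho> (st t)" by auto
    then show "\<sigma> \<in> taut n S" using taut_combine_iff[OF n, of \<rho> t]
      by (auto simp: mem_hex_configs outer_configs_def)
  next
    fix \<sigma> assume \<sigma>: "\<sigma> \<in> taut n S"
    then have ext: "\<sigma> \<in> face_set S \<rightarrow>\<^sub>E UNIV" by (auto simp: taut_def loops_def)
    define \<rho> where "\<rho> = restrict \<sigma> Out"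
    define t where "t = [\<sigma> f1, \<sigma> f2, \<sigma> f3]"
    have c: "\<sigma> = combine \<rho> t" unfolding \<rho>_def t_def by (rule config_split[OF ext])
    have t: "length t = 3" by (simp add: t_def)
    have "\<rho> \<in> outer_configs n Out \<and> colours_agree (st t) \<and> boundary_ok Out \<phi> n \<rho> (st t)"
      using \<sigma> taut_combine_iff[OF n _ t, of \<rho>] unfolding c by (auto simp: \<rho>_def)
    then have "(\<rho>, t) \<in> (SIGMA \<rho>:outer_configs n Out. {t \<in> set (hex_configs H). boundary_ok Out \<phi> n \<rho> (st t)})"
      using t by (simp add: mem_hex_configs)
    then show "\<sigma> \<in> (\<lambda>(\<rho>, t). combine \<rho> t) `
      (SIGMA \<rho>:outer_configs n Out. {t \<in> set (hex_configs H). boundary_ok Out \<phi> n \<rho> (st t)})"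
      by (rule rev_image_eqI) (simp add: c)
  qed
qed

text \<open>The same decomposition for the partition function. For a fixed outside, the sum over the fillings only
  depends on the boundary state through a fixed factor, which is the form of sum treated by
  \<open>sum_hex_configs_transfer\<close>.\<close>

lemma taut_sum_split:
  assumes n: "near_hex n" and neg: "S \<subseteq> negs"
  shows "(\<Sum>\<sigma>\<in>taut n S. 2 ^ loop_count n (face_set S) \<sigma> * (\<Prod>f\<in>near_faces n S. kind_weight g f (kind (\<sigma> f)))) =
    (\<Sum>\<rho>\<in>outer_configs n Out. (\<Prod>f\<in>{f \<in> Out. \<not> far n (cx f)}. kind_weight g f (kind (\<rho> f))) *
      (\<Sum>t\<in>set (hex_configs H). of_bool (boundary_ok Out \<phi> n \<rho> (st t)) * 2 ^ outer_loops Out \<phi> n \<rho> (st t)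
        * 2 ^ closed_loops (st t) * config_weight (kind_weight g f1) (kind_weight g f2) (kind_weight g f3) t))"
proof -
  let ?h = "\<lambda>\<sigma>. 2 ^ loop_count n (face_set S) \<sigma> * (\<Prod>f\<in>near_faces n S. kind_weight g f (kind (\<sigma> f)))"
  let ?W = "\<lambda>\<rho>. \<Prod>f\<in>{f \<in> Out. \<not> far n (cx f)}. kind_weight g f (kind (\<rho> f))"
  have fin: "finite (near_faces n S)" by (rule finite_near_faces[OF neg])
  have near: "near_faces n S = {f \<in> Out. \<not> far n (cx f)} \<union> F"
    using n unfolding near_faces_def S near_hex_def by auto
  then have finO: "finite {f \<in> Out. \<not> far n (cx f)}" using fin by (simp add: finite_subset)
  have h: "?h (combine \<rho> t) = ?W \<rho> * (2 ^ outer_loops Out \<phi> n \<rho> (st t) * 2 ^ closed_loops (st t) *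
      config_weight (kind_weight g f1) (kind_weight g f2) (kind_weight g f3) t)"
    if t: "t \<in> set (hex_configs H)" for \<rho> t
  proof -
    have "(\<Prod>f\<in>near_faces n S. kind_weight g f (kind (combine \<rho> t f))) =
      (\<Prod>f\<in>{f \<in> Out. \<not> far n (cx f)}. kind_weight g f (kind (combine \<rho> t f))) *
      (\<Prod>f\<in>F. kind_weight g f (kind (combine \<rho> t f)))"
      unfolding near by (rule prod.union_disjoint) (use finO dist in auto)
    also have "(\<Prod>f\<in>{f \<in> Out. \<not> far n (cx f)}. kind_weight g f (kind (combine \<rho> t f))) = ?W \<rho>"
      by (rule prod.cong) auto
    also have "(\<Prod>f\<in>F. kind_weight g f (kind (combine \<rho> t f))) =
        config_weight (kind_weight g f1) (kind_weight g f2) (kind_weight g f3) t"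
      using dist by (simp add: config_weight_def)
    finally have w: "(\<Prod>f\<in>near_faces n S. kind_weight g f (kind (combine \<rho> t f))) =
      ?W \<rho> * config_weight (kind_weight g f1) (kind_weight g f2) (kind_weight g f3) t" .
    have fe: "finite (\<Union>f\<in>Out \<union> F. {e \<in> sides f. e \<notin> far_edges n})"
    proof (rule finite_subset)
      have "{e \<in> sides f. e \<notin> far_edges n} = {}" if "f \<in> Out \<union> F" "far n (cx f)" for f
        using that n far_faces_eq[of n S] unfolding far_edges_def far_faces_def S near_hex_def by blast
      then show "(\<Union>f\<in>Out \<union> F. {e \<in> sides f. e \<notin> far_edges n}) \<subseteq> (\<Union>f\<in>near_faces n S. sides f)"
        unfolding near_faces_def S by blast
      show "finite (\<Union>f\<in>near_faces n S. sides f)" using fin by (auto simp: sides_def)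
    qed
    have "loop_count n (face_set S) (combine \<rho> t) = closed_loops (st t) + outer_loops Out \<phi> n \<rho> (st t)"
      unfolding S outer_loops_def by (rule loop_count_combine[OF t far_edges_N[OF n] fe])
    then show ?thesis unfolding w by (simp add: power_add algebra_simps)
  qed
  have "(\<Sum>\<sigma>\<in>taut n S. ?h \<sigma>) =
    (\<Sum>(\<rho>, t)\<in>(SIGMA \<rho>:outer_configs n Out. {t \<in> set (hex_configs H). boundary_ok Out \<phi> n \<rho> (st t)}). ?h (combine \<rho> t))"
    using sum.reindex_bij_betw[OF taut_bij[OF n], of ?h] by (simp add: case_prod_unfold)
  also have "\<dots> = (\<Sum>\<rho>\<in>outer_configs n Out. \<Sum>t\<in>{t \<in> set (hex_configs H). boundary_ok Out \<phi> n \<rho> (st t)}. ?h (combine \<rho> t))"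
    using finite_outer_configs[OF finO] by (intro sum.Sigma[symmetric]) auto
  also have "\<dots> = (\<Sum>\<rho>\<in>outer_configs n Out. \<Sum>t\<in>set (hex_configs H).
      if boundary_ok Out \<phi> n \<rho> (st t) then ?h (combine \<rho> t) else 0)"
    by (intro sum.cong refl sum.inter_filter) auto
  also have "\<dots> = (\<Sum>\<rho>\<in>outer_configs n Out. \<Sum>t\<in>set (hex_configs H). ?W \<rho> *
      (of_bool (boundary_ok Out \<phi> n \<rho> (st t)) * 2 ^ outer_loops Out \<phi> n \<rho> (st t)
        * 2 ^ closed_loops (st t) * config_weight (kind_weight g f1) (kind_weight g f2) (kind_weight g f3) t))"
    by (intro sum.cong refl) (simp only: h, simp)
  finally show ?thesis unfolding sum_distrib_left .
qed

end

section \<open>Removing one cube\<close>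

text \<open>Removing a maximal cell \<open>c\<close> of a down-set replaces its three upper faces by its three lower faces,
  and the vertex \<open>c + (1, 1, 1)\<close> by the vertex \<open>c\<close>.\<close>

locale removal =
  fixes S :: "lattice set" and c :: lattice
  assumes down: "downset S" and neg: "S \<subseteq> negs" and c: "c \<in> S" and down': "downset (S - {c})"
begin

abbreviation U1 :: face where "U1 \<equiv> (c + evec 3, 1, 2)"
abbreviation U2 :: face where "U2 \<equiv> (c + evec 2, 1, 3)"
abbreviation U3 :: face where "U3 \<equiv> (c + evec 1, 2, 3)"
abbreviation L1 :: face where "L1 \<equiv> (c, 1, 2)"
abbreviation L2 :: face where "L2 \<equiv> (c, 1, 3)"
abbreviation L3 :: face where "L3 \<equiv> (c, 2, 3)"
definition Out :: "face set" where "Out = face_set S - {U1, U2, U3}"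
definition N :: "edge set" where "N = {e. c \<notin> e \<and> c + (1, 1, 1) \<notin> e}"
definition rim :: "edge list" where
  "rim = [edge 2 (c + evec 1), edge 1 (c + evec 2), edge 3 (c + evec 2), edge 2 (c + evec 3),
     edge 1 (c + evec 3), edge 3 (c + evec 1)]"
definition \<phi>U :: "nat \<Rightarrow> edge" where
  "\<phi>U = nth (rim @ [edge 3 (c + evec 1 + evec 2), edge 2 (c + evec 1 + evec 3), edge 1 (c + evec 2 + evec 3)])"
definition \<phi>L :: "nat \<Rightarrow> edge" where
  "\<phi>L = nth (rim @ [edge 1 c, edge 2 c, edge 3 c])"

lemma above: "x \<in> S \<Longrightarrow> fst c \<le> fst x \<Longrightarrow> fst (snd c) \<le> fst (snd x) \<Longrightarrow> snd (snd c) \<le> snd (snd x) \<Longrightarrow> x = c"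
  using downsetD[OF down', of "fst x" "fst (snd x)" "snd (snd x)" "fst c" "fst (snd c)" "snd (snd c)"]
  by auto

lemma below: "fst x \<le> fst c \<Longrightarrow> fst (snd x) \<le> fst (snd c) \<Longrightarrow> snd (snd x) \<le> snd (snd c) \<Longrightarrow> x \<in> S"
  using downsetD[OF down, of "fst c" "fst (snd c)" "snd (snd c)" "fst x" "fst (snd x)" "snd (snd x)"] c
  by auto

lemma face_sets:
  "face_set S = Out \<union> {U1, U2, U3}" "face_set (S - {c}) = Out \<union> {L1, L2, L3}"
  "U1 \<notin> Out" "U2 \<notin> Out" "U3 \<notin> Out" "L1 \<notin> Out" "L2 \<notin> Out" "L3 \<notin> Out"
proof -
  obtain a b d where abd: "c = (a, b, d)" by (cases c)
  have up: "(a + 1, b, d) \<notin> S" "(a, b + 1, d) \<notin> S" "(a, b, d + 1) \<notin> S"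
    using above[of "(a + 1, b, d)"] above[of "(a, b + 1, d)"] above[of "(a, b, d + 1)"] by (auto simp: abd)
  have lo: "(a - 1, b, d) \<in> S" "(a, b - 1, d) \<in> S" "(a, b, d - 1) \<in> S"
    using below[of "(a - 1, b, d)"] below[of "(a, b - 1, d)"] below[of "(a, b, d - 1)"] by (auto simp: abd)
  show 1: "face_set S = Out \<union> {U1, U2, U3}"
    using c up unfolding Out_def by (auto simp: abd)
  have shape: "\<exists>x. f = (x, 1, 2) \<or> f = (x, 1, 3) \<or> f = (x, 2, 3)" if "f \<in> face_set T" for f T
    using that unfolding face_set_iff by blast
  have o: "(x, 1, 2) \<in> Out \<longleftrightarrow> x \<notin> S \<and> x - (0, 0, 1) \<in> S \<and> x - (0, 0, 1) \<noteq> c"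
    "(x, 1, 3) \<in> Out \<longleftrightarrow> x \<notin> S \<and> x - (0, 1, 0) \<in> S \<and> x - (0, 1, 0) \<noteq> c"
    "(x, 2, 3) \<in> Out \<longleftrightarrow> x \<notin> S \<and> x - (1, 0, 0) \<in> S \<and> x - (1, 0, 0) \<noteq> c" for x
    unfolding Out_def by (auto simp: diff_eq_eq)
  have lo': "c - (0, 0, 1) \<in> S" "c - (0, 1, 0) \<in> S" "c - (1, 0, 0) \<in> S"
    "c - (0, 0, 1) \<noteq> c" "c - (0, 1, 0) \<noteq> c" "c - (1, 0, 0) \<noteq> c"
    using lo by (simp_all add: abd)
  have iff: "(x, 1, 2) \<in> face_set (S - {c}) \<longleftrightarrow> (x, 1, 2) \<in> Out \<or> x = c"
    "(x, 1, 3) \<in> face_set (S - {c}) \<longleftrightarrow> (x, 1, 3) \<in> Out \<or> x = c"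
    "(x, 2, 3) \<in> face_set (S - {c}) \<longleftrightarrow> (x, 2, 3) \<in> Out \<or> x = c" for x
    unfolding o using lo' c by (auto simp del: minus_prod_def)
  have "f \<in> face_set (S - {c}) \<longleftrightarrow> f \<in> Out \<union> {L1, L2, L3}" for f
  proof
    assume f: "f \<in> face_set (S - {c})"
    obtain x where "f = (x, 1, 2) \<or> f = (x, 1, 3) \<or> f = (x, 2, 3)" using shape[OF f] by blast
    then show "f \<in> Out \<union> {L1, L2, L3}" using f iff[of x] by blast
  next
    assume f: "f \<in> Out \<union> {L1, L2, L3}"
    have L: "{L1, L2, L3} \<subseteq> face_set (S - {c})" using iff[of c] by blast
    show "f \<in> face_set (S - {c})"
    proof (cases "f \<in> Out")
      case True
      then have "f \<in> face_set S" by (simp only: Out_def Diff_iff)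
      then obtain x where "f = (x, 1, 2) \<or> f = (x, 1, 3) \<or> f = (x, 2, 3)" using shape by blast
      then show ?thesis using True iff[of x] by blast
    next
      case False
      then show ?thesis using f L by blast
    qed
  qed
  then show "face_set (S - {c}) = Out \<union> {L1, L2, L3}" by blast
  show "U1 \<notin> Out" "U2 \<notin> Out" "U3 \<notin> Out" "L1 \<notin> Out" "L2 \<notin> Out" "L3 \<notin> Out"
    using c by (simp_all add: Out_def)
qed

lemma Out_sides: "f \<in> Out \<Longrightarrow> sides f \<subseteq> N"
proof -
  assume f: "f \<in> Out"
  obtain a b d where abd: "c = (a, b, d)" by (cases c)
  have corner: "p \<in> {cx f, cu f, cy f, cv f}" if "e \<in> sides f" "p \<in> e" for e p
    using that unfolding sides_def by blast
  have fS: "f \<in> face_set S" "f \<notin> {U1, U2, U3}" using f by (simp_all only: Out_def Diff_iff) simp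
  have fS': "f \<in> face_set (S - {c})" "f \<notin> {L1, L2, L3}"
    unfolding face_sets(2) using f face_sets(6-8) by blast+
  have "c + (1, 1, 1) \<notin> {cx f, cu f, cy f, cv f}"
    using fS(1)
  proof (cases rule: face_cases)
    case (12 x y z)
    then show ?thesis using fS(2) above[of "(x, y, z - 1)"] by (auto simp: abd cx_def cu_def cy_def cv_def)
  next
    case (13 x y z)
    then show ?thesis using fS(2) above[of "(x, y - 1, z)"] by (auto simp: abd cx_def cu_def cy_def cv_def)
  next
    case (23 x y z)
    then show ?thesis using fS(2) above[of "(x - 1, y, z)"] by (auto simp: abd cx_def cu_def cy_def cv_def)
  qed
  moreover have "c \<notin> {cx f, cu f, cy f, cv f}"
    using fS'(1)
  proof (cases rule: face_cases)
    case (12 x y z)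
    have "(x, y, z) \<noteq> c" using 12(1) fS'(2) by (simp add: abd)
    then have "(x, y, z) \<notin> S" using 12(2) by simp
    then have "\<not> (x \<le> a \<and> y \<le> b \<and> z \<le> d)" using below[of "(x, y, z)"] by (auto simp: abd)
    then show ?thesis using 12(1) by (auto simp: abd cx_def cu_def cy_def cv_def)
  next
    case (13 x y z)
    have "(x, y, z) \<noteq> c" using 13(1) fS'(2) by (simp add: abd)
    then have "(x, y, z) \<notin> S" using 13(2) by simp
    then have "\<not> (x \<le> a \<and> y \<le> b \<and> z \<le> d)" using below[of "(x, y, z)"] by (auto simp: abd)
    then show ?thesis using 13(1) by (auto simp: abd cx_def cu_def cy_def cv_def)
  next
    case (23 x y z)
    have "(x, y, z) \<noteq> c" using 23(1) fS'(2) by (simp add: abd)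
    then have "(x, y, z) \<notin> S" using 23(2) by simp
    then have "\<not> (x \<le> a \<and> y \<le> b \<and> z \<le> d)" using below[of "(x, y, z)"] by (auto simp: abd)
    then show ?thesis using 23(1) by (auto simp: abd cx_def cu_def cy_def cv_def)
  qed
  ultimately show "sides f \<subseteq> N" unfolding N_def using corner by blast
qed

lemma lt_9_cases: "k < (9::nat) \<Longrightarrow> k \<in> {0, 1, 2, 3, 4, 5, 6, 7, 8}" by auto

sublocale up: hexagon_taut Out U1 U2 U3 "(4, 7, 8, 3)" "(1, 6, 8, 2)" "(0, 6, 7, 5)" \<phi>U N S
proof
  obtain a b d where abd: "c = (a, b, d)" by (cases c)
  show "[(4, 7, 8, 3), (1, 6, 8, 2), (0, 6, 7, 5)] = lower_hex \<or> [(4, 7, 8, 3), (1, 6, 8, 2), (0, 6, 7, 5)] = upper_hex"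
    by (simp add: upper_hex_def)
  show "realizes \<phi>U (4, 7, 8, 3) U1" "realizes \<phi>U (1, 6, 8, 2) U2" "realizes \<phi>U (0, 6, 7, 5) U3"
    unfolding realizes_def prod.case corner_sides \<phi>U_def rim_def by (simp_all add: abd)
  show "distinct [U1, U2, U3]" by simp
  show "U1 \<notin> Out" "U2 \<notin> Out" "U3 \<notin> Out" "face_set S = Out \<union> {U1, U2, U3}" by (rule face_sets)+
  show "inj_on \<phi>U {..<9}" unfolding \<phi>U_def
    unfolding rim_def by (rule inj_on_nth) (simp_all add: abd)
  show "\<phi>U k \<in> N \<longleftrightarrow> k < 6" if "k < 9" for k
    using lt_9_cases[OF that] unfolding \<phi>U_def rim_def N_def edge_def
    by (elim insertE emptyE; hypsubst; simp add: abd)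
  show "sides f \<subseteq> N" if "f \<in> Out" for f using Out_sides that .
qed

sublocale lo: hexagon_taut Out L1 L2 L3 "(6, 0, 1, 7)" "(6, 5, 4, 8)" "(7, 2, 3, 8)" \<phi>L N "S - {c}"
proof
  obtain a b d where abd: "c = (a, b, d)" by (cases c)
  show "[(6, 0, 1, 7), (6, 5, 4, 8), (7, 2, 3, 8)] = lower_hex \<or> [(6, 0, 1, 7), (6, 5, 4, 8), (7, 2, 3, 8)] = upper_hex"
    by (simp add: lower_hex_def)
  show "realizes \<phi>L (6, 0, 1, 7) L1" "realizes \<phi>L (6, 5, 4, 8) L2" "realizes \<phi>L (7, 2, 3, 8) L3"
    unfolding realizes_def prod.case corner_sides \<phi>L_def rim_def by (simp_all add: abd)
  show "distinct [L1, L2, L3]" by simp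
  show "L1 \<notin> Out" "L2 \<notin> Out" "L3 \<notin> Out" "face_set (S - {c}) = Out \<union> {L1, L2, L3}" by (rule face_sets)+
  show "inj_on \<phi>L {..<9}" unfolding \<phi>L_def
    unfolding rim_def by (rule inj_on_nth) (simp_all add: abd)
  show "\<phi>L k \<in> N \<longleftrightarrow> k < 6" if "k < 9" for k
    using lt_9_cases[OF that] unfolding \<phi>L_def rim_def N_def edge_def
    by (elim insertE emptyE; hypsubst; simp add: abd)
  show "sides f \<subseteq> N" if "f \<in> Out" for f using Out_sides that .
qed

lemma near_hexes:
  assumes n: "full_outside n (S - {c})"
  shows "up.near_hex n \<and> lo.near_hex n"
proof -
  have "c \<in> negs - (S - {c})" using c neg by blast
  then have "\<not> far n c" using n unfolding full_outside_def by blast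
  moreover have "full_outside n S" using n neg down unfolding full_outside_def by blast
  ultimately show ?thesis using n unfolding up.near_hex_def lo.near_hex_def
    by (cases c) (auto simp: cx_def far_def)
qed

lemma hexes: "up.H = upper_hex" "lo.H = lower_hex"
  by (simp_all add: upper_hex_def lower_hex_def)

lemma same_state:
  assumes "length t = 3" "length t' = 3" "boundary_state (lo.st t) = boundary_state (up.st t')"
  shows "boundary_ok Out \<phi>L n \<rho> (lo.st t) \<longleftrightarrow> boundary_ok Out \<phi>U n \<rho> (up.st t')"
    "outer_loops Out \<phi>L n \<rho> (lo.st t) = outer_loops Out \<phi>U n \<rho> (up.st t')"
proof -
  have "length rim = 6" by (simp add: rim_def)
  have *: "\<phi>L k = \<phi>U k" if "k < 6" for k
    using that \<open>length rim = 6\<close> by (simp add: \<phi>L_def \<phi>U_def nth_append)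
  note ** = boundary_state_colour[OF assms(3)] boundary_state_joined[OF assms(3)]
  show "boundary_ok Out \<phi>L n \<rho> (lo.st t) \<longleftrightarrow> boundary_ok Out \<phi>U n \<rho> (up.st t')"
    "outer_loops Out \<phi>L n \<rho> (lo.st t) = outer_loops Out \<phi>U n \<rho> (up.st t')"
    by (rule same_boundary; use * ** lo.node_lt[OF assms(1)] up.node_lt[OF assms(2)] in blast)+
qed

text \<open>For a taut configuration without the cell \<open>c\<close>, take a filling of the upper hexagon with the same boundary
  state. The result is taut on \<open>S\<close>, so the hypothesis applies, and changing back the filling keeps the
  conclusion.\<close>

lemma taut_mono:
  assumes "full_outside m (S - {c})" "full_outside n (S - {c})" "taut m S \<subseteq> taut n S"
  shows "taut m (S - {c}) \<subseteq> taut n (S - {c})"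
proof
  fix \<sigma> assume "\<sigma> \<in> taut m (S - {c})"
  then have "\<sigma> \<in> (\<lambda>(\<rho>, t). lo.combine \<rho> t) `
      (SIGMA \<rho>:outer_configs m Out. {t \<in> set (hex_configs lo.H). boundary_ok Out \<phi>L m \<rho> (lo.st t)})"
    using lo.taut_bij[of m] near_hexes[OF assms(1)] by (auto simp: bij_betw_def)
  then obtain \<rho> t where \<sigma>: "\<sigma> = lo.combine \<rho> t" and \<rho>: "\<rho> \<in> outer_configs m Out"
    and t: "t \<in> set (hex_configs lo.H)" "boundary_ok Out \<phi>L m \<rho> (lo.st t)" by auto
  have ext: "\<rho> \<in> Out \<rightarrow>\<^sub>E UNIV" using \<rho> by (simp add: outer_configs_def)
  obtain t' where t': "t' \<in> set (hex_configs up.H)" "boundary_state (up.st t') = boundary_state (lo.st t)"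
    using hex_configs_same_state[OF lo.hex up.hex t(1)] .
  have len: "length t = 3" "length t' = 3" "colours_agree (lo.st t)" "colours_agree (up.st t')"
    using t t' by (simp_all add: mem_hex_configs)
  note ok = same_state(1)[OF len(1,2) t'(2)[symmetric]]
  have "up.combine \<rho> t' \<in> taut m S"
    using up.taut_combine_iff[OF _ ext len(2)] near_hexes[OF assms(1)] \<rho> len t(2) ok by blast
  then have "up.combine \<rho> t' \<in> taut n S" using assms(3) by blast
  then have "\<rho> \<in> outer_configs n Out" "boundary_ok Out \<phi>U n \<rho> (up.st t')"
    using up.taut_combine_iff[OF _ ext len(2)] near_hexes[OF assms(2)] by blast+
  then show "\<sigma> \<in> taut n (S - {c})"
    unfolding \<sigma> using lo.taut_combine_iff[OF _ ext len(1)] near_hexes[OF assms(2)] len ok by blast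
qed

lemma vertex_sets:
  "vertex_set S = insert (c + (1, 1, 1)) (vertex_set S \<inter> vertex_set (S - {c}))"
  "vertex_set (S - {c}) = insert c (vertex_set S \<inter> vertex_set (S - {c}))"
  "c + (1, 1, 1) \<notin> vertex_set (S - {c})" "c \<notin> vertex_set S"
proof -
  obtain a b d where abd: "c = (a, b, d)" by (cases c)
  have "c + (1, 1, 1) \<notin> S" using above[of "c + (1, 1, 1)"] by (auto simp: abd)
  moreover have "c - (1, 1, 1) \<in> S" using below[of "c - (1, 1, 1)"] by (simp add: abd)
  moreover have "x - (1, 1, 1) = c \<longleftrightarrow> x = c + (1, 1, 1)" for x by (auto simp: algebra_simps)
  moreover have "c - (1, 1, 1) \<noteq> c" by (simp add: abd)
  ultimately show "vertex_set S = insert (c + (1, 1, 1)) (vertex_set S \<inter> vertex_set (S - {c}))"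
    "vertex_set (S - {c}) = insert c (vertex_set S \<inter> vertex_set (S - {c}))"
    "c + (1, 1, 1) \<notin> vertex_set (S - {c})" "c \<notin> vertex_set S"
    using c unfolding vertex_set_def by auto
qed

text \<open>For each configuration outside and each boundary state, the fillings of both hexagons have the same total
  weight after division by the squares of the exchanged vertex variables.\<close>

lemma taut_sum_removal:
  assumes n: "full_outside n (S - {c})" and pos: "\<And>x. 0 < g x" and rec: "g (c + (1, 1, 1)) = kashaev_rhs g c"
  shows "taut_sum n g S = taut_sum n g (S - {c})"
proof -
  define lv where "lv = (\<lambda>\<rho> t. of_bool (boundary_ok Out \<phi>L n \<rho> (lo.st t)) * 2 ^ outer_loops Out \<phi>L n \<rho> (lo.st t) :: real)"
  define uv where "uv = (\<lambda>\<rho> t. of_bool (boundary_ok Out \<phi>U n \<rho> (up.st t)) * 2 ^ outer_loops Out \<phi>U n \<rho> (up.st t) :: real)"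
  define G where "G = (\<lambda>\<rho> k. uv \<rho> (SOME t. t \<in> set (hex_configs up.H) \<and> boundary_state (up.st t) = k))"
  have some: "(SOME t. t \<in> set (hex_configs up.H) \<and> boundary_state (up.st t) = k) \<in> set (hex_configs up.H) \<and>
      boundary_state (up.st (SOME t. t \<in> set (hex_configs up.H) \<and> boundary_state (up.st t) = k)) = k"
    if "t \<in> set (hex_configs up.H)" "boundary_state (up.st t) = k" for t k
    by (rule someI[of _ t]) (use that in blast)
  have uvlv: "lv \<rho> t = uv \<rho> t'" if "t \<in> set (hex_configs lo.H)" "t' \<in> set (hex_configs up.H)"
    "boundary_state (lo.st t) = boundary_state (up.st t')" for \<rho> t t'
    using same_state[of t t'] that by (simp add: mem_hex_configs lv_def uv_def)
  have Gl: "lv \<rho> t = G \<rho> (boundary_state (lo.st t))" if t: "t \<in> set (hex_configs lo.H)" for \<rho> t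
  proof -
    obtain t' where t': "t' \<in> set (hex_configs up.H)" "boundary_state (up.st t') = boundary_state (lo.st t)"
      using hex_configs_same_state[OF lo.hex up.hex t] .
    show ?thesis unfolding G_def by (rule uvlv) (use t some[OF t'] in auto)
  qed
  have Gu: "uv \<rho> t = G \<rho> (boundary_state (up.st t))" if t: "t \<in> set (hex_configs up.H)" for \<rho> t
  proof -
    obtain t' where t': "t' \<in> set (hex_configs lo.H)" "boundary_state (lo.st t') = boundary_state (up.st t)"
      using hex_configs_same_state[OF up.hex lo.hex t] .
    have "uv \<rho> t = lv \<rho> t'" using uvlv[OF t'(1) t t'(2)] by simp
    also have "\<dots> = G \<rho> (boundary_state (lo.st t'))" by (rule Gl[OF t'(1)])
    finally show ?thesis by (simp only: t'(2))
  qed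
  let ?a = "1 / (g c)^2" and ?b = "1 / (g (c + (1, 1, 1)))^2"
  let ?wl = "config_weight (kind_weight g L1) (kind_weight g L2) (kind_weight g L3)"
  let ?wu = "config_weight (kind_weight g U1) (kind_weight g U2) (kind_weight g U3)"
  have local: "(\<Sum>t\<in>set (hex_configs lo.H). lv \<rho> t * 2 ^ closed_loops (lo.st t) * ?wl t) * ?a =
      (\<Sum>t\<in>set (hex_configs up.H). uv \<rho> t * 2 ^ closed_loops (up.st t) * ?wu t) * ?b" for \<rho>
  proof -
    have "rows_weight (kind_weight g L1) (kind_weight g L2) (kind_weight g L3) ls * ?a =
      rows_weight (kind_weight g U1) (kind_weight g U2) (kind_weight g U3) us * ?b"
      if "(ls, us) \<in> set pairs_list" for ls us
    proof -
      obtain a b d where abd: "c = (a, b, d)" by (cases c)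
      have "g (a + 1, b + 1, d + 1) = kashaev_rhs g (a, b, d)" using rec by (simp add: abd)
      then have rec': "g (a + 1, b + 1, d + 1) =
        (2 * g (a + 1, b, d) * g (a, b + 1, d) * g (a, b, d + 1) + g (a, b, d) *
          (g (a + 1, b, d) * g (a, b + 1, d + 1) + g (a, b + 1, d) * g (a + 1, b, d + 1) + g (a, b, d + 1) * g (a + 1, b + 1, d))
        + 2 * sqrt (g (a, b, d) * g (a, b + 1, d + 1) + g (a, b + 1, d) * g (a, b, d + 1))
          * sqrt (g (a, b, d) * g (a + 1, b, d + 1) + g (a + 1, b, d) * g (a, b, d + 1))
          * sqrt (g (a, b, d) * g (a + 1, b + 1, d) + g (a + 1, b, d) * g (a, b + 1, d))) / (g (a, b, d))^2"
        by (simp add: kashaev_rhs_def Let_def)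
      show ?thesis
        using cube_identities[OF pos pos pos pos pos pos pos pos rec' that]
        by (simp add: kind_weight_def cx_def cu_def cy_def cv_def abd)
    qed
    note T = sum_hex_configs_transfer[OF this, where G = "G \<rho>", folded hexes]
    have "(\<Sum>t\<in>set (hex_configs lo.H). lv \<rho> t * 2 ^ closed_loops (lo.st t) * ?wl t) =
      (\<Sum>t\<in>set (hex_configs lo.H). G \<rho> (boundary_state (lo.st t)) * 2 ^ closed_loops (lo.st t) * ?wl t)"
      by (rule sum.cong[OF refl]) (simp only: Gl)
    moreover have "(\<Sum>t\<in>set (hex_configs up.H). uv \<rho> t * 2 ^ closed_loops (up.st t) * ?wu t) =
      (\<Sum>t\<in>set (hex_configs up.H). G \<rho> (boundary_state (up.st t)) * 2 ^ closed_loops (up.st t) * ?wu t)"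
      by (rule sum.cong[OF refl]) (simp only: Gu)
    ultimately show ?thesis using T by (simp only:)
  qed
  define V where "V = {x \<in> vertex_set S \<inter> vertex_set (S - {c}). \<not> far n x}"
  have "c \<in> negs - (S - {c})" using c neg by blast
  then have nfc: "\<not> far n c" using n unfolding full_outside_def by blast
  then have nf: "\<not> far n (c + (1, 1, 1))" by (cases c) (auto simp: far_def)
  have nv: "near_vertices n S = insert (c + (1, 1, 1)) V" "near_vertices n (S - {c}) = insert c V"
  proof (rule_tac [!] set_eqI)
    fix x
    have "x \<in> vertex_set S \<longleftrightarrow> x = c + (1, 1, 1) \<or> x \<in> vertex_set S \<inter> vertex_set (S - {c})"
      using vertex_sets(1) by blast
    then show "x \<in> near_vertices n S \<longleftrightarrow> x \<in> insert (c + (1, 1, 1)) V"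
      using nf unfolding near_vertices_def V_def by blast
    have "x \<in> vertex_set (S - {c}) \<longleftrightarrow> x = c \<or> x \<in> vertex_set S \<inter> vertex_set (S - {c})"
      using vertex_sets(2) by blast
    then show "x \<in> near_vertices n (S - {c}) \<longleftrightarrow> x \<in> insert c V"
      using nfc unfolding near_vertices_def V_def by blast
  qed
  have "finite V"
    by (rule finite_subset[OF _ finite_box[of n]]) (use neg in \<open>auto simp: V_def vertex_set_def\<close>)
  moreover have "c + (1, 1, 1) \<notin> V" "c \<notin> V" unfolding V_def using vertex_sets(3,4) by auto
  ultimately have pv: "(\<Prod>x\<in>near_vertices n S. (g x)^2) = (g (c + (1, 1, 1)))^2 * (\<Prod>x\<in>V. (g x)^2)"
    "(\<Prod>x\<in>near_vertices n (S - {c}). (g x)^2) = (g c)^2 * (\<Prod>x\<in>V. (g x)^2)"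
    unfolding nv by simp_all
  have gen: "(\<Sum>\<rho>\<in>R. A \<rho> * B \<rho>) / (q * v) = (\<Sum>\<rho>\<in>R. A \<rho> * (B \<rho> * (1 / q))) / v"
    for A B :: "(face \<Rightarrow> local_config) \<Rightarrow> real" and q v R
    by (simp add: sum_divide_distrib)
  have neg': "S - {c} \<subseteq> negs" using neg by blast
  have "taut_sum n g S = (\<Sum>\<rho>\<in>outer_configs n Out. (\<Prod>f\<in>{f \<in> Out. \<not> far n (cx f)}. kind_weight g f (kind (\<rho> f))) *
      ((\<Sum>t\<in>set (hex_configs up.H). uv \<rho> t * 2 ^ closed_loops (up.st t) * ?wu t) * ?b)) / (\<Prod>x\<in>V. (g x)^2)"
    unfolding taut_sum_def pv up.taut_sum_split[OF conjunct1[OF near_hexes[OF n]] neg] uv_def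
    by (rule gen)
  moreover have "taut_sum n g (S - {c}) = (\<Sum>\<rho>\<in>outer_configs n Out. (\<Prod>f\<in>{f \<in> Out. \<not> far n (cx f)}. kind_weight g f (kind (\<rho> f))) *
      ((\<Sum>t\<in>set (hex_configs lo.H). lv \<rho> t * 2 ^ closed_loops (lo.st t) * ?wl t) * ?a)) / (\<Prod>x\<in>V. (g x)^2)"
    unfolding taut_sum_def pv lo.taut_sum_split[OF conjunct2[OF near_hexes[OF n]] neg'] lv_def
    by (rule gen)
  ultimately show ?thesis by (simp only: local)
qed

end

section \<open>Rigidity on the octant\<close>

text \<open>In a graph of maximal degree two, the component of a vertex of degree one contains at most one
  other vertex of degree one.\<close>

lemma two_ends:
  fixes r :: "('a \<times> 'a) set"
  assumes sym: "\<And>x y. (x, y) \<in> r \<Longrightarrow> (y, x) \<in> r"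
    and deg: "\<And>x y z w. (x, y) \<in> r \<Longrightarrow> (x, z) \<in> r \<Longrightarrow> (x, w) \<in> r \<Longrightarrow> y = z \<or> y = w \<or> z = w"
    and a: "\<And>y z. (a, y) \<in> r \<Longrightarrow> (a, z) \<in> r \<Longrightarrow> y = z" and b: "\<And>y z. (b, y) \<in> r \<Longrightarrow> (b, z) \<in> r \<Longrightarrow> y = z"
    and c: "\<And>y z. (c, y) \<in> r \<Longrightarrow> (c, z) \<in> r \<Longrightarrow> y = z"
    and ab: "(a, b) \<in> r\<^sup>*" "a \<noteq> b" and ac: "(a, c) \<in> r\<^sup>*"
  shows "c = a \<or> c = b"
proof -
  define m where "m = (LEAST m. (a, b) \<in> r ^^ m)"
  have "\<exists>m. (a, b) \<in> r ^^ m" using ab(1) by (simp add: rtrancl_power)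
  then have m: "(a, b) \<in> r ^^ m" unfolding m_def by (rule LeastI_ex)
  have least: "m \<le> k" if "(a, b) \<in> r ^^ k" for k unfolding m_def using that by (rule Least_le)
  obtain f where f: "f 0 = a" "f m = b" "\<And>i. i < m \<Longrightarrow> (f i, f (Suc i)) \<in> r"
    using m unfolding relpow_fun_conv by blast
  have m0: "m > 0" using f(1,2) ab(2) by (cases m) auto
  have turn: "f (i - 1) \<noteq> f (Suc i)" if "0 < i" "i < m" for i
  proof
    assume eq: "f (i - 1) = f (Suc i)"
    define g where "g k = (if k < i then f k else f (k + 2))" for k
    have "(a, b) \<in> r ^^ (m - 2)"
      unfolding relpow_fun_conv
    proof (intro exI[of _ g] conjI allI impI)
      show "g 0 = a" using that f(1) by (simp add: g_def)
      show "g (m - 2) = b"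
      proof (cases "m - 2 < i")
        case True
        then have "m = Suc i" "m - 2 = i - 1" using that by auto
        then show ?thesis using eq f(2) that by (simp add: g_def)
      next
        case False
        moreover have "m - 2 + 2 = m" using that by simp
        ultimately show ?thesis using f(2) by (simp add: g_def)
      qed
      fix k assume k: "k < m - 2"
      consider "Suc k < i" | "Suc k = i" | "i \<le> k" by linarith
      then show "(g k, g (Suc k)) \<in> r"
      proof cases
        case 1
        then show ?thesis using f(3)[of k] k by (simp add: g_def)
      next
        case 2
        then have "f k = f (Suc i)" using eq by auto
        moreover have "(f (Suc i), f (Suc (Suc i))) \<in> r" using 2 k by (intro f(3)) simp
        ultimately show ?thesis using 2 by (simp add: g_def)
      next
        case 3
        then show ?thesis using f(3)[of "k + 2"] k by (simp add: g_def)
      qed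
    qed
    then have "m \<le> m - 2" by (rule least)
    then show False using m0 by simp
  qed
  have closed: "\<exists>i\<le>m. y = f i" if i: "i \<le> m" and y: "(f i, y) \<in> r" for i y
  proof -
    consider "i = 0" | "i = m" | "0 < i" "i < m" using i by linarith
    then show ?thesis
    proof cases
      case 1
      then have "y = f 1" using a[of y "f 1"] f(1) f(3)[of 0] m0 y by simp
      then show ?thesis using m0 by (intro exI[of _ 1]) simp
    next
      case 2
      have "(f (m - 1), f m) \<in> r" using f(3)[of "m - 1"] m0 by simp
      then have "y = f (m - 1)" using b[of y "f (m - 1)"] sym 2 y f(2) by simp
      then show ?thesis by (intro exI[of _ "m - 1"]) simp
    next
      case 3
      have "(f (i - 1), f i) \<in> r" using f(3)[of "i - 1"] 3 by simp
      then have "(f i, f (i - 1)) \<in> r" by (rule sym)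
      then have "y = f (i - 1) \<or> y = f (Suc i)"
        using deg[OF _ f(3)[OF 3(2)] y] turn[OF 3] by metis
      then show ?thesis
      proof
        assume "y = f (i - 1)"
        then show ?thesis using 3 by (intro exI[of _ "i - 1"]) simp
      next
        assume "y = f (Suc i)"
        then show ?thesis using 3 by (intro exI[of _ "Suc i"]) simp
      qed
    qed
  qed
  from ac have "\<exists>i\<le>m. c = f i"
  proof (induction rule: rtrancl_induct)
    case base
    then show ?case using f(1) by (intro exI[of _ 0]) simp
  next
    case (step y z)
    then obtain i where "i \<le> m" "y = f i" by auto
    then show ?case using closed[of i z] step.hyps(2) by simp
  qed
  then obtain i where i: "i \<le> m" "c = f i" by auto
  consider "i = 0" | "i = m" | "0 < i" "i < m" using i by linarith
  then show ?thesis
  proof cases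
    case 3
    have "(f (i - 1), f i) \<in> r" using f(3)[of "i - 1"] 3 by simp
    then have "(c, f (i - 1)) \<in> r" using sym i by simp
    moreover have "(c, f (Suc i)) \<in> r" using f(3) 3 i by simp
    ultimately show ?thesis using c turn[OF 3] by blast
  qed (use i f in auto)
qed

text \<open>Families of curves in a square grid. If \<open>2 n\<close> disjoint curves all separate two opposite
  corners of a square of side \<open>n\<close>, then every monotone path of length \<open>2 n\<close> between these corners
  crosses each of them exactly once.\<close>

lemma grid_crossings:
  fixes n :: int and ev eh :: "int \<Rightarrow> int \<Rightarrow> 'e" and \<Gamma> :: "'l set" and M :: "'l \<Rightarrow> 'e \<Rightarrow> bool"
  assumes n: "0 \<le> n" and fin: "finite \<Gamma>" and card: "int (card \<Gamma>) = 2 * n"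
    and uniq: "\<And>e l m. l \<in> \<Gamma> \<Longrightarrow> m \<in> \<Gamma> \<Longrightarrow> M l e \<Longrightarrow> M m e \<Longrightarrow> l = m"
    and face: "\<And>l a b. l \<in> \<Gamma> \<Longrightarrow> -n \<le> a \<Longrightarrow> a < 0 \<Longrightarrow> -n \<le> b \<Longrightarrow> b < 0 \<Longrightarrow>
      even (of_bool (M l (ev a b)) + of_bool (M l (eh a b)) + of_bool (M l (ev (a + 1) b)) + of_bool (M l (eh a (b + 1))) :: nat)"
    and boundary: "\<And>l. l \<in> \<Gamma> \<Longrightarrow> odd (card {t \<in> {-n..<0}. M l (ev (-n) t)} + card {t \<in> {-n..<0}. M l (eh t (-n))})"
  shows "-n \<le> a \<Longrightarrow> a \<le> 0 \<Longrightarrow> -n \<le> b \<Longrightarrow> b < 0 \<Longrightarrow> \<exists>l\<in>\<Gamma>. M l (ev a b)" (is "_ \<Longrightarrow> _ \<Longrightarrow> _ \<Longrightarrow> _ \<Longrightarrow> ?V a b")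
    and "-n \<le> a \<Longrightarrow> a < 0 \<Longrightarrow> -n \<le> b \<Longrightarrow> b \<le> 0 \<Longrightarrow> \<exists>l\<in>\<Gamma>. M l (eh a b)" (is "_ \<Longrightarrow> _ \<Longrightarrow> _ \<Longrightarrow> _ \<Longrightarrow> ?H a b")
    and "-n \<le> a \<Longrightarrow> a < 0 \<Longrightarrow> -n \<le> b \<Longrightarrow> b < 0 \<Longrightarrow> l \<in> \<Gamma> \<Longrightarrow> M l (ev a b) \<Longrightarrow> \<not> M l (eh a b)"
proof -
  define h where "h l a b = card {t \<in> {b..<0}. M l (ev (-n) t)} + card {t \<in> {-n..<a}. M l (eh t b)}" for l a b
  have row: "h l (a + 1) b = h l a b + of_bool (M l (eh a b))" if "-n \<le> a" for l a b
  proof -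
    define T where "T = {t \<in> {-n..<a}. M l (eh t b)}"
    have "{t \<in> {-n..<a + 1}. M l (eh t b)} = (if M l (eh a b) then insert a T else T)"
      using that by (auto simp: order_less_le T_def)
    moreover have "finite T" unfolding T_def by (rule finite_subset[of _ "{-n..<a}"]) auto
    moreover have "a \<notin> T" by (simp add: T_def)
    ultimately show ?thesis unfolding h_def by (simp only: flip: T_def) simp
  qed
  have col0: "h l (-n) b = h l (-n) (b + 1) + of_bool (M l (ev (-n) b))" if "b < 0" for l b
  proof -
    define T where "T = {t \<in> {b + 1..<0}. M l (ev (-n) t)}"
    have "{b..<0} = insert b {b + 1..<0}" using that by auto
    then have "{t \<in> {b..<0}. M l (ev (-n) t)} = (if M l (ev (-n) b) then insert b T else T)"
      by (auto simp: T_def)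
    moreover have "finite T" unfolding T_def by (rule finite_subset[of _ "{b + 1..<0}"]) auto
    moreover have "b \<notin> T" by (simp add: T_def)
    ultimately show ?thesis unfolding h_def by (simp only: flip: T_def) simp
  qed
  have col: "even (h l a b + h l a (b + 1) + of_bool (M l (ev a b)))"
    if l: "l \<in> \<Gamma>" and a: "-n \<le> a" "a \<le> 0" and b: "-n \<le> b" "b < 0" for l a b
    using a
  proof (induction a rule: int_ge_induct)
    case base
    show ?case using col0[OF b(2), of l] by simp
  next
    case (step a)
    have "even (h l a b + h l a (b + 1) + of_bool (M l (ev a b)))" using step by simp
    moreover have "even (of_bool (M l (ev a b)) + of_bool (M l (eh a b)) + of_bool (M l (ev (a + 1) b)) + of_bool (M l (eh a (b + 1))) :: nat)"
      using face[OF l step.hyps _ b] step.prems by simp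
    ultimately show ?case unfolding row[OF step.hyps] by (auto simp: of_bool_def split: if_splits)
  qed
  define Od where "Od a b = {l \<in> \<Gamma>. odd (h l a b)}" for a b
  have finO: "finite (Od a b)" for a b using fin by (simp add: Od_def)
  have near: "O1 \<subseteq> insert l O2 \<and> O2 \<subseteq> insert l O1"
    if "\<And>m. m \<in> \<Gamma> \<Longrightarrow> m \<noteq> l \<Longrightarrow> m \<in> O1 \<longleftrightarrow> m \<in> O2" "O1 \<subseteq> \<Gamma>" "O2 \<subseteq> \<Gamma>" for l :: 'l and O1 O2
    using that by blast
  have step: "\<exists>l. (l \<in> \<Gamma> \<and> M l e \<or> O1 = O2) \<and> O1 \<subseteq> insert l O2 \<and> O2 \<subseteq> insert l O1"
    if toggle: "\<And>l. l \<in> \<Gamma> \<Longrightarrow> (l \<in> O1 \<longleftrightarrow> l \<in> O2) \<longleftrightarrow> \<not> M l e" and sub: "O1 \<subseteq> \<Gamma>" "O2 \<subseteq> \<Gamma>"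
    for e and O1 O2 :: "'l set"
  proof (cases "\<exists>l\<in>\<Gamma>. M l e")
    case True
    then obtain l where l: "l \<in> \<Gamma>" "M l e" by blast
    have "m \<in> O1 \<longleftrightarrow> m \<in> O2" if m: "m \<in> \<Gamma>" "m \<noteq> l" for m
      using m uniq[OF l(1) m(1) l(2)] toggle[OF m(1)] by blast
    then show ?thesis using near[of l O1 O2] l sub by blast
  next
    case False
    then have "O1 = O2" using toggle sub by blast
    then show ?thesis by blast
  qed
  have par_h: "l \<in> Od (a + 1) b \<longleftrightarrow> (l \<in> Od a b \<longleftrightarrow> \<not> M l (eh a b))" if "l \<in> \<Gamma>" "-n \<le> a" for l a b
    using that row[OF that(2), of l b] by (auto simp: Od_def)
  have par_v: "l \<in> Od a b \<longleftrightarrow> (l \<in> Od a (b + 1) \<longleftrightarrow> \<not> M l (ev a b))"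
    if "l \<in> \<Gamma>" "-n \<le> a" "a \<le> 0" "-n \<le> b" "b < 0" for l a b
    using that col[OF that] by (auto simp: Od_def)
  have sub: "Od a b \<subseteq> \<Gamma>" for a b by (auto simp: Od_def)
  have hs: "\<exists>l. (l \<in> \<Gamma> \<and> M l (eh a b) \<or> Od a b = Od (a + 1) b) \<and> Od a b \<subseteq> insert l (Od (a + 1) b) \<and> Od (a + 1) b \<subseteq> insert l (Od a b)"
    if "-n \<le> a" for a b by (rule step) (use par_h[OF _ that] sub in auto)
  have vs: "\<exists>l. (l \<in> \<Gamma> \<and> M l (ev a b) \<or> Od a (b + 1) = Od a b) \<and> Od a (b + 1) \<subseteq> insert l (Od a b) \<and> Od a b \<subseteq> insert l (Od a (b + 1))"
    if "-n \<le> a" "a \<le> 0" "-n \<le> b" "b < 0" for a b by (rule step) (use par_v[OF _ that] sub in auto)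
  have le: "card O1 \<le> card O2 + 1" if "O1 \<subseteq> insert l O2" "finite O2" for l :: 'l and O1 O2
    using card_mono[OF _ that(1)] card_insert_le_m1 that(2) by (metis Suc_eq_plus1 card_insert_if finite.insertI le_SucI)
  have hle: "card (Od (a + 1) b) \<le> card (Od a b) + 1" if "-n \<le> a" for a b
    using hs[OF that, of b] le finO by blast
  have vle: "card (Od a b) \<le> card (Od a (b + 1)) + 1" if "-n \<le> a" "a \<le> 0" "-n \<le> b" "b < 0" for a b
    using vs[OF that] le finO by blast
  have O_start: "Od (-n) 0 = {}" by (simp add: Od_def h_def)
  have O_end: "Od 0 (-n) = \<Gamma>" using boundary by (auto simp: Od_def h_def)
  have upper_h: "int (card (Od a b)) \<le> int (card (Od (-n) b)) + (a + n)" if "-n \<le> a" for a b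
    using that
  proof (induction a rule: int_ge_induct)
    case (step a)
    then show ?case using hle[OF step.hyps, of b] by linarith
  qed simp
  have upper_v: "int (card (Od (-n) b)) \<le> - b" if "b \<le> 0" "-n \<le> b" for b
    using that
  proof (induction b rule: int_le_induct)
    case base
    show ?case by (simp add: O_start)
  next
    case (step b)
    then show ?case using vle[of "-n" "b - 1"] n by simp
  qed
  have lower_h: "int (card (Od 0 b)) \<le> int (card (Od a b)) - a" if "a \<le> 0" "-n \<le> a" for a b
    using that
  proof (induction a rule: int_le_induct)
    case (step a)
    then show ?case using hle[of "a - 1" b] by simp
  qed simp
  have lower_v: "2 * n \<le> int (card (Od 0 b)) + (b + n)" if "-n \<le> b" "b \<le> 0" for b
    using that
  proof (induction b rule: int_ge_induct)
    case base
    show ?case by (simp add: O_end card)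
  next
    case (step b)
    then show ?case using vle[of 0 b] n by simp
  qed
  have eq: "int (card (Od a b)) = a - b + n" if "-n \<le> a" "a \<le> 0" "-n \<le> b" "b \<le> 0" for a b
    using upper_h[OF that(1), of b] upper_v[OF that(4,3)] lower_h[OF that(2,1), of b] lower_v[OF that(3,4)] by linarith
  have V: "\<exists>l\<in>\<Gamma>. M l (ev a b) \<and> l \<notin> Od a (b + 1) \<and> Od a b = insert l (Od a (b + 1))"
    if ab: "-n \<le> a" "a \<le> 0" "-n \<le> b" "b < 0" for a b
  proof -
    have c: "card (Od a b) = card (Od a (b + 1)) + 1" using eq[of a b] eq[of a "b + 1"] ab by simp
    obtain l where l: "l \<in> \<Gamma> \<and> M l (ev a b) \<or> Od a (b + 1) = Od a b" "Od a b \<subseteq> insert l (Od a (b + 1))"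
      using vs[OF ab] by blast
    have lM: "l \<in> \<Gamma>" "M l (ev a b)" using l(1) c by auto
    have sub': "\<not> Od a b \<subseteq> Od a (b + 1)" using c card_mono[OF finO, of "Od a b" a "b + 1"] by auto
    then have "l \<in> Od a b" using l(2) by blast
    then have nl: "l \<notin> Od a (b + 1)" using par_v[OF lM(1) ab] lM(2) by blast
    have "Od a b = insert l (Od a (b + 1))"
      by (rule card_subset_eq) (use l(2) finO nl c in auto)
    then show ?thesis using lM nl by blast
  qed
  have Hh: "\<exists>l\<in>\<Gamma>. M l (eh a b) \<and> l \<notin> Od a b"
    if ab: "-n \<le> a" "a < 0" "-n \<le> b" "b \<le> 0" for a b
  proof -
    have c: "card (Od (a + 1) b) = card (Od a b) + 1" using eq[of a b] eq[of "a + 1" b] ab by simp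
    obtain l where l: "l \<in> \<Gamma> \<and> M l (eh a b) \<or> Od a b = Od (a + 1) b" "Od (a + 1) b \<subseteq> insert l (Od a b)"
      using hs[OF ab(1), of b] by blast
    have lM: "l \<in> \<Gamma>" "M l (eh a b)" using l(1) c by auto
    have "\<not> Od (a + 1) b \<subseteq> Od a b" using c card_mono[OF finO, of "Od (a + 1) b" a b] by auto
    then have "l \<in> Od (a + 1) b" using l(2) by blast
    then have "l \<notin> Od a b" using par_h[OF lM(1) ab(1)] lM(2) by blast
    then show ?thesis using lM by blast
  qed
  show "?V a b" if "-n \<le> a" "a \<le> 0" "-n \<le> b" "b < 0" using V[OF that] by blast
  show "?H a b" if "-n \<le> a" "a < 0" "-n \<le> b" "b \<le> 0" using Hh[OF that] by blast
  show "\<not> M l (eh a b)" if ab: "-n \<le> a" "a < 0" "-n \<le> b" "b < 0" and l: "l \<in> \<Gamma>" "M l (ev a b)"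
  proof
    assume M: "M l (eh a b)"
    obtain m where m: "m \<in> \<Gamma>" "M m (ev a b)" "Od a b = insert m (Od a (b + 1))" using V[of a b] ab by auto
    have "m = l" using uniq m l by blast
    then have "l \<in> Od a b" using m(3) by blast
    moreover obtain k where k: "k \<in> \<Gamma>" "M k (eh a b)" "k \<notin> Od a b" using Hh[of a b] ab by auto
    moreover have "k = l" using uniq k l(1) M by blast
    ultimately show False by simp
  qed
qed

definition axis :: "nat \<Rightarrow> int \<Rightarrow> lattice" where
  "axis i a = (if i = 1 then (a, 0, 0) else if i = 2 then (0, a, 0) else (0, 0, a))"

definition pt :: "nat \<Rightarrow> nat \<Rightarrow> int \<Rightarrow> int \<Rightarrow> lattice" where
  "pt i j a b = axis i a + axis j b"

definition rung :: "nat \<Rightarrow> nat \<Rightarrow> int \<Rightarrow> int \<Rightarrow> edge" where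
  "rung i j a b = edge j (pt i j a b)"

text \<open>Each of the three quadrants of the surface of the octant is a grid of squares. The square \<open>quad_face i j a b\<close> is the same
  as \<open>quad_face j i b a\<close>, so that the two directions may be exchanged in proofs.\<close>

definition quad_face :: "nat \<Rightarrow> nat \<Rightarrow> int \<Rightarrow> int \<Rightarrow> face" where
  "quad_face i j a b = (if i < j then (pt i j a b, i, j) else (pt i j a b, j, i))"

lemma cx_quad_face: "cx (quad_face i j a b) = pt i j a b"
  by (simp add: quad_face_def cx_def)

definition axes :: "nat \<Rightarrow> nat \<Rightarrow> bool" where
  "axes i j \<longleftrightarrow> (i, j) \<in> {(1, 2), (2, 1), (1, 3), (3, 1), (2, 3), (3, 2)}"

lemma axes_sym: "axes i j \<Longrightarrow> axes j i"
  by (auto simp: axes_def)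

lemma sides_quadrant:
  assumes "axes i j"
  shows "sides (quad_face i j a b) = {rung j i b a, rung i j (a + 1) b, rung j i (b + 1) a, rung i j a b}"
  using assms unfolding axes_def
  by (elim insertE emptyE) (auto simp: quad_face_def sides_edge rung_def pt_def axis_def)

lemma face_quadrant:
  assumes "axes i j"
  shows "(quad_face i j a b) \<in> face_set negs \<longleftrightarrow> a \<le> -1 \<and> b \<le> -1"
  using assms unfolding axes_def
  by (elim insertE emptyE) (auto simp: quad_face_def pt_def axis_def negs_def)

lemma octant_faceE:
  assumes "f \<in> face_set negs"
  obtains i j a b where "axes i j" "i < j" "a \<le> -1" "b \<le> -1" "f = (quad_face i j a b)"
  using assms
proof (cases rule: face_cases)
  case (12 a b c)
  then show ?thesis by (intro that[of 1 2 a b]) (auto simp: axes_def negs_def pt_def axis_def quad_face_def)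
next
  case (13 a b c)
  then show ?thesis by (intro that[of 1 3 a c]) (auto simp: axes_def negs_def pt_def axis_def quad_face_def)
next
  case (23 a b c)
  then show ?thesis by (intro that[of 2 3 b c]) (auto simp: axes_def negs_def pt_def axis_def quad_face_def)
qed

lemma far_quadrant: "axes i j \<Longrightarrow> 0 \<le> n \<Longrightarrow> far n (pt i j a b) \<longleftrightarrow> a < -n \<or> b < -n"
  unfolding axes_def pt_def axis_def far_def by auto

lemma strands_quadrant:
  assumes "axes i j"
  shows "({rung i j a b, rung j i (b + 1) a}, c) \<in> strands (quad_face i j a b) (C1 c)" (is ?A)
    and "({rung i j a b, rung j i b a}, c) \<in> strands (quad_face i j a b) (C2 c)" (is ?B)
proof -
  consider "i = 1" "j = 2" | "i = 2" "j = 1" | "i = 1" "j = 3" | "i = 3" "j = 1" | "i = 2" "j = 3" | "i = 3" "j = 2"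
    using assms by (auto simp: axes_def)
  then have "?A \<and> ?B"
    by cases (simp_all add: quad_face_def strands_edge rung_def pt_def axis_def doubleton_eq_iff del: strands.simps)
  then show ?A ?B by simp_all
qed

lemma ground_step:
  assumes "axes i j" "a \<le> -1" "b \<le> -1"
  shows "(rung i j a b, rung j i (b + 1) a) \<in> ground"
proof -
  have "({rung i j a b, rung j i (b + 1) a}, Blue) \<in> strands (quad_face i j a b) (C1 Blue)"
    by (rule strands_quadrant[OF assms(1)])
  then show ?thesis using face_quadrant[OF assms(1)] assms(2,3) unfolding ground_def linkage_def by blast
qed

lemma ground_sym: "(a, b) \<in> ground\<^sup>* \<Longrightarrow> (b, a) \<in> ground\<^sup>*"
  unfolding ground_def by (rule linkage_rtrancl_sym)

text \<open>A path of the ground configuration runs diagonally to the edge of the octant, then turns into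
  the adjacent quadrant.\<close>

lemma ground_to_axis:
  assumes "axes i j" "b \<le> -1" "a \<le> b"
  shows "(rung i j a b, edge i (axis i (a - 1 - b))) \<in> ground\<^sup>*"
  using assms(2,3)
proof (induction "nat (- 1 - b)" arbitrary: a b)
  case 0
  then have "b = -1" by simp
  moreover have "rung j i 0 a = edge i (axis i a)"
    using assms(1) by (auto simp: rung_def pt_def axis_def axes_def zero_prod_def)
  ultimately show ?case using ground_step[OF assms(1), of a "-1"] 0 by auto
next
  case (Suc m)
  then have b: "b \<le> -2" by linarith
  have "(rung i j a b, rung j i (b + 1) a) \<in> ground" using ground_step[OF assms(1)] b Suc.prems by simp
  moreover have "(rung j i (b + 1) a, rung i j (a + 1) (b + 1)) \<in> ground"
    using ground_step[OF axes_sym[OF assms(1)], of "b + 1" a] b Suc.prems by simp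
  moreover have "(rung i j (a + 1) (b + 1), edge i (axis i (a + 1 - 1 - (b + 1)))) \<in> ground\<^sup>*"
    using Suc.hyps(2) b Suc.prems by (intro Suc.hyps(1)) auto
  moreover have "a + 1 - 1 - (b + 1) = a - 1 - b" by simp
  ultimately show ?case by (metis converse_rtrancl_into_rtrancl)
qed

lemma ground_gate_partner:
  assumes "axes i j" "axes i k" "-n \<le> b" "b \<le> -1"
  shows "(rung i j (-n) b, rung i k (-n) b) \<in> ground\<^sup>*"
proof -
  have 1: "(rung i j (-n) b, edge i (axis i (-n - 1 - b))) \<in> ground\<^sup>*"
    using ground_to_axis[OF assms(1,4)] assms(3) by simp
  have 2: "(rung i k (-n) b, edge i (axis i (-n - 1 - b))) \<in> ground\<^sup>*"
    using ground_to_axis[OF assms(2,4)] assms(3) by simp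
  show ?thesis using 1 ground_sym[OF 2] by (rule rtrancl_trans)
qed

text \<open>In the ground configuration all strands run diagonally, so that every path leaves each cube. In
  particular there are no closed loops.\<close>

lemma every_edge_reaches_far:
  assumes n: "0 \<le> n" and e: "f \<in> face_set negs" "e \<in> sides f"
  shows "\<exists>e'\<in>far_edges n. (e, e') \<in> ground\<^sup>*"
proof -
  have reach: "\<exists>e'\<in>far_edges n. (rung i j a b, e') \<in> ground\<^sup>*" if "axes i j" "a \<le> 0" "b \<le> -1" for i j a b
    using that(2,3)
  proof (induction "nat (a + n + 1)" arbitrary: a b rule: less_induct)
    case less
    show ?case
    proof (cases "far n (pt i j (a - 1) b)")
      case True
      then have "(quad_face i j (a - 1) b) \<in> far_faces n negs"
        using face_quadrant[OF that(1)] less.prems by (simp add: far_faces_def cx_quad_face)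
      moreover have "rung i j a b \<in> sides (quad_face i j (a - 1) b)"
        unfolding sides_quadrant[OF that(1)] by simp
      ultimately have "rung i j a b \<in> far_edges n" unfolding far_edges_def by blast
      then show ?thesis by blast
    next
      case False
      then have a: "a - 1 \<ge> -n" using far_quadrant[OF that(1) n] by auto
      have 1: "(rung j i b (a - 1), rung i j a b) \<in> ground"
        using ground_step[OF axes_sym[OF that(1)], of b "a - 1"] less.prems by simp
      have 2: "(rung i j (a - 1) (b - 1), rung j i b (a - 1)) \<in> ground"
        using ground_step[OF that(1), of "a - 1" "b - 1"] less.prems by simp
      have "(rung i j a b, rung i j (a - 1) (b - 1)) \<in> ground\<^sup>*"
        by (rule ground_sym[OF converse_rtrancl_into_rtrancl[OF 2 r_into_rtrancl[OF 1]]])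
      moreover have "\<exists>e'\<in>far_edges n. (rung i j (a - 1) (b - 1), e') \<in> ground\<^sup>*"
        by (rule less.hyps) (use a less.prems in auto)
      ultimately show ?thesis by (meson rtrancl_trans)
    qed
  qed
  obtain i j a b where f: "axes i j" "a \<le> -1" "b \<le> -1" "f = (quad_face i j a b)"
    using octant_faceE[OF e(1)] by metis
  show ?thesis using e(2) reach[OF f(1), of a b] reach[OF f(1), of "a + 1" b] reach[OF axes_sym[OF f(1)], of b a]
      reach[OF axes_sym[OF f(1)], of "b + 1" a] f(2,3)
    unfolding f(4) sides_quadrant[OF f(1)] by auto
qed

definition mid :: "edge \<Rightarrow> lattice" where "mid e = (\<Sum>p\<in>e. p)"

lemma mid_edge: "mid (edge (Suc 0) (a, b, c)) = (2 * a + 1, 2 * b, 2 * c)" "mid (edge 2 (a, b, c)) = (2 * a, 2 * b + 1, 2 * c)"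
  "mid (edge 3 (a, b, c)) = (2 * a, 2 * b, 2 * c + 1)"
  by (simp_all add: mid_def edge_def)

text \<open>The diagonal on which a path of the ground configuration runs, for the paths that enter the
  cube of side \<open>n\<close>. It is constant along the path outside of the cube, and it tells apart the edges
  at which these paths enter.\<close>

definition diagonal :: "int \<Rightarrow> edge \<Rightarrow> nat \<times> int" where
  "diagonal n e = (case mid e of (x, y, z) \<Rightarrow>
     if z = 0 \<and> x < 0 \<and> y < 0 \<and> \<bar>x - y\<bar> < 2 * n then (3, x - y)
     else if y = 0 \<and> x < 0 \<and> z < 0 \<and> \<bar>x - z\<bar> < 2 * n then (2, x - z)
     else if x = 0 \<and> y < 0 \<and> z < 0 \<and> \<bar>y - z\<bar> < 2 * n then (1, y - z) else (0, 0))"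

lemma diagonal_far:
  assumes "(e, e') \<in> linkage (far_faces n negs) (\<lambda>_. C1 Blue)" "0 \<le> n"
  shows "diagonal n e = diagonal n e'"
proof -
  obtain f c where f: "f \<in> face_set negs" "far n (cx f)" "({e, e'}, c) \<in> strands f (C1 Blue)"
    using assms(1) unfolding linkage_def far_faces_def by blast
  show ?thesis using f(1)
  proof (cases rule: face_cases)
    case (12 x y z)
    then have 0: "z = 0" "x < 0" "y < 0" by (simp_all add: negs_def)
    have "far n (x, y, z)" using f(2) unfolding 12(1) cx_def prod.case .
    then have far: "x < -n \<or> y < -n" using 0(1) assms(2) unfolding far_def prod.case by linarith
    have "{e, e'} = {edge 1 (x, y, z), edge 2 (x + 1, y, z)} \<or> {e, e'} = {edge 1 (x, y + 1, z), edge 2 (x, y, z)}"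
      using f(3) unfolding 12(1) strands_edge insert_iff empty_iff prod.inject simp_thms evec_simps add_Pair add_0_right
      by argo
    then consider "e = edge 1 (x, y, z)" "e' = edge 2 (x + 1, y, z)" | "e = edge 2 (x + 1, y, z)" "e' = edge 1 (x, y, z)" | "e = edge 1 (x, y + 1, z)" "e' = edge 2 (x, y, z)" | "e = edge 2 (x, y, z)" "e' = edge 1 (x, y + 1, z)"
      unfolding doubleton_eq_iff by metis
    then show ?thesis using 0 far by cases (auto simp: diagonal_def mid_edge)
  next
    case (13 x y z)
    then have 0: "y = 0" "x < 0" "z < 0" by (simp_all add: negs_def)
    have "far n (x, y, z)" using f(2) unfolding 13(1) cx_def prod.case .
    then have far: "x < -n \<or> z < -n" using 0(1) assms(2) unfolding far_def prod.case by linarith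
    have "{e, e'} = {edge 1 (x, y, z), edge 3 (x + 1, y, z)} \<or> {e, e'} = {edge 1 (x, y, z + 1), edge 3 (x, y, z)}"
      using f(3) unfolding 13(1) strands_edge insert_iff empty_iff prod.inject simp_thms evec_simps add_Pair add_0_right
      by argo
    then consider "e = edge 1 (x, y, z)" "e' = edge 3 (x + 1, y, z)" | "e = edge 3 (x + 1, y, z)" "e' = edge 1 (x, y, z)" | "e = edge 1 (x, y, z + 1)" "e' = edge 3 (x, y, z)" | "e = edge 3 (x, y, z)" "e' = edge 1 (x, y, z + 1)"
      unfolding doubleton_eq_iff by metis
    then show ?thesis using 0 far by cases (auto simp: diagonal_def mid_edge)
  next
    case (23 x y z)
    then have 0: "x = 0" "y < 0" "z < 0" by (simp_all add: negs_def)
    have "far n (x, y, z)" using f(2) unfolding 23(1) cx_def prod.case .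
    then have far: "y < -n \<or> z < -n" using 0(1) assms(2) unfolding far_def prod.case by linarith
    have "{e, e'} = {edge 2 (x, y, z), edge 3 (x, y + 1, z)} \<or> {e, e'} = {edge 2 (x, y, z + 1), edge 3 (x, y, z)}"
      using f(3) unfolding 23(1) strands_edge insert_iff empty_iff prod.inject simp_thms evec_simps add_Pair add_0_right
      by argo
    then consider "e = edge 2 (x, y, z)" "e' = edge 3 (x, y + 1, z)" | "e = edge 3 (x, y + 1, z)" "e' = edge 2 (x, y, z)" | "e = edge 2 (x, y, z + 1)" "e' = edge 3 (x, y, z)" | "e = edge 3 (x, y, z)" "e' = edge 2 (x, y, z + 1)"
      unfolding doubleton_eq_iff by metis
    then show ?thesis using 0 far by cases (auto simp: diagonal_def mid_edge)
  qed
qed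

definition gate_shape :: "int \<Rightarrow> edge \<Rightarrow> bool" where
  "gate_shape n e \<longleftrightarrow> (\<exists>b. -n \<le> b \<and> b \<le> -1 \<and>
     (e = edge 2 (-n, b, 0) \<or> e = edge 1 (b, -n, 0) \<or> e = edge 3 (-n, 0, b) \<or>
      e = edge 1 (b, 0, -n) \<or> e = edge 3 (0, -n, b) \<or> e = edge 2 (0, b, -n)))"

lemma near_far_gate:
  assumes "f \<in> near_faces n negs" "f' \<in> far_faces n negs" "e \<in> sides f" "e \<in> sides f'" "0 \<le> n"
  shows "gate_shape n e"
proof -
  have f: "f \<in> face_set negs" "\<not> far n (cx f)" and f': "f' \<in> {h \<in> face_set negs. e \<in> sides h}" "far n (cx f')"
    using assms by (auto simp: near_faces_def far_faces_def)
  show ?thesis using f(1)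
  proof (cases rule: face_cases)
    case (12 a b c)
    then have c: "c = 0" "a < 0" "b < 0" by (auto simp: negs_def)
    have ab: "-n \<le> a" "-n \<le> b" using f(2) 12(1) by (auto simp: far_def cx_def)
    have "e = edge 1 (a, b, 0) \<or> e = edge 2 (a + 1, b, 0) \<or> e = edge 1 (a, b + 1, 0) \<or> e = edge 2 (a, b, 0)"
      using assms(3) unfolding 12(1) sides_edge c(1) by auto
    then show ?thesis
      using f' c ab assms(5)
      by (elim disjE; hypsubst; simp only: faces_at_edge; simp add: negs_def; elim disjE conjE; simp add: far_def cx_def gate_shape_def)
  next
    case (13 a b c)
    then have c: "b = 0" "a < 0" "c < 0" by (auto simp: negs_def)
    have ab: "-n \<le> a" "-n \<le> c" using f(2) 13(1) by (auto simp: far_def cx_def)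
    have "e = edge 1 (a, 0, c) \<or> e = edge 3 (a + 1, 0, c) \<or> e = edge 1 (a, 0, c + 1) \<or> e = edge 3 (a, 0, c)"
      using assms(3) unfolding 13(1) sides_edge c(1) by auto
    then show ?thesis
      using f' c ab assms(5)
      by (elim disjE; hypsubst; simp only: faces_at_edge; simp add: negs_def; elim disjE conjE; simp add: far_def cx_def gate_shape_def)
  next
    case (23 a b c)
    then have c: "a = 0" "b < 0" "c < 0" by (auto simp: negs_def)
    have ab: "-n \<le> b" "-n \<le> c" using f(2) 23(1) by (auto simp: far_def cx_def)
    have "e = edge 2 (0, b, c) \<or> e = edge 3 (0, b + 1, c) \<or> e = edge 2 (0, b, c + 1) \<or> e = edge 3 (0, b, c)"
      using assms(3) unfolding 23(1) sides_edge c(1) by auto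
    then show ?thesis
      using f' c ab assms(5)
      by (elim disjE; hypsubst; simp only: faces_at_edge; simp add: negs_def; elim disjE conjE; simp add: far_def cx_def gate_shape_def)
  qed
qed

lemma diagonal_gate:
  assumes "gate_shape n e" "gate_shape n e'" "diagonal n e = diagonal n e'"
  shows "e = e'"
proof -
  have d: "-n \<le> b \<Longrightarrow> b \<le> -1 \<Longrightarrow> diagonal n (edge 2 (-n, b, 0)) = (3, - 2 * n - (2 * b + 1))"
    "-n \<le> b \<Longrightarrow> b \<le> -1 \<Longrightarrow> diagonal n (edge 1 (b, -n, 0)) = (3, 2 * n + (2 * b + 1))"
    "-n \<le> b \<Longrightarrow> b \<le> -1 \<Longrightarrow> diagonal n (edge 3 (-n, 0, b)) = (2, - 2 * n - (2 * b + 1))"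
    "-n \<le> b \<Longrightarrow> b \<le> -1 \<Longrightarrow> diagonal n (edge 1 (b, 0, -n)) = (2, 2 * n + (2 * b + 1))"
    "-n \<le> b \<Longrightarrow> b \<le> -1 \<Longrightarrow> diagonal n (edge 3 (0, -n, b)) = (1, - 2 * n - (2 * b + 1))"
    "-n \<le> b \<Longrightarrow> b \<le> -1 \<Longrightarrow> diagonal n (edge 2 (0, b, -n)) = (1, 2 * n + (2 * b + 1))" for b
    by (auto simp: diagonal_def mid_edge)
  obtain b where b: "-n \<le> b" "b \<le> -1"
    "e = edge 2 (-n, b, 0) \<or> e = edge 1 (b, -n, 0) \<or> e = edge 3 (-n, 0, b) \<or>
      e = edge 1 (b, 0, -n) \<or> e = edge 3 (0, -n, b) \<or> e = edge 2 (0, b, -n)"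
    using assms(1) unfolding gate_shape_def by blast
  obtain c where c: "-n \<le> c" "c \<le> -1"
    "e' = edge 2 (-n, c, 0) \<or> e' = edge 1 (c, -n, 0) \<or> e' = edge 3 (-n, 0, c) \<or>
      e' = edge 1 (c, 0, -n) \<or> e' = edge 3 (0, -n, c) \<or> e' = edge 2 (0, c, -n)"
    using assms(2) unfolding gate_shape_def by blast
  show ?thesis
    using b(3) c(3) by (elim disjE; use assms(3) b(1,2) c(1,2) in \<open>simp only: d\<close>; auto)
qed

lemma strand_partner_unique:
  assumes "f \<in> face_set S" "({x, y}, c) \<in> strands f \<tau>" "({x, z}, c') \<in> strands f \<tau>"
  shows "y = z"
  using assms(1)
proof (cases rule: face_cases)
  case (12 a b d)
  then show ?thesis using assms(2,3)
    by (cases \<tau>) (auto simp: strands_edge doubleton_eq_iff simp del: strands.simps)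
next
  case (13 a b d)
  then show ?thesis using assms(2,3)
    by (cases \<tau>) (auto simp: strands_edge doubleton_eq_iff simp del: strands.simps)
next
  case (23 a b d)
  then show ?thesis using assms(2,3)
    by (cases \<tau>) (auto simp: strands_edge doubleton_eq_iff simp del: strands.simps)
qed

lemma even_sides:
  assumes "\<And>x y. (x, y) \<in> linkage {f} \<sigma> \<Longrightarrow> P x = P y"
  shows "even (of_bool (P {cx f, cu f}) + of_bool (P {cu f, cy f}) + of_bool (P {cy f, cv f}) + of_bool (P {cv f, cx f}) :: nat)"
proof -
  have "P x = P y" if "({x, y}, c) \<in> strands f (\<sigma> f)" for x y c
    using assms[of x y] that by (auto simp: linkage_def)
  then show ?thesis by (cases "\<sigma> f") fastforce+
qed

lemma even_quadrant:
  assumes "axes i j" "\<And>x y. (x, y) \<in> linkage {quad_face i j a b} \<sigma> \<Longrightarrow> P x = P y"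
  shows "even (of_bool (P (rung i j a b)) + of_bool (P (rung j i b a)) + of_bool (P (rung i j (a + 1) b))
    + of_bool (P (rung j i (b + 1) a)) :: nat)"
proof -
  consider "i = 1" "j = 2" | "i = 2" "j = 1" | "i = 1" "j = 3" | "i = 3" "j = 1" | "i = 2" "j = 3" | "i = 3" "j = 2"
    using assms(1) by (auto simp: axes_def)
  then show ?thesis using even_sides[of "quad_face i j a b" \<sigma> P, OF assms(2)]
    by cases (simp_all add: quad_face_def corner_sides rung_def pt_def axis_def of_bool_def split: if_splits)
qed

lemma blue_face:
  assumes "fits col f \<tau>" "\<And>e. e \<in> sides f \<Longrightarrow> col e = Blue"
  shows "\<tau> = C1 Blue \<or> \<tau> = C2 Blue"
proof -
  have blue: "c = Blue" if "({x, y}, c) \<in> strands f \<tau>" for x y c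
  proof -
    have "x \<in> sides f" using strand_sides[OF that] by blast
    then show ?thesis using fitsD[OF assms(1) that, of x] assms(2) by simp
  qed
  show ?thesis
  proof (cases \<tau>)
    case (C1 c)
    then show ?thesis using blue[of "{cx f, cu f}" "{cu f, cy f}" c] by simp
  next
    case (C2 c)
    then show ?thesis using blue[of "{cu f, cy f}" "{cy f, cv f}" c] by simp
  next
    case (C3 c)
    then show ?thesis
      using blue[of "{cx f, cu f}" "{cu f, cy f}" c] blue[of "{cy f, cv f}" "{cv f, cx f}" "other c"] by simp
  next
    case (C4 c)
    then show ?thesis
      using blue[of "{cu f, cy f}" "{cy f, cv f}" c] blue[of "{cv f, cx f}" "{cx f, cu f}" "other c"] by simp
  next
    case (C5 c)
    then show ?thesis
      using blue[of "{cu f, cy f}" "{cv f, cx f}" c] blue[of "{cx f, cu f}" "{cy f, cv f}" "other c"] by simp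
  qed
qed

lemma rung_eq_iff:
  assumes "axes i j"
  shows "rung i j a b = rung i j a' b' \<longleftrightarrow> a = a' \<and> b = b'"
  using assms unfolding axes_def by (auto simp: rung_def pt_def axis_def)

lemma rung_direction:
  assumes "axes i j" "axes k l" "j \<noteq> l"
  shows "rung i j a b \<noteq> rung k l a' b'"
  using assms edge_eq_iff[of j l "pt i j a b" "pt k l a' b'"] unfolding rung_def axes_def by auto

text \<open>In each quadrant, the \<open>2 n\<close> paths that enter the square of side \<open>n\<close> leave it through the two
  other quadrants. They are therefore distinct and separate the two far corners of the square on the
  axes, whose distance is \<open>2 n\<close>. Hence every edge of the square is on exactly one of these blue
  paths, and there is no room for anything but the ground configuration.\<close>

theorem octant_rigid:
  assumes \<sigma>: "\<sigma> \<in> taut n negs" and n: "0 \<le> n" and f: "f \<in> face_set negs"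
  shows "\<sigma> f = C1 Blue"
proof (cases "far n (cx f)")
  case True
  then show ?thesis using \<sigma> f by (simp add: taut_def far_faces_def)
next
  case False
  obtain i j a b where ij: "axes i j" and ab: "a \<le> -1" "b \<le> -1" and fq: "f = quad_face i j a b"
    using octant_faceE[OF f] by metis
  have ab': "-n \<le> a" "-n \<le> b" using False far_quadrant[OF ij n] unfolding fq cx_quad_face by auto
  have "axes i (6 - i - j) \<and> axes j (6 - i - j) \<and> 6 - i - j \<noteq> i \<and> 6 - i - j \<noteq> j"
    using ij unfolding axes_def by (elim insertE emptyE) simp_all
  then obtain k where k: "axes i k" "axes j k" "k \<noteq> i" "k \<noteq> j" by blast
  obtain col where col: "\<And>f. f \<in> face_set negs \<Longrightarrow> fits col f (\<sigma> f)" using \<sigma> by (auto simp: taut_def loops_def)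
  have far_blue: "\<sigma> f = C1 Blue" if "f \<in> far_faces n negs" for f using \<sigma> that by (simp add: taut_def)
  define A where "A = linkage (far_faces n negs) \<sigma>"
  define B where "B = linkage (near_faces n negs) \<sigma>"
  define L where "L = linkage (face_set negs) \<sigma>"
  define N where "N = (\<Union>f\<in>near_faces n negs. sides f)"
  have L: "L = B \<union> A" unfolding L_def A_def B_def by (subst face_set_split[of negs n]) (simp add: linkage_Un Un_commute)
  have A_ground: "A = linkage (far_faces n negs) (\<lambda>_. C1 Blue)" unfolding A_def by (rule linkage_cong) (rule far_blue)
  have BN: "B \<subseteq> N \<times> N" unfolding B_def N_def using linkage_sides by fastforce
  have Lsym: "(y, x) \<in> L\<^sup>*" if "(x, y) \<in> L\<^sup>*" for x y using that unfolding L_def by (rule linkage_rtrancl_sym)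
  have Ltrans: "(x, z) \<in> L\<^sup>*" if "(x, y) \<in> L\<^sup>*" "(y, z) \<in> L\<^sup>*" for x y z using that by (rule rtrancl_trans)
  have A_id: "x = y" if xy: "(x, y) \<in> A\<^sup>*" "x \<in> N" "y \<in> N" for x y
  proof (rule ccontr)
    assume "x \<noteq> y"
    then obtain x' y' where "(x, x') \<in> A" "(y', y) \<in> A" using xy(1) by (metis converse_rtranclE rtranclE)
    then obtain g g' where g: "g \<in> far_faces n negs" "x \<in> sides g" "g' \<in> far_faces n negs" "y \<in> sides g'"
      unfolding A_def using linkage_sides by blast
    obtain h h' where h: "h \<in> near_faces n negs" "x \<in> sides h" "h' \<in> near_faces n negs" "y \<in> sides h'"
      using xy(2,3) unfolding N_def by blast
    have "gate_shape n x" "gate_shape n y"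
      using near_far_gate[OF h(1) g(1) h(2) g(2) n] near_far_gate[OF h(3) g(3) h(4) g(4) n] .
    moreover have "diagonal n x = diagonal n y"
      using xy(1)
    proof (induction rule: rtrancl_induct)
      case (step y z)
      then show ?case using diagonal_far[OF _ n] unfolding A_ground by metis
    qed simp
    ultimately show False using diagonal_gate \<open>x \<noteq> y\<close> by blast
  qed
  have inner: "(x, y) \<in> B\<^sup>*" if xy: "(x, y) \<in> L\<^sup>*" "x \<in> N" "y \<in> N" for x y
  proof -
    have "(x, y) \<in> (B \<union> (A\<^sup>* \<inter> N \<times> N))\<^sup>*"
      using xy(1) unfolding L using rtrancl_Un_interface[OF BN xy(2,3), of A] by simp
    moreover have "B \<union> (A\<^sup>* \<inter> N \<times> N) \<subseteq> B \<union> Id" using A_id by blast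
    ultimately have "(x, y) \<in> (B \<union> Id)\<^sup>*" using rtrancl_mono by blast
    then show ?thesis by (simp only: rtrancl_reflcl)
  qed
  have strand: "\<exists>f\<in>near_faces n negs. x \<in> sides f \<and> y \<in> sides f \<and> (\<exists>c. ({x, y}, c) \<in> strands f (\<sigma> f))"
    if xyB: "(x, y) \<in> B" for x y
  proof -
    obtain f c where f: "f \<in> near_faces n negs" "({x, y}, c) \<in> strands f (\<sigma> f)"
      using xyB unfolding B_def linkage_def by blast
    have "{x, y} \<subseteq> sides f" by (rule strand_sides[OF f(2)])
    then show ?thesis using f by blast
  qed
  have same: "y = z" if "f \<in> near_faces n negs" "({x, y}, c) \<in> strands f (\<sigma> f)" "({x, z}, c') \<in> strands f (\<sigma> f)" for f x y z c c'
  proof -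
    have "f \<in> face_set negs" using that(1) by (simp add: near_faces_def)
    then show ?thesis by (rule strand_partner_unique[OF _ that(2,3)])
  qed
  have Bsym: "(y, x) \<in> B" if "(x, y) \<in> B" for x y using that unfolding B_def by (rule linkage_sym)
  have deg: "y = z \<or> y = w \<or> z = w" if xB: "(x, y) \<in> B" "(x, z) \<in> B" "(x, w) \<in> B" for x y z w
  proof -
    obtain f1 c1 where 1: "f1 \<in> near_faces n negs" "x \<in> sides f1" "({x, y}, c1) \<in> strands f1 (\<sigma> f1)" using strand[OF xB(1)] by blast
    obtain f2 c2 where 2: "f2 \<in> near_faces n negs" "x \<in> sides f2" "({x, z}, c2) \<in> strands f2 (\<sigma> f2)" using strand[OF xB(2)] by blast
    obtain f3 c3 where 3: "f3 \<in> near_faces n negs" "x \<in> sides f3" "({x, w}, c3) \<in> strands f3 (\<sigma> f3)" using strand[OF xB(3)] by blast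
    have "f1 \<in> face_set negs" using 1(1) by (simp add: near_faces_def)
    then obtain f' where "f' \<noteq> f1" and two: "{h \<in> face_set negs. x \<in> sides h} = {f1, f'}"
      by (rule edge_in_two_faces[OF downset_negs _ 1(2)])
    have "f2 \<in> {h \<in> face_set negs. x \<in> sides h}" "f3 \<in> {h \<in> face_set negs. x \<in> sides h}"
      using 2(1,2) 3(1,2) by (simp_all add: near_faces_def)
    then consider "f2 = f1" | "f3 = f1" | "f2 = f3" unfolding two by blast
    then show ?thesis
    proof cases
      assume eq: "f2 = f1"
      show ?thesis using same[OF 1(1,3) 2(3)[unfolded eq]] by simp
    next
      assume eq: "f3 = f1"
      show ?thesis using same[OF 1(1,3) 3(3)[unfolded eq]] by simp
    next
      assume eq: "f2 = f3"
      show ?thesis using same[OF 2(1,3) 3(3)[folded eq]] by simp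
    qed
  qed
  have gate: "rung p q (-n) t \<in> far_edges n" "rung p q (-n) t \<in> N"
    "\<And>y z. (rung p q (-n) t, y) \<in> B \<Longrightarrow> (rung p q (-n) t, z) \<in> B \<Longrightarrow> y = z" "col (rung p q (-n) t) = Blue"
    if pq: "axes p q" and t: "-n \<le> t" "t < 0" for p q t
  proof -
    let ?e = "rung p q (-n) t"
    let ?g = "quad_face p q (-n - 1) t" and ?h = "quad_face p q (-n) t"
    have g: "?g \<in> far_faces n negs" "?e \<in> sides ?g"
      using face_quadrant[OF pq] t n far_quadrant[OF pq n] sides_quadrant[OF pq, of "-n - 1" t]
      by (auto simp: far_faces_def cx_quad_face)
    have h: "?h \<in> near_faces n negs" "?e \<in> sides ?h"
      using face_quadrant[OF pq] t n far_quadrant[OF pq n] sides_quadrant[OF pq, of "-n" t]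
      by (auto simp: near_faces_def cx_quad_face)
    show "?e \<in> far_edges n" unfolding far_edges_def using g by blast
    show "?e \<in> N" unfolding N_def using h by blast
    have gS: "?g \<in> face_set negs" "far n (cx ?g)" using g(1) by (auto simp: far_faces_def)
    obtain f' where "f' \<noteq> ?g" and two: "{h \<in> face_set negs. ?e \<in> sides h} = {?g, f'}"
      by (rule edge_in_two_faces[OF downset_negs gS(1) g(2)])
    have only: "f1 = f2" if "f1 \<in> near_faces n negs" "?e \<in> sides f1" "f2 \<in> near_faces n negs" "?e \<in> sides f2" for f1 f2
    proof -
      have "f1 \<in> {h \<in> face_set negs. ?e \<in> sides h}" "f2 \<in> {h \<in> face_set negs. ?e \<in> sides h}" "f1 \<noteq> ?g" "f2 \<noteq> ?g"
        using that gS(2) unfolding near_faces_def by blast+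
      then show ?thesis unfolding two by blast
    qed
    show "y = z" if yz: "(?e, y) \<in> B" "(?e, z) \<in> B" for y z
    proof -
      obtain f1 c1 where 1: "f1 \<in> near_faces n negs" "?e \<in> sides f1" "({?e, y}, c1) \<in> strands f1 (\<sigma> f1)" using strand[OF yz(1)] by blast
      obtain f2 c2 where 2: "f2 \<in> near_faces n negs" "?e \<in> sides f2" "({?e, z}, c2) \<in> strands f2 (\<sigma> f2)" using strand[OF yz(2)] by blast
      show ?thesis using same[OF 2(1) 1(3)[unfolded only[OF 1(1,2) 2(1,2)]] 2(3)] .
    qed
    have "\<exists>s. (s, Blue) \<in> strands ?g (C1 Blue) \<and> ?e \<in> s"
      using g(2) by (auto simp: sides_def)
    then obtain s where "(s, Blue) \<in> strands ?g (\<sigma> ?g)" "?e \<in> s" unfolding far_blue[OF g(1)] by blast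
    then show "col ?e = Blue" by (rule fitsD[OF col[OF gS(1)]])
  qed
  have partner: "(rung p q (-n) t, rung p r (-n) t) \<in> L\<^sup>*"
    if "axes p q" "axes p r" "-n \<le> t" "t < 0" for p q r t
  proof -
    have "(rung p q (-n) t, rung p r (-n) t) \<in> ground\<^sup>*" using ground_gate_partner[OF that(1,2)] that(3,4) by simp
    then show ?thesis using \<sigma> gate(1)[OF that(1,3,4)] gate(1)[OF that(2,3,4)] unfolding taut_def L_def by blast
  qed
  define ev where "ev = rung i j"
  define eh where "eh = (\<lambda>a b. rung j i b a)"
  define \<Gamma> where "\<Gamma> = ev (-n) ` {-n..<0} \<union> (\<lambda>t. eh t (-n)) ` {-n..<0}"
  have ji: "axes j i" by (rule axes_sym[OF ij])
  have \<Gamma>E: "\<exists>p q t. (p = i \<and> q = j \<or> p = j \<and> q = i) \<and> -n \<le> t \<and> t < 0 \<and> l = rung p q (-n) t" if "l \<in> \<Gamma>" for l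
    using that[unfolded \<Gamma>_def ev_def eh_def]
  proof (elim UnE imageE)
    fix t assume "l = rung i j (-n) t" "t \<in> {-n..<0}"
    then show ?thesis by (intro exI[of _ i] exI[of _ j] exI[of _ t]) simp
  next
    fix t assume "l = rung j i (-n) t" "t \<in> {-n..<0}"
    then show ?thesis by (intro exI[of _ j] exI[of _ i] exI[of _ t]) simp
  qed
  have distinct: "l = m" if l: "l \<in> \<Gamma>" and m: "m \<in> \<Gamma>" and lm: "(l, m) \<in> L\<^sup>*" for l m
  proof (rule ccontr)
    assume "l \<noteq> m"
    obtain p q t where pq: "p = i \<and> q = j \<or> p = j \<and> q = i" and t: "-n \<le> t" "t < 0" "l = rung p q (-n) t" using \<Gamma>E[OF l] by blast
    obtain p' q' t' where pq': "p' = i \<and> q' = j \<or> p' = j \<and> q' = i" and t': "-n \<le> t'" "t' < 0" "m = rung p' q' (-n) t'" using \<Gamma>E[OF m] by blast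
    have ax: "axes p q" "axes p k" "axes p' q'" "k \<noteq> q" "k \<noteq> q'" using pq pq' ij ji k by auto
    define h where "h = rung p k (-n) t"
    have hl: "h \<noteq> l" "h \<noteq> m" unfolding h_def t(3) t'(3) using rung_direction ax by auto
    have NN: "l \<in> N" "m \<in> N" "h \<in> N" unfolding h_def t(3) t'(3) using gate(2) ax t t' by auto
    have lhB: "(l, h) \<in> B\<^sup>*" using inner[OF partner[OF ax(1,2) t(1,2)]] NN unfolding h_def t(3) by blast
    have lmB: "(l, m) \<in> B\<^sup>*" using inner[OF lm] NN by blast
    have "m = l \<or> m = h"
    proof (rule two_ends[of B l h m])
      show "(y, x) \<in> B" if "(x, y) \<in> B" for x y by (rule Bsym[OF that])
      show "y = z \<or> y = w \<or> z = w" if "(x, y) \<in> B" "(x, z) \<in> B" "(x, w) \<in> B" for x y z w by (rule deg[OF that])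
      show "y = z" if "(l, y) \<in> B" "(l, z) \<in> B" for y z by (rule gate(3)[OF ax(1) t(1,2), folded t(3), OF that])
      show "y = z" if "(h, y) \<in> B" "(h, z) \<in> B" for y z by (rule gate(3)[OF ax(2) t(1,2), folded h_def, OF that])
      show "y = z" if "(m, y) \<in> B" "(m, z) \<in> B" for y z by (rule gate(3)[OF ax(3) t'(1,2), folded t'(3), OF that])
    qed (use lhB lmB hl in blast)+
    then show False using \<open>l \<noteq> m\<close> hl by blast
  qed
  let ?M = "\<lambda>l e. (l, e) \<in> L\<^sup>*"
  have inj: "inj_on (ev (-n)) {-n..<0}" "inj_on (\<lambda>t. eh t (-n)) {-n..<0}"
    unfolding inj_on_def ev_def eh_def using rung_eq_iff[OF ij] rung_eq_iff[OF ji] by auto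
  have i_ne_j: "i \<noteq> j" using ij by (auto simp: axes_def)
  have disj: "ev (-n) ` {-n..<0} \<inter> (\<lambda>t. eh t (-n)) ` {-n..<0} = {}"
    unfolding ev_def eh_def using rung_direction[OF ij ji] i_ne_j by auto
  have fin: "finite \<Gamma>" unfolding \<Gamma>_def by simp
  have card: "int (card \<Gamma>) = 2 * n"
    unfolding \<Gamma>_def by (subst card_Un_disjoint) (use disj n inj in \<open>auto simp: card_image\<close>)
  have uniq: "l = m" if "l \<in> \<Gamma>" "m \<in> \<Gamma>" "?M l e" "?M m e" for e l m
    using distinct[OF that(1,2)] Ltrans[OF that(3) Lsym[OF that(4)]] by blast
  have face: "even (of_bool (?M l (ev a b)) + of_bool (?M l (eh a b)) + of_bool (?M l (ev (a + 1) b)) + of_bool (?M l (eh a (b + 1))) :: nat)"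
    if "-n \<le> a" "a < 0" "-n \<le> b" "b < 0" for l a b
  proof -
    have q: "quad_face i j a b \<in> face_set negs" using face_quadrant[OF ij] that by simp
    have "?M l x = ?M l y" if "(x, y) \<in> linkage {quad_face i j a b} \<sigma>" for x y
    proof -
      have "(x, y) \<in> L" unfolding L_def using that linkage_mono[of "{quad_face i j a b}" "face_set negs" \<sigma>] q by blast
      then show ?thesis using Ltrans Lsym by blast
    qed
    from even_quadrant[OF ij, of a b \<sigma> "?M l", OF this] show ?thesis unfolding ev_def eh_def .
  qed
  have self: "{t \<in> {-n..<0}. ?M l (ev (-n) t)} = {t \<in> {-n..<0}. l = ev (-n) t}"
    "{t \<in> {-n..<0}. ?M l (eh t (-n))} = {t \<in> {-n..<0}. l = eh t (-n)}" if l: "l \<in> \<Gamma>" for l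
  proof -
    have "?M l (ev (-n) t) \<longleftrightarrow> l = ev (-n) t" "?M l (eh t (-n)) \<longleftrightarrow> l = eh t (-n)" if "t \<in> {-n..<0}" for t
    proof -
      have "ev (-n) t \<in> \<Gamma>" "eh t (-n) \<in> \<Gamma>" unfolding \<Gamma>_def using that by blast+
      then show "?M l (ev (-n) t) \<longleftrightarrow> l = ev (-n) t" "?M l (eh t (-n)) \<longleftrightarrow> l = eh t (-n)"
        using distinct[OF l] by blast+
    qed
    then show "{t \<in> {-n..<0}. ?M l (ev (-n) t)} = {t \<in> {-n..<0}. l = ev (-n) t}"
      "{t \<in> {-n..<0}. ?M l (eh t (-n))} = {t \<in> {-n..<0}. l = eh t (-n)}" by blast+
  qed
  have boundary: "odd (card {t \<in> {-n..<0}. ?M l (ev (-n) t)} + card {t \<in> {-n..<0}. ?M l (eh t (-n))})" if l: "l \<in> \<Gamma>" for l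
  proof -
    consider t where "t \<in> {-n..<0}" "l = ev (-n) t" | t where "t \<in> {-n..<0}" "l = eh t (-n)"
      using l unfolding \<Gamma>_def by blast
    then show ?thesis
    proof cases
      case 1
      then have A: "{s \<in> {-n..<0}. l = ev (-n) s} = {t}" using inj(1) by (auto simp: inj_on_def)
      have "l \<notin> (\<lambda>t. eh t (-n)) ` {-n..<0}" using 1 disj by blast
      then have B: "{s \<in> {-n..<0}. l = eh s (-n)} = {}" by blast
      show ?thesis unfolding self[OF l] A B by simp
    next
      case 2
      then have A: "{s \<in> {-n..<0}. l = eh s (-n)} = {t}" using inj(2) by (auto simp: inj_on_def)
      have "l \<notin> ev (-n) ` {-n..<0}" using 2 disj by blast
      then have B: "{s \<in> {-n..<0}. l = ev (-n) s} = {}" by blast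
      show ?thesis unfolding self[OF l] A B by simp
    qed
  qed
  have blue: "col e = Blue" if le: "l \<in> \<Gamma>" "?M l e" for l e
  proof -
    have "col l = Blue" using \<Gamma>E[OF le(1)] gate(4) ij ji by blast
    with le(2) show ?thesis
    proof (induction rule: rtrancl_induct)
      case (step y z)
      then obtain f c where "f \<in> face_set negs" "({y, z}, c) \<in> strands f (\<sigma> f)" unfolding L_def linkage_def by blast
      then show ?case using fitsD[OF col, of f "{y, z}" c] step by auto
    qed
  qed
  have V: "\<exists>l\<in>\<Gamma>. ?M l (ev x y)" if "-n \<le> x" "x \<le> 0" "-n \<le> y" "y < 0" for x y
    by (rule grid_crossings(1)[where ev = ev and eh = eh and M = ?M and n = n and \<Gamma> = \<Gamma> and a = x and b = y];
      (rule n fin card | (rule uniq, assumption+) | (rule face, assumption+) | (rule boundary, assumption) | (rule that)))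
  have H: "\<exists>l\<in>\<Gamma>. ?M l (eh x y)" if "-n \<le> x" "x < 0" "-n \<le> y" "y \<le> 0" for x y
    by (rule grid_crossings(2)[where ev = ev and eh = eh and M = ?M and n = n and \<Gamma> = \<Gamma> and a = x and b = y];
      (rule n fin card | (rule uniq, assumption+) | (rule face, assumption+) | (rule boundary, assumption) | (rule that)))
  have once: "\<not> ?M l (eh x y)" if "-n \<le> x" "x < 0" "-n \<le> y" "y < 0" "l \<in> \<Gamma>" "?M l (ev x y)" for l x y
    by (rule grid_crossings(3)[where ev = ev and eh = eh and M = ?M and n = n and \<Gamma> = \<Gamma> and a = x and b = y];
      (rule n fin card | (rule uniq, assumption+) | (rule face, assumption+) | (rule boundary, assumption) | (rule that)))
  have "col e = Blue" if "e \<in> sides f" for e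
  proof -
    have "e = eh a b \<or> e = ev (a + 1) b \<or> e = eh a (b + 1) \<or> e = ev a b"
      using that unfolding fq sides_quadrant[OF ij] ev_def eh_def by blast
    then show ?thesis using V[of a b] V[of "a + 1" b] H[of a b] H[of a "b + 1"] ab ab' blue by auto
  qed
  then have "\<sigma> f = C1 Blue \<or> \<sigma> f = C2 Blue" by (rule blue_face[OF col[OF f]])
  moreover have "\<sigma> f \<noteq> C2 Blue"
  proof
    assume C2: "\<sigma> f = C2 Blue"
    obtain l where l: "l \<in> \<Gamma>" "?M l (ev a b)" using V[of a b] ab ab' by auto
    have "({ev a b, eh a b}, Blue) \<in> strands f (C2 Blue)"
      unfolding fq ev_def eh_def by (rule strands_quadrant(2)[OF ij])
    then have "({ev a b, eh a b}, Blue) \<in> strands f (\<sigma> f)" by (simp only: C2)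
    then have "(ev a b, eh a b) \<in> L" unfolding L_def linkage_def using f by blast
    then have "?M l (eh a b)" using l(2) by (rule rtrancl_into_rtrancl[rotated])
    moreover have "\<not> ?M l (eh a b)" using once[of a b l] ab ab' l by simp
    ultimately show False by blast
  qed
  ultimately show ?thesis by blast
qed

section \<open>Functions on the faces whose sums around the vertices vanish\<close>

text \<open>All faces that may have the given vertex as a corner: three for which it is the corner \<open>x\<close>, then
  three for each of the corners \<open>y\<close>, \<open>u\<close>, \<open>v\<close>.\<close>

definition faces_around :: "lattice \<Rightarrow> face list" where
  "faces_around = (\<lambda>(a, b, c).
    [((a, b, c), 1, 2), ((a, b, c), 1, 3), ((a, b, c), 2, 3),
     ((a - 1, b - 1, c), 1, 2), ((a - 1, b, c - 1), 1, 3), ((a, b - 1, c - 1), 2, 3),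
     ((a - 1, b, c), 1, 2), ((a - 1, b, c), 1, 3), ((a, b - 1, c), 2, 3),
     ((a, b - 1, c), 1, 2), ((a, b, c - 1), 1, 3), ((a, b, c - 1), 2, 3)])"

text \<open>A finitely supported function on the faces whose sum around every vertex vanishes is zero. In the
  direction where its support reaches farthest, the squares of two of the three kinds cannot stop:
  each of them forces the next one of its row into the support, which is finite. A square of the third
  kind is then alone at its extreme corner.\<close>

lemma zero_vertex_sums:
  fixes D :: "face \<Rightarrow> 'a::linordered_idom"
  assumes S: "downset S" and supp: "\<And>f. D f \<noteq> 0 \<Longrightarrow> f \<in> face_set S" and fin: "finite {f. D f \<noteq> 0}"
    and sum: "\<And>p. (\<Sum>f\<leftarrow>faces_around p. D f) = 0"
  shows "D f = 0"
proof (rule ccontr)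
  assume "D f \<noteq> 0"
  define top :: "face \<Rightarrow> int" where "top = (\<lambda>((a, b, c), i, j). a - c + (if i = 1 then 1 else 0))"
  define m where "m = Max (top ` {f. D f \<noteq> 0})"
  have le: "top f \<le> m" if "D f \<noteq> 0" for f unfolding m_def using fin that by (intro Max_ge) auto
  have "m \<in> top ` {f. D f \<noteq> 0}" unfolding m_def
    by (rule Max_in) (use fin \<open>D f \<noteq> 0\<close> in blast)+
  then obtain h where h: "D h \<noteq> 0" "top h = m" by blast
  have down: "(i', j', k') \<in> S" if "(i, j, k) \<in> S" "i' \<le> i" "j' \<le> j" "k' \<le> k" for i j k i' j' k'
    using downsetD[OF S that] .
  have z12: "D ((a, b, c), 1, 2) = 0" if "(a, b, c) \<in> S \<or> (a, b, c - 1) \<notin> S \<or> m < a - c + 1" for a b c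
    using that supp[of "((a, b, c), 1, 2)"] le[of "((a, b, c), 1, 2)"]
    unfolding top_def by (cases "D ((a, b, c), 1, 2) = 0") auto
  have z13: "D ((a, b, c), 1, 3) = 0" if "(a, b, c) \<in> S \<or> (a, b - 1, c) \<notin> S \<or> m < a - c + 1" for a b c
    using that supp[of "((a, b, c), 1, 3)"] le[of "((a, b, c), 1, 3)"]
    unfolding top_def by (cases "D ((a, b, c), 1, 3) = 0") auto
  have z23: "D ((a, b, c), 2, 3) = 0" if "(a, b, c) \<in> S \<or> (a - 1, b, c) \<notin> S \<or> m < a - c" for a b c
    using that supp[of "((a, b, c), 2, 3)"] le[of "((a, b, c), 2, 3)"]
    unfolding top_def by (cases "D ((a, b, c), 2, 3) = 0") auto
  have in12: "(a, b, c) \<notin> S" "(a, b, c - 1) \<in> S" if "D ((a, b, c), 1, 2) \<noteq> 0" for a b c using supp[OF that] by auto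
  have in23: "(a, b, c) \<notin> S" "(a - 1, b, c) \<in> S" if "D ((a, b, c), 2, 3) \<noteq> 0" for a b c using supp[OF that] by auto
  have in13: "(a, b, c) \<notin> S" "(a, b - 1, c) \<in> S" if "D ((a, b, c), 1, 3) \<noteq> 0" for a b c using supp[OF that] by auto
  have step23: "D ((a, b - 1, c), 2, 3) \<noteq> 0" if nz: "D ((a, b, c), 2, 3) \<noteq> 0" and m: "a - c = m" for a b c
  proof -
    have s: "(a - 1, b - 1, c) \<in> S" "(a - 1, b, c - 1) \<in> S" using in23(2)[OF nz] by (auto elim: down)
    have "(\<Sum>f\<leftarrow>faces_around (a, b, c). D f) = D ((a, b, c), 2, 3) + D ((a, b - 1, c), 2, 3)"
      unfolding faces_around_def using m s in23[OF nz]
      by (simp add: z12[of a b c] z13[of a b c] z12[of "a - 1" "b - 1" c] z13[of "a - 1" b "c - 1"]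
        z23[of a "b - 1" "c - 1"] z12[of "a - 1" b c] z13[of "a - 1" b c] z12[of a "b - 1" c]
        z13[of a b "c - 1"] z23[of a b "c - 1"] del: One_nat_def)
    then show ?thesis using sum[of "(a, b, c)"] nz by auto
  qed
  have step12: "D ((a, b + 1, c), 1, 2) \<noteq> 0" if nz: "D ((a, b, c), 1, 2) \<noteq> 0" and m: "a - c + 1 = m" for a b c
  proof -
    have s: "(a, b + 1, c) \<notin> S" "(a + 1, b, c) \<notin> S" using in12(1)[OF nz] down[of a "b + 1" c a b c] down[of "a + 1" b c a b c] by auto
    have "(\<Sum>f\<leftarrow>faces_around (a + 1, b + 1, c). D f) = D ((a, b, c), 1, 2) + D ((a, b + 1, c), 1, 2)"
      unfolding faces_around_def using m s in12[OF nz]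
      by (simp add: z12[of "a + 1" "b + 1" c] z13[of "a + 1" "b + 1" c] z23[of "a + 1" "b + 1" c] z13[of a "b + 1" "c - 1"]
        z23[of "a + 1" b "c - 1"] z13[of a "b + 1" c] z23[of "a + 1" b c] z12[of "a + 1" b c]
        z13[of "a + 1" "b + 1" "c - 1"] z23[of "a + 1" "b + 1" "c - 1"] del: One_nat_def)
    then show ?thesis using sum[of "(a + 1, b + 1, c)"] nz by auto
  qed
  have row: "infinite {f. D f \<noteq> 0}" if "\<And>k::nat. D (g k) \<noteq> 0" "inj g" for g :: "nat \<Rightarrow> face"
  proof -
    have "range g \<subseteq> {f. D f \<noteq> 0}" using that(1) by auto
    moreover have "infinite (range g)" using that(2) by (simp add: finite_image_iff)
    ultimately show ?thesis using finite_subset by blast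
  qed
  have no23: "D ((a, b, c), 2, 3) = 0" if "a - c = m" for a b c
  proof (rule ccontr)
    assume nz: "D ((a, b, c), 2, 3) \<noteq> 0"
    have "D ((a, b - int k, c), 2, 3) \<noteq> 0" for k
    proof (induction k)
      case (Suc k)
      then show ?case using step23[OF Suc that] by (simp add: algebra_simps)
    qed (use nz in simp)
    from row[of "\<lambda>k. ((a, b - int k, c), 2, 3)", OF this] fin show False by (simp add: inj_on_def)
  qed
  have no12: "D ((a, b, c), 1, 2) = 0" if "a - c + 1 = m" for a b c
  proof (rule ccontr)
    assume nz: "D ((a, b, c), 1, 2) \<noteq> 0"
    have "D ((a, b + int k, c), 1, 2) \<noteq> 0" for k
    proof (induction k)
      case (Suc k)
      then show ?case using step12[OF Suc that] by (simp add: algebra_simps)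
    qed (use nz in simp)
    from row[of "\<lambda>k. ((a, b + int k, c), 1, 2)", OF this] fin show False by (simp add: inj_on_def)
  qed
  show False using supp[OF h(1)]
  proof (cases rule: face_cases)
    case (12 a b c)
    then show False using h no12[of a c b] by (simp add: top_def)
  next
    case (23 a b c)
    then show False using h no23[of a c b] by (simp add: top_def)
  next
    case (13 a b c)
    then have m: "a - c + 1 = m" using h(2) by (simp add: top_def)
    have nz: "D ((a, b, c), 1, 3) \<noteq> 0" using h(1) 13(1) by simp
    have "(\<Sum>f\<leftarrow>faces_around (a + 1, b, c). D f) = D ((a, b, c), 1, 3)"
      unfolding faces_around_def using m
      by (simp add: z12[of "a + 1" b c] z13[of "a + 1" b c] z12[of "a + 1" "b - 1" c] z13[of a b "c - 1"]
        z13[of "a + 1" b "c - 1"] z23[of "a + 1" "b - 1" "c - 1"] z23[of "a + 1" b "c - 1"]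
        no23[of "a + 1" c] no12[of a c] del: One_nat_def)
    then show False using sum[of "(a + 1, b, c)"] nz by simp
  qed
qed

lemma side_in_strand:
  assumes "fits col f \<tau>" "fits col' f \<tau>" "e \<in> sides f"
  shows "col e = col' e"
proof -
  have "\<exists>s c. (s, c) \<in> strands f \<tau> \<and> e \<in> s"
    using assms(3) unfolding sides_def by (cases \<tau>) auto
  then show ?thesis using fitsD[OF assms(1)] fitsD[OF assms(2)] by metis
qed

section \<open>Exponents\<close>

definition exponent :: "lattice set \<Rightarrow> (face \<Rightarrow> local_config) \<Rightarrow> var \<Rightarrow> rat" where
  "exponent S \<sigma> v = (\<Sum>f | f \<in> face_set S \<and> weight_exponent f (\<sigma> f) v \<noteq> 0. weight_exponent f (\<sigma> f) v)
     - 2 * of_bool (v \<in> Vertex ` vertex_set S)"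

lemma Vertex_image_iff: "Vertex p \<in> Vertex ` V \<longleftrightarrow> p \<in> V" "Face f \<notin> Vertex ` V"
  by auto

lemma weight_exponent_vertex:
  "weight_exponent f \<tau> (Vertex p) \<noteq> 0 \<Longrightarrow> p \<in> {cx f, cu f, cy f, cv f}"
  by (cases \<tau>) (auto split: if_splits)

lemma weight_exponent_face: "weight_exponent h \<tau> (Face f) = of_bool (kind \<tau> \<in> {3, 4} \<and> f = h)"
  by (cases \<tau>) auto

lemma face_around_corner:
  assumes "f \<in> face_set S" "p \<in> {cx f, cu f, cy f, cv f}"
  shows "f \<in> set (faces_around p)"
  using assms(1)
proof (cases rule: face_cases)
  case (12 a b c)
  then have "p \<in> {(a, b, c), (a + 1, b, c), (a + 1, b + 1, c), (a, b + 1, c)}"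
    using assms(2) by (simp add: cx_def cu_def cy_def cv_def)
  then show ?thesis unfolding 12 by (auto simp: faces_around_def)
next
  case (13 a b c)
  then have "p \<in> {(a, b, c), (a + 1, b, c), (a + 1, b, c + 1), (a, b, c + 1)}"
    using assms(2) by (simp add: cx_def cu_def cy_def cv_def)
  then show ?thesis unfolding 13 by (auto simp: faces_around_def)
next
  case (23 a b c)
  then have "p \<in> {(a, b, c), (a, b + 1, c), (a, b + 1, c + 1), (a, b, c + 1)}"
    using assms(2) by (simp add: cx_def cu_def cy_def cv_def)
  then show ?thesis unfolding 23 by (auto simp: faces_around_def)
qed

lemma vertex_exponent:
  "exponent S \<sigma> (Vertex p) =
     (\<Sum>f\<leftarrow>faces_around p. if f \<in> face_set S then weight_exponent f (\<sigma> f) (Vertex p) else 0)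
     - 2 * of_bool (p \<in> vertex_set S)"
proof -
  let ?w = "\<lambda>f. if f \<in> face_set S then weight_exponent f (\<sigma> f) (Vertex p) else 0"
  have "(\<Sum>f | f \<in> face_set S \<and> weight_exponent f (\<sigma> f) (Vertex p) \<noteq> 0. weight_exponent f (\<sigma> f) (Vertex p))
      = (\<Sum>f\<in>set (faces_around p). ?w f)"
  proof (rule sum.mono_neutral_cong_left)
    show "{f. f \<in> face_set S \<and> weight_exponent f (\<sigma> f) (Vertex p) \<noteq> 0} \<subseteq> set (faces_around p)"
      using face_around_corner[OF _ weight_exponent_vertex] by blast
  qed simp_all
  also have "\<dots> = (\<Sum>f\<leftarrow>faces_around p. ?w f)"
    by (rule sum_list_distinct_conv_sum_set[symmetric]) (cases p, simp add: faces_around_def)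
  finally show ?thesis by (simp add: exponent_def Vertex_image_iff)
qed

lemma face_exponent:
  "exponent S \<sigma> (Face f) = of_bool (f \<in> face_set S \<and> kind (\<sigma> f) \<in> {3, 4})"
proof -
  have "{h. h \<in> face_set S \<and> weight_exponent h (\<sigma> h) (Face f) \<noteq> 0} =
      (if f \<in> face_set S \<and> kind (\<sigma> f) \<in> {3, 4} then {f} else {})"
    unfolding weight_exponent_face by auto
  then show ?thesis unfolding exponent_def by (simp only: Vertex_image_iff) (simp add: weight_exponent_face)
qed

text \<open>At a corner of a face, the exponent is a half-integer exactly when the strands through the two
  sides at this corner have different colours. Since there is an even number of changes of colour
  around a vertex, its total exponent is an integer.\<close>

definition corner_share :: "bool \<Rightarrow> colour \<Rightarrow> colour \<Rightarrow> rat \<Rightarrow> bool" where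
  "corner_share present c c' r \<longleftrightarrow> (if present then if c = c' then r = 0 \<or> r = 1 else r = 1 / 2 else r = 0)"

lemma corner_shares:
  assumes fit: "fits col (x, i, j) \<tau>" and ij: "(i, j) \<in> {(1, 2), (1, 3), (2, 3)}"
  shows "corner_share True (col (edge i x)) (col (edge j x)) (weight_exponent (x, i, j) \<tau> (Vertex x))"
    and "corner_share True (col (edge j (x + evec i))) (col (edge i x)) (weight_exponent (x, i, j) \<tau> (Vertex (x + evec i)))"
    and "corner_share True (col (edge j (x + evec i))) (col (edge i (x + evec j))) (weight_exponent (x, i, j) \<tau> (Vertex (x + evec i + evec j)))"
    and "corner_share True (col (edge i (x + evec j))) (col (edge j x)) (weight_exponent (x, i, j) \<tau> (Vertex (x + evec j)))"
proof -
  let ?a = "edge i x" and ?b = "edge j (x + evec i)" and ?c = "edge i (x + evec j)" and ?d = "edge j x"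
  have other: "other c \<noteq> c" "c \<noteq> other c" for c by (cases c, simp_all)+
  have cols: "case \<tau> of C1 k \<Rightarrow> col ?a = k \<and> col ?b = k \<and> col ?c = k \<and> col ?d = k
      | C2 k \<Rightarrow> col ?a = k \<and> col ?b = k \<and> col ?c = k \<and> col ?d = k
      | C3 k \<Rightarrow> col ?a = k \<and> col ?b = k \<and> col ?c = other k \<and> col ?d = other k
      | C4 k \<Rightarrow> col ?a = other k \<and> col ?b = k \<and> col ?c = k \<and> col ?d = other k
      | C5 k \<Rightarrow> col ?a = other k \<and> col ?b = k \<and> col ?c = other k \<and> col ?d = k"
  proof (cases \<tau>)
    case (C1 k)
    have "({?a, ?b}, k) \<in> strands (x, i, j) \<tau>" "({?c, ?d}, k) \<in> strands (x, i, j) \<tau>" unfolding C1 strands_edge by blast+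
    from fitsD[OF fit this(1), of ?a] fitsD[OF fit this(1), of ?b] fitsD[OF fit this(2), of ?c] fitsD[OF fit this(2), of ?d]
    show ?thesis by (simp add: C1)
  next
    case (C2 k)
    have "({?b, ?c}, k) \<in> strands (x, i, j) \<tau>" "({?d, ?a}, k) \<in> strands (x, i, j) \<tau>" unfolding C2 strands_edge by blast+
    from fitsD[OF fit this(1), of ?b] fitsD[OF fit this(1), of ?c] fitsD[OF fit this(2), of ?d] fitsD[OF fit this(2), of ?a]
    show ?thesis by (simp add: C2)
  next
    case (C3 k)
    have "({?a, ?b}, k) \<in> strands (x, i, j) \<tau>" "({?c, ?d}, other k) \<in> strands (x, i, j) \<tau>" unfolding C3 strands_edge by blast+
    from fitsD[OF fit this(1), of ?a] fitsD[OF fit this(1), of ?b] fitsD[OF fit this(2), of ?c] fitsD[OF fit this(2), of ?d]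
    show ?thesis by (simp add: C3)
  next
    case (C4 k)
    have "({?b, ?c}, k) \<in> strands (x, i, j) \<tau>" "({?d, ?a}, other k) \<in> strands (x, i, j) \<tau>" unfolding C4 strands_edge by blast+
    from fitsD[OF fit this(1), of ?b] fitsD[OF fit this(1), of ?c] fitsD[OF fit this(2), of ?d] fitsD[OF fit this(2), of ?a]
    show ?thesis by (simp add: C4)
  next
    case (C5 k)
    have "({?b, ?d}, k) \<in> strands (x, i, j) \<tau>" "({?a, ?c}, other k) \<in> strands (x, i, j) \<tau>" unfolding C5 strands_edge by blast+
    from fitsD[OF fit this(1), of ?b] fitsD[OF fit this(1), of ?d] fitsD[OF fit this(2), of ?a] fitsD[OF fit this(2), of ?c]
    show ?thesis by (simp add: C5)
  qed
  obtain a b c where x: "x = (a, b, c)" by (cases x)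
  have corners: "cx (x, i, j) = x" "cu (x, i, j) = x + evec i" "cy (x, i, j) = x + evec i + evec j" "cv (x, i, j) = x + evec j"
    by (simp_all add: cx_def cu_def cy_def cv_def)
  have "i = 1 \<and> j = 2 \<or> i = 1 \<and> j = 3 \<or> i = 2 \<and> j = 3" using ij by simp
  then have ne: "x \<noteq> x + evec i \<and> x \<noteq> x + evec j \<and> x \<noteq> x + evec i + evec j \<and> x + evec i \<noteq> x + evec j \<and>
    x + evec i \<noteq> x + evec i + evec j \<and> x + evec j \<noteq> x + evec i + evec j"
    unfolding x by (elim disjE conjE; hypsubst; simp only: evec_simps add_Pair prod.inject; simp)
  have distinct: "x \<noteq> x + evec i" "x \<noteq> x + evec j" "x \<noteq> x + evec i + evec j" "x + evec i \<noteq> x + evec j"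
    "x + evec i \<noteq> x + evec i + evec j" "x + evec j \<noteq> x + evec i + evec j"
    using ne by blast+
  note simps = corner_share_def weight_exponent.simps corners insert_iff empty_iff var.inject var.distinct distinct distinct[symmetric]
  show "corner_share True (col ?a) (col ?d) (weight_exponent (x, i, j) \<tau> (Vertex x))"
    using cols other by (cases \<tau>) (simp_all only: simps, simp_all)
  show "corner_share True (col ?b) (col ?a) (weight_exponent (x, i, j) \<tau> (Vertex (x + evec i)))"
    using cols other by (cases \<tau>) (simp_all only: simps, simp_all)
  show "corner_share True (col ?b) (col ?c) (weight_exponent (x, i, j) \<tau> (Vertex (x + evec i + evec j)))"
    using cols other by (cases \<tau>) (simp_all only: simps, simp_all)
  show "corner_share True (col ?c) (col ?d) (weight_exponent (x, i, j) \<tau> (Vertex (x + evec j)))"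
    using cols other by (cases \<tau>) (simp_all only: simps, simp_all)
qed

text \<open>The eight truth values say which of the cells around a vertex belong to the solid.\<close>

definition cells_around :: "bool \<Rightarrow> bool \<Rightarrow> bool \<Rightarrow> bool \<Rightarrow> bool \<Rightarrow> bool \<Rightarrow> bool \<Rightarrow> bool \<Rightarrow> bool" where
  "cells_around z s1 s2 s3 t1 t2 t3 w \<longleftrightarrow>
     (z \<longrightarrow> s1 \<and> s2 \<and> s3) \<and> (s1 \<longrightarrow> t2 \<and> t3) \<and> (s2 \<longrightarrow> t1 \<and> t3) \<and> (s3 \<longrightarrow> t1 \<and> t2) \<and> (t1 \<or> t2 \<or> t3 \<longrightarrow> w)"

text \<open>With truth values as numbers, the presence of a face is the difference between those of the two cells
  separated by it. So the number of faces is a linear expression, which is bounded by monotonicity.\<close>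

lemma faces_at_vertex_le_6:
  assumes "cells_around z s1 s2 s3 t1 t2 t3 w"
  shows "of_bool (\<not> z \<and> s3) + of_bool (\<not> z \<and> s2) + of_bool (\<not> z \<and> s1) +
    of_bool (\<not> t3 \<and> w) + of_bool (\<not> t2 \<and> w) + of_bool (\<not> t1 \<and> w) +
    of_bool (\<not> s1 \<and> t2) + of_bool (\<not> s1 \<and> t3) + of_bool (\<not> s2 \<and> t3) +
    of_bool (\<not> s2 \<and> t1) + of_bool (\<not> s3 \<and> t1) + of_bool (\<not> s3 \<and> t2) \<le> 6 * (of_bool (\<not> z \<and> w) :: int)"
proof -
  have d: "of_bool (\<not> P \<and> Q) = (of_bool Q - of_bool P :: int)" if "P \<longrightarrow> Q" for P Q
    using that by (cases P; cases Q) simp_all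
  have imp: "z \<longrightarrow> s1" "z \<longrightarrow> s2" "z \<longrightarrow> s3" "s1 \<longrightarrow> t2" "s1 \<longrightarrow> t3" "s2 \<longrightarrow> t1" "s2 \<longrightarrow> t3" "s3 \<longrightarrow> t1" "s3 \<longrightarrow> t2"
    "t1 \<longrightarrow> w" "t2 \<longrightarrow> w" "t3 \<longrightarrow> w" "z \<longrightarrow> w"
    using assms unfolding cells_around_def by blast+
  have le: "of_bool P \<le> (of_bool Q :: int)" if "P \<longrightarrow> Q" for P Q using that by simp
  have lin: "(s1 - z) + (s2 - z) + (s3 - z) + (w - t1) + (w - t2) + (w - t3) + 2 * (t1 + t2 + t3) - 2 * (s1 + s2 + s3) \<le> 6 * (w - z)"
    if "z \<le> s1" "z \<le> s2" "z \<le> s3" "t1 \<le> w" "t2 \<le> w" "t3 \<le> w" for z s1 s2 s3 t1 t2 t3 w :: int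
    using that by (linarith | presburger | (smt (verit)) | (simp add: algebra_simps))
  show ?thesis unfolding imp[THEN d]
    using lin[OF le[OF imp(1)] le[OF imp(2)] le[OF imp(3)] le[OF imp(10)] le[OF imp(11)] le[OF imp(12)]]
    by (simp only: algebra_simps)
qed

text \<open>Each of the six edges at the vertex, if it is present, is a side of exactly two of the present faces, so
  each colour is compared twice. With truth values as numbers, all pairs of cells on both sides of a
  face are nested, and the presence of a face is a difference of two numbers.\<close>

lemma even_colour_changes:
  assumes "cells_around z s1 s2 s3 t1 t2 t3 w"
  shows "even (of_bool (\<not> z \<and> s3 \<and> A1 \<noteq> A2) + of_bool (\<not> z \<and> s2 \<and> A1 \<noteq> A3) + of_bool (\<not> z \<and> s1 \<and> A2 \<noteq> A3) +
    of_bool (\<not> t3 \<and> w \<and> B2 \<noteq> B1) + of_bool (\<not> t2 \<and> w \<and> B3 \<noteq> B1) + of_bool (\<not> t1 \<and> w \<and> B3 \<noteq> B2) +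
    of_bool (\<not> s1 \<and> t2 \<and> A2 \<noteq> B1) + of_bool (\<not> s1 \<and> t3 \<and> A3 \<noteq> B1) + of_bool (\<not> s2 \<and> t3 \<and> A3 \<noteq> B2) +
    of_bool (\<not> s2 \<and> t1 \<and> A1 \<noteq> B2) + of_bool (\<not> s3 \<and> t1 \<and> A1 \<noteq> B3) + of_bool (\<not> s3 \<and> t2 \<and> A2 \<noteq> (B3 :: colour)) :: int)"
proof -
  define b where "b = (\<lambda>c. of_bool (c = Blue) :: int)"
  have d: "of_bool (\<not> P \<and> Q \<and> c \<noteq> c') = (of_bool Q - of_bool P) * (b c + b c' - 2 * (b c * b c'))"
    if "P \<longrightarrow> Q" for P Q c c'
    using that by (cases c; cases c'; cases P; cases Q) (simp_all add: b_def)
  have imp: "z \<longrightarrow> s1" "z \<longrightarrow> s2" "z \<longrightarrow> s3" "s1 \<longrightarrow> t2" "s1 \<longrightarrow> t3" "s2 \<longrightarrow> t1" "s2 \<longrightarrow> t3" "s3 \<longrightarrow> t1" "s3 \<longrightarrow> t2"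
    "t1 \<longrightarrow> w" "t2 \<longrightarrow> w" "t3 \<longrightarrow> w"
    using assms unfolding cells_around_def by blast+
  have "(s3 - z) * (a1 + a2 - 2 * (a1 * a2)) + (s2 - z) * (a1 + a3 - 2 * (a1 * a3)) + (s1 - z) * (a2 + a3 - 2 * (a2 * a3)) +
    (w - t3) * (b2 + b1 - 2 * (b2 * b1)) + (w - t2) * (b3 + b1 - 2 * (b3 * b1)) + (w - t1) * (b3 + b2 - 2 * (b3 * b2)) +
    (t2 - s1) * (a2 + b1 - 2 * (a2 * b1)) + (t3 - s1) * (a3 + b1 - 2 * (a3 * b1)) + (t3 - s2) * (a3 + b2 - 2 * (a3 * b2)) +
    (t1 - s2) * (a1 + b2 - 2 * (a1 * b2)) + (t1 - s3) * (a1 + b3 - 2 * (a1 * b3)) + (t2 - s3) * (a2 + b3 - 2 * (a2 * b3)) =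
    2 * ((t1 - z) * a1 + (t2 - z) * a2 + (t3 - z) * a3 + (w - s1) * b1 + (w - s2) * b2 + (w - s3) * b3
      - ((s3 - z) * a1 * a2 + (s2 - z) * a1 * a3 + (s1 - z) * a2 * a3 + (w - t3) * b2 * b1 + (w - t2) * b3 * b1 + (w - t1) * b3 * b2 +
        (t2 - s1) * a2 * b1 + (t3 - s1) * a3 * b1 + (t3 - s2) * a3 * b2 + (t1 - s2) * a1 * b2 + (t1 - s3) * a1 * b3 + (t2 - s3) * a2 * b3))"
    for z s1 s2 s3 t1 t2 t3 w a1 a2 a3 b1 b2 b3 :: int by algebra
  then show ?thesis unfolding imp[THEN d] by (simp only: dvd_triv_left)
qed

lemma sum_of_shares:
  assumes cells: "cells_around z s1 s2 s3 t1 t2 t3 w"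
    and sh: "corner_share (\<not> z \<and> s3) A1 A2 r1" "corner_share (\<not> z \<and> s2) A1 A3 r2" "corner_share (\<not> z \<and> s1) A2 A3 r3"
      "corner_share (\<not> t3 \<and> w) B2 B1 r4" "corner_share (\<not> t2 \<and> w) B3 B1 r5" "corner_share (\<not> t1 \<and> w) B3 B2 r6"
      "corner_share (\<not> s1 \<and> t2) A2 B1 r7" "corner_share (\<not> s1 \<and> t3) A3 B1 r8" "corner_share (\<not> s2 \<and> t3) A3 B2 r9"
      "corner_share (\<not> s2 \<and> t1) A1 B2 r10" "corner_share (\<not> s3 \<and> t1) A1 B3 r11" "corner_share (\<not> s3 \<and> t2) A2 B3 r12"
  shows "\<exists>m. r1 + r2 + r3 + r4 + r5 + r6 + r7 + r8 + r9 + r10 + r11 + r12 = of_int m \<and>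
    0 \<le> m \<and> m \<le> 6 * of_bool (\<not> z \<and> w)"
proof -
  have split: "\<exists>m. r = of_int m + of_int (of_bool (P \<and> Q \<and> c \<noteq> c')) / 2 \<and> 0 \<le> m \<and> m + of_bool (P \<and> Q \<and> c \<noteq> c') \<le> of_bool (P \<and> Q)"
    if "corner_share (P \<and> Q) c c' r" for P Q c c' r
    using that unfolding corner_share_def by (cases "P \<and> Q"; cases "c = c'") (auto intro: exI[of _ 0] exI[of _ 1])
  obtain m1 where 1: "r1 = of_int m1 + of_int (of_bool (\<not> z \<and> s3 \<and> A1 \<noteq> A2)) / 2" "0 \<le> m1" "m1 + of_bool (\<not> z \<and> s3 \<and> A1 \<noteq> A2) \<le> of_bool (\<not> z \<and> s3)" using split[OF sh(1)] by blast
  obtain m2 where 2: "r2 = of_int m2 + of_int (of_bool (\<not> z \<and> s2 \<and> A1 \<noteq> A3)) / 2" "0 \<le> m2" "m2 + of_bool (\<not> z \<and> s2 \<and> A1 \<noteq> A3) \<le> of_bool (\<not> z \<and> s2)" using split[OF sh(2)] by blast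
  obtain m3 where 3: "r3 = of_int m3 + of_int (of_bool (\<not> z \<and> s1 \<and> A2 \<noteq> A3)) / 2" "0 \<le> m3" "m3 + of_bool (\<not> z \<and> s1 \<and> A2 \<noteq> A3) \<le> of_bool (\<not> z \<and> s1)" using split[OF sh(3)] by blast
  obtain m4 where 4: "r4 = of_int m4 + of_int (of_bool (\<not> t3 \<and> w \<and> B2 \<noteq> B1)) / 2" "0 \<le> m4" "m4 + of_bool (\<not> t3 \<and> w \<and> B2 \<noteq> B1) \<le> of_bool (\<not> t3 \<and> w)" using split[OF sh(4)] by blast
  obtain m5 where 5: "r5 = of_int m5 + of_int (of_bool (\<not> t2 \<and> w \<and> B3 \<noteq> B1)) / 2" "0 \<le> m5" "m5 + of_bool (\<not> t2 \<and> w \<and> B3 \<noteq> B1) \<le> of_bool (\<not> t2 \<and> w)" using split[OF sh(5)] by blast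
  obtain m6 where 6: "r6 = of_int m6 + of_int (of_bool (\<not> t1 \<and> w \<and> B3 \<noteq> B2)) / 2" "0 \<le> m6" "m6 + of_bool (\<not> t1 \<and> w \<and> B3 \<noteq> B2) \<le> of_bool (\<not> t1 \<and> w)" using split[OF sh(6)] by blast
  obtain m7 where 7: "r7 = of_int m7 + of_int (of_bool (\<not> s1 \<and> t2 \<and> A2 \<noteq> B1)) / 2" "0 \<le> m7" "m7 + of_bool (\<not> s1 \<and> t2 \<and> A2 \<noteq> B1) \<le> of_bool (\<not> s1 \<and> t2)" using split[OF sh(7)] by blast
  obtain m8 where 8: "r8 = of_int m8 + of_int (of_bool (\<not> s1 \<and> t3 \<and> A3 \<noteq> B1)) / 2" "0 \<le> m8" "m8 + of_bool (\<not> s1 \<and> t3 \<and> A3 \<noteq> B1) \<le> of_bool (\<not> s1 \<and> t3)" using split[OF sh(8)] by blast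
  obtain m9 where 9: "r9 = of_int m9 + of_int (of_bool (\<not> s2 \<and> t3 \<and> A3 \<noteq> B2)) / 2" "0 \<le> m9" "m9 + of_bool (\<not> s2 \<and> t3 \<and> A3 \<noteq> B2) \<le> of_bool (\<not> s2 \<and> t3)" using split[OF sh(9)] by blast
  obtain m10 where 10: "r10 = of_int m10 + of_int (of_bool (\<not> s2 \<and> t1 \<and> A1 \<noteq> B2)) / 2" "0 \<le> m10" "m10 + of_bool (\<not> s2 \<and> t1 \<and> A1 \<noteq> B2) \<le> of_bool (\<not> s2 \<and> t1)" using split[OF sh(10)] by blast
  obtain m11 where 11: "r11 = of_int m11 + of_int (of_bool (\<not> s3 \<and> t1 \<and> A1 \<noteq> B3)) / 2" "0 \<le> m11" "m11 + of_bool (\<not> s3 \<and> t1 \<and> A1 \<noteq> B3) \<le> of_bool (\<not> s3 \<and> t1)" using split[OF sh(11)] by blast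
  obtain m12 where 12: "r12 = of_int m12 + of_int (of_bool (\<not> s3 \<and> t2 \<and> A2 \<noteq> B3)) / 2" "0 \<le> m12" "m12 + of_bool (\<not> s3 \<and> t2 \<and> A2 \<noteq> B3) \<le> of_bool (\<not> s3 \<and> t2)" using split[OF sh(12)] by blast
  obtain k where k: "of_bool (\<not> z \<and> s3 \<and> A1 \<noteq> A2) + of_bool (\<not> z \<and> s2 \<and> A1 \<noteq> A3) + of_bool (\<not> z \<and> s1 \<and> A2 \<noteq> A3) +
    of_bool (\<not> t3 \<and> w \<and> B2 \<noteq> B1) + of_bool (\<not> t2 \<and> w \<and> B3 \<noteq> B1) + of_bool (\<not> t1 \<and> w \<and> B3 \<noteq> B2) +
    of_bool (\<not> s1 \<and> t2 \<and> A2 \<noteq> B1) + of_bool (\<not> s1 \<and> t3 \<and> A3 \<noteq> B1) + of_bool (\<not> s2 \<and> t3 \<and> A3 \<noteq> B2) +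
    of_bool (\<not> s2 \<and> t1 \<and> A1 \<noteq> B2) + of_bool (\<not> s3 \<and> t1 \<and> A1 \<noteq> B3) + of_bool (\<not> s3 \<and> t2 \<and> A2 \<noteq> B3) = 2 * (k :: int)" (is "?K = _")
    using even_colour_changes[OF cells] by (rule evenE)
  have nonneg: "0 \<le> ?K" by (intro add_nonneg_nonneg) simp_all
  let ?m = "m1 + m2 + m3 + m4 + m5 + m6 + m7 + m8 + m9 + m10 + m11 + m12"
  have "r1 + r2 + r3 + r4 + r5 + r6 + r7 + r8 + r9 + r10 + r11 + r12 = of_int ?m + of_int ?K / 2"
    unfolding 1(1) 2(1) 3(1) 4(1) 5(1) 6(1) 7(1) 8(1) 9(1) 10(1) 11(1) 12(1) by (simp only: of_int_add add_divide_distrib add_ac)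
  also have "\<dots> = of_int (?m + k)" unfolding k by simp
  finally have "r1 + r2 + r3 + r4 + r5 + r6 + r7 + r8 + r9 + r10 + r11 + r12 = of_int (?m + k)" .
  moreover have "0 \<le> ?m + k" using nonneg k 1(2) 2(2) 3(2) 4(2) 5(2) 6(2) 7(2) 8(2) 9(2) 10(2) 11(2) 12(2) by linarith
  moreover have "?m + k \<le> 6 * of_bool (\<not> z \<and> w)"
    using nonneg k faces_at_vertex_le_6[OF cells] 1(3) 2(3) 3(3) 4(3) 5(3) 6(3) 7(3) 8(3) 9(3) 10(3) 11(3) 12(3) by linarith
  ultimately show ?thesis by blast
qed

lemma vertex_exponent_bounds:
  assumes S: "downset S" and fit: "\<And>f. f \<in> face_set S \<Longrightarrow> fits col f (\<sigma> f)"
  shows "\<exists>m. exponent S \<sigma> (Vertex p) = of_int m \<and> m \<in> {-2..4} \<and> (p \<notin> vertex_set S \<longrightarrow> m = 0)"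
proof -
  obtain a b c where p: "p = (a, b, c)" by (cases p)
  let ?z = "(a, b, c) \<in> S" and ?s1 = "(a - 1, b, c) \<in> S" and ?s2 = "(a, b - 1, c) \<in> S" and ?s3 = "(a, b, c - 1) \<in> S"
    and ?t1 = "(a, b - 1, c - 1) \<in> S" and ?t2 = "(a - 1, b, c - 1) \<in> S" and ?t3 = "(a - 1, b - 1, c) \<in> S"
    and ?w = "(a - 1, b - 1, c - 1) \<in> S"
  have down: "(i', j', k') \<in> S" if "(i, j, k) \<in> S" "i' \<le> i" "j' \<le> j" "k' \<le> k" for i j k i' j' k'
    using downsetD[OF S that] .
  have cells: "cells_around ?z ?s1 ?s2 ?s3 ?t1 ?t2 ?t3 ?w"
    unfolding cells_around_def by (intro conjI impI; (elim disjE)?) (erule down; simp)+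
  let ?r = "\<lambda>f. if f \<in> face_set S then weight_exponent f (\<sigma> f) (Vertex p) else 0"
  have share: "corner_share P k k' (?r f)"
    if "f \<in> face_set S \<longleftrightarrow> P" "f \<in> face_set S \<Longrightarrow> corner_share True k k' (weight_exponent f (\<sigma> f) (Vertex p))" for P k k' f
    using that by (simp add: corner_share_def split: if_splits)
  have ij: "(1::nat, 2::nat) \<in> {(1, 2), (1, 3), (2, 3)}" "(1::nat, 3::nat) \<in> {(1, 2), (1, 3), (2, 3)}" "(2::nat, 3::nat) \<in> {(1, 2), (1, 3), (2, 3)}" by simp_all
  let ?A1 = "col (edge 1 (a, b, c))" and ?A2 = "col (edge 2 (a, b, c))" and ?A3 = "col (edge 3 (a, b, c))"
    and ?B1 = "col (edge 1 (a - 1, b, c))" and ?B2 = "col (edge 2 (a, b - 1, c))" and ?B3 = "col (edge 3 (a, b, c - 1))"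
  have c12: "corner_share True (col (edge 1 (p1, p2, p3))) (col (edge 2 (p1, p2, p3))) (weight_exponent ((p1, p2, p3), 1, 2) (\<sigma> ((p1, p2, p3), 1, 2)) (Vertex (p1, p2, p3)))"
    "corner_share True (col (edge 2 (p1 + 1, p2, p3))) (col (edge 1 (p1, p2, p3))) (weight_exponent ((p1, p2, p3), 1, 2) (\<sigma> ((p1, p2, p3), 1, 2)) (Vertex (p1 + 1, p2, p3)))"
    "corner_share True (col (edge 2 (p1 + 1, p2, p3))) (col (edge 1 (p1, p2 + 1, p3))) (weight_exponent ((p1, p2, p3), 1, 2) (\<sigma> ((p1, p2, p3), 1, 2)) (Vertex (p1 + 1, p2 + 1, p3)))"
    "corner_share True (col (edge 1 (p1, p2 + 1, p3))) (col (edge 2 (p1, p2, p3))) (weight_exponent ((p1, p2, p3), 1, 2) (\<sigma> ((p1, p2, p3), 1, 2)) (Vertex (p1, p2 + 1, p3)))"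
    if "((p1, p2, p3), 1, 2) \<in> face_set S" for p1 p2 p3
    using corner_shares[OF fit[OF that] ij(1)] by simp_all
  have c13: "corner_share True (col (edge 1 (p1, p2, p3))) (col (edge 3 (p1, p2, p3))) (weight_exponent ((p1, p2, p3), 1, 3) (\<sigma> ((p1, p2, p3), 1, 3)) (Vertex (p1, p2, p3)))"
    "corner_share True (col (edge 3 (p1 + 1, p2, p3))) (col (edge 1 (p1, p2, p3))) (weight_exponent ((p1, p2, p3), 1, 3) (\<sigma> ((p1, p2, p3), 1, 3)) (Vertex (p1 + 1, p2, p3)))"
    "corner_share True (col (edge 3 (p1 + 1, p2, p3))) (col (edge 1 (p1, p2, p3 + 1))) (weight_exponent ((p1, p2, p3), 1, 3) (\<sigma> ((p1, p2, p3), 1, 3)) (Vertex (p1 + 1, p2, p3 + 1)))"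
    "corner_share True (col (edge 1 (p1, p2, p3 + 1))) (col (edge 3 (p1, p2, p3))) (weight_exponent ((p1, p2, p3), 1, 3) (\<sigma> ((p1, p2, p3), 1, 3)) (Vertex (p1, p2, p3 + 1)))"
    if "((p1, p2, p3), 1, 3) \<in> face_set S" for p1 p2 p3
    using corner_shares[OF fit[OF that] ij(2)] by simp_all
  have c23: "corner_share True (col (edge 2 (p1, p2, p3))) (col (edge 3 (p1, p2, p3))) (weight_exponent ((p1, p2, p3), 2, 3) (\<sigma> ((p1, p2, p3), 2, 3)) (Vertex (p1, p2, p3)))"
    "corner_share True (col (edge 3 (p1, p2 + 1, p3))) (col (edge 2 (p1, p2, p3))) (weight_exponent ((p1, p2, p3), 2, 3) (\<sigma> ((p1, p2, p3), 2, 3)) (Vertex (p1, p2 + 1, p3)))"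
    "corner_share True (col (edge 3 (p1, p2 + 1, p3))) (col (edge 2 (p1, p2, p3 + 1))) (weight_exponent ((p1, p2, p3), 2, 3) (\<sigma> ((p1, p2, p3), 2, 3)) (Vertex (p1, p2 + 1, p3 + 1)))"
    "corner_share True (col (edge 2 (p1, p2, p3 + 1))) (col (edge 3 (p1, p2, p3))) (weight_exponent ((p1, p2, p3), 2, 3) (\<sigma> ((p1, p2, p3), 2, 3)) (Vertex (p1, p2, p3 + 1)))"
    if "((p1, p2, p3), 2, 3) \<in> face_set S" for p1 p2 p3
    using corner_shares[OF fit[OF that] ij(3)] by simp_all
  have sh1: "corner_share (\<not> ?z \<and> ?s3) ?A1 ?A2 (?r ((a, b, c), 1, 2))"
    by (rule share) (use c12(1)[of a b c] in \<open>simp_all add: p\<close>)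
  have sh2: "corner_share (\<not> ?z \<and> ?s2) ?A1 ?A3 (?r ((a, b, c), 1, 3))"
    by (rule share) (use c13(1)[of a b c] in \<open>simp_all add: p\<close>)
  have sh3: "corner_share (\<not> ?z \<and> ?s1) ?A2 ?A3 (?r ((a, b, c), 2, 3))"
    by (rule share) (use c23(1)[of a b c] in \<open>simp_all add: p\<close>)
  have sh4: "corner_share (\<not> ?t3 \<and> ?w) ?B2 ?B1 (?r ((a - 1, b - 1, c), 1, 2))"
    by (rule share) (use c12(3)[of "a - 1" "b - 1" c] in \<open>simp_all add: p\<close>)
  have sh5: "corner_share (\<not> ?t2 \<and> ?w) ?B3 ?B1 (?r ((a - 1, b, c - 1), 1, 3))"
    by (rule share) (use c13(3)[of "a - 1" b "c - 1"] in \<open>simp_all add: p\<close>)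
  have sh6: "corner_share (\<not> ?t1 \<and> ?w) ?B3 ?B2 (?r ((a, b - 1, c - 1), 2, 3))"
    by (rule share) (use c23(3)[of a "b - 1" "c - 1"] in \<open>simp_all add: p\<close>)
  have sh7: "corner_share (\<not> ?s1 \<and> ?t2) ?A2 ?B1 (?r ((a - 1, b, c), 1, 2))"
    by (rule share) (use c12(2)[of "a - 1" b c] in \<open>simp_all add: p\<close>)
  have sh8: "corner_share (\<not> ?s1 \<and> ?t3) ?A3 ?B1 (?r ((a - 1, b, c), 1, 3))"
    by (rule share) (use c13(2)[of "a - 1" b c] in \<open>simp_all add: p\<close>)
  have sh9: "corner_share (\<not> ?s2 \<and> ?t3) ?A3 ?B2 (?r ((a, b - 1, c), 2, 3))"
    by (rule share) (use c23(2)[of a "b - 1" c] in \<open>simp_all add: p\<close>)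
  have sh10: "corner_share (\<not> ?s2 \<and> ?t1) ?A1 ?B2 (?r ((a, b - 1, c), 1, 2))"
    by (rule share) (use c12(4)[of a "b - 1" c] in \<open>simp_all add: p\<close>)
  have sh11: "corner_share (\<not> ?s3 \<and> ?t1) ?A1 ?B3 (?r ((a, b, c - 1), 1, 3))"
    by (rule share) (use c13(4)[of a b "c - 1"] in \<open>simp_all add: p\<close>)
  have sh12: "corner_share (\<not> ?s3 \<and> ?t2) ?A2 ?B3 (?r ((a, b, c - 1), 2, 3))"
    by (rule share) (use c23(4)[of a b "c - 1"] in \<open>simp_all add: p\<close>)
  obtain m where m: "(\<Sum>f\<leftarrow>faces_around p. ?r f) = of_int m" "0 \<le> m" "m \<le> 6 * of_bool (\<not> ?z \<and> ?w)"
    using sum_of_shares[OF cells sh1 sh2 sh3 sh4 sh5 sh6 sh7 sh8 sh9 sh10 sh11 sh12] unfolding p faces_around_def prod.case list.map sum_list_simps add_0_right by (simp only: add.assoc) blast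
  have v: "p \<in> vertex_set S \<longleftrightarrow> \<not> ?z \<and> ?w" by (auto simp: vertex_set_def p)
  show ?thesis
    by (rule exI[of _ "m - 2 * of_bool (p \<in> vertex_set S)"]) (use m v in \<open>auto simp: vertex_exponent split: if_splits\<close>)
qed

lemma finite_near_vertices: "S \<subseteq> negs \<Longrightarrow> finite (near_vertices n S)"
  by (rule finite_subset[OF _ finite_box[of n]]) (auto simp: near_vertices_def vertex_set_def)

lemma finite_contributions: "finite {f \<in> face_set S. weight_exponent f (\<sigma> f) v \<noteq> 0}"
proof (cases v)
  case (Vertex p)
  have "{f \<in> face_set S. weight_exponent f (\<sigma> f) v \<noteq> 0} \<subseteq> set (faces_around p)"
    unfolding Vertex using face_around_corner[OF _ weight_exponent_vertex] by blast
  then show ?thesis by (rule finite_subset) simp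
next
  case (Face h)
  then have "{f \<in> face_set S. weight_exponent f (\<sigma> f) v \<noteq> 0} \<subseteq> {h}" by (auto simp: weight_exponent_face)
  then show ?thesis by (rule finite_subset) simp
qed

lemma full_outside_negs: "0 \<le> n \<Longrightarrow> full_outside n negs"
  by (simp add: full_outside_def downset_negs)

lemma exponent_split:
  assumes T: "full_outside n T" and \<tau>: "\<And>f. f \<in> far_faces n negs \<Longrightarrow> \<tau> f = C1 Blue"
  shows "exponent T \<tau> v = (\<Sum>f | f \<in> far_faces n negs \<and> weight_exponent f (C1 Blue) v \<noteq> 0. weight_exponent f (C1 Blue) v)
    + (\<Sum>f\<in>near_faces n T. weight_exponent f (\<tau> f) v) - 2 * of_bool (v \<in> Vertex ` vertex_set T)"
proof -
  let ?w = "\<lambda>f. weight_exponent f (\<tau> f) v"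
  have neg: "T \<subseteq> negs" using T by (simp add: full_outside_def)
  have far: "far_faces n T = far_faces n negs" by (rule far_faces_eq[OF T])
  have eq: "{f. f \<in> face_set T \<and> ?w f \<noteq> 0} = {f \<in> far_faces n T. ?w f \<noteq> 0} \<union> {f \<in> near_faces n T. ?w f \<noteq> 0}"
    unfolding face_set_split[of T n] by blast
  have fin: "finite {f \<in> far_faces n T. ?w f \<noteq> 0}"
    by (rule finite_subset[OF _ finite_contributions[of T \<tau> v]]) (auto simp: far_faces_def)
  have "(\<Sum>f | f \<in> face_set T \<and> ?w f \<noteq> 0. ?w f) = sum ?w {f \<in> far_faces n T. ?w f \<noteq> 0} + sum ?w {f \<in> near_faces n T. ?w f \<noteq> 0}"
    unfolding eq
  proof (rule sum.union_disjoint[OF fin])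
    show "finite {f \<in> near_faces n T. ?w f \<noteq> 0}" by (rule finite_subset[OF _ finite_near_faces[OF neg, of n]]) blast
    show "{f \<in> far_faces n T. ?w f \<noteq> 0} \<inter> {f \<in> near_faces n T. ?w f \<noteq> 0} = {}"
      unfolding far_faces_def near_faces_def by blast
  qed
  also have "sum ?w {f \<in> near_faces n T. ?w f \<noteq> 0} = sum ?w (near_faces n T)"
    by (rule sum.mono_neutral_left) (use finite_near_faces[OF neg] in auto)
  also have "sum ?w {f \<in> far_faces n T. ?w f \<noteq> 0} = (\<Sum>f | f \<in> far_faces n negs \<and> weight_exponent f (C1 Blue) v \<noteq> 0. weight_exponent f (C1 Blue) v)"
    unfolding far by (rule sum.cong) (use \<tau> in auto)
  finally show ?thesis by (simp add: exponent_def)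
qed

lemma exponent_ground: "exponent negs (\<lambda>_. C1 Blue) v = of_bool (v = Vertex (0, 0, 0))"
proof (cases v)
  case (Vertex p)
  obtain a b c where p: "p = (a, b, c)" by (cases p)
  let ?in = "\<lambda>i j k. (i, j, k) \<in> negs"
  have "exponent negs (\<lambda>_. C1 Blue) v = of_bool (\<not> ?in a b c \<and> ?in a b (c - 1)) + of_bool (\<not> ?in a b c \<and> ?in a (b - 1) c)
      + of_bool (\<not> ?in a b c \<and> ?in (a - 1) b c) + of_bool (\<not> ?in (a - 1) (b - 1) c \<and> ?in (a - 1) (b - 1) (c - 1))
      + of_bool (\<not> ?in (a - 1) b (c - 1) \<and> ?in (a - 1) (b - 1) (c - 1)) + of_bool (\<not> ?in a (b - 1) (c - 1) \<and> ?in (a - 1) (b - 1) (c - 1))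
      - 2 * of_bool (\<not> ?in a b c \<and> ?in (a - 1) (b - 1) (c - 1))"
    unfolding Vertex vertex_exponent p faces_around_def prod.case
    by (simp add: cx_def cy_def vertex_set_def of_bool_def)
  moreover have "?in i j k \<longleftrightarrow> i < 0 \<and> j < 0 \<and> k < 0" for i j k by (auto simp: negs_def)
  moreover have "a < 0 \<or> a = 0 \<or> a > 0" "b < 0 \<or> b = 0 \<or> b > 0" "c < 0 \<or> c = 0 \<or> c > 0" by linarith+
  ultimately show ?thesis unfolding Vertex p
    by (elim disjE) simp_all
next
  case (Face f)
  then show ?thesis by (simp add: face_exponent)
qed

text \<open>All exponents are obtained from those of the ground configuration of the octant, whose monomial is
  the variable at the origin, by a finite correction.\<close>

lemma exponent_difference:
  assumes S: "full_outside n S" and \<sigma>: "\<sigma> \<in> outer_configs n (face_set S)"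
  shows "exponent S \<sigma> v = of_bool (v = Vertex (0, 0, 0))
    + (\<Sum>f\<in>near_faces n S. weight_exponent f (\<sigma> f) v) - (\<Sum>f\<in>near_faces n negs. weight_exponent f (C1 Blue) v)
    - 2 * of_bool (v \<in> Vertex ` near_vertices n S) + 2 * of_bool (v \<in> Vertex ` near_vertices n negs)"
proof -
  have n: "0 \<le> n" using S by (simp add: full_outside_def)
  have blue: "\<sigma> f = C1 Blue" if "f \<in> far_faces n negs" for f
  proof -
    have "f \<in> far_faces n S" using that by (simp only: far_faces_eq[OF S])
    then have "f \<in> face_set S" "far n (cx f)" by (simp_all add: far_faces_def)
    then show ?thesis using \<sigma> by (simp add: outer_configs_def)
  qed
  have vertices: "of_bool (v \<in> Vertex ` vertex_set S) - of_bool (v \<in> Vertex ` vertex_set negs) =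
      of_bool (v \<in> Vertex ` near_vertices n S) - (of_bool (v \<in> Vertex ` near_vertices n negs) :: rat)"
    using far_vertex_iff[OF S] by (cases v) (auto simp: Vertex_image_iff near_vertices_def)
  show ?thesis
    using exponent_split[OF S, where \<tau> = \<sigma> and v = v, OF blue] exponent_split[OF full_outside_negs[OF n], where \<tau> = "\<lambda>_. C1 Blue" and v = v, OF refl] vertices
    unfolding exponent_ground by linarith
qed

lemma finite_exponent_support:
  assumes "full_outside n S" "\<sigma> \<in> outer_configs n (face_set S)"
  shows "finite {v. exponent S \<sigma> v \<noteq> 0}"
proof -
  have neg: "S \<subseteq> negs" "negs \<subseteq> negs" using assms(1) by (simp_all add: full_outside_def)
  have w: "v \<in> {Vertex (cx f), Vertex (cu f), Vertex (cy f), Vertex (cv f), Face f}" if "weight_exponent f \<tau> v \<noteq> 0" for f \<tau> v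
    using that by (cases \<tau>) (auto split: if_splits)
  let ?X = "\<Union>f\<in>near_faces n S \<union> near_faces n negs. {Vertex (cx f), Vertex (cu f), Vertex (cy f), Vertex (cv f), Face f}"
  let ?Y = "insert (Vertex (0, 0, 0)) (?X \<union> Vertex ` near_vertices n S \<union> Vertex ` near_vertices n negs)"
  have "exponent S \<sigma> v = 0" if "v \<notin> ?Y" for v
  proof -
    have zero: "weight_exponent f \<tau> v = 0" if f: "f \<in> near_faces n S \<union> near_faces n negs" for f \<tau>
    proof (rule ccontr)
      assume "weight_exponent f \<tau> v \<noteq> 0"
      then have "v \<in> ?X" using w f by (intro UN_I[of f])
      then show False using \<open>v \<notin> ?Y\<close> by simp
    qed
    have "(\<Sum>f\<in>near_faces n S. weight_exponent f (\<sigma> f) v) = 0" "(\<Sum>f\<in>near_faces n negs. weight_exponent f (C1 Blue) v) = 0"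
      by (rule sum.neutral, rule ballI, rule zero, simp)+
    then show ?thesis using that by (simp add: exponent_difference[OF assms])
  qed
  then have "{v. exponent S \<sigma> v \<noteq> 0} \<subseteq> ?Y" by blast
  moreover have "finite ?Y"
    using finite_near_faces[OF neg(1)] finite_near_faces[OF neg(2)] finite_near_vertices[OF neg(1)] finite_near_vertices[OF neg(2)] by auto
  ultimately show ?thesis by (rule finite_subset)
qed

section \<open>Values of the monomials\<close>

lemma kind_weight_pos:
  assumes "\<And>x. 0 < g x"
  shows "0 < kind_weight g f (kind \<tau>)"
proof -
  have p: "0 < g x" "0 \<le> g x" for x using assms[of x] by simp_all
  then have F: "0 < g (cx f) * g (cy f) + g (cu f) * g (cv f)" by (intro add_pos_pos mult_pos_pos)
  show ?thesis by (cases \<tau>) (simp_all add: kind_weight_def corner_weight_def p F)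
qed

lemma face_corners_distinct: "f \<in> face_set S \<Longrightarrow> distinct [cx f, cu f, cy f, cv f]"
  by (cases f rule: face_cases) (auto simp: cx_def cu_def cy_def cv_def)

text \<open>Logarithms turn the products with rational exponents into sums which can be exchanged.\<close>

lemma ln_kind_weight:
  assumes pos: "\<And>x. 0 < g x" and f: "f \<in> face_set S" and A: "finite A"
    and sub: "{Vertex (cx f), Vertex (cu f), Vertex (cy f), Vertex (cv f), Face f} \<subseteq> A"
  shows "ln (kind_weight g f (kind \<tau>)) = (\<Sum>v\<in>A. real_of_rat (weight_exponent f \<tau> v) * ln (var_value g v))"
proof -
  let ?L = "\<lambda>v. ln (var_value g v)"
  have ind: "(\<Sum>v\<in>A. of_bool (v \<in> B) * ?L v) = sum ?L B" if "B \<subseteq> A" for B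
    by (rule sum.mono_neutral_cong_right) (use that A in auto)
  have d: "cx f \<noteq> cu f" "cx f \<noteq> cy f" "cx f \<noteq> cv f" "cu f \<noteq> cy f" "cu f \<noteq> cv f" "cy f \<noteq> cv f"
    using face_corners_distinct[OF f] by simp_all
  let ?XY = "{Vertex (cx f), Vertex (cy f)}" and ?UV = "{Vertex (cu f), Vertex (cv f)}"
    and ?Q = "{Vertex (cx f), Vertex (cy f), Vertex (cu f), Vertex (cv f)}"
  have B: "?XY \<subseteq> A" "?UV \<subseteq> A" "?Q \<subseteq> A" "{Face f} \<subseteq> A" using sub by simp_all
  have XY: "sum ?L ?XY = ln (g (cx f)) + ln (g (cy f))" and UV: "sum ?L ?UV = ln (g (cu f)) + ln (g (cv f))"
    and Q: "sum ?L ?Q = ln (g (cx f)) + ln (g (cy f)) + (ln (g (cu f)) + ln (g (cv f)))"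
    by (simp_all add: d d[symmetric] add.assoc)
  define F where "F = g (cx f) * g (cy f) + g (cu f) * g (cv f)"
  have FF: "sum ?L {Face f} = ln (sqrt F)" by (simp add: F_def)
  have s1: "(\<Sum>v\<in>A. real_of_rat (of_bool (v \<in> B)) * ?L v) = sum ?L B" if "B \<subseteq> A" for B
  proof -
    have "real_of_rat (of_bool P) = of_bool P" for P by (cases P) simp_all
    then show ?thesis using ind[OF that] by (simp only:)
  qed
  have s2: "(\<Sum>v\<in>A. real_of_rat (of_bool (v \<in> B) / 2) * ?L v) = sum ?L B / 2" if "B \<subseteq> A" for B
  proof -
    have "real_of_rat (of_bool P / 2) * l = of_bool P * l / 2" for P l by (cases P) (simp_all add: of_rat_divide)
    then show ?thesis using ind[OF that] by (simp only: sum_divide_distrib[symmetric])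
  qed
  have s3: "(\<Sum>v\<in>A. real_of_rat (of_bool (v \<in> B) / 2 + of_bool (v = Face f)) * ?L v) = sum ?L B / 2 + ln (sqrt F)" if "B \<subseteq> A" for B
    using s2[OF that] s1[OF B(4)] FF unfolding of_rat_add distrib_right sum.distrib by (simp only: singleton_iff)
  have p: "0 < g x" "g x \<noteq> 0" "0 \<le> g x" for x using pos[of x] by simp_all
  have F: "0 < F" unfolding F_def by (intro add_pos_pos mult_pos_pos p)
  note kw = kind_weight_def corner_weight_def F_def[symmetric]
  show ?thesis
  proof (cases \<tau>)
    case (C1 c)
    show ?thesis unfolding C1 weight_exponent.simps s1[OF B(1)] XY by (simp add: kw p ln_mult)
  next
    case (C2 c)
    show ?thesis unfolding C2 weight_exponent.simps s1[OF B(2)] UV by (simp add: kw p ln_mult)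
  next
    case (C3 c)
    show ?thesis unfolding C3 weight_exponent.simps s3[OF B(1)] XY using F by (simp add: kw p ln_mult ln_sqrt)
  next
    case (C4 c)
    show ?thesis unfolding C4 weight_exponent.simps s3[OF B(2)] UV using F by (simp add: kw p ln_mult ln_sqrt)
  next
    case (C5 c)
    show ?thesis unfolding C5 weight_exponent.simps s2[OF B(3)] Q by (simp add: kw p ln_mult ln_sqrt)
  qed
qed

lemma monomial_value_eq:
  assumes pos: "\<And>x. 0 < g x" and S: "full_outside n S" and \<sigma>: "\<sigma> \<in> outer_configs n (face_set S)"
    and m: "\<And>v. of_int (Poly_Mapping.lookup m v) = exponent S \<sigma> v"
  shows "monomial_value g m = g (0, 0, 0) * (\<Prod>f\<in>near_faces n S. kind_weight g f (kind (\<sigma> f))) / (\<Prod>x\<in>near_vertices n S. (g x)^2)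
    * ((\<Prod>x\<in>near_vertices n negs. (g x)^2) / (\<Prod>f\<in>near_faces n negs. kind_weight g f 1))"
proof -
  let ?L = "\<lambda>v. ln (var_value g v)"
  let ?NS = "near_faces n S" and ?N0 = "near_faces n negs" and ?VS = "near_vertices n S" and ?V0 = "near_vertices n negs"
  have neg: "S \<subseteq> negs" "negs \<subseteq> negs" using S by (simp_all add: full_outside_def)
  have fin: "finite ?NS" "finite ?N0" "finite ?VS" "finite ?V0"
    using finite_near_faces[OF neg(1)] finite_near_faces[OF neg(2)] finite_near_vertices[OF neg(1)] finite_near_vertices[OF neg(2)] by blast+
  define X where "X = (\<Union>f\<in>?NS \<union> ?N0. {Vertex (cx f), Vertex (cu f), Vertex (cy f), Vertex (cv f), Face f})"
  define A where "A = Poly_Mapping.keys m \<union> insert (Vertex (0, 0, 0)) (X \<union> Vertex ` ?VS \<union> Vertex ` ?V0)"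
  have "finite X" unfolding X_def using fin by blast
  then have finA: "finite A" unfolding A_def using fin by simp
  have V: "0 < var_value g v" for v
    by (cases v) (simp_all add: pos add_pos_pos)
  have ind: "(\<Sum>v\<in>A. of_bool (v \<in> B) * ?L v) = sum ?L B" if "B \<subseteq> A" for B
    by (rule sum.mono_neutral_cong_right) (use that finA in auto)
  have powi: "var_value g v powi k = exp (of_int k * ?L v)" for v k
    using powr_real_of_int'[of "var_value g v" k] V[of v] by (simp add: powr_def)
  have "monomial_value g m = exp (\<Sum>v\<in>Poly_Mapping.keys m. of_int (Poly_Mapping.lookup m v) * ?L v)"
    unfolding monomial_value_def powi by (simp add: exp_sum)
  also have "(\<Sum>v\<in>Poly_Mapping.keys m. of_int (Poly_Mapping.lookup m v) * ?L v) = (\<Sum>v\<in>A. of_int (Poly_Mapping.lookup m v) * ?L v)"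
    by (rule sum.mono_neutral_left[OF finA]) (auto simp: A_def in_keys_iff)
  also have "\<dots> = (\<Sum>v\<in>A. real_of_rat (exponent S \<sigma> v) * ?L v)"
    by (simp add: m[symmetric])
  also have "\<dots> = ln (g (0, 0, 0)) + (\<Sum>f\<in>?NS. ln (kind_weight g f (kind (\<sigma> f)))) - (\<Sum>f\<in>?N0. ln (kind_weight g f (kind (C1 Blue))))
      - 2 * (\<Sum>x\<in>?VS. ln (g x)) + 2 * (\<Sum>x\<in>?V0. ln (g x))"
  proof -
    have rat: "real_of_rat (of_bool P) = of_bool P" for P by (cases P) simp_all
    have e: "real_of_rat (exponent S \<sigma> v) * ?L v = of_bool (v \<in> {Vertex (0, 0, 0)}) * ?L v
      + (\<Sum>f\<in>?NS. real_of_rat (weight_exponent f (\<sigma> f) v) * ?L v) - (\<Sum>f\<in>?N0. real_of_rat (weight_exponent f (C1 Blue) v) * ?L v)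
      - 2 * (of_bool (v \<in> Vertex ` ?VS) * ?L v) + 2 * (of_bool (v \<in> Vertex ` ?V0) * ?L v)" for v
      unfolding exponent_difference[OF S \<sigma>] of_rat_add of_rat_diff of_rat_mult of_rat_sum rat sum_distrib_right[symmetric]
      by (simp add: algebra_simps)
    have T1: "(\<Sum>v\<in>A. of_bool (v \<in> {Vertex (0, 0, 0)}) * ?L v) = ln (g (0, 0, 0))"
      by (subst ind) (simp_all add: A_def)
    have T2: "(\<Sum>v\<in>A. \<Sum>f\<in>?NS. real_of_rat (weight_exponent f (\<sigma> f) v) * ?L v) = (\<Sum>f\<in>?NS. ln (kind_weight g f (kind (\<sigma> f))))"
      unfolding sum.swap[of _ ?NS A]
    proof (rule sum.cong[OF refl])
      fix f assume f: "f \<in> ?NS"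
      have "{Vertex (cx f), Vertex (cu f), Vertex (cy f), Vertex (cv f), Face f} \<subseteq> X" using f unfolding X_def by blast
      then have "{Vertex (cx f), Vertex (cu f), Vertex (cy f), Vertex (cv f), Face f} \<subseteq> A" unfolding A_def by blast
      moreover have "f \<in> face_set S" using f by (simp add: near_faces_def)
      ultimately show "(\<Sum>v\<in>A. real_of_rat (weight_exponent f (\<sigma> f) v) * ?L v) = ln (kind_weight g f (kind (\<sigma> f)))"
        using ln_kind_weight[of g f S A, OF pos _ finA] by simp
    qed
    have T3: "(\<Sum>v\<in>A. \<Sum>f\<in>?N0. real_of_rat (weight_exponent f (C1 Blue) v) * ?L v) = (\<Sum>f\<in>?N0. ln (kind_weight g f (kind (C1 Blue))))"
      unfolding sum.swap[of _ ?N0 A]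
    proof (rule sum.cong[OF refl])
      fix f assume f: "f \<in> ?N0"
      have "{Vertex (cx f), Vertex (cu f), Vertex (cy f), Vertex (cv f), Face f} \<subseteq> X" using f unfolding X_def by blast
      then have "{Vertex (cx f), Vertex (cu f), Vertex (cy f), Vertex (cv f), Face f} \<subseteq> A" unfolding A_def by blast
      moreover have "f \<in> face_set negs" using f by (simp add: near_faces_def)
      ultimately show "(\<Sum>v\<in>A. real_of_rat (weight_exponent f (C1 Blue) v) * ?L v) = ln (kind_weight g f (kind (C1 Blue)))"
        using ln_kind_weight[of g f negs A "C1 Blue", OF pos _ finA] by simp
    qed
    have T4: "(\<Sum>v\<in>A. of_bool (v \<in> Vertex ` W) * ?L v) = (\<Sum>x\<in>W. ln (g x))" if "Vertex ` W \<subseteq> A" for W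
      by (subst ind[OF that], subst sum.reindex) (simp_all add: inj_on_def)
    have W: "Vertex ` ?VS \<subseteq> A" "Vertex ` ?V0 \<subseteq> A" unfolding A_def by blast+
    show ?thesis
      unfolding e sum.distrib sum_subtractf sum_distrib_left[symmetric] T1 T2 T3 T4[OF W(1)] T4[OF W(2)] by (rule refl)
  qed
  finally have 1: "monomial_value g m = exp (ln (g (0, 0, 0)) + (\<Sum>f\<in>?NS. ln (kind_weight g f (kind (\<sigma> f)))) - (\<Sum>f\<in>?N0. ln (kind_weight g f (kind (C1 Blue))))
      - 2 * (\<Sum>x\<in>?VS. ln (g x)) + 2 * (\<Sum>x\<in>?V0. ln (g x)))" .
  have 2: "exp (ln (g (0, 0, 0))) = g (0, 0, 0)" by (simp add: pos)
  have faces: "exp (\<Sum>f\<in>M. ln (kind_weight g f (kind (\<rho> f)))) = (\<Prod>f\<in>M. kind_weight g f (kind (\<rho> f)))" if "finite M" for M \<rho>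
    using that kind_weight_pos[of g, OF pos] by (simp add: exp_sum)
  have vertices: "exp (2 * (\<Sum>x\<in>W. ln (g x))) = (\<Prod>x\<in>W. (g x)^2)" if "finite W" for W
    using that by (simp add: exp_double exp_sum pos prod_power_distrib)
  have one: "(\<Prod>f\<in>?N0. kind_weight g f (kind (C1 Blue))) = (\<Prod>f\<in>?N0. kind_weight g f 1)" by simp
  show ?thesis
    unfolding 1 exp_add exp_diff 2 faces[OF fin(1)] faces[OF fin(2), of "\<lambda>_. C1 Blue"] vertices[OF fin(3)] vertices[OF fin(4)] one
    by (simp only: times_divide_eq_right times_divide_eq_left divide_divide_eq_left mult_ac)
qed

section \<open>A configuration is determined by its monomial\<close>

text \<open>The exponents at neighbouring corners sum to \<open>1\<close>, or to \<open>1/2\<close> if the face variable occurs. The exponent at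
  the first corner then tells the types apart in each case.\<close>

lemma corner_exponents:
  assumes "f \<in> face_set S"
  shows "weight_exponent f \<tau> (Vertex (cy f)) = weight_exponent f \<tau> (Vertex (cx f))"
    and "weight_exponent f \<tau> (Vertex (cu f)) = 1 - of_bool (kind \<tau> \<in> {3, 4}) / 2 - weight_exponent f \<tau> (Vertex (cx f))"
    and "weight_exponent f \<tau> (Vertex (cv f)) = 1 - of_bool (kind \<tau> \<in> {3, 4}) / 2 - weight_exponent f \<tau> (Vertex (cx f))"
    and "weight_exponent f \<tau> (Vertex (cx f)) = (if kind \<tau> = 1 then 1 else if kind \<tau> \<in> {3, 5} then 1 / 2 else 0)"
proof -
  have "distinct [cx f, cu f, cy f, cv f]" by (rule face_corners_distinct[OF assms])
  then have d: "cx f \<noteq> cu f" "cx f \<noteq> cy f" "cx f \<noteq> cv f" "cu f \<noteq> cy f" "cu f \<noteq> cv f" "cy f \<noteq> cv f" by simp_all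
  note d' = d d[symmetric]
  show "weight_exponent f \<tau> (Vertex (cy f)) = weight_exponent f \<tau> (Vertex (cx f))" by (cases \<tau>) (simp_all add: d')
  show "weight_exponent f \<tau> (Vertex (cu f)) = 1 - of_bool (kind \<tau> \<in> {3, 4}) / 2 - weight_exponent f \<tau> (Vertex (cx f))"
    by (cases \<tau>) (simp_all add: d')
  show "weight_exponent f \<tau> (Vertex (cv f)) = 1 - of_bool (kind \<tau> \<in> {3, 4}) / 2 - weight_exponent f \<tau> (Vertex (cx f))"
    by (cases \<tau>) (simp_all add: d')
  show "weight_exponent f \<tau> (Vertex (cx f)) = (if kind \<tau> = 1 then 1 else if kind \<tau> \<in> {3, 5} then 1 / 2 else 0)"
    by (cases \<tau>) (simp_all add: d')
qed

definition parity :: "lattice \<Rightarrow> rat" where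
  "parity = (\<lambda>(a, b, c). if even (a + b + c) then 1 else -1)"

lemma parity_corners:
  assumes "f \<in> face_set S"
  shows "parity (cy f) = parity (cx f)" "parity (cu f) = - parity (cx f)" "parity (cv f) = - parity (cx f)"
  using assms by (cases f rule: face_cases; auto simp: parity_def cx_def cu_def cy_def cv_def)+

lemma corners_of_face_around:
  "f \<in> set (faces_around p) \<Longrightarrow> p \<in> {cx f, cu f, cy f, cv f}"
  by (cases p) (auto simp: faces_around_def cx_def cu_def cy_def cv_def)

text \<open>If two configurations have the same monomial, then the difference of their exponents at a corner
  of a face changes its sign from each corner to the next, because of the face variable. With
  alternating signs it becomes a function of the faces whose sum around each vertex is zero.\<close>

lemma equal_exponents_kind:
  assumes S: "downset S" "S \<subseteq> negs" and \<sigma>: "\<sigma> \<in> outer_configs n (face_set S)" and \<tau>: "\<tau> \<in> outer_configs n (face_set S)"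
    and eq: "\<And>v. exponent S \<sigma> v = exponent S \<tau> v" and f: "f \<in> face_set S"
  shows "kind (\<sigma> f) = kind (\<tau> f)"
proof -
  define d where "d = (\<lambda>f p. weight_exponent f (\<sigma> f) (Vertex p) - weight_exponent f (\<tau> f) (Vertex p))"
  \<comment> \<open>The parity makes the alternating signs at the corners of a face into a global sign per vertex.\<close>
  define D where "D = (\<lambda>f. if f \<in> face_set S then parity (cx f) * d f (cx f) else 0)"
  have face: "kind (\<sigma> h) \<in> {3, 4} \<longleftrightarrow> kind (\<tau> h) \<in> {3, 4}" if "h \<in> face_set S" for h
    using eq[of "Face h"] that unfolding face_exponent of_bool_eq_iff by blast
  have pp: "parity p * parity p = 1" for p by (simp add: parity_def split: prod.splits)
  have d: "parity p * d h p = D h" if h: "h \<in> face_set S" and p: "p \<in> {cx h, cu h, cy h, cv h}" for h p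
  proof -
    have e: "d h (cy h) = d h (cx h)" "d h (cu h) = - d h (cx h)" "d h (cv h) = - d h (cx h)"
      unfolding d_def corner_exponents(1-3)[OF h] using face[OF h] by simp_all
    have "p = cx h \<or> p = cu h \<or> p = cy h \<or> p = cv h" using p by blast
    then show ?thesis by (elim disjE; hypsubst) (simp_all add: D_def h e parity_corners[OF h])
  qed
  have "D f = 0"
  proof (rule zero_vertex_sums[OF S(1), of D])
    show "h \<in> face_set S" if "D h \<noteq> 0" for h using that by (auto simp: D_def split: if_splits)
    have "{h. D h \<noteq> 0} \<subseteq> near_faces n S"
    proof
      fix h assume "h \<in> {h. D h \<noteq> 0}"
      then have h: "h \<in> face_set S" "d h (cx h) \<noteq> 0" by (auto simp: D_def split: if_splits)
      have "\<not> far n (cx h)"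
      proof
        assume "far n (cx h)"
        then have "\<sigma> h = C1 Blue" "\<tau> h = C1 Blue" using h(1) \<sigma> \<tau> unfolding outer_configs_def by blast+
        then show False using h(2) by (simp add: d_def)
      qed
      then show "h \<in> near_faces n S" using h(1) by (simp add: near_faces_def)
    qed
    then show "finite {h. D h \<noteq> 0}" using finite_near_faces[OF S(2)] by (rule finite_subset)
    fix p
    let ?e = "\<lambda>\<rho> h. if h \<in> face_set S then weight_exponent h (\<rho> h) (Vertex p) else 0"
    have "(\<Sum>h\<leftarrow>faces_around p. D h) = (\<Sum>h\<leftarrow>faces_around p. parity p * (?e \<sigma> h - ?e \<tau> h))"
    proof (rule arg_cong[of _ _ sum_list], rule map_cong[OF refl])
      fix h assume "h \<in> set (faces_around p)"
      then show "D h = parity p * (?e \<sigma> h - ?e \<tau> h)"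
        using d[OF _ corners_of_face_around, of h p] by (cases "h \<in> face_set S") (simp_all add: d_def, simp add: D_def)
    qed
    also have "\<dots> = parity p * ((\<Sum>h\<leftarrow>faces_around p. ?e \<sigma> h) - (\<Sum>h\<leftarrow>faces_around p. ?e \<tau> h))"
      by (simp only: sum_list_const_mult sum_list_subtractf)
    also have "(\<Sum>h\<leftarrow>faces_around p. ?e \<sigma> h) = (\<Sum>h\<leftarrow>faces_around p. ?e \<tau> h)"
      using eq[of "Vertex p"] unfolding vertex_exponent by simp
    finally show "(\<Sum>h\<leftarrow>faces_around p. D h) = 0" by simp
  qed
  then have "d f (cx f) = 0" using f by (simp add: D_def parity_def split: prod.splits if_splits)
  then have "weight_exponent f (\<sigma> f) (Vertex (cx f)) = weight_exponent f (\<tau> f) (Vertex (cx f))" by (simp add: d_def)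
  then show ?thesis using face[OF f] unfolding corner_exponents(4)[OF f]
    by (cases "\<sigma> f"; cases "\<tau> f") simp_all
qed

text \<open>The two local configurations of the same type have opposite colours on every side.\<close>

lemma same_kind_side:
  assumes "fits col f \<rho>" "fits col' f \<tau>" "kind \<rho> = kind \<tau>" "e \<in> sides f" "col e = col' e"
  shows "\<rho> = \<tau>"
proof (rule ccontr)
  assume ne: "\<rho> \<noteq> \<tau>"
  have oth: "c \<noteq> c' \<Longrightarrow> c' = other c" for c c' by (cases c; cases c') simp_all
  have o2: "other c \<noteq> c" "other (other c) = c" for c by (cases c, simp_all)+
  have "\<exists>s d. (s, d) \<in> strands f \<rho> \<and> e \<in> s"
    using assms(4) unfolding sides_def by (cases \<rho>) auto
  then obtain s d where s: "(s, d) \<in> strands f \<rho>" "e \<in> s" by blast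
  have "(s, other d) \<in> strands f \<tau>"
  proof (cases \<rho>)
    case (C1 c)
    then have "\<tau> = C1 (other c)" using assms(3) ne oth by (cases \<tau>) auto
    then show ?thesis using s(1) by (auto simp: C1)
  next
    case (C2 c)
    then have "\<tau> = C2 (other c)" using assms(3) ne oth by (cases \<tau>) auto
    then show ?thesis using s(1) by (auto simp: C2)
  next
    case (C3 c)
    then have "\<tau> = C3 (other c)" using assms(3) ne oth by (cases \<tau>) auto
    then show ?thesis using s(1) by (auto simp: C3)
  next
    case (C4 c)
    then have "\<tau> = C4 (other c)" using assms(3) ne oth by (cases \<tau>) auto
    then show ?thesis using s(1) by (auto simp: C4)
  next
    case (C5 c)
    then have "\<tau> = C5 (other c)" using assms(3) ne oth by (cases \<tau>) auto
    then show ?thesis using s(1) by (auto simp: C5)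
  qed
  then have "col' e = other d" using fitsD[OF assms(2)] s(2) by blast
  moreover have "col e = d" using fitsD[OF assms(1)] s by blast
  ultimately show False using assms(5) o2(1) by metis
qed

text \<open>Once the types are known, the colours spread from each face to its neighbours. Every face is
  joined to the blue part far away by a chain of faces: one moves along the strip of squares that
  cross parallel edges, in a direction in which this strip never ends.\<close>

lemma equal_kinds_eq:
  assumes S: "downset S" "S \<subseteq> negs" and \<sigma>: "\<sigma> \<in> loops S" "\<sigma> \<in> outer_configs n (face_set S)"
    and \<tau>: "\<tau> \<in> loops S" "\<tau> \<in> outer_configs n (face_set S)"
    and kind: "\<And>f. f \<in> face_set S \<Longrightarrow> kind (\<sigma> f) = kind (\<tau> f)"
  shows "\<sigma> = \<tau>"
proof -
  obtain col where col: "\<And>f. f \<in> face_set S \<Longrightarrow> fits col f (\<sigma> f)" using \<sigma>(1) by (auto simp: loops_def)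
  obtain col' where col': "\<And>f. f \<in> face_set S \<Longrightarrow> fits col' f (\<tau> f)" using \<tau>(1) by (auto simp: loops_def)
  have far: "\<sigma> f = \<tau> f" if "f \<in> face_set S" "far n (cx f)" for f
    using \<sigma>(2) \<tau>(2) that unfolding outer_configs_def by simp
  have spread: "\<sigma> f = \<tau> f" if f: "f \<in> face_set S" "f' \<in> face_set S" "e \<in> sides f" "e \<in> sides f'" "\<sigma> f' = \<tau> f'" for f f' e
  proof -
    have "col e = col' e" using side_in_strand[OF col[OF f(2)] _ f(4)] col'[OF f(2)] f(5) by simp
    then show ?thesis using same_kind_side[OF col[OF f(1)] col'[OF f(1)] kind[OF f(1)] f(3)] by simp
  qed
  have down: "(i', j', k') \<in> S" if "(i, j, k) \<in> S" "i' \<le> i" "j' \<le> j" "k' \<le> k" for i j k i' j' k'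
    using downsetD[OF S(1) that] .
  have neg: "i \<le> -1" "j \<le> -1" "k \<le> -1" if "(i, j, k) \<in> S" for i j k
    using S(2) that by (auto simp: negs_def)
  define strip :: "bool \<Rightarrow> lattice \<Rightarrow> face" where "strip = (\<lambda>q x. (x, 1, if q then 3 else 2))"
  have strip: "\<sigma> (strip q (a, b, c)) = \<tau> (strip q (a, b, c))" if "strip q (a, b, c) \<in> face_set S" for q a b c
    using that
  proof (induction "nat (2 * (b - c + n) + (if q then 3 else 4))" arbitrary: a b c q rule: less_induct)
    case less
    show ?case
    proof (cases "far n (a, b, c)")
      case True
      then show ?thesis using far[OF less.prems] by (simp add: strip_def cx_def)
    next
      case False
      show ?thesis
      proof (cases q)
        case False
        then have mem: "(a, b, c) \<notin> S" "(a, b, c - 1) \<in> S" using less.prems by (simp_all add: strip_def)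
        have m: "0 \<le> b - c + n" using \<open>\<not> far n (a, b, c)\<close> neg[OF mem(2)] by (simp add: far_def)
        show ?thesis
        proof (cases "(a, b - 1, c) \<in> S")
          case True
          have f': "strip True (a, b, c) \<in> face_set S" using mem True by (simp add: strip_def)
          have "\<sigma> (strip True (a, b, c)) = \<tau> (strip True (a, b, c))"
            by (rule less.hyps[OF _ f']) (use m False in simp)
          then show ?thesis
            by (rule spread[OF less.prems f', of "edge 1 (a, b, c)", rotated 2]) (use False in \<open>simp_all add: strip_def sides_edge\<close>)
        next
          case nS: False
          have f': "strip False (a, b - 1, c) \<in> face_set S" using mem(2) nS by (auto simp: strip_def elim: down)
          have "\<sigma> (strip False (a, b - 1, c)) = \<tau> (strip False (a, b - 1, c))"
            by (rule less.hyps[OF _ f']) (use m False in simp)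
          then show ?thesis
            by (rule spread[OF less.prems f', of "edge 1 (a, b, c)", rotated 2]) (use False in \<open>simp_all add: strip_def sides_edge\<close>)
        qed
      next
        case True
        then have mem: "(a, b, c) \<notin> S" "(a, b - 1, c) \<in> S" using less.prems by (simp_all add: strip_def)
        have m: "0 \<le> b - c + n" using \<open>\<not> far n (a, b, c)\<close> neg[OF mem(2)] by (simp add: far_def)
        have up: "(a, b, c + 1) \<notin> S" using mem(1) down[of a b "c + 1" a b c] by auto
        show ?thesis
        proof (cases "(a, b - 1, c + 1) \<in> S")
          case inS: True
          have f': "strip True (a, b, c + 1) \<in> face_set S" using up inS by (simp add: strip_def)
          have "\<sigma> (strip True (a, b, c + 1)) = \<tau> (strip True (a, b, c + 1))"
            by (rule less.hyps[OF _ f']) (use m True in simp)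
          then show ?thesis
            by (rule spread[OF less.prems f', of "edge 1 (a, b, c + 1)", rotated 2]) (use True in \<open>simp_all add: strip_def sides_edge\<close>)
        next
          case nS: False
          have f': "strip False (a, b - 1, c + 1) \<in> face_set S" using mem(2) nS by (simp add: strip_def)
          have "\<sigma> (strip False (a, b - 1, c + 1)) = \<tau> (strip False (a, b - 1, c + 1))"
            by (rule less.hyps[OF _ f']) (use m True in simp)
          then show ?thesis
            by (rule spread[OF less.prems f', of "edge 1 (a, b, c + 1)", rotated 2]) (use True in \<open>simp_all add: strip_def sides_edge\<close>)
        qed
      qed
    qed
  qed
  have strip23: "\<sigma> ((a, b, c), 2, 3) = \<tau> ((a, b, c), 2, 3)" if "((a, b, c), 2, 3) \<in> face_set S" for a b c
    using that
  proof (induction "nat (- c)" arbitrary: c rule: less_induct)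
    case less
    then have mem: "(a, b, c) \<notin> S" "(a - 1, b, c) \<in> S" by simp_all
    have up: "(a, b, c + 1) \<notin> S" using mem(1) down[of a b "c + 1" a b c] by auto
    show ?case
    proof (cases "(a - 1, b, c + 1) \<in> S")
      case True
      have f': "((a, b, c + 1), 2, 3) \<in> face_set S" using up True by simp
      have "\<sigma> ((a, b, c + 1), 2, 3) = \<tau> ((a, b, c + 1), 2, 3)"
        by (rule less.hyps[OF _ f']) (use neg[OF mem(2)] in simp)
      then show ?thesis
        by (rule spread[OF less.prems f', of "edge 2 (a, b, c + 1)", rotated 2]) (simp_all add: sides_edge)
    next
      case False
      have f': "strip False (a - 1, b, c + 1) \<in> face_set S" using False mem(2) by (simp add: strip_def)
      have "\<sigma> (strip False (a - 1, b, c + 1)) = \<tau> (strip False (a - 1, b, c + 1))" by (rule strip[OF f'])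
      then show ?thesis
        by (rule spread[OF less.prems f', of "edge 2 (a, b, c + 1)", rotated 2]) (simp_all add: strip_def sides_edge)
    qed
  qed
  have "\<sigma> f = \<tau> f" if f: "f \<in> face_set S" for f
    using f
  proof (cases rule: face_cases)
    case (12 a b c)
    then show ?thesis using strip[of False a b c] f by (simp add: strip_def)
  next
    case (13 a b c)
    then show ?thesis using strip[of True a b c] f by (simp add: strip_def)
  next
    case (23 a b c)
    then show ?thesis using strip23[of a b c] f by simp
  qed
  then show ?thesis
    using \<sigma>(1) \<tau>(1) by (intro PiE_ext[of \<sigma> "face_set S" "\<lambda>_. UNIV" \<tau>]) (auto simp: loops_def)
qed

section \<open>Removing all cubes\<close>

text \<open>Every solid that misses finitely many cubes of the octant is obtained from the octant by removing
  cubes one at a time.\<close>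

lemma removal_induct [consumes 3, case_names octant remove]:
  assumes "downset S" "S \<subseteq> negs" "finite (negs - S)"
    and base: "P negs"
    and step: "\<And>S c. removal S c \<Longrightarrow> finite (negs - S) \<Longrightarrow> P S \<Longrightarrow> P (S - {c})"
  shows "P S"
  using assms(1-3)
proof (induction "card (negs - S)" arbitrary: S)
  case 0
  then have "S = negs" by auto
  then show ?case using base by simp
next
  case (Suc k)
  define s where "s = (\<lambda>(i, j, l). i + j + l :: int)"
  \<comment> \<open>A missing cell of minimal coordinate sum has only cells of \<open>S\<close> below it and can be put back.\<close>
  have ne: "negs - S \<noteq> {}" using Suc.hyps(2) by fastforce
  have fin: "finite (s ` (negs - S))" using Suc.prems(3) by simp
  then have "Min (s ` (negs - S)) \<in> s ` (negs - S)" by (rule Min_in) (use ne in simp)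
  then obtain d where d: "d \<in> negs - S" "s d = Min (s ` (negs - S))" by force
  have least: "s d \<le> s x" if "x \<in> negs - S" for x unfolding d(2) using fin that by (intro Min_le) auto
  obtain a b c where abc: "d = (a, b, c)" by (cases d)
  let ?T = "insert d S"
  have "downset ?T" unfolding downset_def
  proof (intro allI impI)
    fix i j k i' j' k' assume h: "(i, j, k) \<in> ?T \<and> i' \<le> i \<and> j' \<le> j \<and> k' \<le> k"
    have n: "(i, j, k) \<in> negs" using h d(1) Suc.prems(2) by blast
    then have n': "(i', j', k') \<in> negs" using h downsetD[OF downset_negs n] by simp
    show "(i', j', k') \<in> ?T"
    proof (cases "(i, j, k) \<in> S")
      case True
      then show ?thesis using downsetD[OF Suc.prems(1) True] h by simp
    next
      case False
      then have ijk: "i = a" "j = b" "k = c" using h abc by simp_all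
      show ?thesis
      proof (rule ccontr)
        assume c: "(i', j', k') \<notin> ?T"
        then have "s d \<le> s (i', j', k')" using least n' by simp
        then have "i' = a \<and> j' = b \<and> k' = c" using h unfolding ijk by (simp add: s_def abc)
        then show False using c abc by simp
      qed
    qed
  qed
  moreover have neg: "?T \<subseteq> negs" using d(1) Suc.prems(2) by blast
  moreover have eq: "?T - {d} = S" using d(1) by blast
  ultimately have rem: "removal ?T d" using Suc.prems(1) by (simp add: removal_def)
  have split: "negs - S = insert d (negs - ?T)" using d(1) by blast
  have finT: "finite (negs - ?T)" by (rule finite_subset[OF _ Suc.prems(3)]) blast
  have "card (negs - S) = Suc (card (negs - ?T))"
    unfolding split by (rule card_insert_disjoint[OF finT]) simp
  then have "k = card (negs - ?T)" using Suc.hyps(2) by linarith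
  then have "P ?T" using Suc.hyps(1)[of ?T] \<open>downset ?T\<close> neg finT by blast
  from step[OF rem finT this] show ?case unfolding eq .
qed

lemma full_outside_removal: "removal S c \<Longrightarrow> full_outside n (S - {c}) \<Longrightarrow> full_outside n S"
  unfolding removal_def full_outside_def by blast

lemma taut_octant:
  assumes "0 \<le> n"
  shows "taut n negs = {restrict (\<lambda>_. C1 Blue) (face_set negs)}"
proof (intro equalityI subsetI)
  fix \<sigma> assume \<sigma>: "\<sigma> \<in> taut n negs"
  then have "\<sigma> \<in> face_set negs \<rightarrow>\<^sub>E UNIV" by (simp add: taut_def loops_def)
  then have "\<sigma> = restrict (\<lambda>_. C1 Blue) (face_set negs)"
    using octant_rigid[OF \<sigma> assms] by (intro ext) (auto simp: PiE_def extensional_def)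
  then show "\<sigma> \<in> {restrict (\<lambda>_. C1 Blue) (face_set negs)}" by simp
next
  fix \<sigma> :: "face \<Rightarrow> local_config" assume "\<sigma> \<in> {restrict (\<lambda>_. C1 Blue) (face_set negs)}"
  then have \<sigma>: "\<sigma> = restrict (\<lambda>_. C1 Blue) (face_set negs)" by simp
  have "fits (\<lambda>_. Blue) f (C1 Blue)" for f by (auto simp: fits_def)
  then have "\<sigma> \<in> loops negs" unfolding loops_def \<sigma> by (auto intro!: exI[of _ "\<lambda>_. Blue"])
  moreover have "linkage (face_set negs) \<sigma> = ground" unfolding ground_def \<sigma> by (rule linkage_cong) simp
  ultimately show "\<sigma> \<in> taut n negs" by (simp add: taut_def far_faces_def \<sigma>)
qed

text \<open>On the octant there is just the ground configuration for each \<open>n\<close>, and independence is preserved by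
  removing a cell.\<close>

lemma taut_independent:
  assumes "downset S" "S \<subseteq> negs" "finite (negs - S)" "full_outside m S" "full_outside n S"
  shows "taut m S = taut n S"
proof -
  have "\<forall>m n. full_outside m S \<longrightarrow> full_outside n S \<longrightarrow> taut m S \<subseteq> taut n S"
    using assms(1-3)
  proof (induction rule: removal_induct)
    case octant
    show ?case by (auto simp: taut_octant full_outside_def)
  next
    case (remove S c)
    show ?case
    proof (intro allI impI)
      fix m n assume mn: "full_outside m (S - {c})" "full_outside n (S - {c})"
      have "taut m S \<subseteq> taut n S"
        using remove.IH full_outside_removal[OF remove.hyps(1)] mn by blast
      then show "taut m (S - {c}) \<subseteq> taut n (S - {c})" by (rule removal.taut_mono[OF remove.hyps(1) mn])
    qed
  qed
  then show ?thesis using assms(4,5) by blast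
qed

lemma taut_sum_octant:
  assumes n: "0 \<le> n"
  shows "taut_sum n g negs = (\<Prod>f\<in>near_faces n negs. kind_weight g f 1) / (\<Prod>x\<in>near_vertices n negs. (g x)^2)"
proof -
  define \<sigma> where "\<sigma> = restrict (\<lambda>_. C1 Blue) (face_set negs)"
  have L: "linkage (face_set negs) \<sigma> = ground" unfolding ground_def \<sigma>_def by (rule linkage_cong) simp
  have "{(linkage (face_set negs) \<sigma>)\<^sup>* `` {a} | a. a \<in> (\<Union>f\<in>face_set negs. sides f) \<and>
      (linkage (face_set negs) \<sigma>)\<^sup>* `` {a} \<inter> far_edges n = {}} = {}"
    unfolding L using every_edge_reaches_far[OF n] by blast
  then have "loop_count n (face_set negs) \<sigma> = 0" unfolding loop_count_def by (simp only: card.empty)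
  moreover have "(\<Prod>f\<in>near_faces n negs. kind_weight g f (kind (\<sigma> f))) = (\<Prod>f\<in>near_faces n negs. kind_weight g f 1)"
    by (rule prod.cong) (simp_all add: \<sigma>_def near_faces_def)
  ultimately show ?thesis unfolding taut_sum_def taut_octant[OF n] \<sigma>_def by simp
qed

lemma taut_sum_constant:
  assumes "downset S" "S \<subseteq> negs" "finite (negs - S)" and n: "full_outside n S" and pos: "\<And>x. 0 < g x"
    and rec: "\<And>x. x \<in> negs - S \<Longrightarrow> g (x + (1, 1, 1)) = kashaev_rhs g x"
  shows "taut_sum n g S = taut_sum n g negs"
  using assms(1-3) n rec
proof (induction rule: removal_induct)
  case (remove S c)
  have "c \<in> S" "S \<subseteq> negs" using remove.hyps(1) by (simp_all add: removal_def)
  then have "g (c + (1, 1, 1)) = kashaev_rhs g c" by (intro remove.prems(2)) blast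
  then have "taut_sum n g (S - {c}) = taut_sum n g S"
    using removal.taut_sum_removal[OF remove.hyps(1) remove.prems(1) pos] by simp
  also have "\<dots> = taut_sum n g negs"
    by (rule remove.IH[OF full_outside_removal[OF remove.hyps(1) remove.prems(1)]]) (use remove.prems(2) in blast)
  finally show ?case .
qed simp

section \<open>Solutions of the recurrence\<close>

lemma kashaev_rhs_pos:
  assumes "0 < g x" "0 < g (x + evec 1)" "0 < g (x + evec 2)" "0 < g (x + evec 3)"
    "0 < g (x + evec 1 + evec 2)" "0 < g (x + evec 1 + evec 3)" "0 < g (x + evec 2 + evec 3)"
  shows "0 < kashaev_rhs g x"
  unfolding kashaev_rhs_def Let_def
  by (intro divide_pos_pos add_pos_nonneg mult_pos_pos add_nonneg_nonneg mult_nonneg_nonneg real_sqrt_ge_zero zero_less_power zero_less_numeral)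
    (use assms in \<open>auto intro: less_imp_le\<close>)

text \<open>The points at which a solution is defined: the vertices and the points reached by the recurrence.\<close>

definition computed :: "lattice set \<Rightarrow> lattice set" where
  "computed S = {z. z - (1, 1, 1) \<in> negs \<and> z \<notin> S}"

lemma computed_plus:
  assumes S: "downset S" and x: "x \<in> negs - S" and d: "d \<in> {0, 1} \<times> {0, 1} \<times> {0, 1}"
  shows "x + d \<in> computed S"
proof -
  obtain a b c where abc: "x = (a, b, c)" by (cases x)
  obtain i j k where ijk: "d = (i, j, k)" "i \<in> {0, 1}" "j \<in> {0, 1}" "k \<in> {0, 1}" using d by (cases d) auto
  have "x + d \<notin> S"
    using x downsetD[OF S, of "a + i" "b + j" "c + k" a b c] ijk by (auto simp: abc)
  moreover have "x + d - (1, 1, 1) \<in> negs" using x ijk by (auto simp: abc negs_def)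
  ultimately show ?thesis by (simp add: computed_def)
qed

text \<open>Undoing the last removal first: the recurrence produces the vertex above the removed cell from the
  seven others, all of which are vertices of the smaller solid.\<close>

lemma solution_pos:
  assumes "downset S" "S \<subseteq> negs" "finite (negs - S)"
    and "\<And>x. x \<in> vertex_set S \<Longrightarrow> 0 < g x"
    and "\<And>x. x \<in> negs - S \<Longrightarrow> g (x + (1, 1, 1)) = kashaev_rhs g x"
    and "x \<in> computed S"
  shows "0 < (g x :: real)"
  using assms
proof (induction arbitrary: x rule: removal_induct)
  case octant
  then show ?case by (simp add: computed_def vertex_set_def)
next
  case (remove S c)
  note rem = remove.hyps(1)
  have S: "downset S" "S \<subseteq> negs" "c \<in> S" "downset (S - {c})" using rem by (simp_all add: removal_def)
  obtain a b d where abd: "c = (a, b, d)" by (cases c)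
  have below: "(i, j, k) \<in> S" if "i \<le> a" "j \<le> b" "k \<le> d" for i j k
    using downsetD[OF S(1) S(3)[unfolded abd] that] .
  have above: "(i, j, k) \<in> S \<Longrightarrow> (i, j, k) = c" if "a \<le> i" "b \<le> j" "d \<le> k" for i j k
    using downsetD[OF S(4), of i j k a b d] that by (auto simp: abd)
  have vert: "c + e \<in> vertex_set (S - {c})" if e: "e = (i, j, k)" "i \<in> {0, 1}" "j \<in> {0, 1}" "k \<in> {0, 1}" "e \<noteq> (1, 1, 1)" for e i j k
  proof -
    have "c + e - (1, 1, 1) \<in> S" using below[of "a + i - 1" "b + j - 1" "d + k - 1"] e by (auto simp: abd)
    moreover have "c + e - (1, 1, 1) \<noteq> c" using e by (auto simp: abd)
    moreover have "c + e \<notin> S - {c}" using above[of "a + i" "b + j" "d + k"] e by (auto simp: abd)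
    ultimately show ?thesis by (simp add: vertex_set_def)
  qed
  have pos: "0 < g (c + e)" if "e = (i, j, k)" "i \<in> {0, 1}" "j \<in> {0, 1}" "k \<in> {0, 1}" "e \<noteq> (1, 1, 1)" for e i j k
    by (rule remove.prems(1)[OF vert[OF that]])
  have "0 < kashaev_rhs g c"
    using pos[of "(0, 0, 0)"] pos[of "(1, 0, 0)"] pos[of "(0, 1, 0)"] pos[of "(0, 0, 1)"] pos[of "(1, 1, 0)"] pos[of "(1, 0, 1)"] pos[of "(0, 1, 1)"]
    by (intro kashaev_rhs_pos) (simp_all add: abd)
  moreover have "c \<in> negs - (S - {c})" using S by blast
  ultimately have top: "0 < g (c + (1, 1, 1))" using remove.prems(2) by simp
  show ?case
  proof (cases "x = c")
    case True
    then show ?thesis using pos[of "(0, 0, 0)"] by (simp add: abd)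
  next
    case False
    show ?thesis
    proof (rule remove.IH)
      show "0 < g y" if "y \<in> vertex_set S" for y
      proof (cases "y = c + (1, 1, 1)")
        case True
        then show ?thesis using top by simp
      next
        case False
        then have "y - (1, 1, 1) \<noteq> c" by (auto simp: algebra_simps)
        then have "y \<in> vertex_set (S - {c})" using that by (simp add: vertex_set_def)
        then show ?thesis by (rule remove.prems(1))
      qed
      show "g (y + (1, 1, 1)) = kashaev_rhs g y" if "y \<in> negs - S" for y
        using remove.prems(2) that by blast
      show "x \<in> computed S" using remove.prems(3) False by (simp add: computed_def)
    qed
  qed
qed

lemma corners_in_vertex_set:
  assumes "f \<in> face_set S" "downset S"
  shows "{cx f, cu f, cy f, cv f} \<subseteq> vertex_set S"
  using assms(1)
proof (cases rule: face_cases)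
  case (12 a b c)
  note d = downsetD[OF assms(2)]
  have "(a + i, b + j, c) \<in> vertex_set S" if "i \<in> {0, 1}" "j \<in> {0, 1}" for i j
    using that 12(2) d[of "a + i" "b + j" c a b c] d[OF 12(3), of "a + i - 1" "b + j - 1" "c - 1"] by (auto simp: vertex_set_def)
  from this[of 0 0] this[of 1 0] this[of 1 1] this[of 0 1] show ?thesis unfolding 12(1) by (simp add: cx_def cu_def cy_def cv_def)
next
  case (13 a b c)
  note d = downsetD[OF assms(2)]
  have "(a + i, b, c + j) \<in> vertex_set S" if "i \<in> {0, 1}" "j \<in> {0, 1}" for i j
    using that 13(2) d[of "a + i" b "c + j" a b c] d[OF 13(3), of "a + i - 1" "b - 1" "c + j - 1"] by (auto simp: vertex_set_def)
  from this[of 0 0] this[of 1 0] this[of 1 1] this[of 0 1] show ?thesis unfolding 13(1) by (simp add: cx_def cu_def cy_def cv_def)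
next
  case (23 a b c)
  note d = downsetD[OF assms(2)]
  have "(a, b + i, c + j) \<in> vertex_set S" if "i \<in> {0, 1}" "j \<in> {0, 1}" for i j
    using that 23(2) d[of a "b + i" "c + j" a b c] d[OF 23(3), of "a - 1" "b + i - 1" "c + j - 1"] by (auto simp: vertex_set_def)
  from this[of 0 0] this[of 1 0] this[of 1 1] this[of 0 1] show ?thesis unfolding 23(1) by (simp add: cx_def cu_def cy_def cv_def)
qed

lemma exponent_eq:
  "regular_solid U \<Longrightarrow> taut_exponent U \<sigma> v = exponent (cells U) \<sigma> v"
  by (simp add: taut_exponent_def exponent_def regular_cells(1,2))

lemma exponent_integer:
  assumes "downset S" "\<sigma> \<in> loops S"
  shows "\<exists>m. exponent S \<sigma> v = of_int m"
proof (cases v)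
  case (Vertex p)
  obtain col where "\<And>f. f \<in> face_set S \<Longrightarrow> fits col f (\<sigma> f)" using assms(2) by (auto simp: loops_def)
  then show ?thesis unfolding Vertex using vertex_exponent_bounds[OF assms(1), of col \<sigma> p] by blast
next
  case (Face f)
  show ?thesis unfolding Face face_exponent by (rule exI[of _ "of_bool (f \<in> face_set S \<and> kind (\<sigma> f) \<in> {3, 4})"]) simp
qed

lemma monomial_exists:
  assumes "full_outside n S" "\<sigma> \<in> taut n S"
  shows "\<exists>m. \<forall>v. of_int (Poly_Mapping.lookup m v) = exponent S \<sigma> v"
proof -
  have "\<sigma> \<in> loops S" "downset S" using assms by (simp_all add: taut_def full_outside_def)
  then obtain F where F: "exponent S \<sigma> v = of_int (F v)" for v using exponent_integer by metis
  have "\<sigma> \<in> outer_configs n (face_set S)" using assms(2) taut_subset_outer by blast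
  from finite_exponent_support[OF assms(1) this] have "finite {v. F v \<noteq> 0}" by (simp add: F)
  then show ?thesis by (intro exI[of _ "Abs_poly_mapping F"]) (simp add: F)
qed

text \<open>The values of a solution at the vertices of the solid and at the points computed from them are positive.
  Replacing all other values that are not positive by \<open>1\<close> affects neither the recurrence at the missing cells nor the
  initial condition.\<close>

lemma restricted_solution:
  assumes U: "regular_solid U" and g: "kashaev_solution U g" "\<forall>x\<in>vertices U. 0 < g x"
  obtains h where "\<And>x. 0 < h x" "h (0, 0, 0) = g (0, 0, 0)" "\<And>x. x \<in> vertices U \<Longrightarrow> h x = g x"
    "\<And>x. x \<in> negs - cells U \<Longrightarrow> h (x + (1, 1, 1)) = kashaev_rhs h x"
proof -
  define S where "S = cells U"
  note reg = regular_cells[OF U, folded S_def]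
  have z: "x + evec 1 + evec 2 + evec 3 = x + (1, 1, 1)" for x :: lattice by (cases x) simp
  have rec: "g (x + (1, 1, 1)) = kashaev_rhs g x" if "x \<in> negs - S" for x
  proof -
    have "emb (x + (1, 1, 1)) \<in> octant" using that emb_mem_iff[OF octant_solid(1,2), of "x + (1, 1, 1)"] by (simp add: octant_solid(3))
    moreover have "emb (x + (1, 1, 1)) \<notin> U" using that emb_mem_iff[OF reg(6,7), of "x + (1, 1, 1)"] by (simp add: S_def)
    ultimately show ?thesis using g(1) unfolding kashaev_solution_def Let_def z by blast
  qed
  have pos: "0 < g x" if "x \<in> computed S" for x
    by (rule solution_pos[OF reg(3-5) _ rec that]) (use g(2) reg(2) in simp)
  define h where "h x = (if 0 < g x then g x else 1)" for x
  have hg: "h x = g x" if "x \<in> computed S" for x using pos[OF that] by (simp add: h_def)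
  show ?thesis
  proof (rule that[of h])
    show "0 < h x" for x by (simp add: h_def)
    have "(0, 0, 0) \<in> computed S" using reg(4) by (auto simp: computed_def negs_def)
    then show "h (0, 0, 0) = g (0, 0, 0)" by (rule hg)
    show "h x = g x" if "x \<in> vertices U" for x using g(2) that by (simp add: h_def)
    fix x assume "x \<in> negs - cells U"
    then have x: "x \<in> negs - S" by (simp add: S_def)
    have c: "h (x + d) = g (x + d)" if "d \<in> {0, 1} \<times> {0, 1} \<times> {0, 1}" for d
      by (rule hg[OF computed_plus[OF reg(3) x that]])
    have x0: "h x = g x" using c[of "(0, 0, 0)"] by (cases x) simp
    have "kashaev_rhs h x = kashaev_rhs g x"
      unfolding kashaev_rhs_def add.assoc using x0 c by simp
    then show "h (x + (1, 1, 1)) = kashaev_rhs h x" using c[of "(1, 1, 1)"] rec[OF x] by simp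
  qed
qed

lemma laurent_value_cong:
  assumes U: "regular_solid U" and vars: "\<forall>m\<in>Poly_Mapping.keys P. Poly_Mapping.keys m \<subseteq> variables U"
    and gh: "\<And>x. x \<in> vertices U \<Longrightarrow> h x = g x"
  shows "laurent_value h P = laurent_value g P"
proof -
  have "var_value h v = var_value g v" if "v \<in> variables U" for v
  proof (cases v)
    case (Vertex x)
    then show ?thesis using that gh by (auto simp: variables_def)
  next
    case (Face f)
    then have "f \<in> face_set (cells U)" using that by (auto simp: variables_def regular_cells(1)[OF U])
    from corners_in_vertex_set[OF this regular_cells(3)[OF U]] show ?thesis
      unfolding Face using gh by (simp add: regular_cells(2)[OF U])
  qed
  then have "monomial_value h m = monomial_value g m" if "m \<in> Poly_Mapping.keys P" for m
    unfolding monomial_value_def using vars that by (intro prod.cong refl) (metis subsetD)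
  then show ?thesis unfolding laurent_value_def by (intro sum.cong refl) simp
qed

lemma inj_monomials_sum:
  fixes \<mu> :: "'a \<Rightarrow> laurent_monomial" and c :: "'a \<Rightarrow> int"
  assumes fin: "finite T" and inj: "inj_on \<mu> T" and c: "\<And>\<sigma>. \<sigma> \<in> T \<Longrightarrow> c \<sigma> \<noteq> 0"
    and P_def: "P = (\<Sum>\<sigma>\<in>T. Poly_Mapping.single (\<mu> \<sigma>) (c \<sigma>))"
  shows "Poly_Mapping.keys P = \<mu> ` T" "\<And>\<sigma>. \<sigma> \<in> T \<Longrightarrow> Poly_Mapping.lookup P (\<mu> \<sigma>) = c \<sigma>"
    "laurent_value g P = (\<Sum>\<sigma>\<in>T. of_int (c \<sigma>) * monomial_value g (\<mu> \<sigma>))"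
proof -
  have L: "Poly_Mapping.lookup P m = (\<Sum>\<sigma>\<in>T. if \<mu> \<sigma> = m then c \<sigma> else 0)" for m
    unfolding P_def lookup_sum lookup_single by (simp add: when_def)
  show look: "Poly_Mapping.lookup P (\<mu> \<sigma>) = c \<sigma>" if "\<sigma> \<in> T" for \<sigma>
  proof -
    have "(\<Sum>\<tau>\<in>T. if \<mu> \<tau> = \<mu> \<sigma> then c \<tau> else 0) = (\<Sum>\<tau>\<in>T. if \<tau> = \<sigma> then c \<tau> else 0)"
      by (rule sum.cong) (use inj that in \<open>auto simp: inj_on_def\<close>)
    then show ?thesis unfolding L using fin that by simp
  qed
  have "Poly_Mapping.lookup P m = 0" if "m \<notin> \<mu> ` T" for m
    unfolding L by (rule sum.neutral) (use that in auto)
  then show keys: "Poly_Mapping.keys P = \<mu> ` T" using look c unfolding set_eq_iff in_keys_iff by (metis imageE imageI)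
  show "laurent_value g P = (\<Sum>\<sigma>\<in>T. of_int (c \<sigma>) * monomial_value g (\<mu> \<sigma>))"
    unfolding laurent_value_def keys sum.reindex[OF inj] by (rule sum.cong) (simp_all add: look)
qed

theorem theorem4:
  fixes U :: "space set"
  assumes "regular_solid U"
  shows "\<exists>P :: laurent_poly.
      (\<forall>m\<in>Poly_Mapping.keys P. Poly_Mapping.keys m \<subseteq> variables U) \<and>
      (\<forall>g. kashaev_solution U g \<and> (\<forall>x\<in>vertices U. 0 < g x) \<longrightarrow> g (0, 0, 0) = laurent_value g P) \<and>
      (\<exists>\<mu>. bij_betw \<mu> (taut_configs U) (Poly_Mapping.keys P) \<and>
           (\<forall>\<sigma>\<in>taut_configs U. is_taut_monomial U \<sigma> (\<mu> \<sigma>))) \<and>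
      (\<forall>m\<in>Poly_Mapping.keys P.
          (\<forall>x\<in>vertices U. Poly_Mapping.lookup m (Vertex x) \<in> {-2..4}) \<and>
          (\<forall>f\<in>faces U. Poly_Mapping.lookup m (Face f) \<in> {0, 1})) \<and>
      (\<forall>m\<in>Poly_Mapping.keys P. \<exists>n::nat. Poly_Mapping.lookup P m = 2 ^ n)"
proof -
  define S where "S = cells U"
  note reg = regular_cells[OF assms, folded S_def]
  obtain n where n: "full_outside n S" using full_outside_exists[OF assms] unfolding S_def by metis
  define T where "T = taut n S"
  have "taut_configs U = (\<Union>m\<in>{m. full_outside m S}. taut m S)" unfolding S_def by (rule taut_configs_eq[OF assms])
  also have "\<dots> = T" using taut_independent[OF reg(3-5) _ n] n unfolding T_def by blast
  finally have TU: "taut_configs U = T" .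
  have fin: "finite T" unfolding T_def by (rule finite_taut[OF reg(4)])
  have outer: "\<sigma> \<in> outer_configs n (face_set S)" "\<sigma> \<in> loops S" if "\<sigma> \<in> T" for \<sigma>
    using that taut_subset_outer unfolding T_def by (blast, simp add: taut_def)
  define \<mu> where "\<mu> = (\<lambda>\<sigma>. SOME m. \<forall>v. of_int (Poly_Mapping.lookup m v) = exponent S \<sigma> v)"
  have \<mu>: "of_int (Poly_Mapping.lookup (\<mu> \<sigma>) v) = exponent S \<sigma> v" if "\<sigma> \<in> T" for \<sigma> v
    using someI_ex[OF monomial_exists[OF n that[unfolded T_def]]] unfolding \<mu>_def by blast
  have inj: "inj_on \<mu> T"
  proof (rule inj_onI)
    fix \<sigma> \<tau> assume T: "\<sigma> \<in> T" "\<tau> \<in> T" and eq: "\<mu> \<sigma> = \<mu> \<tau>"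
    have "exponent S \<sigma> v = exponent S \<tau> v" for v using \<mu>[OF T(1), of v] \<mu>[OF T(2), of v] eq by simp
    then have "kind (\<sigma> f) = kind (\<tau> f)" if "f \<in> face_set S" for f
      using equal_exponents_kind[OF reg(3,4) outer(1)[OF T(1)] outer(1)[OF T(2)] _ that] by blast
    then show "\<sigma> = \<tau>"
      by (rule equal_kinds_eq[OF reg(3,4) outer(2)[OF T(1)] outer(1)[OF T(1)] outer(2)[OF T(2)] outer(1)[OF T(2)]])
  qed
  define c where "c = (\<lambda>\<sigma>. 2 ^ loop_count n (face_set S) \<sigma> :: int)"
  define P where "P = (\<Sum>\<sigma>\<in>T. Poly_Mapping.single (\<mu> \<sigma>) (c \<sigma>))"
  have c0: "c \<sigma> \<noteq> 0" for \<sigma> by (simp add: c_def)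
  note P = inj_monomials_sum[OF fin inj c0 P_def]
  have int: "Poly_Mapping.lookup (\<mu> \<sigma>) (Vertex x) \<in> {-2..4}" "x \<notin> vertex_set S \<Longrightarrow> Poly_Mapping.lookup (\<mu> \<sigma>) (Vertex x) = 0"
    if \<sigma>: "\<sigma> \<in> T" for \<sigma> x
  proof -
    obtain col where "\<And>f. f \<in> face_set S \<Longrightarrow> fits col f (\<sigma> f)" using outer(2)[OF \<sigma>] by (auto simp: loops_def)
    then obtain m where "exponent S \<sigma> (Vertex x) = of_int m" "m \<in> {-2..4}" "x \<notin> vertex_set S \<longrightarrow> m = 0"
      using vertex_exponent_bounds[OF reg(3), of col \<sigma> x] by blast
    then show "Poly_Mapping.lookup (\<mu> \<sigma>) (Vertex x) \<in> {-2..4}" "x \<notin> vertex_set S \<Longrightarrow> Poly_Mapping.lookup (\<mu> \<sigma>) (Vertex x) = 0"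
      using \<mu>[OF \<sigma>, of "Vertex x"] by simp_all
  qed
  have face: "Poly_Mapping.lookup (\<mu> \<sigma>) (Face f) = of_bool (f \<in> face_set S \<and> kind (\<sigma> f) \<in> {3, 4})" if "\<sigma> \<in> T" for \<sigma> f
  proof -
    have "(of_int (Poly_Mapping.lookup (\<mu> \<sigma>) (Face f)) :: rat) = of_int (of_bool (f \<in> face_set S \<and> kind (\<sigma> f) \<in> {3, 4}))"
      unfolding \<mu>[OF that] face_exponent by simp
    then show ?thesis by (simp only: of_int_eq_iff)
  qed
  have vars: "Poly_Mapping.keys (\<mu> \<sigma>) \<subseteq> variables U" if "\<sigma> \<in> T" for \<sigma>
  proof
    fix v assume "v \<in> Poly_Mapping.keys (\<mu> \<sigma>)"
    then have nz: "Poly_Mapping.lookup (\<mu> \<sigma>) v \<noteq> 0" by (simp add: in_keys_iff)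
    show "v \<in> variables U"
    proof (cases v)
      case (Vertex x)
      then show ?thesis using nz int(2)[OF that, of x] by (auto simp: variables_def reg(2))
    next
      case (Face f)
      then have "f \<in> face_set S" using nz face[OF that, of f] by (cases "f \<in> face_set S") simp_all
      then show ?thesis by (simp add: Face variables_def reg(1))
    qed
  qed
  have varsP: "\<forall>m\<in>Poly_Mapping.keys P. Poly_Mapping.keys m \<subseteq> variables U" unfolding P(1) using vars by blast
  have solution: "g (0, 0, 0) = laurent_value g P" if sol: "kashaev_solution U g" "\<forall>x\<in>vertices U. 0 < g x" for g
  proof -
    obtain h where h: "\<And>x. 0 < h x" "h (0, 0, 0) = g (0, 0, 0)" "\<And>x. x \<in> vertices U \<Longrightarrow> h x = g x"
      "\<And>x. x \<in> negs - S \<Longrightarrow> h (x + (1, 1, 1)) = kashaev_rhs h x"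
      using restricted_solution[OF assms sol] unfolding S_def by blast
    define W where "W = (\<Prod>f\<in>near_faces n negs. kind_weight h f 1)"
    define G where "G = (\<Prod>x\<in>near_vertices n negs. (h x)^2)"
    have n0: "0 \<le> n" using n by (simp add: full_outside_def)
    have "kind_weight h f 1 > 0" for f using kind_weight_pos[of h f "C1 Blue", OF h(1)] by simp
    then have W: "W \<noteq> 0" unfolding W_def by (intro prod_pos less_imp_neq[symmetric]) simp
    have "0 < G" unfolding G_def by (rule prod_pos, rule zero_less_power, rule h(1))
    then have G: "G \<noteq> 0" by simp
    have "laurent_value h P = (\<Sum>\<sigma>\<in>T. of_int (c \<sigma>) * monomial_value h (\<mu> \<sigma>))" by (rule P(3))
    also have "\<dots> = (\<Sum>\<sigma>\<in>T. h (0, 0, 0) * (G / W) * (2 ^ loop_count n (face_set S) \<sigma> *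
        (\<Prod>f\<in>near_faces n S. kind_weight h f (kind (\<sigma> f))) / (\<Prod>x\<in>near_vertices n S. (h x)^2)))"
    proof (rule sum.cong[OF refl])
      fix \<sigma> assume T: "\<sigma> \<in> T"
      show "of_int (c \<sigma>) * monomial_value h (\<mu> \<sigma>) = h (0, 0, 0) * (G / W) * (2 ^ loop_count n (face_set S) \<sigma> *
          (\<Prod>f\<in>near_faces n S. kind_weight h f (kind (\<sigma> f))) / (\<Prod>x\<in>near_vertices n S. (h x)^2))"
        unfolding monomial_value_eq[OF h(1) n outer(1)[OF T] \<mu>[OF T]] W_def[symmetric] G_def[symmetric] c_def
        by (simp only: of_int_power of_int_numeral times_divide_eq_right times_divide_eq_left divide_divide_eq_left mult_ac)
    qed
    also have "\<dots> = h (0, 0, 0) * (G / W) * taut_sum n h S"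
      unfolding taut_sum_def T_def[symmetric] sum_divide_distrib sum_distrib_left ..
    also have "taut_sum n h S = W / G"
      using taut_sum_constant[OF reg(3-5) n h(1,4)] taut_sum_octant[OF n0, of h] by (simp add: W_def G_def)
    finally have "laurent_value h P = h (0, 0, 0)" using W G by simp
    then show ?thesis using laurent_value_cong[OF assms varsP, of h g] h(2,3) by simp
  qed
  have "bij_betw \<mu> (taut_configs U) (Poly_Mapping.keys P)" unfolding TU P(1) using inj by (rule inj_on_imp_bij_betw)
  moreover have "\<forall>\<sigma>\<in>taut_configs U. is_taut_monomial U \<sigma> (\<mu> \<sigma>)"
    unfolding TU is_taut_monomial_def exponent_eq[OF assms] S_def[symmetric] using \<mu> by blast
  ultimately have monomials: "\<exists>\<mu>. bij_betw \<mu> (taut_configs U) (Poly_Mapping.keys P) \<and> (\<forall>\<sigma>\<in>taut_configs U. is_taut_monomial U \<sigma> (\<mu> \<sigma>))"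
    by blast
  have "(\<forall>x\<in>vertices U. Poly_Mapping.lookup m (Vertex x) \<in> {-2..4}) \<and> (\<forall>f\<in>faces U. Poly_Mapping.lookup m (Face f) \<in> {0, 1})"
    if m: "m \<in> Poly_Mapping.keys P" for m
  proof -
    obtain \<sigma> where \<sigma>: "\<sigma> \<in> T" "m = \<mu> \<sigma>" using m unfolding P(1) by blast
    have "(of_bool Q :: int) \<in> {0, 1}" for Q by (cases Q) simp_all
    then show ?thesis unfolding \<sigma>(2) face[OF \<sigma>(1)] using int(1)[OF \<sigma>(1)] by blast
  qed
  then have bounds: "\<forall>m\<in>Poly_Mapping.keys P. (\<forall>x\<in>vertices U. Poly_Mapping.lookup m (Vertex x) \<in> {-2..4}) \<and>
      (\<forall>f\<in>faces U. Poly_Mapping.lookup m (Face f) \<in> {0, 1})" by blast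
  have coefficients: "\<forall>m\<in>Poly_Mapping.keys P. \<exists>n::nat. Poly_Mapping.lookup P m = 2 ^ n"
    unfolding P(1) using P(2) by (auto simp: c_def)
  have "\<forall>g. kashaev_solution U g \<and> (\<forall>x\<in>vertices U. 0 < g x) \<longrightarrow> g (0, 0, 0) = laurent_value g P"
    using solution by blast
  then show ?thesis by (intro exI[of _ P] conjI varsP monomials bounds coefficients)
qed

end
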